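(* Let $k$ be a field and $\mathcal{C}$ an essentially small category. The functor $X\mapsto RD(X)'$ is a Serre duality for $\mathcal{D}_{\mathrm{perf}}(\mathcal{C}\text{-mod})$.
   Context: $\mathcal{C}\text{-mod}$ (resp. $\mathcal{C}^{op}\text{-mod}$) is the category of covariant functors from $\mathcal{C}$ (resp. $\mathcal{C}^{op}$) to $k$-modules. $P_x^{\mathcal{C}}=k[\operatorname{Hom}_{\mathcal{C}}(x,-)]$ (free $k$-module on the Hom set) is the standard projective. The functor $D:(\mathcal{C}\text{-mod})^{op}\to\mathcal{C}^{op}\text{-mod}$ is $DF(x)=\operatorname{Hom}_{\mathcal{C}\text{-mod}}(F,P_x^{\mathcal{C}})$, and $RD:\mathcal{D}^b(\mathcal{C}\text{-mod})^{op}\to\mathcal{D}^b(\mathcal{C}^{op}\text{-mod})$ is its derived functor (apply $D$ to a projective resolution). $V'=\operatorname{Hom}_k(V,k)$, and $F'$ denotes the postcomposition of $F$ (a functor, or complex of functors) with $V\mapsto V'$; it turns right $\mathcal{C}$-modules into left $\mathcal{C}$-modules. An object of $\mathcal{C}\text{-mod}$ is of finite type if it is a quotient of a finite sum of standard projectives. A complex is perfect if it is quasi-isomorphic to a bounded complex of finite type projectives; $\mathcal{D}_{\mathrm{perf}}(\mathcal{C}\text{-mod})$ is the full subcategory of $\mathcal{D}(\mathcal{C}\text{-mod})$ of perfect complexes. A Serre duality for a $k$-linear category $\mathcal{A}$ is an endofunctor $S:\mathcal{A}\to\mathcal{A}$ with a natural isomorphism $\operatorname{Hom}_{\mathcal{A}}(a,b)'\cong\operatorname{Hom}_{\mathcal{A}}(b,Sa)$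 for all objects $a,b$ of $\mathcal{A}$.
   Formalization: RD(-)' need not preserve perfect complexes (for k[t]-modules, k[t]' is not perfect), so the duality is proved with RD(-)' as a functor from D_perf to D(C-mod), Hom taken in D(C-mod); it is a Serre duality for D_perf itself whenever RD(-)' maps perfect complexes to perfect ones. *)

theory Defs
  imports Complex_Main "HOL-Library.Function_Algebras"
begin

section \<open>Categories and k-linear categories\<close>

text \<open>Composition and identities are indexed by objects, so hom sets need not be disjoint.
  The value \<open>Cmp C x y z g f\<close> is the composite of \<open>f : x \<rightarrow> y\<close> and \<open>g : y \<rightarrow> z\<close>.\<close>

record ('o, 'm) cat =
  Ob :: "'o set"
  Hom :: "'o \<Rightarrow> 'o \<Rightarrow> 'm set"
  Idn :: "'o \<Rightarrow> 'm"
  Cmp :: "'o \<Rightarrow> 'o \<Rightarrow> 'o \<Rightarrow> 'm \<Rightarrow> 'm \<Rightarrow> 'm"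

definition category :: "('o, 'm, 'z) cat_scheme \<Rightarrow> bool" where
  "category C \<longleftrightarrow>
    (\<forall>x\<in>Ob C. Idn C x \<in> Hom C x x) \<and>
    (\<forall>x\<in>Ob C. \<forall>y\<in>Ob C. \<forall>z\<in>Ob C. \<forall>f\<in>Hom C x y. \<forall>g\<in>Hom C y z. Cmp C x y z g f \<in> Hom C x z) \<and>
    (\<forall>x\<in>Ob C. \<forall>y\<in>Ob C. \<forall>f\<in>Hom C x y.
       Cmp C x x y f (Idn C x) = f \<and> Cmp C x y y (Idn C y) f = f) \<and>
    (\<forall>w\<in>Ob C. \<forall>x\<in>Ob C. \<forall>y\<in>Ob C. \<forall>z\<in>Ob C. \<forall>f\<in>Hom C w x. \<forall>g\<in>Hom C x y. \<forall>h\<in>Hom C y z.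
       Cmp C w x z (Cmp C x y z h g) f = Cmp C w y z h (Cmp C w x y g f))"

definition op_cat :: "('o, 'm) cat \<Rightarrow> ('o, 'm) cat" where
  "op_cat C = \<lparr>Ob = Ob C, Hom = (\<lambda>x y. Hom C y x), Idn = Idn C,
               Cmp = (\<lambda>x y z g f. Cmp C z y x f g)\<rparr>"

definition isomorphic :: "('o, 'm, 'z) cat_scheme \<Rightarrow> 'o \<Rightarrow> 'o \<Rightarrow> bool" where
  "isomorphic A a b \<longleftrightarrow> (\<exists>f\<in>Hom A a b. \<exists>g\<in>Hom A b a.
     Cmp A a b a g f = Idn A a \<and> Cmp A b a b f g = Idn A b)"

definition full_subcat :: "('o, 'm, 'z) cat_scheme \<Rightarrow> 'o set \<Rightarrow> ('o, 'm, 'z) cat_scheme" where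
  "full_subcat A P = A\<lparr>Ob := Ob A \<inter> P\<rparr>"

definition is_functor :: "('o, 'm, 'z) cat_scheme \<Rightarrow> ('p, 'n, 'y) cat_scheme
    \<Rightarrow> ('o \<Rightarrow> 'p) \<Rightarrow> ('o \<Rightarrow> 'o \<Rightarrow> 'm \<Rightarrow> 'n) \<Rightarrow> bool" where
  "is_functor A B So Sm \<longleftrightarrow>
    (\<forall>a\<in>Ob A. So a \<in> Ob B) \<and>
    (\<forall>a\<in>Ob A. \<forall>b\<in>Ob A. \<forall>f\<in>Hom A a b. Sm a b f \<in> Hom B (So a) (So b)) \<and>
    (\<forall>a\<in>Ob A. Sm a a (Idn A a) = Idn B (So a)) \<and>
    (\<forall>a\<in>Ob A. \<forall>b\<in>Ob A. \<forall>c\<in>Ob A. \<forall>f\<in>Hom A a b. \<forall>g\<in>Hom A b c.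
       Sm a c (Cmp A a b c g f) = Cmp B (So a) (So b) (So c) (Sm b c g) (Sm a b f))"

record ('o, 'm, 'k) lincat = "('o, 'm) cat" +
  Add :: "'o \<Rightarrow> 'o \<Rightarrow> 'm \<Rightarrow> 'm \<Rightarrow> 'm"
  Smul :: "'o \<Rightarrow> 'o \<Rightarrow> 'k \<Rightarrow> 'm \<Rightarrow> 'm"

definition klinear_category :: "('o, 'm, 'k::field) lincat \<Rightarrow> bool" where
  "klinear_category A \<longleftrightarrow> category A \<and>
    (\<forall>a\<in>Ob A. \<forall>b\<in>Ob A.
      (\<forall>f\<in>Hom A a b. \<forall>g\<in>Hom A a b. Add A a b f g \<in> Hom A a b \<and> Add A a b f g = Add A a b g f) \<and>
      (\<forall>f\<in>Hom A a b. \<forall>g\<in>Hom A a b. \<forall>h\<in>Hom A a b.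
         Add A a b (Add A a b f g) h = Add A a b f (Add A a b g h)) \<and>
      (\<exists>z\<in>Hom A a b. \<forall>f\<in>Hom A a b. Add A a b z f = f \<and> (\<exists>g\<in>Hom A a b. Add A a b f g = z)) \<and>
      (\<forall>f\<in>Hom A a b. \<forall>c. Smul A a b c f \<in> Hom A a b) \<and>
      (\<forall>f\<in>Hom A a b. \<forall>c d. Smul A a b (c + d) f = Add A a b (Smul A a b c f) (Smul A a b d f)) \<and>
      (\<forall>f\<in>Hom A a b. \<forall>c d. Smul A a b (c * d) f = Smul A a b c (Smul A a b d f)) \<and>
      (\<forall>f\<in>Hom A a b. Smul A a b 1 f = f) \<and>
      (\<forall>f\<in>Hom A a b. \<forall>g\<in>Hom A a b. \<forall>c.
         Smul A a b c (Add A a b f g) = Add A a b (Smul A a b c f) (Smul A a b c g))) \<and>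
    (\<forall>a\<in>Ob A. \<forall>b\<in>Ob A. \<forall>c\<in>Ob A.
      (\<forall>f\<in>Hom A a b. \<forall>g\<in>Hom A b c. \<forall>g'\<in>Hom A b c.
         Cmp A a b c (Add A b c g g') f = Add A a c (Cmp A a b c g f) (Cmp A a b c g' f)) \<and>
      (\<forall>f\<in>Hom A a b. \<forall>f'\<in>Hom A a b. \<forall>g\<in>Hom A b c.
         Cmp A a b c g (Add A a b f f') = Add A a c (Cmp A a b c g f) (Cmp A a b c g f')) \<and>
      (\<forall>f\<in>Hom A a b. \<forall>g\<in>Hom A b c. \<forall>r.
         Cmp A a b c (Smul A b c r g) f = Smul A a c r (Cmp A a b c g f) \<and>
         Cmp A a b c g (Smul A a b r f) = Smul A a c r (Cmp A a b c g f)))"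

section \<open>Serre duality\<close>

text \<open>The dual k-module of \<open>Hom A a b\<close>. A functional is extended by \<open>0\<close> outside the hom set, so
  that it is determined by its values there; the module operations are pointwise.\<close>

definition hom_dual :: "('o, 'm, 'k::field) lincat \<Rightarrow> 'o \<Rightarrow> 'o \<Rightarrow> ('m \<Rightarrow> 'k) set" where
  "hom_dual A a b = {\<phi>.
     (\<forall>f\<in>Hom A a b. \<forall>g\<in>Hom A a b. \<phi> (Add A a b f g) = \<phi> f + \<phi> g) \<and>
     (\<forall>f\<in>Hom A a b. \<forall>c. \<phi> (Smul A a b c f) = c * \<phi> f) \<and>
     (\<forall>f. f \<notin> Hom A a b \<longrightarrow> \<phi> f = 0)}"

text \<open>\<open>\<eta> a b : Hom(a,b)' \<rightarrow> Hom(b,Sa)\<close> for objects \<open>a\<close>, \<open>b\<close> of the full subcategory of \<open>A\<close>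
  on \<open>P\<close>: k-linear, bijective, and natural in \<open>a\<close> and in \<open>b\<close>.\<close>

definition serre_iso :: "('o, 'm, 'k::field) lincat \<Rightarrow> 'o set \<Rightarrow> ('o \<Rightarrow> 'o)
    \<Rightarrow> ('o \<Rightarrow> 'o \<Rightarrow> 'm \<Rightarrow> 'm) \<Rightarrow> ('o \<Rightarrow> 'o \<Rightarrow> ('m \<Rightarrow> 'k) \<Rightarrow> 'm) \<Rightarrow> bool" where
  "serre_iso A P So Sm \<eta> \<longleftrightarrow>
    (\<forall>a\<in>P. \<forall>b\<in>P.
      bij_betw (\<eta> a b) (hom_dual A a b) (Hom A b (So a)) \<and>
      (\<forall>\<phi>\<in>hom_dual A a b. \<forall>\<psi>\<in>hom_dual A a b.
         \<eta> a b (\<phi> + \<psi>) = Add A b (So a) (\<eta> a b \<phi>) (\<eta> a b \<psi>)) \<and>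
      (\<forall>\<phi>\<in>hom_dual A a b. \<forall>c. \<eta> a b (\<lambda>f. c * \<phi> f) = Smul A b (So a) c (\<eta> a b \<phi>))) \<and>
    (\<forall>a\<in>P. \<forall>a'\<in>P. \<forall>b\<in>P. \<forall>u\<in>Hom A a a'. \<forall>\<phi>\<in>hom_dual A a b.
      \<eta> a' b (\<lambda>f. if f \<in> Hom A a' b then \<phi> (Cmp A a a' b f u) else 0)
        = Cmp A b (So a) (So a') (Sm a a' u) (\<eta> a b \<phi>)) \<and>
    (\<forall>a\<in>P. \<forall>b\<in>P. \<forall>b'\<in>P. \<forall>v\<in>Hom A b' b. \<forall>\<phi>\<in>hom_dual A a b.
      \<eta> a b' (\<lambda>f. if f \<in> Hom A a b' then \<phi> (Cmp A a b' b v f) else 0)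
        = Cmp A b' b (So a) (\<eta> a b \<phi>) v)"

definition serre_duality :: "('o, 'm, 'k::field) lincat \<Rightarrow> ('o \<Rightarrow> 'o)
    \<Rightarrow> ('o \<Rightarrow> 'o \<Rightarrow> 'm \<Rightarrow> 'm) \<Rightarrow> bool" where
  "serre_duality A So Sm \<longleftrightarrow> klinear_category A \<and> is_functor A A So Sm \<and>
     (\<exists>\<eta>. serre_iso A (Ob A) So Sm \<eta>)"

text \<open>Variant for a full subcategory \<open>P\<close> of \<open>A\<close>, where \<open>S\<close> is defined on \<open>P\<close> but takes its values
  in \<open>A\<close>, and \<open>Hom(b,Sa)\<close> is formed in \<open>A\<close>. This is the form in which the duality holds for perfect
  complexes over an arbitrary category: already for the monoid of natural numbers, i.e. for modules
  over \<open>k[t]\<close>, the complex \<open>RD(k[t])' = Hom\<^sub>k(k[t],k)\<close> is not perfect.\<close>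

definition relative_serre_duality :: "('o, 'm, 'k::field) lincat \<Rightarrow> 'o set \<Rightarrow> ('o \<Rightarrow> 'o)
    \<Rightarrow> ('o \<Rightarrow> 'o \<Rightarrow> 'm \<Rightarrow> 'm) \<Rightarrow> bool" where
  "relative_serre_duality A P So Sm \<longleftrightarrow> klinear_category A \<and> P \<subseteq> Ob A \<and>
     is_functor (full_subcat A P) A So Sm \<and> (\<exists>\<eta>. serre_iso A P So Sm \<eta>)"

section \<open>Functors to k-modules\<close>

text \<open>k is a field, and k-modules are the subspaces of an ambient k-vector space \<open>'v\<close> with scalar
  multiplication \<open>s\<close>: up to isomorphism these are all k-modules of dimension at most that of \<open>'v\<close>.
  Linear maps, and families of them, are extended by \<open>0\<close> outside their domain, so that
  equality of functions is equality of maps.\<close>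

definition pw :: "('k \<Rightarrow> 'v \<Rightarrow> 'v) \<Rightarrow> 'k \<Rightarrow> ('a \<Rightarrow> 'v) \<Rightarrow> 'a \<Rightarrow> 'v" where
  "pw s c f = (\<lambda>x. s c (f x))"

definition restr :: "'v set \<Rightarrow> ('v \<Rightarrow> 'w::zero) \<Rightarrow> 'v \<Rightarrow> 'w" where
  "restr V g = (\<lambda>u. if u \<in> V then g u else 0)"

definition linmaps :: "('k \<Rightarrow> 'v \<Rightarrow> 'v) \<Rightarrow> 'v::ab_group_add set
    \<Rightarrow> ('k \<Rightarrow> 'w \<Rightarrow> 'w) \<Rightarrow> 'w::ab_group_add set \<Rightarrow> ('v \<Rightarrow> 'w) set" where
  "linmaps s V t W = {g.
     (\<forall>u\<in>V. g u \<in> W) \<and>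
     (\<forall>u\<in>V. \<forall>v\<in>V. g (u + v) = g u + g v) \<and>
     (\<forall>c. \<forall>u\<in>V. g (s c u) = t c (g u)) \<and>
     (\<forall>u. u \<notin> V \<longrightarrow> g u = 0)}"

record ('o, 'm, 'v) cmod =
  sp :: "'o \<Rightarrow> 'v set"
  act :: "'o \<Rightarrow> 'o \<Rightarrow> 'm \<Rightarrow> 'v \<Rightarrow> 'v"

definition is_cmod :: "('o, 'm) cat \<Rightarrow> ('k::field \<Rightarrow> 'v \<Rightarrow> 'v)
    \<Rightarrow> ('o, 'm, 'v::ab_group_add) cmod \<Rightarrow> bool" where
  "is_cmod C s F \<longleftrightarrow>
    (\<forall>x\<in>Ob C. module.subspace s (sp F x)) \<and>
    (\<forall>x\<in>Ob C. \<forall>y\<in>Ob C. \<forall>f\<in>Hom C x y. act F x y f \<in> linmaps s (sp F x) s (sp F y)) \<and>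
    (\<forall>x\<in>Ob C. act F x x (Idn C x) = restr (sp F x) (\<lambda>u. u)) \<and>
    (\<forall>x\<in>Ob C. \<forall>y\<in>Ob C. \<forall>z\<in>Ob C. \<forall>f\<in>Hom C x y. \<forall>g\<in>Hom C y z.
       act F x z (Cmp C x y z g f) = act F y z g \<circ> act F x y f)"

definition nattrans :: "('o, 'm) cat
    \<Rightarrow> ('k::field \<Rightarrow> 'v \<Rightarrow> 'v) \<Rightarrow> ('o, 'm, 'v::ab_group_add) cmod
    \<Rightarrow> ('k \<Rightarrow> 'w \<Rightarrow> 'w) \<Rightarrow> ('o, 'm, 'w::ab_group_add) cmod \<Rightarrow> ('o \<Rightarrow> 'v \<Rightarrow> 'w) set" where
  "nattrans C s F t G = {\<eta>.
     (\<forall>x\<in>Ob C. \<eta> x \<in> linmaps s (sp F x) t (sp G x)) \<and>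
     (\<forall>x. x \<notin> Ob C \<longrightarrow> \<eta> x = 0) \<and>
     (\<forall>x\<in>Ob C. \<forall>y\<in>Ob C. \<forall>f\<in>Hom C x y. \<eta> y \<circ> act F x y f = act G x y f \<circ> \<eta> x)}"

definition restr_fam :: "('o, 'm) cat \<Rightarrow> ('o, 'm, 'v) cmod \<Rightarrow> ('o \<Rightarrow> 'v \<Rightarrow> 'w::zero) \<Rightarrow> 'o \<Rightarrow> 'v \<Rightarrow> 'w" where
  "restr_fam C F \<eta> = (\<lambda>x u. if x \<in> Ob C \<and> u \<in> sp F x then \<eta> x u else 0)"

text \<open>An epimorphism of \<open>C\<close>-modules is a pointwise surjective natural transformation.\<close>

definition surjective :: "('o, 'm) cat \<Rightarrow> ('o, 'm, 'v) cmod \<Rightarrow> ('o, 'm, 'w) cmod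
    \<Rightarrow> ('o \<Rightarrow> 'v \<Rightarrow> 'w) \<Rightarrow> bool" where
  "surjective C F G \<eta> \<longleftrightarrow> (\<forall>x\<in>Ob C. \<eta> x ` sp F x = sp G x)"

definition projective :: "('o, 'm) cat \<Rightarrow> ('k::field \<Rightarrow> 'v \<Rightarrow> 'v)
    \<Rightarrow> ('o, 'm, 'v::ab_group_add) cmod \<Rightarrow> bool" where
  "projective C s F \<longleftrightarrow> is_cmod C s F \<and>
    (\<forall>M N p g. is_cmod C s M \<and> is_cmod C s N \<and> p \<in> nattrans C s M s N \<and> surjective C M N p
        \<and> g \<in> nattrans C s F s N
      \<longrightarrow> (\<exists>h\<in>nattrans C s F s M. \<forall>x\<in>Ob C. p x \<circ> h x = g x))"

text \<open>Elements of \<open>k[Hom(x,y)]\<close> are finitely supported functions on \<open>Hom(x,y)\<close>;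
  \<open>push \<alpha>\<close> is the linear extension of \<open>\<alpha>\<close> to such functions.\<close>

definition push :: "('m \<Rightarrow> 'm) \<Rightarrow> ('m \<Rightarrow> 'k::field) \<Rightarrow> 'm \<Rightarrow> 'k" where
  "push \<alpha> p = (\<lambda>m. \<Sum>h | p h \<noteq> 0 \<and> \<alpha> h = m. p h)"

definition std_proj :: "('o, 'm) cat \<Rightarrow> 'o \<Rightarrow> ('o, 'm, 'm \<Rightarrow> 'k::field) cmod" where
  "std_proj C x =
    (let V = (\<lambda>y. {p. finite {h. p h \<noteq> 0} \<and> {h. p h \<noteq> 0} \<subseteq> Hom C x y})
     in \<lparr>sp = V, act = (\<lambda>y z g. restr (V y) (push (\<lambda>h. Cmp C x y z g h)))\<rparr>)"

text \<open>For \<open>f : x \<rightarrow> y\<close>, precomposition with \<open>f\<close> is a natural transformation from \<open>std_proj C y\<close>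
  to \<open>std_proj C x\<close>.\<close>

definition yoneda_map :: "('o, 'm) cat \<Rightarrow> 'o \<Rightarrow> 'o \<Rightarrow> 'm
    \<Rightarrow> 'o \<Rightarrow> ('m \<Rightarrow> 'k::field) \<Rightarrow> 'm \<Rightarrow> 'k" where
  "yoneda_map C x y f = restr_fam C (std_proj C y) (\<lambda>z. push (\<lambda>h. Cmp C x y z h f))"

text \<open>The direct sum of the standard projectives at the entries of a list, the \<open>i\<close>-th component
  of an element \<open>p\<close> being \<open>\<lambda>h. p (i, h)\<close>.\<close>

definition std_sum :: "('o, 'm) cat \<Rightarrow> 'o list \<Rightarrow> ('o, 'm, nat \<times> 'm \<Rightarrow> 'k::field) cmod" where
  "std_sum C xs =
    (let V = (\<lambda>y. {p. \<forall>i. (if i < length xs then (\<lambda>h. p (i, h)) \<in> sp (std_proj C (xs ! i)) y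
                            else (\<forall>h. p (i, h) = 0))})
     in \<lparr>sp = V, act = (\<lambda>y z g. restr (V y)
          (\<lambda>p (i, m). if i < length xs then act (std_proj C (xs ! i)) y z g (\<lambda>h. p (i, h)) m else 0))\<rparr>)"

definition finite_type :: "('o, 'm) cat \<Rightarrow> ('k::field \<Rightarrow> 'v \<Rightarrow> 'v)
    \<Rightarrow> ('o, 'm, 'v::ab_group_add) cmod \<Rightarrow> bool" where
  "finite_type C s F \<longleftrightarrow> is_cmod C s F \<and>
    (\<exists>xs. set xs \<subseteq> Ob C \<and>
       (\<exists>\<eta>\<in>nattrans C (pw (*)) (std_sum C xs :: ('o, 'm, nat \<times> 'm \<Rightarrow> 'k) cmod) s F.
          surjective C (std_sum C xs) F \<eta>))"

text \<open>\<open>DF(x) = Hom(F, P\<^sub>x)\<close>, contravariant in \<open>x\<close>; a morphism of \<open>op_cat C\<close> from \<open>x\<close> to \<open>y\<close> is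
  a morphism \<open>f : y \<rightarrow> x\<close> of \<open>C\<close>.\<close>

definition D_mod :: "('o, 'm) cat \<Rightarrow> ('k::field \<Rightarrow> 'v \<Rightarrow> 'v) \<Rightarrow> ('o, 'm, 'v::ab_group_add) cmod
    \<Rightarrow> ('o, 'm, 'o \<Rightarrow> 'v \<Rightarrow> 'm \<Rightarrow> 'k) cmod" where
  "D_mod C s F =
    (let V = (\<lambda>x. nattrans C s F (pw (*)) (std_proj C x))
     in \<lparr>sp = V, act = (\<lambda>x y f. restr (V x) (\<lambda>\<eta> z. yoneda_map C y x f z \<circ> \<eta> z))\<rparr>)"

text \<open>Postcomposition with \<open>V' = Hom\<^sub>k(V,k)\<close>: turns modules over a category into modules over the
  opposite category.\<close>

definition dual_mod :: "('k::field \<Rightarrow> 'v \<Rightarrow> 'v) \<Rightarrow> ('o, 'm, 'v::ab_group_add) cmod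
    \<Rightarrow> ('o, 'm, 'v \<Rightarrow> 'k) cmod" where
  "dual_mod s F =
    (let V = (\<lambda>x. linmaps s (sp F x) (*) UNIV)
     in \<lparr>sp = V, act = (\<lambda>x y f. restr (V x) (\<lambda>\<phi>. \<phi> \<circ> act F y x f))\<rparr>)"

section \<open>Complexes\<close>

text \<open>Complexes are indexed by all integers and cohomologically graded.\<close>

record ('o, 'm, 'v) cpx =
  cx :: "int \<Rightarrow> ('o, 'm, 'v) cmod"
  df :: "int \<Rightarrow> 'o \<Rightarrow> 'v \<Rightarrow> 'v"

definition is_complex :: "('o, 'm) cat \<Rightarrow> ('k::field \<Rightarrow> 'v \<Rightarrow> 'v)
    \<Rightarrow> ('o, 'm, 'v::ab_group_add) cpx \<Rightarrow> bool" where
  "is_complex C s X \<longleftrightarrow>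
    (\<forall>n. is_cmod C s (cx X n)) \<and>
    (\<forall>n. df X n \<in> nattrans C s (cx X n) s (cx X (n + 1))) \<and>
    (\<forall>n. \<forall>x\<in>Ob C. \<forall>u\<in>sp (cx X n) x. df X (n + 1) x (df X n x u) = 0)"

definition chain_maps :: "('o, 'm) cat
    \<Rightarrow> ('k::field \<Rightarrow> 'v \<Rightarrow> 'v) \<Rightarrow> ('o, 'm, 'v::ab_group_add) cpx
    \<Rightarrow> ('k \<Rightarrow> 'w \<Rightarrow> 'w) \<Rightarrow> ('o, 'm, 'w::ab_group_add) cpx \<Rightarrow> (int \<Rightarrow> 'o \<Rightarrow> 'v \<Rightarrow> 'w) set" where
  "chain_maps C s X t Y = {f.
     (\<forall>n. f n \<in> nattrans C s (cx X n) t (cx Y n)) \<and>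
     (\<forall>n. \<forall>x\<in>Ob C. f (n + 1) x \<circ> df X n x = df Y n x \<circ> f n x)}"

definition chain_id :: "('o, 'm) cat \<Rightarrow> ('o, 'm, 'v::zero) cpx \<Rightarrow> int \<Rightarrow> 'o \<Rightarrow> 'v \<Rightarrow> 'v" where
  "chain_id C X n = restr_fam C (cx X n) (\<lambda>x u. u)"

definition chain_comp :: "(int \<Rightarrow> 'o \<Rightarrow> 'w \<Rightarrow> 'z) \<Rightarrow> (int \<Rightarrow> 'o \<Rightarrow> 'v \<Rightarrow> 'w) \<Rightarrow> int \<Rightarrow> 'o \<Rightarrow> 'v \<Rightarrow> 'z" where
  "chain_comp g f = (\<lambda>n x. g n x \<circ> f n x)"

definition homotopic :: "('o, 'm) cat
    \<Rightarrow> ('k::field \<Rightarrow> 'v \<Rightarrow> 'v) \<Rightarrow> ('o, 'm, 'v::ab_group_add) cpx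
    \<Rightarrow> ('k \<Rightarrow> 'w \<Rightarrow> 'w) \<Rightarrow> ('o, 'm, 'w::ab_group_add) cpx
    \<Rightarrow> (int \<Rightarrow> 'o \<Rightarrow> 'v \<Rightarrow> 'w) \<Rightarrow> (int \<Rightarrow> 'o \<Rightarrow> 'v \<Rightarrow> 'w) \<Rightarrow> bool" where
  "homotopic C s X t Y f g \<longleftrightarrow>
    (\<exists>h. (\<forall>n. h n \<in> nattrans C s (cx X n) t (cx Y (n - 1))) \<and>
       (\<forall>n. \<forall>x\<in>Ob C. \<forall>u\<in>sp (cx X n) x.
          f n x u - g n x u = df Y (n - 1) x (h n x u) + h (n + 1) x (df X n x u)))"

definition cocycles :: "('o, 'm, 'v::zero) cpx \<Rightarrow> int \<Rightarrow> 'o \<Rightarrow> 'v set" where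
  "cocycles X n x = {z \<in> sp (cx X n) x. df X n x z = 0}"

definition coboundaries :: "('o, 'm, 'v) cpx \<Rightarrow> int \<Rightarrow> 'o \<Rightarrow> 'v set" where
  "coboundaries X n x = df X (n - 1) x ` sp (cx X (n - 1)) x"

definition cohomology_class :: "('o, 'm, 'v::ab_group_add) cpx \<Rightarrow> int \<Rightarrow> 'o \<Rightarrow> 'v \<Rightarrow> 'v set" where
  "cohomology_class X n x z = {z + b | b. b \<in> coboundaries X n x}"

definition cohomology :: "('o, 'm, 'v::ab_group_add) cpx \<Rightarrow> int \<Rightarrow> 'o \<Rightarrow> 'v set set" where
  "cohomology X n x = cohomology_class X n x ` cocycles X n x"

definition quasi_iso :: "('o, 'm) cat
    \<Rightarrow> ('k::field \<Rightarrow> 'v \<Rightarrow> 'v) \<Rightarrow> ('o, 'm, 'v::ab_group_add) cpx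
    \<Rightarrow> ('k \<Rightarrow> 'w \<Rightarrow> 'w) \<Rightarrow> ('o, 'm, 'w::ab_group_add) cpx \<Rightarrow> (int \<Rightarrow> 'o \<Rightarrow> 'v \<Rightarrow> 'w) \<Rightarrow> bool" where
  "quasi_iso C s X t Y f \<longleftrightarrow> f \<in> chain_maps C s X t Y \<and>
    (\<forall>n. \<forall>x\<in>Ob C.
      bij_betw (\<lambda>c. \<Union>z\<in>c. cohomology_class Y n x (f n x z)) (cohomology X n x) (cohomology Y n x))"

text \<open>\<open>D\<close> and \<open>'\<close> on complexes reverse the grading: \<open>(DX)\<^sup>n = D(X\<^sup>-\<^sup>n)\<close> and \<open>(X')\<^sup>n = (X\<^sup>-\<^sup>n)'\<close>,
  without signs in the differentials.\<close>

definition D_cpx :: "('o, 'm) cat \<Rightarrow> ('k::field \<Rightarrow> 'v \<Rightarrow> 'v) \<Rightarrow> ('o, 'm, 'v::ab_group_add) cpx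
    \<Rightarrow> ('o, 'm, 'o \<Rightarrow> 'v \<Rightarrow> 'm \<Rightarrow> 'k) cpx" where
  "D_cpx C s X = \<lparr>cx = (\<lambda>n. D_mod C s (cx X (- n))),
     df = (\<lambda>n. restr_fam C (D_mod C s (cx X (- n))) (\<lambda>x \<eta> z. \<eta> z \<circ> df X (- (n + 1)) z))\<rparr>"

definition D_map :: "('o, 'm) cat \<Rightarrow> ('k::field \<Rightarrow> 'v \<Rightarrow> 'v) \<Rightarrow> ('o, 'm, 'v::ab_group_add) cpx
    \<Rightarrow> (int \<Rightarrow> 'o \<Rightarrow> 'v \<Rightarrow> 'v) \<Rightarrow> int \<Rightarrow> 'o \<Rightarrow> ('o \<Rightarrow> 'v \<Rightarrow> 'm \<Rightarrow> 'k) \<Rightarrow> 'o \<Rightarrow> 'v \<Rightarrow> 'm \<Rightarrow> 'k" where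
  \<comment> \<open>\<open>g : X \<rightarrow> Y\<close> induces \<open>D_map C s Y g : DY \<rightarrow> DX\<close>\<close>
  "D_map C s Y g n = restr_fam C (D_mod C s (cx Y (- n))) (\<lambda>x \<eta> z. \<eta> z \<circ> g (- n) z)"

definition dual_cpx :: "('o, 'm) cat \<Rightarrow> ('k::field \<Rightarrow> 'v \<Rightarrow> 'v) \<Rightarrow> ('o, 'm, 'v::ab_group_add) cpx
    \<Rightarrow> ('o, 'm, 'v \<Rightarrow> 'k) cpx" where
  "dual_cpx C s X = \<lparr>cx = (\<lambda>n. dual_mod s (cx X (- n))),
     df = (\<lambda>n. restr_fam C (dual_mod s (cx X (- n))) (\<lambda>x \<phi>. \<phi> \<circ> df X (- (n + 1)) x))\<rparr>"

definition dual_map :: "('o, 'm) cat \<Rightarrow> ('k::field \<Rightarrow> 'v \<Rightarrow> 'v) \<Rightarrow> ('o, 'm, 'v::ab_group_add) cpx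
    \<Rightarrow> (int \<Rightarrow> 'o \<Rightarrow> 'v \<Rightarrow> 'v) \<Rightarrow> int \<Rightarrow> 'o \<Rightarrow> ('v \<Rightarrow> 'k) \<Rightarrow> 'v \<Rightarrow> 'k" where
  \<comment> \<open>\<open>g : X \<rightarrow> Y\<close> induces \<open>dual_map C s Y g : Y' \<rightarrow> X'\<close>\<close>
  "dual_map C s Y g n = restr_fam C (dual_mod s (cx Y (- n))) (\<lambda>x \<phi>. \<phi> \<circ> g (- n) x)"

text \<open>Transport of structure along a linear injection \<open>e\<close> of ambient spaces.\<close>

definition transport_mod :: "('v \<Rightarrow> 'w::zero) \<Rightarrow> ('o, 'm, 'v) cmod \<Rightarrow> ('o, 'm, 'w) cmod" where
  "transport_mod e F = \<lparr>sp = (\<lambda>x. e ` sp F x),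
     act = (\<lambda>x y f. restr (e ` sp F x) (e \<circ> act F x y f \<circ> inv e))\<rparr>"

definition transport_map :: "('o, 'm) cat \<Rightarrow> ('v \<Rightarrow> 'w::zero) \<Rightarrow> ('o, 'm, 'v) cpx
    \<Rightarrow> (int \<Rightarrow> 'o \<Rightarrow> 'v \<Rightarrow> 'v) \<Rightarrow> int \<Rightarrow> 'o \<Rightarrow> 'w \<Rightarrow> 'w" where
  \<comment> \<open>\<open>X\<close> is the source of the family \<open>g\<close>\<close>
  "transport_map C e X g n = restr_fam C (transport_mod e (cx X n)) (\<lambda>x. e \<circ> g n x \<circ> inv e)"

definition transport_cpx :: "('o, 'm) cat \<Rightarrow> ('v \<Rightarrow> 'w::zero) \<Rightarrow> ('o, 'm, 'v) cpx \<Rightarrow> ('o, 'm, 'w) cpx" where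
  "transport_cpx C e X = \<lparr>cx = (\<lambda>n. transport_mod e (cx X n)), df = transport_map C e X (df X)\<rparr>"

section \<open>The derived category\<close>

text \<open>The localisation of the homotopy category at the quasi-isomorphisms: morphisms from \<open>X\<close> to \<open>Y\<close>
  are equivalence classes of roofs, \<open>(Z, \<sigma>, f)\<close> standing for \<open>X \<leftarrow> Z \<rightarrow> Y\<close>
  with \<open>\<sigma> : Z \<rightarrow> X\<close> a quasi-isomorphism.\<close>

type_synonym ('o, 'm, 'v) roof =
  "('o, 'm, 'v) cpx \<times> (int \<Rightarrow> 'o \<Rightarrow> 'v \<Rightarrow> 'v) \<times> (int \<Rightarrow> 'o \<Rightarrow> 'v \<Rightarrow> 'v)"

definition roofs :: "('o, 'm) cat \<Rightarrow> ('k::field \<Rightarrow> 'v \<Rightarrow> 'v) \<Rightarrow> ('o, 'm, 'v::ab_group_add) cpx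
    \<Rightarrow> ('o, 'm, 'v) cpx \<Rightarrow> ('o, 'm, 'v) roof set" where
  "roofs C s X Y = {(Z, \<sigma>, f). is_complex C s Z \<and> quasi_iso C s Z s X \<sigma> \<and> f \<in> chain_maps C s Z s Y}"

definition roof_rel :: "('o, 'm) cat \<Rightarrow> ('k::field \<Rightarrow> 'v \<Rightarrow> 'v) \<Rightarrow> ('o, 'm, 'v::ab_group_add) cpx
    \<Rightarrow> ('o, 'm, 'v) cpx \<Rightarrow> (('o, 'm, 'v) roof \<times> ('o, 'm, 'v) roof) set" where
  "roof_rel C s X Y = {((Z, \<sigma>, f), (Z', \<sigma>', f')).
     (Z, \<sigma>, f) \<in> roofs C s X Y \<and> (Z', \<sigma>', f') \<in> roofs C s X Y \<and>
     (\<exists>W p q. is_complex C s W \<and> p \<in> chain_maps C s W s Z \<and> q \<in> chain_maps C s W s Z' \<and>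
        quasi_iso C s W s X (chain_comp \<sigma> p) \<and>
        homotopic C s W s X (chain_comp \<sigma> p) (chain_comp \<sigma>' q) \<and>
        homotopic C s W s Y (chain_comp f p) (chain_comp f' q))}"

definition roof_class :: "('o, 'm) cat \<Rightarrow> ('k::field \<Rightarrow> 'v \<Rightarrow> 'v) \<Rightarrow> ('o, 'm, 'v::ab_group_add) cpx
    \<Rightarrow> ('o, 'm, 'v) cpx \<Rightarrow> ('o, 'm, 'v) roof \<Rightarrow> ('o, 'm, 'v) roof set" where
  "roof_class C s X Y R = roof_rel C s X Y `` {R}"

text \<open>Image of a chain map \<open>f : X \<rightarrow> Y\<close> in the derived category.\<close>

definition loc :: "('o, 'm) cat \<Rightarrow> ('k::field \<Rightarrow> 'v \<Rightarrow> 'v) \<Rightarrow> ('o, 'm, 'v::ab_group_add) cpx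
    \<Rightarrow> ('o, 'm, 'v) cpx \<Rightarrow> (int \<Rightarrow> 'o \<Rightarrow> 'v \<Rightarrow> 'v) \<Rightarrow> ('o, 'm, 'v) roof set" where
  "loc C s X Y f = roof_class C s X Y (X, chain_id C X, f)"

text \<open>Composition completes \<open>Z \<rightarrow> Y \<leftarrow> W\<close> to a homotopy commutative square with apex \<open>U\<close>; addition
  uses representatives with a common denominator. The unions are over representatives, all of which
  give the same class.\<close>

definition derived_comp :: "('o, 'm) cat \<Rightarrow> ('k::field \<Rightarrow> 'v \<Rightarrow> 'v) \<Rightarrow> ('o, 'm, 'v::ab_group_add) cpx
    \<Rightarrow> ('o, 'm, 'v) cpx \<Rightarrow> ('o, 'm, 'v) cpx
    \<Rightarrow> ('o, 'm, 'v) roof set \<Rightarrow> ('o, 'm, 'v) roof set \<Rightarrow> ('o, 'm, 'v) roof set" where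
  "derived_comp C s X Y V \<beta> \<alpha> =
    \<Union>{roof_class C s X V (U, chain_comp \<sigma> u, chain_comp g h) | U \<sigma> u g h.
       \<exists>Z f W \<tau>. (Z, \<sigma>, f) \<in> \<alpha> \<and> (W, \<tau>, g) \<in> \<beta> \<and> is_complex C s U \<and>
         quasi_iso C s U s Z u \<and> h \<in> chain_maps C s U s W \<and>
         homotopic C s U s Y (chain_comp f u) (chain_comp \<tau> h)}"

definition derived_add :: "('o, 'm) cat \<Rightarrow> ('k::field \<Rightarrow> 'v \<Rightarrow> 'v) \<Rightarrow> ('o, 'm, 'v::ab_group_add) cpx
    \<Rightarrow> ('o, 'm, 'v) cpx
    \<Rightarrow> ('o, 'm, 'v) roof set \<Rightarrow> ('o, 'm, 'v) roof set \<Rightarrow> ('o, 'm, 'v) roof set" where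
  "derived_add C s X Y \<alpha> \<beta> =
    \<Union>{roof_class C s X Y (Z, \<sigma>, f + g) | Z \<sigma> f g. (Z, \<sigma>, f) \<in> \<alpha> \<and> (Z, \<sigma>, g) \<in> \<beta>}"

definition derived_smul :: "('o, 'm) cat \<Rightarrow> ('k::field \<Rightarrow> 'v \<Rightarrow> 'v) \<Rightarrow> ('o, 'm, 'v::ab_group_add) cpx
    \<Rightarrow> ('o, 'm, 'v) cpx \<Rightarrow> 'k \<Rightarrow> ('o, 'm, 'v) roof set \<Rightarrow> ('o, 'm, 'v) roof set" where
  "derived_smul C s X Y c \<alpha> =
    \<Union>{roof_class C s X Y (Z, \<sigma>, \<lambda>n x u. s c (f n x u)) | Z \<sigma> f. (Z, \<sigma>, f) \<in> \<alpha>}"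

definition derived :: "('o, 'm) cat \<Rightarrow> ('k::field \<Rightarrow> 'v \<Rightarrow> 'v)
    \<Rightarrow> (('o, 'm, 'v::ab_group_add) cpx, ('o, 'm, 'v) roof set, 'k) lincat" where
  "derived C s = \<lparr>Ob = {X. is_complex C s X},
     Hom = (\<lambda>X Y. roofs C s X Y // roof_rel C s X Y),
     Idn = (\<lambda>X. loc C s X X (chain_id C X)),
     Cmp = derived_comp C s, Add = derived_add C s, Smul = derived_smul C s\<rparr>"

section \<open>Perfect complexes\<close>

definition bounded_ft_projective :: "('o, 'm) cat \<Rightarrow> ('k::field \<Rightarrow> 'v \<Rightarrow> 'v)
    \<Rightarrow> ('o, 'm, 'v::ab_group_add) cpx \<Rightarrow> bool" where
  "bounded_ft_projective C s P \<longleftrightarrow> is_complex C s P \<and>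
    (\<forall>n. projective C s (cx P n) \<and> finite_type C s (cx P n)) \<and>
    (\<exists>N. \<forall>n. \<bar>n\<bar> > N \<longrightarrow> (\<forall>x\<in>Ob C. sp (cx P n) x = {0}))"

definition Perf :: "('o, 'm) cat \<Rightarrow> ('k::field \<Rightarrow> 'v \<Rightarrow> 'v) \<Rightarrow> ('o, 'm, 'v::ab_group_add) cpx set" where
  "Perf C s = {X. is_complex C s X \<and>
     (\<exists>P. bounded_ft_projective C s P \<and> isomorphic (derived C s) P X)}"

section \<open>The functor \<open>X \<mapsto> RD(X)'\<close> on perfect complexes\<close>

text \<open>\<open>RD(X)\<close> is obtained by applying \<open>D\<close> to a projective resolution of \<open>X\<close>. A perfect complex has a
  resolution which is a bounded complex of finite type projectives, and finite type projectives
  can be realised inside the space of functions on \<open>nat \<times> 'm\<close>. One such resolution is chosen.\<close>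

type_synonym ('m, 'k) pspace = "nat \<times> 'm \<Rightarrow> 'k"

definition resolution :: "('o, 'm) cat \<Rightarrow> ('k::field \<Rightarrow> 'v \<Rightarrow> 'v) \<Rightarrow> ('o, 'm, 'v::ab_group_add) cpx
    \<Rightarrow> ('o, 'm, ('m, 'k) pspace) cpx \<times> (int \<Rightarrow> 'o \<Rightarrow> ('m, 'k) pspace \<Rightarrow> 'v)" where
  "resolution C s X =
    (SOME (P, r). bounded_ft_projective C (pw (*)) P \<and> quasi_iso C (pw (*)) P s X r)"

definition RD :: "('o, 'm) cat \<Rightarrow> ('k::field \<Rightarrow> 'v \<Rightarrow> 'v) \<Rightarrow> ('o, 'm, 'v::ab_group_add) cpx
    \<Rightarrow> ('o, 'm, 'o \<Rightarrow> ('m, 'k) pspace \<Rightarrow> 'm \<Rightarrow> 'k) cpx" where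
  "RD C s X = D_cpx C (pw (*)) (fst (resolution C s X))"

text \<open>A lift of a morphism \<open>\<alpha> = [X \<leftarrow> Z \<rightarrow> Y]\<close> to the resolutions: a chain map \<open>g : P\<^sub>X \<rightarrow> P\<^sub>Y\<close> with
  \<open>r\<^sub>Y g = \<alpha> r\<^sub>X\<close> in the derived category, where \<open>h\<close> lifts \<open>r\<^sub>X\<close> through \<open>Z \<rightarrow> X\<close>.\<close>

definition is_lift :: "('o, 'm) cat \<Rightarrow> ('k::field \<Rightarrow> 'v \<Rightarrow> 'v) \<Rightarrow> ('o, 'm, 'v::ab_group_add) cpx
    \<Rightarrow> ('o, 'm, 'v) cpx \<Rightarrow> ('o, 'm, 'v) roof set
    \<Rightarrow> (int \<Rightarrow> 'o \<Rightarrow> ('m, 'k) pspace \<Rightarrow> ('m, 'k) pspace) \<Rightarrow> bool" where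
  "is_lift C s X Y \<alpha> g \<longleftrightarrow>
    (let (P, r) = resolution C s X; (Q, q) = resolution C s Y
     in g \<in> chain_maps C (pw (*)) P (pw (*)) Q \<and>
        (\<exists>Z \<sigma> f. (Z, \<sigma>, f) \<in> \<alpha> \<and>
          (\<exists>h\<in>chain_maps C (pw (*)) P s Z.
             homotopic C (pw (*)) P s X (chain_comp \<sigma> h) r \<and>
             homotopic C (pw (*)) P s Y (chain_comp f h) (chain_comp q g))))"

text \<open>\<open>RD(X)\<close> is a complex in the ambient space with scalar multiplication \<open>Dscale\<close>, so \<open>RD(X)'\<close> is
  one in the ambient space \<open>('o, 'm, 'k) bidual_space\<close>; \<open>e\<close> embeds the latter in \<open>'v\<close>.\<close>

type_synonym ('o, 'm, 'k) bidual_space = "('o \<Rightarrow> ('m, 'k) pspace \<Rightarrow> 'm \<Rightarrow> 'k) \<Rightarrow> 'k"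

definition Dscale :: "'k::field \<Rightarrow> ('o \<Rightarrow> 'v \<Rightarrow> 'm \<Rightarrow> 'k) \<Rightarrow> 'o \<Rightarrow> 'v \<Rightarrow> 'm \<Rightarrow> 'k" where
  "Dscale = pw (pw (pw (*)))"

definition RD_dual :: "('o, 'm) cat \<Rightarrow> ('k::field \<Rightarrow> 'v \<Rightarrow> 'v)
    \<Rightarrow> (('o, 'm, 'k) bidual_space \<Rightarrow> 'v) \<Rightarrow> ('o, 'm, 'v::ab_group_add) cpx \<Rightarrow> ('o, 'm, 'v) cpx" where
  "RD_dual C s e X = transport_cpx C e (dual_cpx C Dscale (RD C s X))"

text \<open>If \<open>g : P\<^sub>X \<rightarrow> P\<^sub>Y\<close> lifts \<open>\<alpha>\<close>, then \<open>RD(\<alpha>)\<close> is \<open>Dg : RD(Y) \<rightarrow> RD(X)\<close>, and \<open>RD(\<alpha>)'\<close> is its dual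
  \<open>RD(X)' \<rightarrow> RD(Y)'\<close>.\<close>

definition RD_dual_map :: "('o, 'm) cat \<Rightarrow> ('k::field \<Rightarrow> 'v \<Rightarrow> 'v)
    \<Rightarrow> (('o, 'm, 'k) bidual_space \<Rightarrow> 'v) \<Rightarrow> ('o, 'm, 'v::ab_group_add) cpx \<Rightarrow> ('o, 'm, 'v) cpx
    \<Rightarrow> ('o, 'm, 'v) roof set \<Rightarrow> ('o, 'm, 'v) roof set" where
  "RD_dual_map C s e X Y \<alpha> = (THE \<beta>. \<exists>g. is_lift C s X Y \<alpha> g \<and>
     \<beta> = loc C s (RD_dual C s e X) (RD_dual C s e Y)
           (transport_map C e (dual_cpx C Dscale (RD C s X))
              (dual_map C Dscale (RD C s X)
                 (D_map C (pw (*)) (fst (resolution C s Y)) g))))"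

end

theory Submission
  imports Defs "HOL-Library.Product_Plus"
begin

text \<open>For a finitely generated projective \<open>P\<close> the trace identifies natural transformations
  \<open>\<tau> : Y \<rightarrow> (DP)'\<close> with functionals \<open>f \<mapsto> tr(\<tau> f)\<close> on the transformations \<open>f : P \<rightarrow> Y\<close>. For a bounded
  complex \<open>P\<close> of such, the alternating sum \<open>\<Sum>\<^sub>n (-1)\<^sup>n tr(\<tau>\<^sub>n f\<^sub>n)\<close> is a pairing of chain maps that
  vanishes when one side is null homotopic. It is perfect on homotopy classes: over a field, a
  functional on chain maps that kills the null homotopic ones extends to all graded families, and the
  extension yields the chain map \<open>\<tau>\<close>; likewise, if all traces against \<open>\<tau>\<close> vanish then the functional
  factors through the coboundary, and the factor yields a homotopy \<open>\<tau> \<sim> 0\<close>. Since \<open>P\<close> is a bounded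
  complex of projectives, homotopy classes of maps \<open>P \<rightarrow> Y\<close> are the morphisms \<open>X \<rightarrow> Y\<close> of the derived
  category when \<open>P\<close> resolves \<open>X\<close>, and the isomorphism \<open>Hom(X,Y)' \<cong> Hom(Y,RD(X)')\<close> follows.

  The derived category is a category of fractions because homotopy pullbacks exist. They need room:
  the hypothesis on \<open>e\<close> makes \<open>'v\<close> infinite dimensional, hence \<open>'v \<times> 'v \<times> 'v\<close> embeds in \<open>'v\<close>.\<close>

section \<open>Calculus of fractions\<close>

text \<open>Checking every well-definedness claim by diagrams of roofs would dominate the proof.
  Instead a roof is replaced by the relation \<open>tr\<close> that it induces on generalised
  elements, that is on pairs of maps into source and target, up to refining their common domain by a
  quasi-isomorphism. Two roofs are equivalent exactly if their relations coincide
  (\<open>rel_iff\<close>), and composing roofs composes relations (\<open>tr_comp\<close>), so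
  independence of representatives becomes formal. The alternating sign is forced: by cyclicity of
  the trace, a null homotopy contributes A(n) + A(n+1) in degree n, and the alternating sum of these
  telescopes to boundary terms, which vanish because \<open>P\<close> is bounded. The pairing is
  developed for an arbitrary complex \<open>Y\<close> in an arbitrary ambient space; only
  \<open>P\<close> is restricted. This generality is used: that \<open>RD_dual_map\<close> is
  independent of the chosen lift is proved by pairing with maps into a bidual complex, which need
  not be perfect. Resolutions and biduals live in ambient spaces of their own, so each is compared
  with its copy inside \<open>'v\<close> by the isomorphisms \<open>tin\<close> and
  \<open>tout\<close>.\<close>

locale fraction_data =
  fixes Obj :: "'x set"
    and ch :: "'x \<Rightarrow> 'x \<Rightarrow> 'f::ab_group_add set"
    and cp :: "'f \<Rightarrow> 'f \<Rightarrow> 'f" (infixl "\<cdot>" 75)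
    and idm :: "'x \<Rightarrow> 'f"
    and hom :: "'x \<Rightarrow> 'x \<Rightarrow> 'f \<Rightarrow> 'f \<Rightarrow> bool"
    and qi :: "'x \<Rightarrow> 'x \<Rightarrow> 'f \<Rightarrow> bool"
    and sc :: "'k::field \<Rightarrow> 'f \<Rightarrow> 'f"
begin

definition Ar :: "'x \<Rightarrow> 'x \<Rightarrow> 'f \<Rightarrow> bool" where
  "Ar X Y f \<longleftrightarrow> X \<in> Obj \<and> Y \<in> Obj \<and> f \<in> ch X Y"

definition H :: "'x \<Rightarrow> 'x \<Rightarrow> 'f \<Rightarrow> 'f \<Rightarrow> bool" where
  "H X Y f g \<longleftrightarrow> Ar X Y f \<and> Ar X Y g \<and> hom X Y f g"

definition Q :: "'x \<Rightarrow> 'x \<Rightarrow> 'f \<Rightarrow> bool" where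
  "Q X Y f \<longleftrightarrow> Ar X Y f \<and> qi X Y f"

text \<open>From here to \<open>fcat\<close> the definitions repeat those of the derived category
  with its ingredients abstracted, so that \<open>derived_eq\<close> identifies the two by
  unfolding.\<close>

definition rfs :: "'x \<Rightarrow> 'x \<Rightarrow> ('x \<times> 'f \<times> 'f) set" where
  "rfs X Y = {(Z, \<sigma>, f). Z \<in> Obj \<and> qi Z X \<sigma> \<and> f \<in> ch Z Y}"

definition rel :: "'x \<Rightarrow> 'x \<Rightarrow> (('x \<times> 'f \<times> 'f) \<times> ('x \<times> 'f \<times> 'f)) set" where
  "rel X Y = {((Z, \<sigma>, f), (Z', \<sigma>', f')).
     (Z, \<sigma>, f) \<in> rfs X Y \<and> (Z', \<sigma>', f') \<in> rfs X Y \<and>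
     (\<exists>W p q. W \<in> Obj \<and> p \<in> ch W Z \<and> q \<in> ch W Z' \<and>
        qi W X (\<sigma> \<cdot> p) \<and>
        hom W X (\<sigma> \<cdot> p) (\<sigma>' \<cdot> q) \<and>
        hom W Y (f \<cdot> p) (f' \<cdot> q))}"

definition cls :: "'x \<Rightarrow> 'x \<Rightarrow> 'x \<times> 'f \<times> 'f \<Rightarrow> ('x \<times> 'f \<times> 'f) set" where
  "cls X Y R = rel X Y `` {R}"

definition fcomp :: "'x \<Rightarrow> 'x \<Rightarrow> 'x \<Rightarrow> ('x \<times> 'f \<times> 'f) set \<Rightarrow> ('x \<times> 'f \<times> 'f) set \<Rightarrow> ('x \<times> 'f \<times> 'f) set" where
  "fcomp X Y V \<beta> \<alpha> =
    \<Union>{cls X V (U, \<sigma> \<cdot> u, g \<cdot> h) | U \<sigma> u g h.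
       \<exists>Z f W \<tau>. (Z, \<sigma>, f) \<in> \<alpha> \<and> (W, \<tau>, g) \<in> \<beta> \<and> U \<in> Obj \<and>
         qi U Z u \<and> h \<in> ch U W \<and>
         hom U Y (f \<cdot> u) (\<tau> \<cdot> h)}"

definition fadd :: "'x \<Rightarrow> 'x \<Rightarrow> ('x \<times> 'f \<times> 'f) set \<Rightarrow> ('x \<times> 'f \<times> 'f) set \<Rightarrow> ('x \<times> 'f \<times> 'f) set" where
  "fadd X Y \<alpha> \<beta> =
    \<Union>{cls X Y (Z, \<sigma>, f + g) | Z \<sigma> f g. (Z, \<sigma>, f) \<in> \<alpha> \<and> (Z, \<sigma>, g) \<in> \<beta>}"

definition fsmul :: "'x \<Rightarrow> 'x \<Rightarrow> 'k \<Rightarrow> ('x \<times> 'f \<times> 'f) set \<Rightarrow> ('x \<times> 'f \<times> 'f) set" where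
  "fsmul X Y c \<alpha> = \<Union>{cls X Y (Z, \<sigma>, sc c f) | Z \<sigma> f. (Z, \<sigma>, f) \<in> \<alpha>}"

definition floc :: "'x \<Rightarrow> 'x \<Rightarrow> 'f \<Rightarrow> ('x \<times> 'f \<times> 'f) set" where
  "floc X Y f = cls X Y (X, idm X, f)"

definition fcat :: "('x, ('x \<times> 'f \<times> 'f) set, 'k) lincat" where
  "fcat = \<lparr>Ob = Obj, Hom = (\<lambda>X Y. rfs X Y // rel X Y), Idn = (\<lambda>X. floc X X (idm X)),
     Cmp = fcomp, Add = fadd, Smul = fsmul\<rparr>"

text \<open>The effect of the fraction \<open>f \<sigma>\<inverse>\<close> on generalised elements: \<open>f \<sigma>\<inverse> x = y\<close>.\<close>

definition tr :: "'x \<Rightarrow> 'x \<Rightarrow> 'x \<times> 'f \<times> 'f \<Rightarrow> 'x \<Rightarrow> 'f \<Rightarrow> 'f \<Rightarrow> bool" where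
  "tr X Y a T x y \<longleftrightarrow> (case a of (Z, \<sigma>, f) \<Rightarrow>
     Ar T X x \<and> Ar T Y y \<and>
     (\<exists>T' p h. Q T' T p \<and> Ar T' Z h \<and> H T' X (\<sigma> \<cdot> h) (x \<cdot> p) \<and> H T' Y (f \<cdot> h) (y \<cdot> p)))"

end

text \<open>The laws are phrased with the typed predicates \<open>Ar\<close>, \<open>H\<close> and
  \<open>Q\<close>, which is why these are defined beforehand in a locale without assumptions.
  \<open>Ore\<close> and \<open>cancel\<close> are the two conditions of a calculus of fractions,
  with squares commuting only up to homotopy; \<open>Q_comp\<close> and \<open>Q_cancel\<close> are
  the parts of two out of three on which the calculus rests.\<close>

locale fractions = fraction_data +
  assumes qi_ch: "qi X Y f \<Longrightarrow> f \<in> ch X Y"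
    and Ar_comp: "Ar X Y f \<Longrightarrow> Ar Y Z g \<Longrightarrow> Ar X Z (g \<cdot> f)"
    and Ar_id: "X \<in> Obj \<Longrightarrow> Ar X X (idm X)"
    and Ar_zero: "X \<in> Obj \<Longrightarrow> Y \<in> Obj \<Longrightarrow> Ar X Y 0"
    and Ar_add: "Ar X Y f \<Longrightarrow> Ar X Y g \<Longrightarrow> Ar X Y (f + g)"
    and Ar_sc: "Ar X Y f \<Longrightarrow> Ar X Y (sc c f)"
    and assoc: "h \<cdot> g \<cdot> f = h \<cdot> (g \<cdot> f)"
    and id_left: "Ar X Y f \<Longrightarrow> idm Y \<cdot> f = f"
    and id_right: "Ar X Y f \<Longrightarrow> f \<cdot> idm X = f"
    and comp_add_right: "Ar X Y f \<Longrightarrow> Ar X Y f' \<Longrightarrow> Ar Y Z g \<Longrightarrow> g \<cdot> (f + f') = g \<cdot> f + g \<cdot> f'"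
    and comp_add_left: "(g + g') \<cdot> f = g \<cdot> f + g' \<cdot> f"
    and comp_sc_right: "Ar X Y f \<Longrightarrow> Ar Y Z g \<Longrightarrow> g \<cdot> sc c f = sc c (g \<cdot> f)"
    and comp_sc_left: "sc c g \<cdot> f = sc c (g \<cdot> f)"
    and vs: "vector_space sc"
    and H_refl: "Ar X Y f \<Longrightarrow> H X Y f f"
    and H_sym: "H X Y f g \<Longrightarrow> H X Y g f"
    and H_trans: "H X Y f g \<Longrightarrow> H X Y g h \<Longrightarrow> H X Y f h"
    and H_comp: "H X Y f f' \<Longrightarrow> H Y Z g g' \<Longrightarrow> H X Z (g \<cdot> f) (g' \<cdot> f')"
    and H_add: "H X Y f f' \<Longrightarrow> H X Y g g' \<Longrightarrow> H X Y (f + g) (f' + g')"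
    and H_sc: "H X Y f f' \<Longrightarrow> H X Y (sc c f) (sc c f')"
    and Q_id: "X \<in> Obj \<Longrightarrow> Q X X (idm X)"
    and Q_comp: "Q X Y f \<Longrightarrow> Q Y Z g \<Longrightarrow> Q X Z (g \<cdot> f)"
    and Q_cancel: "Ar X Y f \<Longrightarrow> Q Y Z g \<Longrightarrow> Q X Z (g \<cdot> f) \<Longrightarrow> Q X Y f"
    and Q_H: "H X Y f g \<Longrightarrow> Q X Y f \<Longrightarrow> Q X Y g"
    and Ore: "Ar Z Y f \<Longrightarrow> Q W Y g \<Longrightarrow> \<exists>U u h. Q U Z u \<and> Ar U W h \<and> H U Y (f \<cdot> u) (g \<cdot> h)"
    and cancel: "Ar Z W f \<Longrightarrow> Ar Z W f' \<Longrightarrow> Q W Y g \<Longrightarrow> H Z Y (g \<cdot> f) (g \<cdot> f') \<Longrightarrow>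
      \<exists>U u. Q U Z u \<and> H U W (f \<cdot> u) (f' \<cdot> u)"
begin

lemma ArD: "Ar X Y f \<Longrightarrow> X \<in> Obj" "Ar X Y f \<Longrightarrow> Y \<in> Obj" "Ar X Y f \<Longrightarrow> f \<in> ch X Y"
  by (auto simp: Ar_def)

lemma HD: "H X Y f g \<Longrightarrow> Ar X Y f" "H X Y f g \<Longrightarrow> Ar X Y g"
  by (auto simp: H_def)

lemma QD: "Q X Y f \<Longrightarrow> Ar X Y f"
  by (auto simp: Q_def)

lemma H_pre: "H Y Z g g' \<Longrightarrow> Ar X Y f \<Longrightarrow> H X Z (g \<cdot> f) (g' \<cdot> f)"
  by (rule H_comp[OF H_refl])

lemma H_post: "H X Y f f' \<Longrightarrow> Ar Y Z g \<Longrightarrow> H X Z (g \<cdot> f) (g \<cdot> f')"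
  by (rule H_comp[OF _ H_refl])

section \<open>Roofs as relations on generalised elements\<close>

definition Rf :: "'a \<Rightarrow> 'a \<Rightarrow> 'a \<times> 'b \<times> 'b \<Rightarrow> bool" where
  "Rf X Y a \<longleftrightarrow> (case a of (Z, \<sigma>, f) \<Rightarrow> Q Z X \<sigma> \<and> Ar Z Y f)"

lemma Rf_iff[simp]: "Rf X Y (Z, \<sigma>, f) \<longleftrightarrow> Q Z X \<sigma> \<and> Ar Z Y f"
  by (simp add: Rf_def)

lemma tr_iff: "tr X Y (Z, \<sigma>, f) T x y \<longleftrightarrow> Ar T X x \<and> Ar T Y y \<and>
  (\<exists>T' p h. Q T' T p \<and> Ar T' Z h \<and> H T' X (\<sigma> \<cdot> h) (x \<cdot> p) \<and> H T' Y (f \<cdot> h) (y \<cdot> p))"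
  by (simp add: tr_def)

lemma trI: "Ar T X x \<Longrightarrow> Ar T Y y \<Longrightarrow> Q T' T p \<Longrightarrow> Ar T' Z h \<Longrightarrow> H T' X (\<sigma> \<cdot> h) (x \<cdot> p)
  \<Longrightarrow> H T' Y (f \<cdot> h) (y \<cdot> p) \<Longrightarrow> tr X Y (Z, \<sigma>, f) T x y"
  unfolding tr_iff by blast

lemma trD: "tr X Y a T x y \<Longrightarrow> Ar T X x" "tr X Y a T x y \<Longrightarrow> Ar T Y y"
  by (auto simp: tr_def split: prod.splits)

lemma tr_direct:
  assumes "Ar T Z h" "H T X (\<sigma> \<cdot> h) x" "H T Y (f \<cdot> h) y"
  shows "tr X Y (Z, \<sigma>, f) T x y"
proof (rule trI[OF _ _ Q_id assms(1)])
  show "T \<in> Obj" using assms(1) by (rule ArD)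
  show "H T X (\<sigma> \<cdot> h) (x \<cdot> idm T)" "H T Y (f \<cdot> h) (y \<cdot> idm T)"
    using assms(2,3) HD id_right by metis+
qed (use assms HD in blast)+

lemma tr_H:
  assumes "tr X Y a T x y" "H T X x x'" "H T Y y y'"
  shows "tr X Y a T x' y'"
proof -
  obtain Z \<sigma> f where a: "a = (Z, \<sigma>, f)" by (cases a)
  from assms(1)[unfolded a tr_iff] obtain T' p h where 1: "Q T' T p" "Ar T' Z h"
    "H T' X (\<sigma> \<cdot> h) (x \<cdot> p)" "H T' Y (f \<cdot> h) (y \<cdot> p)" by blast
  show ?thesis unfolding a
    by (rule trI[OF _ _ 1(1,2)]) (meson 1 assms(2,3) H_pre H_trans QD HD)+
qed

text \<open>The definition of \<open>tr\<close> already allows a refinement of the domain, and two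
  refinements compose; the relation can therefore be tested locally.\<close>

lemma tr_local:
  assumes "tr X Y a T' (x \<cdot> p) (y \<cdot> p)" "Q T' T p" "Ar T X x" "Ar T Y y"
  shows "tr X Y a T x y"
proof -
  obtain Z \<sigma> f where a: "a = (Z, \<sigma>, f)" by (cases a)
  from assms(1)[unfolded a tr_iff] obtain S q h where 1: "Q S T' q" "Ar S Z h"
    "H S X (\<sigma> \<cdot> h) (x \<cdot> p \<cdot> q)" "H S Y (f \<cdot> h) (y \<cdot> p \<cdot> q)" by blast
  show ?thesis unfolding a
    using trI[OF assms(3,4) Q_comp[OF 1(1) assms(2)] 1(2)] 1(3,4) by (simp add: assoc)
qed

text \<open>The witness over \<open>T\<close> is pulled back along \<open>g\<close>: the Ore square
  of \<open>g\<close> against the refinement \<open>p\<close> supplies a refinement of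
  \<open>S\<close> and a map back to the old witness.\<close>

lemma tr_pre:
  assumes "tr X Y a T x y" "Ar S T g"
  shows "tr X Y a S (x \<cdot> g) (y \<cdot> g)"
proof -
  obtain Z \<sigma> f where a: "a = (Z, \<sigma>, f)" by (cases a)
  from assms(1)[unfolded a tr_iff] obtain T' p h where 1: "Q T' T p" "Ar T' Z h"
    "H T' X (\<sigma> \<cdot> h) (x \<cdot> p)" "H T' Y (f \<cdot> h) (y \<cdot> p)" by blast
  obtain U u k where 2: "Q U S u" "Ar U T' k" "H U T (g \<cdot> u) (p \<cdot> k)"
    using Ore[OF assms(2) 1(1)] by blast
  have *: "H U V (m \<cdot> (h \<cdot> k)) (z \<cdot> g \<cdot> u)" if "H T' V (m \<cdot> h) (z \<cdot> p)" "Ar T V z" for V m z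
  proof -
    have "H U V (m \<cdot> h \<cdot> k) (z \<cdot> p \<cdot> k)" using H_pre[OF that(1) 2(2)] .
    moreover have "H U V (z \<cdot> (g \<cdot> u)) (z \<cdot> (p \<cdot> k))" using H_post[OF 2(3) that(2)] .
    ultimately show ?thesis unfolding assoc using H_sym H_trans by meson
  qed
  show ?thesis unfolding a
    by (rule trI[OF _ _ 2(1) Ar_comp[OF 2(2) 1(2)]])
      (use * 1 trD[OF assms(1)] assms(2) Ar_comp in auto)
qed

lemma cancel_two:
  assumes "Rf X Y (Z, \<sigma>, f)" "Ar T Z h" "Ar T Z h'" "H T X (\<sigma> \<cdot> h) (\<sigma> \<cdot> h')"
  shows "\<exists>U u. Q U T u \<and> H U Y (f \<cdot> h \<cdot> u) (f \<cdot> h' \<cdot> u)"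
proof -
  obtain U u where "Q U T u" "H U Z (h \<cdot> u) (h' \<cdot> u)"
    using cancel[OF assms(2,3) _ assms(4)] assms(1) by auto
  then show ?thesis using H_post[of U Z "h \<cdot> u" "h' \<cdot> u" Y f] assms(1) by (auto simp: assoc)
qed

text \<open>Single-valuedness up to refinement. On a common refinement the two lifts to
  \<open>Z\<close> agree after \<open>\<sigma>\<close>, and \<open>cancel\<close> makes them agree
  after one further quasi-isomorphism, hence also after \<open>f\<close>.\<close>

lemma tr_unique:
  assumes R: "Rf X Y a" and t: "tr X Y a T x y" "tr X Y a T x y'"
  shows "\<exists>U u. Q U T u \<and> H U Y (y \<cdot> u) (y' \<cdot> u)"
proof -
  obtain Z \<sigma> f where a: "a = (Z, \<sigma>, f)" by (cases a)
  from t(1)[unfolded a tr_iff] obtain T1 p h where 1: "Q T1 T p" "Ar T1 Z h"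
    "H T1 X (\<sigma> \<cdot> h) (x \<cdot> p)" "H T1 Y (f \<cdot> h) (y \<cdot> p)" by blast
  from t(2)[unfolded a tr_iff] obtain T2 p' h' where 2: "Q T2 T p'" "Ar T2 Z h'"
    "H T2 X (\<sigma> \<cdot> h') (x \<cdot> p')" "H T2 Y (f \<cdot> h') (y' \<cdot> p')" by blast
  note x = trD(1)[OF t(1)] and y = trD(2)[OF t(1)] and y' = trD(2)[OF t(2)]
  obtain U u k where 3: "Q U T1 u" "Ar U T2 k" "H U T (p \<cdot> u) (p' \<cdot> k)"
    using Ore[OF QD[OF 1(1)] 2(1)] by blast
  have xx: "H U X (x \<cdot> (p \<cdot> u)) (x \<cdot> (p' \<cdot> k))" using H_post[OF 3(3) x] .
  have "H U X (\<sigma> \<cdot> h \<cdot> u) (x \<cdot> p \<cdot> u)" "H U X (\<sigma> \<cdot> h' \<cdot> k) (x \<cdot> p' \<cdot> k)"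
    using H_pre[OF 1(3) QD[OF 3(1)]] H_pre[OF 2(3) 3(2)] by auto
  then have "H U X (\<sigma> \<cdot> (h \<cdot> u)) (\<sigma> \<cdot> (h' \<cdot> k))"
    using xx unfolding assoc by (meson H_sym H_trans)
  then obtain V v where 4: "Q V U v" "H V Y (f \<cdot> (h \<cdot> u) \<cdot> v) (f \<cdot> (h' \<cdot> k) \<cdot> v)"
    using cancel_two[OF R[unfolded a] Ar_comp[OF QD[OF 3(1)] 1(2)] Ar_comp[OF 3(2) 2(2)]] by blast
  have "H V Y (f \<cdot> h \<cdot> (u \<cdot> v)) (y \<cdot> p \<cdot> (u \<cdot> v))"
    by (rule H_pre[OF 1(4) Ar_comp[OF QD[OF 4(1)] QD[OF 3(1)]]])
  moreover have "H V Y (f \<cdot> h' \<cdot> (k \<cdot> v)) (y' \<cdot> p' \<cdot> (k \<cdot> v))"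
    by (rule H_pre[OF 2(4) Ar_comp[OF QD[OF 4(1)] 3(2)]])
  moreover have "H V Y (y' \<cdot> (p \<cdot> u \<cdot> v)) (y' \<cdot> (p' \<cdot> k \<cdot> v))"
    by (rule H_post[OF H_pre[OF 3(3) QD[OF 4(1)]] y'])
  ultimately have "H V Y (y \<cdot> (p \<cdot> u \<cdot> v)) (y' \<cdot> (p \<cdot> u \<cdot> v))"
    using 4(2) unfolding assoc by (meson H_sym H_trans)
  moreover have "Q V T (p \<cdot> u \<cdot> v)"
    using Q_comp[OF 4(1) Q_comp[OF 3(1) 1(1)]] .
  ultimately show ?thesis by blast
qed

text \<open>Totality up to refinement is the Ore condition for \<open>x\<close> against the
  denominator.\<close>

lemma tr_exists:
  assumes R: "Rf X Y a" and x: "Ar T X x"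
  shows "\<exists>U u y. Q U T u \<and> tr X Y a U (x \<cdot> u) y"
proof -
  obtain Z \<sigma> f where a: "a = (Z, \<sigma>, f)" by (cases a)
  obtain U u h where 1: "Q U T u" "Ar U Z h" "H U X (x \<cdot> u) (\<sigma> \<cdot> h)"
    using Ore[OF x, of Z \<sigma>] R a by auto
  have "tr X Y (Z, \<sigma>, f) U (x \<cdot> u) (f \<cdot> h)"
    using tr_direct[OF 1(2) H_sym[OF 1(3)] H_refl] Ar_comp[OF 1(2)] R a by auto
  then show ?thesis using 1 a by blast
qed

lemma rfs_Rf: "X \<in> Obj \<Longrightarrow> Y \<in> Obj \<Longrightarrow> a \<in> rfs X Y \<longleftrightarrow> Rf X Y a"
  using qi_ch by (auto simp: Rf_def Q_def Ar_def rfs_def)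

lemma rel_typed:
  assumes "X \<in> Obj" "Y \<in> Obj"
  shows "((Z, \<sigma>, f), (Z', \<sigma>', f')) \<in> rel X Y \<longleftrightarrow> Rf X Y (Z, \<sigma>, f) \<and> Rf X Y (Z', \<sigma>', f') \<and>
    (\<exists>W p q. Ar W Z p \<and> Ar W Z' q \<and> Q W X (\<sigma> \<cdot> p) \<and> H W X (\<sigma> \<cdot> p) (\<sigma>' \<cdot> q) \<and> H W Y (f \<cdot> p) (f' \<cdot> q))"
  (is "?l \<longleftrightarrow> ?r")
proof
  assume ?l
  then obtain W p q where *: "W \<in> Obj" "p \<in> ch W Z" "q \<in> ch W Z'" "qi W X (\<sigma> \<cdot> p)"
        "hom W X (\<sigma> \<cdot> p) (\<sigma>' \<cdot> q)" "hom W Y (f \<cdot> p) (f' \<cdot> q)"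
    and R: "Rf X Y (Z, \<sigma>, f)" "Rf X Y (Z', \<sigma>', f')" using rfs_Rf[OF assms] by (auto simp: rel_def)
  have pq: "Ar W Z p" "Ar W Z' q" using * R by (auto simp: Ar_def Q_def)
  have "Ar W X (\<sigma> \<cdot> p)" "Ar W X (\<sigma>' \<cdot> q)" "Ar W Y (f \<cdot> p)" "Ar W Y (f' \<cdot> q)"
    using pq R Ar_comp by (auto dest: QD)
  then show ?r using * R pq by (auto simp: H_def Q_def)
next
  assume ?r
  then obtain W p q where *: "Ar W Z p" "Ar W Z' q" "Q W X (\<sigma> \<cdot> p)" "H W X (\<sigma> \<cdot> p) (\<sigma>' \<cdot> q)"
        "H W Y (f \<cdot> p) (f' \<cdot> q)"
    and R: "(Z, \<sigma>, f) \<in> rfs X Y" "(Z', \<sigma>', f') \<in> rfs X Y" using rfs_Rf[OF assms] by blast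
  have "W \<in> Obj" "p \<in> ch W Z" "q \<in> ch W Z'" "qi W X (\<sigma> \<cdot> p)"
        "hom W X (\<sigma> \<cdot> p) (\<sigma>' \<cdot> q)" "hom W Y (f \<cdot> p) (f' \<cdot> q)"
    using * by (auto simp: Ar_def H_def Q_def)
  then show ?l using R by (auto simp: rel_def)
qed

text \<open>The two maps of a roof equivalence are a lift and a refinement, witnessing that the
  first fraction sends \<open>\<sigma>'\<close> to \<open>f'\<close>. The one difference is that
  \<open>rel\<close> asks for \<open>\<sigma> \<cdot> p\<close> to be a quasi-isomorphism and
  \<open>tr\<close> for \<open>q\<close>; two out of three exchanges these conditions.\<close>

lemma rel_tr:
  assumes "X \<in> Obj" "Y \<in> Obj"
  shows "(a, (Z', \<sigma>', f')) \<in> rel X Y \<longleftrightarrow> Rf X Y a \<and> Rf X Y (Z', \<sigma>', f') \<and> tr X Y a Z' \<sigma>' f'"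
proof -
  obtain Z \<sigma> f where a: "a = (Z, \<sigma>, f)" by (cases a)
  show ?thesis
  proof (cases "Rf X Y (Z, \<sigma>, f) \<and> Rf X Y (Z', \<sigma>', f')")
    case True
    have "Q W Z' q" if "Ar W Z p" "Ar W Z' q" "Q W X (\<sigma> \<cdot> p)" "H W X (\<sigma> \<cdot> p) (\<sigma>' \<cdot> q)" for W p q
      using Q_cancel[OF that(2) _ Q_H[OF that(4,3)]] True by auto
    moreover have "Q W X (\<sigma> \<cdot> p)" if "Q W Z' q" "H W X (\<sigma> \<cdot> p) (\<sigma>' \<cdot> q)" for W p q
      using Q_H[OF H_sym[OF that(2)] Q_comp[OF that(1)]] True by auto
    ultimately show ?thesis using True unfolding a rel_typed[OF assms] tr_iff
      by (auto dest: QD) (meson QD)+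
  next
    case False
    then show ?thesis unfolding a rel_typed[OF assms] by blast
  qed
qed

lemma rel_sym:
  assumes "X \<in> Obj" "Y \<in> Obj" "(a, b) \<in> rel X Y"
  shows "(b, a) \<in> rel X Y"
proof -
  obtain Z \<sigma> f where a: "a = (Z, \<sigma>, f)" by (cases a)
  obtain Z' \<sigma>' f' where b: "b = (Z', \<sigma>', f')" by (cases b)
  show ?thesis using assms(3) unfolding a b rel_typed[OF assms(1,2)] using H_sym Q_H by blast
qed

text \<open>The relation of \<open>b\<close> is generated, under restriction and refinement, by its
  own pair of legs, and this pair lies in the relation of \<open>a\<close> by
  \<open>rel_tr\<close>.\<close>

lemma tr_rel_imp:
  assumes "X \<in> Obj" "Y \<in> Obj" "(a, b) \<in> rel X Y" "tr X Y b T x y"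
  shows "tr X Y a T x y"
proof -
  obtain Z' \<sigma>' f' where b: "b = (Z', \<sigma>', f')" by (cases b)
  from assms(4)[unfolded b tr_iff] obtain T' p h where 1: "Q T' T p" "Ar T' Z' h"
    "H T' X (\<sigma>' \<cdot> h) (x \<cdot> p)" "H T' Y (f' \<cdot> h) (y \<cdot> p)" "Ar T X x" "Ar T Y y" by blast
  have "tr X Y a Z' \<sigma>' f'" using assms(3) rel_tr[OF assms(1,2)] b by auto
  from tr_pre[OF this 1(2)] have "tr X Y a T' (\<sigma>' \<cdot> h) (f' \<cdot> h)" .
  from tr_H[OF this 1(3,4)] show ?thesis using 1 tr_local by blast
qed

lemma tr_rel: "X \<in> Obj \<Longrightarrow> Y \<in> Obj \<Longrightarrow> (a, b) \<in> rel X Y \<Longrightarrow> tr X Y a = tr X Y b"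
  using tr_rel_imp rel_sym by (intro ext) blast

lemma tr_refl: "Rf X Y (Z, \<sigma>, f) \<Longrightarrow> tr X Y (Z, \<sigma>, f) Z \<sigma> f"
  by (rule tr_direct[OF Ar_id]) (auto dest: QD ArD simp: id_right[OF QD] id_right intro: H_refl[OF QD] H_refl)

text \<open>Equivalence of roofs is the kernel of the assignment of \<open>tr X Y a\<close> to
  \<open>a\<close>, so reflexivity, symmetry and transitivity need no further diagrams.\<close>

lemma rel_iff:
  assumes "X \<in> Obj" "Y \<in> Obj"
  shows "(a, b) \<in> rel X Y \<longleftrightarrow> Rf X Y a \<and> Rf X Y b \<and> tr X Y a = tr X Y b"
proof -
  obtain Z' \<sigma>' f' where b: "b = (Z', \<sigma>', f')" by (cases b)
  show ?thesis
    using rel_tr[OF assms] tr_rel[OF assms] tr_refl unfolding b by metis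
qed

section \<open>Fractions and their composition\<close>

definition Hm :: "'a \<Rightarrow> 'a \<Rightarrow> ('a \<times> 'b \<times> 'b) set set" where
  "Hm X Y = rfs X Y // rel X Y"

abbreviation fr :: "'a \<Rightarrow> 'a \<Rightarrow> 'a \<Rightarrow> 'b \<Rightarrow> 'b \<Rightarrow> ('a \<times> 'b \<times> 'b) set" where
  "fr X Y Z \<sigma> f \<equiv> cls X Y (Z, \<sigma>, f)"

lemma Rf_Obj: "Rf X Y a \<Longrightarrow> X \<in> Obj" "Rf X Y a \<Longrightarrow> Y \<in> Obj"
  by (auto simp: Rf_def dest: QD ArD)

lemma cls_in: "Rf X Y a \<Longrightarrow> cls X Y a \<in> Hm X Y"
  unfolding Hm_def cls_def by (rule quotientI) (simp add: rfs_Rf Rf_Obj)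

lemma mem_cls: "Rf X Y a \<Longrightarrow> b \<in> cls X Y a \<longleftrightarrow> Rf X Y b \<and> tr X Y a = tr X Y b"
  by (simp add: cls_def rel_iff Rf_Obj)

lemma cls_eq_iff: "Rf X Y a \<Longrightarrow> Rf X Y b \<Longrightarrow> cls X Y a = cls X Y b \<longleftrightarrow> tr X Y a = tr X Y b"
  using mem_cls by (intro iffI set_eqI) metis+

lemma Hm_cases:
  assumes "X \<in> Obj" "Y \<in> Obj" "\<alpha> \<in> Hm X Y"
  obtains Z \<sigma> f where "Q Z X \<sigma>" "Ar Z Y f" "\<alpha> = fr X Y Z \<sigma> f"
  using assms(3) unfolding Hm_def cls_def quotient_def using assms(1,2) by (auto simp: rfs_Rf)

lemma Hm_mem:
  assumes "X \<in> Obj" "Y \<in> Obj" "\<alpha> \<in> Hm X Y" "a \<in> \<alpha>"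
  shows "Rf X Y a \<and> \<alpha> = cls X Y a"
proof -
  obtain Z \<sigma> f where *: "Q Z X \<sigma>" "Ar Z Y f" "\<alpha> = fr X Y Z \<sigma> f"
    using Hm_cases[OF assms(1-3)] .
  then have "Rf X Y (Z, \<sigma>, f)" by simp
  then show ?thesis using assms(4) *(3) mem_cls cls_eq_iff by metis
qed

lemma fr_refine:
  assumes "Q Z X \<sigma>" "Ar Z Y f" "Q W Z p"
  shows "fr X Y W (\<sigma> \<cdot> p) (f \<cdot> p) = fr X Y Z \<sigma> f"
proof -
  have "tr X Y (Z, \<sigma>, f) W (\<sigma> \<cdot> p) (f \<cdot> p)"
    by (rule tr_pre[OF tr_refl QD]) (use assms in auto)
  moreover have "Rf X Y (W, \<sigma> \<cdot> p, f \<cdot> p)" "Rf X Y (Z, \<sigma>, f)"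
    using assms Q_comp Ar_comp by (auto dest: QD)
  ultimately show ?thesis by (metis Rf_Obj cls_eq_iff rel_tr rel_iff)
qed

lemma fr_refine':
  assumes "Q Z X \<sigma>" "Ar Z Y f" "Ar W Z p" "Q W X (\<sigma> \<cdot> p)"
  shows "fr X Y W (\<sigma> \<cdot> p) (f \<cdot> p) = fr X Y Z \<sigma> f"
  using fr_refine Q_cancel assms by blast

lemma fr_H:
  assumes "Q Z X \<sigma>" "H Z X \<sigma> \<sigma>'" "H Z Y f f'"
  shows "fr X Y Z \<sigma> f = fr X Y Z \<sigma>' f'"
proof -
  have R: "Rf X Y (Z, \<sigma>, f)" "Rf X Y (Z, \<sigma>', f')" using assms Q_H HD by auto
  have "tr X Y (Z, \<sigma>, f) Z \<sigma>' f'" by (rule tr_H[OF tr_refl[OF R(1)] assms(2,3)])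
  then show ?thesis using R by (metis Rf_Obj cls_eq_iff rel_tr rel_iff)
qed

text \<open>Both numerators are values of the same relation at the generalised element
  \<open>\<sigma>\<close>, so \<open>tr_unique\<close> applies.\<close>

lemma fr_eqD:
  assumes "Q Z X \<sigma>" "Ar Z Y f" "Ar Z Y g" "fr X Y Z \<sigma> f = fr X Y Z \<sigma> g"
  shows "\<exists>W p. Q W Z p \<and> H W Y (f \<cdot> p) (g \<cdot> p)"
proof -
  have R: "Rf X Y (Z, \<sigma>, f)" "Rf X Y (Z, \<sigma>, g)" using assms by auto
  have "tr X Y (Z, \<sigma>, f) Z \<sigma> g" using tr_refl[OF R(2)] assms(4) R cls_eq_iff by metis
  then show ?thesis using tr_unique[OF R(1) tr_refl[OF R(1)]] by blast
qed

lemma fr_in: "Q Z X \<sigma> \<Longrightarrow> Ar Z Y f \<Longrightarrow> fr X Y Z \<sigma> f \<in> Hm X Y"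
  by (rule cls_in) simp

lemma tr_fr_eq:
  assumes "Rf X Y a" "Q Z X \<sigma>" "tr X Y a Z \<sigma> f"
  shows "cls X Y a = fr X Y Z \<sigma> f"
proof -
  have "Rf X Y (Z, \<sigma>, f)" using assms trD by auto
  then show ?thesis using assms by (metis Rf_Obj cls_eq_iff rel_tr rel_iff)
qed

text \<open>The relation of a composite is the composite relation, hence depends only on the
  relations of the factors. Backwards, a value of the composite roof exists on some refinement by
  totality, and it agrees with \<open>v\<close> after further refinement because both factors are
  single-valued.\<close>

lemma tr_comp:
  assumes a: "Rf X Y (Z, \<sigma>, f)" and b: "Rf Y V (W, \<tau>, g)"
    and u: "Q U Z u" "Ar U W h" "H U Y (f \<cdot> u) (\<tau> \<cdot> h)"
  shows "tr X V (U, \<sigma> \<cdot> u, g \<cdot> h) T x v \<longleftrightarrow> Ar T X x \<and> Ar T V v \<and>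
    (\<exists>T' p y. Q T' T p \<and> tr X Y (Z, \<sigma>, f) T' (x \<cdot> p) y \<and> tr Y V (W, \<tau>, g) T' y (v \<cdot> p))"
    (is "?l T x v \<longleftrightarrow> ?r T x v")
proof
  have lr: "?r T x v" if "?l T x v" for T x v
  proof -
    from that[unfolded tr_iff] obtain T' p k where 1: "Q T' T p" "Ar T' U k"
      "H T' X (\<sigma> \<cdot> u \<cdot> k) (x \<cdot> p)" "H T' V (g \<cdot> h \<cdot> k) (v \<cdot> p)" "Ar T X x" "Ar T V v" by blast
    have uk: "Ar T' Z (u \<cdot> k)" using 1(2) u(1) Ar_comp QD by blast
    have "tr X Y (Z, \<sigma>, f) T' (x \<cdot> p) (f \<cdot> (u \<cdot> k))"
      by (rule tr_direct[OF uk 1(3)[unfolded assoc] H_refl]) (use uk a Ar_comp in auto)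
    moreover have "tr Y V (W, \<tau>, g) T' (f \<cdot> (u \<cdot> k)) (v \<cdot> p)"
      by (rule tr_direct[OF Ar_comp[OF 1(2) u(2)] _ 1(4)[unfolded assoc]])
        (use H_sym[OF H_pre[OF u(3) 1(2)]] in \<open>simp add: assoc\<close>)
    ultimately show ?thesis using 1 by blast
  qed
  show "?r T x v" if "?l T x v" using lr that .
  assume "?r T x v"
  then obtain T' p y where 1: "Q T' T p" "tr X Y (Z, \<sigma>, f) T' (x \<cdot> p) y"
    "tr Y V (W, \<tau>, g) T' y (v \<cdot> p)" "Ar T X x" "Ar T V v" by blast
  have c: "Rf X V (U, \<sigma> \<cdot> u, g \<cdot> h)" using a b u Q_comp Ar_comp by auto
  note xp = Ar_comp[OF QD[OF 1(1)] 1(4)] and vp = Ar_comp[OF QD[OF 1(1)] 1(5)]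
  \<comment> \<open>Totality gives a value \<open>v'\<close> of the composite; the direction
    \<open>lr\<close> factors it through an intermediate \<open>y'\<close>, which is then compared
    with \<open>y\<close>.\<close>
  obtain S q v' where 2: "Q S T' q" "tr X V (U, \<sigma> \<cdot> u, g \<cdot> h) S (x \<cdot> p \<cdot> q) v'"
    using tr_exists[OF c xp] by blast
  from lr[OF 2(2)] obtain S' q' y' where 3: "Q S' S q'" "tr X Y (Z, \<sigma>, f) S' (x \<cdot> p \<cdot> q \<cdot> q') y'"
    "tr Y V (W, \<tau>, g) S' y' (v' \<cdot> q')" by blast
  have q: "Q S' T' (q \<cdot> q')" using Q_comp 2 3 by blast
  obtain S2 r where 4: "Q S2 S' r" "H S2 Y (y \<cdot> (q \<cdot> q') \<cdot> r) (y' \<cdot> r)"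
    using tr_unique[OF a tr_pre[OF 1(2) QD[OF q], unfolded assoc] 3(2)[unfolded assoc]]
    by (metis (no_types, opaque_lifting) assoc)
  have t1: "tr Y V (W, \<tau>, g) S2 (y \<cdot> (q \<cdot> q') \<cdot> r) (v \<cdot> p \<cdot> (q \<cdot> q') \<cdot> r)"
    using tr_pre[OF tr_pre[OF 1(3) QD[OF q]] QD[OF 4(1)]] .
  have t2: "tr Y V (W, \<tau>, g) S2 (y' \<cdot> r) (v' \<cdot> q' \<cdot> r)" using tr_pre[OF 3(3) QD[OF 4(1)]] .
  have t2': "tr Y V (W, \<tau>, g) S2 (y \<cdot> (q \<cdot> q') \<cdot> r) (v' \<cdot> q' \<cdot> r)"
    by (rule tr_H[OF t2 H_sym[OF 4(2)] H_refl[OF trD(2)[OF t2]]])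
  obtain S3 w where 5: "Q S3 S2 w" "H S3 V (v \<cdot> p \<cdot> (q \<cdot> q') \<cdot> r \<cdot> w) (v' \<cdot> q' \<cdot> r \<cdot> w)"
    using tr_unique[OF b t1 t2'] by blast
  have e: "Q S3 S (q' \<cdot> r \<cdot> w)" using Q_comp[OF 5(1) Q_comp[OF 4(1) 3(1)]] .
  have "tr X V (U, \<sigma> \<cdot> u, g \<cdot> h) S3 (x \<cdot> p \<cdot> q \<cdot> (q' \<cdot> r \<cdot> w)) (v' \<cdot> (q' \<cdot> r \<cdot> w))"
    using tr_pre[OF 2(2) QD[OF e]] .
  then have "tr X V (U, \<sigma> \<cdot> u, g \<cdot> h) S3 (x \<cdot> (p \<cdot> q \<cdot> q' \<cdot> r \<cdot> w)) (v \<cdot> (p \<cdot> q \<cdot> q' \<cdot> r \<cdot> w))"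
    using tr_H[OF _ H_refl H_sym[OF 5(2)]] trD(1) by (simp add: assoc)
  moreover have "Q S3 T (p \<cdot> q \<cdot> q' \<cdot> r \<cdot> w)" using Q_comp[OF 5(1) Q_comp[OF 4(1) Q_comp[OF 3(1) Q_comp[OF 2(1) 1(1)]]]] .
  ultimately show "?l T x v" using tr_local 1 by blast
qed

lemma Union_const: "(\<And>S. S \<in> \<F> \<Longrightarrow> S = A) \<Longrightarrow> A \<in> \<F> \<Longrightarrow> \<Union>\<F> = A"
  by blast

text \<open>Each set in the union is the class of some composite roof, and by \<open>tr_comp\<close>
  all these roofs have the same relation; the union is therefore over a single set.\<close>

lemma fcomp_fr:
  assumes a: "Q Z X \<sigma>" "Ar Z Y f" and b: "Q W Y \<tau>" "Ar W V g"
    and u: "Q U Z u" "Ar U W h" "H U Y (f \<cdot> u) (\<tau> \<cdot> h)"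
  shows "fcomp X Y V (fr Y V W \<tau> g) (fr X Y Z \<sigma> f) = fr X V U (\<sigma> \<cdot> u) (g \<cdot> h)"
  unfolding fcomp_def
proof (rule Union_const)
  have R: "Rf X Y (Z, \<sigma>, f)" "Rf Y V (W, \<tau>, g)" using a b by auto
  have obj: "X \<in> Obj" "Y \<in> Obj" "V \<in> Obj" using R Rf_Obj by blast+
  have m: "(Z, \<sigma>, f) \<in> fr X Y Z \<sigma> f" "(W, \<tau>, g) \<in> fr Y V W \<tau> g"
    using R mem_cls by metis+
  show "cls X V (U, \<sigma> \<cdot> u, g \<cdot> h) \<in> {cls X V (U, \<sigma>' \<cdot> u, g' \<cdot> h) |U \<sigma>' u g' h. \<exists>Z' f' W' \<tau>'. (Z', \<sigma>', f') \<in> fr X Y Z \<sigma> f \<and>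
      (W', \<tau>', g') \<in> fr Y V W \<tau> g \<and> U \<in> Obj \<and> qi U Z' u \<and> h \<in> ch U W' \<and> hom U Y (f' \<cdot> u) (\<tau>' \<cdot> h)}"
    using u m by (force simp: Q_def H_def Ar_def)
  fix S assume "S \<in> {cls X V (U, \<sigma>' \<cdot> u, g' \<cdot> h) |U \<sigma>' u g' h. \<exists>Z' f' W' \<tau>'. (Z', \<sigma>', f') \<in> fr X Y Z \<sigma> f \<and>
      (W', \<tau>', g') \<in> fr Y V W \<tau> g \<and> U \<in> Obj \<and> qi U Z' u \<and> h \<in> ch U W' \<and> hom U Y (f' \<cdot> u) (\<tau>' \<cdot> h)}"
  then obtain U' \<sigma>' u' g' h' Z' f' W' \<tau>' where S: "S = cls X V (U', \<sigma>' \<cdot> u', g' \<cdot> h')"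
     and m: "(Z', \<sigma>', f') \<in> fr X Y Z \<sigma> f" "(W', \<tau>', g') \<in> fr Y V W \<tau> g"
     and c: "U' \<in> Obj" "qi U' Z' u'" "h' \<in> ch U' W'" "hom U' Y (f' \<cdot> u') (\<tau>' \<cdot> h')" by blast
  have R': "Rf X Y (Z', \<sigma>', f')" "Rf Y V (W', \<tau>', g')"
    and t: "tr X Y (Z', \<sigma>', f') = tr X Y (Z, \<sigma>, f)" "tr Y V (W', \<tau>', g') = tr Y V (W, \<tau>, g)"
    using m mem_cls[OF R(1)] mem_cls[OF R(2)] by auto
  have q: "Q U' Z' u'" "Ar U' W' h'" using c R' qi_ch by (auto simp: Q_def Ar_def)
  have "H U' Y (f' \<cdot> u') (\<tau>' \<cdot> h')" using q R' c Ar_comp by (auto simp: H_def dest: QD)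
  note q = q this
  have "tr X V (U', \<sigma>' \<cdot> u', g' \<cdot> h') = tr X V (U, \<sigma> \<cdot> u, g \<cdot> h)"
    using tr_comp[OF R u] tr_comp[OF R' q] t by (intro ext) simp
  moreover have "Rf X V (U', \<sigma>' \<cdot> u', g' \<cdot> h')" "Rf X V (U, \<sigma> \<cdot> u, g \<cdot> h)"
    using R R' q u Q_comp Ar_comp by auto
  ultimately show "S = fr X V U (\<sigma> \<cdot> u) (g \<cdot> h)" unfolding S using cls_eq_iff by metis
qed

end

section \<open>The k-linear category of fractions\<close>

context fractions
begin

lemma common_denominator:
  assumes "Q Z X \<sigma>" "Ar Z Y f" "Q Z' X \<sigma>'" "Ar Z' Y' f'"
  obtains U p p' where "Q U Z p" "Ar U Z' p'" "Q U X (\<sigma> \<cdot> p)" "H U X (\<sigma> \<cdot> p) (\<sigma>' \<cdot> p')"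
    "fr X Y Z \<sigma> f = fr X Y U (\<sigma> \<cdot> p) (f \<cdot> p)" "fr X Y' Z' \<sigma>' f' = fr X Y' U (\<sigma> \<cdot> p) (f' \<cdot> p')"
proof -
  obtain U p p' where u: "Q U Z p" "Ar U Z' p'" "H U X (\<sigma> \<cdot> p) (\<sigma>' \<cdot> p')"
    using Ore[OF QD[OF assms(1)] assms(3)] by blast
  have q: "Q U X (\<sigma> \<cdot> p)" "Q U X (\<sigma>' \<cdot> p')" using Q_comp Q_H u assms by blast+
  have "fr X Y' U (\<sigma>' \<cdot> p') (f' \<cdot> p') = fr X Y' U (\<sigma> \<cdot> p) (f' \<cdot> p')"
    by (rule fr_H[OF q(2) H_sym[OF u(3)] H_refl[OF Ar_comp[OF u(2) assms(4)]]])
  then show ?thesis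
    using that[OF u(1,2) q(1) u(3)] fr_refine fr_refine' u q assms by metis
qed

text \<open>The second equality has to survive the refinement chosen for the first, so it is carried
  along that refinement before it is resolved in turn.\<close>

lemma common_eq:
  assumes "Q U X \<rho>" "Ar U Y f" "Ar U Y f'" "Ar U Y g" "Ar U Y g'"
    "fr X Y U \<rho> f = fr X Y U \<rho> f'" "fr X Y U \<rho> g = fr X Y U \<rho> g'"
  obtains W p where "Q W U p" "H W Y (f \<cdot> p) (f' \<cdot> p)" "H W Y (g \<cdot> p) (g' \<cdot> p)"
proof -
  obtain V v where v: "Q V U v" "H V Y (f \<cdot> v) (f' \<cdot> v)" using fr_eqD assms by blast
  have "fr X Y V (\<rho> \<cdot> v) (g \<cdot> v) = fr X Y V (\<rho> \<cdot> v) (g' \<cdot> v)"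
    using fr_refine assms v by metis
  then obtain W w where w: "Q W V w" "H W Y (g \<cdot> v \<cdot> w) (g' \<cdot> v \<cdot> w)"
    using fr_eqD[OF Q_comp[OF v(1) assms(1)]] Ar_comp[OF QD[OF v(1)]] assms by metis
  have "H W Y (f \<cdot> v \<cdot> w) (f' \<cdot> v \<cdot> w)" using H_pre v w QD by blast
  then show ?thesis using that[OF Q_comp[OF w(1) v(1)]] w by (simp add: assoc)
qed

text \<open>Another pair of representatives with a shared denominator is compared on a common
  refinement \<open>U\<close>; \<open>common_eq\<close> then makes both numerators homotopic at
  once, so the sums are homotopic.\<close>

lemma fadd_fr:
  assumes a: "Q Z X \<sigma>" "Ar Z Y f" "Ar Z Y g"
  shows "fadd X Y (fr X Y Z \<sigma> f) (fr X Y Z \<sigma> g) = fr X Y Z \<sigma> (f + g)"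
  unfolding fadd_def
proof (rule Union_const)
  have R: "Rf X Y (Z, \<sigma>, f)" "Rf X Y (Z, \<sigma>, g)" using a by auto
  have "(Z, \<sigma>, f) \<in> fr X Y Z \<sigma> f" "(Z, \<sigma>, g) \<in> fr X Y Z \<sigma> g"
    using R mem_cls by metis+
  then show "fr X Y Z \<sigma> (f + g) \<in> {cls X Y (Z', \<sigma>', f' + g') |Z' \<sigma>' f' g'.
      (Z', \<sigma>', f') \<in> fr X Y Z \<sigma> f \<and> (Z', \<sigma>', g') \<in> fr X Y Z \<sigma> g}" by blast
  fix S assume "S \<in> {cls X Y (Z', \<sigma>', f' + g') |Z' \<sigma>' f' g'.
      (Z', \<sigma>', f') \<in> fr X Y Z \<sigma> f \<and> (Z', \<sigma>', g') \<in> fr X Y Z \<sigma> g}"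
  then obtain Z' \<sigma>' f' g' where S: "S = cls X Y (Z', \<sigma>', f' + g')"
    and m: "(Z', \<sigma>', f') \<in> fr X Y Z \<sigma> f" "(Z', \<sigma>', g') \<in> fr X Y Z \<sigma> g" by blast
  have R': "Rf X Y (Z', \<sigma>', f')" "Rf X Y (Z', \<sigma>', g')" using m R mem_cls by metis+
  have e: "fr X Y Z \<sigma> f = fr X Y Z' \<sigma>' f'" "fr X Y Z \<sigma> g = fr X Y Z' \<sigma>' g'"
    using m R R' mem_cls cls_eq_iff by metis+
  have a': "Q Z' X \<sigma>'" "Ar Z' Y f'" "Ar Z' Y g'" using R' by auto
  obtain U p p' where u: "Q U Z p" "Ar U Z' p'" "Q U X (\<sigma> \<cdot> p)" "H U X (\<sigma> \<cdot> p) (\<sigma>' \<cdot> p')"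
    by (rule common_denominator[OF a(1,2) a'(1,2)])
  have q': "Q U X (\<sigma>' \<cdot> p')" using Q_H u by blast
  have c: "fr X Y Z' \<sigma>' k = fr X Y U (\<sigma> \<cdot> p) (k \<cdot> p')" if "Ar Z' Y k" for k
    using fr_refine'[OF a'(1) that u(2) q'] fr_H[OF q' H_sym[OF u(4)] H_refl[OF Ar_comp[OF u(2) that]]]
    by simp
  have "fr X Y U (\<sigma> \<cdot> p) (f \<cdot> p) = fr X Y U (\<sigma> \<cdot> p) (f' \<cdot> p')"
    "fr X Y U (\<sigma> \<cdot> p) (g \<cdot> p) = fr X Y U (\<sigma> \<cdot> p) (g' \<cdot> p')"
    using fr_refine[OF a(1,2) u(1)] fr_refine[OF a(1,3) u(1)] c[OF a'(2)] c[OF a'(3)]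
    unfolding e by simp_all
  then obtain W w where w: "Q W U w" "H W Y (f \<cdot> p \<cdot> w) (f' \<cdot> p' \<cdot> w)" "H W Y (g \<cdot> p \<cdot> w) (g' \<cdot> p' \<cdot> w)"
    by (rule common_eq[OF u(3) Ar_comp[OF QD[OF u(1)] a(2)] Ar_comp[OF u(2) a'(2)]
      Ar_comp[OF QD[OF u(1)] a(3)] Ar_comp[OF u(2) a'(3)]])
  have "H W Y ((f + g) \<cdot> p \<cdot> w) ((f' + g') \<cdot> p' \<cdot> w)"
    using H_add[OF w(2,3)] by (simp add: comp_add_left)
  then have "fr X Y W (\<sigma> \<cdot> p \<cdot> w) ((f + g) \<cdot> p \<cdot> w) = fr X Y W (\<sigma> \<cdot> p \<cdot> w) ((f' + g') \<cdot> p' \<cdot> w)"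
    using fr_H[OF Q_comp[OF w(1) u(3)] H_refl[OF QD[OF Q_comp[OF w(1) u(3)]]]] by blast
  moreover have "fr X Y W (\<sigma> \<cdot> p \<cdot> w) ((f + g) \<cdot> p \<cdot> w) = fr X Y Z \<sigma> (f + g)"
    using fr_refine[OF u(3) Ar_comp[OF QD[OF u(1)]] w(1)] fr_refine[OF a(1) _ u(1)] Ar_add[OF a(2,3)] by simp
  moreover have "fr X Y W (\<sigma> \<cdot> p \<cdot> w) ((f' + g') \<cdot> p' \<cdot> w) = fr X Y Z' \<sigma>' (f' + g')"
    using fr_refine[OF u(3) Ar_comp[OF u(2)] w(1)] c Ar_add[OF a'(2,3)] by simp
  ultimately show "S = fr X Y Z \<sigma> (f + g)" using S by simp
qed

lemma fsmul_fr:
  assumes a: "Q Z X \<sigma>" "Ar Z Y f"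
  shows "fsmul X Y c (fr X Y Z \<sigma> f) = fr X Y Z \<sigma> (sc c f)"
  unfolding fsmul_def
proof (rule Union_const)
  have R: "Rf X Y (Z, \<sigma>, f)" using a by auto
  have "(Z, \<sigma>, f) \<in> fr X Y Z \<sigma> f" using R mem_cls by metis
  then show "fr X Y Z \<sigma> (sc c f) \<in> {cls X Y (Z', \<sigma>', sc c f') |Z' \<sigma>' f'. (Z', \<sigma>', f') \<in> fr X Y Z \<sigma> f}" by blast
  fix S assume "S \<in> {cls X Y (Z', \<sigma>', sc c f') |Z' \<sigma>' f'. (Z', \<sigma>', f') \<in> fr X Y Z \<sigma> f}"
  then obtain Z' \<sigma>' f' where S: "S = cls X Y (Z', \<sigma>', sc c f')"
    and m: "(Z', \<sigma>', f') \<in> fr X Y Z \<sigma> f" by blast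
  have R': "Rf X Y (Z', \<sigma>', f')" using m R mem_cls by metis
  have t: "tr X Y (Z', \<sigma>', f') Z \<sigma> f" using m R R' mem_cls tr_refl by metis
  then obtain T p h where 1: "Q T Z p" "Ar T Z' h" "H T X (\<sigma>' \<cdot> h) (\<sigma> \<cdot> p)" "H T Y (f' \<cdot> h) (f \<cdot> p)"
    unfolding tr_iff by blast
  have "tr X Y (Z', \<sigma>', sc c f') Z \<sigma> (sc c f)"
    using trI[OF QD[OF a(1)] Ar_sc[OF a(2)] 1(1,2,3), of "sc c f'"] H_sc[OF 1(4)] by (simp add: comp_sc_left)
  then show "S = fr X Y Z \<sigma> (sc c f)" unfolding S using tr_fr_eq[OF _ a(1)] R' Ar_sc by simp
qed

text \<open>When the first numerator factors through \<open>\<tau>\<close>, the identity of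
  \<open>U\<close> and \<open>h\<close> already form the square that \<open>fcomp_fr\<close> asks
  for.\<close>

lemma fcomp_direct:
  assumes "Q U X \<rho>" "Ar U W h" "Q W Y \<tau>" "Ar W V g"
  shows "fcomp X Y V (fr Y V W \<tau> g) (fr X Y U \<rho> (\<tau> \<cdot> h)) = fr X V U \<rho> (g \<cdot> h)"
proof -
  have U: "U \<in> Obj" using assms ArD by blast
  have th: "Ar U Y (\<tau> \<cdot> h)" using assms Ar_comp QD by blast
  show ?thesis using fcomp_fr[OF assms(1) th assms(3,4) Q_id[OF U] assms(2)]
    by (simp add: id_right[OF th] id_right[OF QD[OF assms(1)]] H_refl[OF th])
qed

text \<open>Choosing the numerator to factor through the denominator of the next fraction turns
  later composites into instances of \<open>fcomp_direct\<close>, where no new Ore square occurs.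
  Associativity and bilinearity are verified in this form.\<close>

lemma fr_normal:
  assumes "Q Z X \<sigma>" "Ar Z Y f" "Q W Y \<tau>"
  obtains U u h where "Q U Z u" "Ar U W h" "Q U X (\<sigma> \<cdot> u)" "fr X Y Z \<sigma> f = fr X Y U (\<sigma> \<cdot> u) (\<tau> \<cdot> h)"
    "H U Y (f \<cdot> u) (\<tau> \<cdot> h)"
proof -
  obtain U u h where u: "Q U Z u" "Ar U W h" "H U Y (f \<cdot> u) (\<tau> \<cdot> h)"
    using Ore[OF assms(2,3)] by blast
  have q: "Q U X (\<sigma> \<cdot> u)" using Q_comp u assms by blast
  have "fr X Y Z \<sigma> f = fr X Y U (\<sigma> \<cdot> u) (\<tau> \<cdot> h)"
    using fr_refine[OF assms(1,2) u(1)] fr_H[OF q H_refl[OF QD[OF q]] u(3)] by simp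
  then show ?thesis using that u q by blast
qed

lemma zero_comp: "0 \<cdot> f = 0"
  using comp_add_left[of 0 0 f] by simp

lemma floc_fr:
  assumes "Ar X Y f" "Q Z X \<sigma>"
  shows "floc X Y f = fr X Y Z \<sigma> (f \<cdot> \<sigma>)"
proof -
  have "X \<in> Obj" using ArD assms by blast
  from fr_refine[OF Q_id[OF this] assms] show ?thesis
    by (simp add: floc_def id_left[OF QD[OF assms(2)]])
qed

lemma floc_in: "Ar X Y f \<Longrightarrow> floc X Y f \<in> Hm X Y"
  unfolding floc_def by (rule fr_in[OF Q_id]) (auto dest: ArD)

lemma fcomp_in:
  assumes "X \<in> Obj" "Y \<in> Obj" "V \<in> Obj" "\<alpha> \<in> Hm X Y" "\<beta> \<in> Hm Y V"
  shows "fcomp X Y V \<beta> \<alpha> \<in> Hm X V"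
proof -
  obtain Z \<sigma> f where 1: "Q Z X \<sigma>" "Ar Z Y f" "\<alpha> = fr X Y Z \<sigma> f" using Hm_cases assms by blast
  obtain W \<tau> g where 2: "Q W Y \<tau>" "Ar W V g" "\<beta> = fr Y V W \<tau> g" using Hm_cases assms by blast
  obtain U u h where 3: "Q U Z u" "Ar U W h" "Q U X (\<sigma> \<cdot> u)" "\<alpha> = fr X Y U (\<sigma> \<cdot> u) (\<tau> \<cdot> h)"
    by (rule fr_normal[OF 1(1,2) 2(1)]) (use 1 in simp)
  show ?thesis using fcomp_direct[OF 3(3,2) 2(1,2)] fr_in[OF 3(3) Ar_comp[OF 3(2) 2(2)]] unfolding 2(3) 3(4) by simp
qed

lemma fcomp_floc_left:
  assumes "Q Z X \<sigma>" "Ar Z Y f" "Ar Y V g"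
  shows "fcomp X Y V (floc Y V g) (fr X Y Z \<sigma> f) = fr X V Z \<sigma> (g \<cdot> f)"
proof -
  have "Y \<in> Obj" using assms ArD by blast
  from fcomp_direct[OF assms(1,2) Q_id[OF this] assms(3)]
  show ?thesis by (simp add: floc_def id_left[OF assms(2)])
qed

lemma fcomp_floc_right:
  assumes "Ar X W h" "Q W Y \<tau>" "Ar W V g"
  shows "fcomp X Y V (fr Y V W \<tau> g) (floc X Y (\<tau> \<cdot> h)) = floc X V (g \<cdot> h)"
proof -
  have "X \<in> Obj" using assms ArD by blast
  from fcomp_direct[OF Q_id[OF this] assms] show ?thesis by (simp add: floc_def)
qed

lemma floc_comp: "Ar X Y f \<Longrightarrow> Ar Y Z g \<Longrightarrow> fcomp X Y Z (floc Y Z g) (floc X Y f) = floc X Z (g \<cdot> f)"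
  using fcomp_floc_left[OF Q_id, of X Y f Z g] ArD by (simp add: floc_def)

lemma floc_H: "H X Y f g \<Longrightarrow> floc X Y f = floc X Y g"
  unfolding floc_def by (rule fr_H[OF Q_id H_refl[OF Ar_id]]) (auto dest: HD ArD)

lemma floc_eqD:
  assumes "Ar X Y f" "Ar X Y g" "floc X Y f = floc X Y g"
  shows "\<exists>W p. Q W X p \<and> H W Y (f \<cdot> p) (g \<cdot> p)"
  using fr_eqD[OF Q_id assms(1,2)] assms(3) ArD(1)[OF assms(1)] unfolding floc_def by blast

lemma floc_add: "Ar X Y f \<Longrightarrow> Ar X Y g \<Longrightarrow> fadd X Y (floc X Y f) (floc X Y g) = floc X Y (f + g)"
  unfolding floc_def by (rule fadd_fr[OF Q_id]) (auto dest: ArD)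

lemma floc_smul: "Ar X Y f \<Longrightarrow> fsmul X Y c (floc X Y f) = floc X Y (sc c f)"
  unfolding floc_def by (rule fsmul_fr[OF Q_id]) (auto dest: ArD)

lemma Hm_pair:
  assumes "X \<in> Obj" "Y \<in> Obj" "Y' \<in> Obj" "\<alpha> \<in> Hm X Y" "\<beta> \<in> Hm X Y'"
  obtains Z \<sigma> f g where "Q Z X \<sigma>" "Ar Z Y f" "Ar Z Y' g" "\<alpha> = fr X Y Z \<sigma> f" "\<beta> = fr X Y' Z \<sigma> g"
proof -
  obtain Z \<sigma> f where 1: "Q Z X \<sigma>" "Ar Z Y f" "\<alpha> = fr X Y Z \<sigma> f"
    by (rule Hm_cases[OF assms(1,2,4)])
  obtain W \<tau> g where 2: "Q W X \<tau>" "Ar W Y' g" "\<beta> = fr X Y' W \<tau> g"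
    by (rule Hm_cases[OF assms(1,3,5)])
  obtain U p p' where u: "Q U Z p" "Ar U W p'" "Q U X (\<sigma> \<cdot> p)"
    "\<alpha> = fr X Y U (\<sigma> \<cdot> p) (f \<cdot> p)" "\<beta> = fr X Y' U (\<sigma> \<cdot> p) (g \<cdot> p')"
    by (rule common_denominator[OF 1(1,2) 2(1,2)]) (simp only: 1(3) 2(3))
  show ?thesis by (rule that[OF u(3) Ar_comp[OF QD[OF u(1)] 1(2)] Ar_comp[OF u(2) 2(2)] u(4,5)])
qed

lemma Hm_triple:
  assumes "X \<in> Obj" "Y \<in> Obj" "\<alpha> \<in> Hm X Y" "\<beta> \<in> Hm X Y" "\<gamma> \<in> Hm X Y"
  obtains Z \<sigma> f g h where "Q Z X \<sigma>" "Ar Z Y f" "Ar Z Y g" "Ar Z Y h"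
    "\<alpha> = fr X Y Z \<sigma> f" "\<beta> = fr X Y Z \<sigma> g" "\<gamma> = fr X Y Z \<sigma> h"
proof -
  obtain Z \<sigma> f g where 1: "Q Z X \<sigma>" "Ar Z Y f" "Ar Z Y g" "\<alpha> = fr X Y Z \<sigma> f" "\<beta> = fr X Y Z \<sigma> g"
    by (rule Hm_pair[OF assms(1,2,2,3,4)])
  obtain W \<tau> h where 2: "Q W X \<tau>" "Ar W Y h" "\<gamma> = fr X Y W \<tau> h"
    by (rule Hm_cases[OF assms(1,2,5)])
  obtain U p p' where u: "Q U Z p" "Ar U W p'" "Q U X (\<sigma> \<cdot> p)" 
    "\<alpha> = fr X Y U (\<sigma> \<cdot> p) (f \<cdot> p)" "\<gamma> = fr X Y U (\<sigma> \<cdot> p) (h \<cdot> p')"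
    by (rule common_denominator[OF 1(1,2) 2(1,2)]) (simp only: 1(4) 2(3))
  have "\<beta> = fr X Y U (\<sigma> \<cdot> p) (g \<cdot> p)" using fr_refine[OF 1(1,3) u(1)] 1(5) by metis
  then show ?thesis
    by (rule that[OF u(3) Ar_comp[OF QD[OF u(1)] 1(2)] Ar_comp[OF QD[OF u(1)] 1(3)] Ar_comp[OF u(2) 2(2)] u(4) _ u(5)])
qed

lemma category_fcat: "category fcat"
  unfolding category_def fcat_def cat.select_convs lincat.select_convs Hm_def[symmetric]
proof (intro conjI ballI)
  fix X assume X: "X \<in> Obj"
  show "floc X X (idm X) \<in> Hm X X" by (rule floc_in[OF Ar_id[OF X]])
next
  fix X Y Z \<alpha> \<beta> assume "X \<in> Obj" "Y \<in> Obj" "Z \<in> Obj" "\<alpha> \<in> Hm X Y" "\<beta> \<in> Hm Y Z"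
  then show "fcomp X Y Z \<beta> \<alpha> \<in> Hm X Z" by (rule fcomp_in)
next
  fix X Y \<alpha> assume X: "X \<in> Obj" and Y: "Y \<in> Obj" and m: "\<alpha> \<in> Hm X Y"
  obtain Z \<sigma> f where 1: "Q Z X \<sigma>" "Ar Z Y f" "\<alpha> = fr X Y Z \<sigma> f" by (rule Hm_cases[OF X Y m])
  show "fcomp X Y Y (floc Y Y (idm Y)) \<alpha> = \<alpha>"
    using fcomp_floc_left[OF 1(1,2) Ar_id[OF Y]] unfolding 1(3) by (simp add: id_left[OF 1(2)])
  have Z: "Z \<in> Obj" using 1 ArD by blast
  have "floc X X (idm X) = fr X X Z \<sigma> (\<sigma> \<cdot> idm Z)"
    using floc_fr[OF Ar_id[OF X] 1(1)] by (simp add: id_left[OF QD[OF 1(1)]] id_right[OF QD[OF 1(1)]])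
  then show "fcomp X X Y \<alpha> (floc X X (idm X)) = \<alpha>"
    using fcomp_direct[OF 1(1) Ar_id[OF Z] 1(1,2)] unfolding 1(3) by (simp add: id_right[OF 1(2)])
next
  fix X Y Z V \<alpha> \<beta> \<gamma> assume o: "X \<in> Obj" "Y \<in> Obj" "Z \<in> Obj" "V \<in> Obj"
    and m: "\<alpha> \<in> Hm X Y" "\<beta> \<in> Hm Y Z" "\<gamma> \<in> Hm Z V"
  obtain Z3 \<tau> g where 3: "Q Z3 Z \<tau>" "Ar Z3 V g" "\<gamma> = fr Z V Z3 \<tau> g"
    by (rule Hm_cases[OF o(3,4) m(3)])
  obtain Z2 \<sigma>0 f2 where 2: "Q Z2 Y \<sigma>0" "Ar Z2 Z f2" "\<beta> = fr Y Z Z2 \<sigma>0 f2"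
    by (rule Hm_cases[OF o(2,3) m(2)])
  obtain Z1 \<rho>0 f1 where 1: "Q Z1 X \<rho>0" "Ar Z1 Y f1" "\<alpha> = fr X Y Z1 \<rho>0 f1"
    by (rule Hm_cases[OF o(1,2) m(1)])
  \<comment> \<open>Normalising from the last factor backwards makes both bracketings compute to the
    same roof over \<open>U\<close>.\<close>
  obtain W \<sigma> h where w: "Q W Y \<sigma>" "Ar W Z3 h" "\<beta> = fr Y Z W \<sigma> (\<tau> \<cdot> h)"
    by (rule fr_normal[OF 2(1,2) 3(1)]) (use 2(3) in simp)
  obtain U \<rho> k where u: "Q U X \<rho>" "Ar U W k" "\<alpha> = fr X Y U \<rho> (\<sigma> \<cdot> k)"
    by (rule fr_normal[OF 1(1,2) w(1)]) (use 1(3) in simp)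
  have th: "Ar W Z (\<tau> \<cdot> h)" "Ar W V (g \<cdot> h)" "Ar U Z3 (h \<cdot> k)" using Ar_comp w u 3 QD by blast+
  show "fcomp X Y V (fcomp Y Z V \<gamma> \<beta>) \<alpha> = fcomp X Z V \<gamma> (fcomp X Y Z \<beta> \<alpha>)"
    using fcomp_direct[OF w(1,2) 3(1,2)] fcomp_direct[OF u(1,2) w(1) th(1)]
      fcomp_direct[OF u(1,2) w(1) th(2)] fcomp_direct[OF u(1) th(3) 3(1,2)]
    unfolding u(3) w(3) 3(3) by (simp add: assoc)
qed

sublocale vsc: vector_space sc by (rule vs)

lemma klinear_fcat: "klinear_category fcat"
  unfolding klinear_category_def
proof (intro conjI category_fcat ballI allI; (simp only: fcat_def cat.select_convs lincat.select_convs Hm_def[symmetric])?)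
  fix X Y \<alpha> \<beta> assume o: "X \<in> Obj" "Y \<in> Obj" and m: "\<alpha> \<in> Hm X Y" "\<beta> \<in> Hm X Y"
  obtain Z \<sigma> f g where 1: "Q Z X \<sigma>" "Ar Z Y f" "Ar Z Y g" "\<alpha> = fr X Y Z \<sigma> f" "\<beta> = fr X Y Z \<sigma> g"
    by (rule Hm_pair[OF o o(2) m])
  show "fadd X Y \<alpha> \<beta> \<in> Hm X Y" "fadd X Y \<alpha> \<beta> = fadd X Y \<beta> \<alpha>"
    using fadd_fr[OF 1(1,2,3)] fadd_fr[OF 1(1,3,2)] fr_in[OF 1(1) Ar_add[OF 1(2,3)]] unfolding 1(4,5)
    by (simp_all add: add.commute)
  fix c :: 'c
  show "fsmul X Y c (fadd X Y \<alpha> \<beta>) = fadd X Y (fsmul X Y c \<alpha>) (fsmul X Y c \<beta>)"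
    using 1(1,2,3) unfolding 1(4,5) by (simp add: fadd_fr fsmul_fr Ar_sc Ar_add vsc.scale_right_distrib)
next
  fix X Y \<alpha> \<beta> \<gamma> assume o: "X \<in> Obj" "Y \<in> Obj" and m: "\<alpha> \<in> Hm X Y" "\<beta> \<in> Hm X Y" "\<gamma> \<in> Hm X Y"
  obtain Z \<sigma> f g h where 1: "Q Z X \<sigma>" "Ar Z Y f" "Ar Z Y g" "Ar Z Y h"
    "\<alpha> = fr X Y Z \<sigma> f" "\<beta> = fr X Y Z \<sigma> g" "\<gamma> = fr X Y Z \<sigma> h" by (rule Hm_triple[OF o m])
  from 1(1-4) show "fadd X Y (fadd X Y \<alpha> \<beta>) \<gamma> = fadd X Y \<alpha> (fadd X Y \<beta> \<gamma>)"
    unfolding 1(5-7) by (simp add: fadd_fr Ar_add add.assoc)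
next
  fix X Y assume o: "X \<in> Obj" "Y \<in> Obj"
  show "\<exists>z\<in>Hm X Y. \<forall>\<alpha>\<in>Hm X Y. fadd X Y z \<alpha> = \<alpha> \<and> (\<exists>\<beta>\<in>Hm X Y. fadd X Y \<alpha> \<beta> = z)"
  proof (intro bexI ballI)
    show "floc X Y 0 \<in> Hm X Y" by (rule floc_in[OF Ar_zero[OF o]])
    fix \<alpha> assume m: "\<alpha> \<in> Hm X Y"
    obtain Z \<sigma> f where 1: "Q Z X \<sigma>" "Ar Z Y f" "\<alpha> = fr X Y Z \<sigma> f" by (rule Hm_cases[OF o m])
    have z: "floc X Y 0 = fr X Y Z \<sigma> 0" using floc_fr[OF Ar_zero[OF o] 1(1)] by (simp add: zero_comp)
    have Z: "Ar Z Y 0" using Ar_zero 1 ArD by blast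
    have n: "Ar Z Y (sc (-1) f)" "f + sc (-1) f = 0" using Ar_sc[OF 1(2)] by (blast, simp add: vsc.scale_minus_left)
    have "fadd X Y \<alpha> (fr X Y Z \<sigma> (sc (-1) f)) = floc X Y 0"
      using fadd_fr[OF 1(1,2) n(1)] unfolding z 1(3) n(2) .
    then show "fadd X Y (floc X Y 0) \<alpha> = \<alpha> \<and> (\<exists>\<beta>\<in>Hm X Y. fadd X Y \<alpha> \<beta> = floc X Y 0)"
      using fadd_fr[OF 1(1) Z 1(2)] fr_in[OF 1(1) n(1)] unfolding z 1(3) by (intro conjI bexI) simp_all
  qed
next
  fix X Y \<alpha> and c d :: 'c assume o: "X \<in> Obj" "Y \<in> Obj" and m: "\<alpha> \<in> Hm X Y"
  obtain Z \<sigma> f where 1: "Q Z X \<sigma>" "Ar Z Y f" "\<alpha> = fr X Y Z \<sigma> f" by (rule Hm_cases[OF o m])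
  show "fsmul X Y c \<alpha> \<in> Hm X Y"
    "fsmul X Y (c + d) \<alpha> = fadd X Y (fsmul X Y c \<alpha>) (fsmul X Y d \<alpha>)"
    "fsmul X Y (c * d) \<alpha> = fsmul X Y c (fsmul X Y d \<alpha>)" "fsmul X Y 1 \<alpha> = \<alpha>"
    unfolding 1(3) using 1(1,2) by (simp_all add: fadd_fr fsmul_fr Ar_sc vsc.scale_left_distrib fr_in)
next
  fix X Y V \<alpha> \<beta> \<beta>' assume o: "X \<in> Obj" "Y \<in> Obj" "V \<in> Obj" and m: "\<alpha> \<in> Hm X Y" "\<beta> \<in> Hm Y V" "\<beta>' \<in> Hm Y V"
  obtain Z \<sigma> f where 1: "Q Z X \<sigma>" "Ar Z Y f" "\<alpha> = fr X Y Z \<sigma> f"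
    by (rule Hm_cases[OF o(1,2) m(1)])
  obtain W \<tau> g g' where 2: "Q W Y \<tau>" "Ar W V g" "Ar W V g'" "\<beta> = fr Y V W \<tau> g" "\<beta>' = fr Y V W \<tau> g'"
    by (rule Hm_pair[OF o(2,3,3) m(2,3)])
  obtain U \<rho> h where 3: "Q U X \<rho>" "Ar U W h" "\<alpha> = fr X Y U \<rho> (\<tau> \<cdot> h)"
    by (rule fr_normal[OF 1(1,2) 2(1)]) (use 1 in simp)
  show "fcomp X Y V (fadd Y V \<beta> \<beta>') \<alpha> = fadd X V (fcomp X Y V \<beta> \<alpha>) (fcomp X Y V \<beta>' \<alpha>)"
    using fadd_fr[OF 2(1,2,3)] fcomp_direct[OF 3(1,2) 2(1,2)] fcomp_direct[OF 3(1,2) 2(1,3)]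
      fcomp_direct[OF 3(1,2) 2(1) Ar_add[OF 2(2,3)]]
      fadd_fr[OF 3(1) Ar_comp[OF 3(2) 2(2)] Ar_comp[OF 3(2) 2(3)]]
    unfolding 2(4,5) 3(3) by (simp add: comp_add_left)
next
  fix X Y V \<alpha> \<alpha>' \<beta> assume o: "X \<in> Obj" "Y \<in> Obj" "V \<in> Obj" and m: "\<alpha> \<in> Hm X Y" "\<alpha>' \<in> Hm X Y" "\<beta> \<in> Hm Y V"
  obtain Z \<sigma> f f' where 1: "Q Z X \<sigma>" "Ar Z Y f" "Ar Z Y f'" "\<alpha> = fr X Y Z \<sigma> f" "\<alpha>' = fr X Y Z \<sigma> f'"
    by (rule Hm_pair[OF o(1,2,2) m(1,2)])
  obtain W \<tau> g where 2: "Q W Y \<tau>" "Ar W V g" "\<beta> = fr Y V W \<tau> g" by (rule Hm_cases[OF o(2,3) m(3)])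
  obtain U u h where 3: "Q U Z u" "Ar U W h" "Q U X (\<sigma> \<cdot> u)" "\<alpha> = fr X Y U (\<sigma> \<cdot> u) (\<tau> \<cdot> h)"
    by (rule fr_normal[OF 1(1,2) 2(1)]) (use 1 in simp)
  have r: "\<alpha>' = fr X Y U (\<sigma> \<cdot> u) (f' \<cdot> u)" "Ar U Y (f' \<cdot> u)"
    using fr_refine[OF 1(1,3) 3(1), symmetric] Ar_comp[OF QD[OF 3(1)] 1(3)] unfolding 1(5) by blast+
  \<comment> \<open>Both summands must factor through \<open>\<tau>\<close> over the same
    denominator: \<open>\<alpha>'\<close> is normalised on a refinement of the one chosen for
    \<open>\<alpha>\<close>, and \<open>\<alpha>\<close> is then restricted to it.\<close>
  obtain U' u' h' where 4: "Q U' U u'" "Ar U' W h'" "Q U' X (\<sigma> \<cdot> u \<cdot> u')" "\<alpha>' = fr X Y U' (\<sigma> \<cdot> u \<cdot> u') (\<tau> \<cdot> h')"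
    by (rule fr_normal[OF 3(3) r(2) 2(1)]) (simp add: r(1))
  have 5: "\<alpha> = fr X Y U' (\<sigma> \<cdot> u \<cdot> u') (\<tau> \<cdot> (h \<cdot> u'))" "Ar U' W (h \<cdot> u')"
    using fr_refine[OF 3(3) Ar_comp[OF 3(2) QD[OF 2(1)]] 4(1)] 3(4) Ar_comp[OF QD[OF 4(1)] 3(2)]
    by (simp_all add: assoc)
  have 6: "fadd X Y \<alpha> \<alpha>' = fr X Y U' (\<sigma> \<cdot> u \<cdot> u') (\<tau> \<cdot> (h \<cdot> u' + h'))"
    unfolding 5(1) 4(4) comp_add_right[OF 5(2) 4(2) QD[OF 2(1)]]
    by (rule fadd_fr[OF 4(3) Ar_comp[OF 5(2) QD[OF 2(1)]] Ar_comp[OF 4(2) QD[OF 2(1)]]])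
  show "fcomp X Y V \<beta> (fadd X Y \<alpha> \<alpha>') = fadd X V (fcomp X Y V \<beta> \<alpha>) (fcomp X Y V \<beta> \<alpha>')"
    using fcomp_direct[OF 4(3) Ar_add[OF 5(2) 4(2)] 2(1,2)] fcomp_direct[OF 4(3) 5(2) 2(1,2)]
      fcomp_direct[OF 4(3) 4(2) 2(1,2)] fadd_fr[OF 4(3) Ar_comp[OF 5(2) 2(2)] Ar_comp[OF 4(2) 2(2)]]
      comp_add_right[OF 5(2) 4(2) 2(2)]
    unfolding 6 unfolding 5(1) 4(4) 2(3) by simp
next
  fix X Y V \<alpha> \<beta> and r :: 'c assume o: "X \<in> Obj" "Y \<in> Obj" "V \<in> Obj" and m: "\<alpha> \<in> Hm X Y" "\<beta> \<in> Hm Y V"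
  obtain Z \<sigma> f where 1: "Q Z X \<sigma>" "Ar Z Y f" "\<alpha> = fr X Y Z \<sigma> f"
    by (rule Hm_cases[OF o(1,2) m(1)])
  obtain W \<tau> g where 2: "Q W Y \<tau>" "Ar W V g" "\<beta> = fr Y V W \<tau> g" by (rule Hm_cases[OF o(2,3) m(2)])
  obtain U \<rho> h where 3: "Q U X \<rho>" "Ar U W h" "\<alpha> = fr X Y U \<rho> (\<tau> \<cdot> h)"
    by (rule fr_normal[OF 1(1,2) 2(1)]) (use 1 in simp)
  have 4: "sc r (\<tau> \<cdot> h) = \<tau> \<cdot> sc r h" using comp_sc_right[OF 3(2) QD[OF 2(1)]] by simp
  show "fcomp X Y V (fsmul Y V r \<beta>) \<alpha> = fsmul X V r (fcomp X Y V \<beta> \<alpha>)"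
    using fsmul_fr[OF 2(1,2)] fcomp_direct[OF 3(1,2) 2(1,2)] fcomp_direct[OF 3(1,2) 2(1) Ar_sc[OF 2(2)]]
      fsmul_fr[OF 3(1) Ar_comp[OF 3(2) 2(2)]]
    unfolding 2(3) 3(3) by (simp add: comp_sc_left)
  show "fcomp X Y V \<beta> (fsmul X Y r \<alpha>) = fsmul X V r (fcomp X Y V \<beta> \<alpha>)"
    using fsmul_fr[OF 3(1) Ar_comp[OF 3(2) QD[OF 2(1)]]] fcomp_direct[OF 3(1,2) 2(1,2)]
      fcomp_direct[OF 3(1) Ar_sc[OF 3(2)] 2(1,2)]
      fsmul_fr[OF 3(1) Ar_comp[OF 3(2) 2(2)]]
    unfolding 2(3) 3(3) by (simp add: 4 comp_sc_right[OF 3(2) 2(2)])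
qed

end

section \<open>Modules and complexes\<close>

lemma subspace_iff:
  "vector_space s \<Longrightarrow> module.subspace s V \<longleftrightarrow>
    0 \<in> V \<and> (\<forall>u\<in>V. \<forall>v\<in>V. u + v \<in> V) \<and> (\<forall>c. \<forall>u\<in>V. s c u \<in> V)"
proof -
  assume "vector_space s"
  then interpret vector_space s .
  show ?thesis by (auto simp: subspace_def)
qed

text \<open>If \<open>0\<close> lies outside \<open>V\<close>, the extension by \<open>0\<close>
  gives the value; otherwise additivity does.\<close>

lemma linmaps_zero: "g \<in> linmaps s V t W \<Longrightarrow> g 0 = 0"
  unfolding linmaps_def by (cases "0 \<in> V") (auto, metis add.right_neutral add_cancel_left_right)

lemma linmapsI:
  assumes "\<And>u. u \<in> V \<Longrightarrow> g u \<in> W" "\<And>u v. u \<in> V \<Longrightarrow> v \<in> V \<Longrightarrow> g (u + v) = g u + g v"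
    "\<And>c u. u \<in> V \<Longrightarrow> g (s c u) = t c (g u)" "\<And>u. u \<notin> V \<Longrightarrow> g u = 0"
  shows "g \<in> linmaps s V t W"
  using assms by (simp add: linmaps_def)

locale cmodule =
  fixes C :: "('o, 'm) cat" and s :: "'k::field \<Rightarrow> 'v::ab_group_add \<Rightarrow> 'v" and F :: "('o, 'm, 'v) cmod"
  assumes cat: "category C" and vs: "vector_space s" and md: "is_cmod C s F"
begin

lemma sub: "x \<in> Ob C \<Longrightarrow> 0 \<in> sp F x \<and> (\<forall>u\<in>sp F x. \<forall>v\<in>sp F x. u + v \<in> sp F x) \<and> (\<forall>c. \<forall>u\<in>sp F x. s c u \<in> sp F x)"
  using md subspace_iff[OF vs] by (simp add: is_cmod_def)

lemma zero_in [simp, intro]: "x \<in> Ob C \<Longrightarrow> 0 \<in> sp F x"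
  and add_in [simp, intro]: "x \<in> Ob C \<Longrightarrow> u \<in> sp F x \<Longrightarrow> v \<in> sp F x \<Longrightarrow> u + v \<in> sp F x"
  and scale_in [simp, intro]: "x \<in> Ob C \<Longrightarrow> u \<in> sp F x \<Longrightarrow> s c u \<in> sp F x"
  using sub by auto

lemma neg_in [simp, intro]: "x \<in> Ob C \<Longrightarrow> u \<in> sp F x \<Longrightarrow> - u \<in> sp F x"
proof -
  interpret vector_space s by (rule vs)
  assume "x \<in> Ob C" "u \<in> sp F x"
  moreover have "s (-1) u = - u" by simp
  ultimately show "- u \<in> sp F x" using scale_in by metis
qed

lemma diff_in [simp, intro]: "x \<in> Ob C \<Longrightarrow> u \<in> sp F x \<Longrightarrow> v \<in> sp F x \<Longrightarrow> u - v \<in> sp F x"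
  using add_in[of x u "- v"] by simp

lemma sum_in [simp, intro]: "x \<in> Ob C \<Longrightarrow> (\<And>i. i \<in> I \<Longrightarrow> u i \<in> sp F x) \<Longrightarrow> sum u I \<in> sp F x"
  by (induction I rule: infinite_finite_induct) auto

lemma act_lin: "x \<in> Ob C \<Longrightarrow> y \<in> Ob C \<Longrightarrow> h \<in> Hom C x y \<Longrightarrow> act F x y h \<in> linmaps s (sp F x) s (sp F y)"
  using md by (simp add: is_cmod_def)

context
  fixes x y h assumes xy: "x \<in> Ob C" "y \<in> Ob C" "h \<in> Hom C x y"
begin

lemma act_in [simp, intro]: "u \<in> sp F x \<Longrightarrow> act F x y h u \<in> sp F y"
  and act_add [simp]: "u \<in> sp F x \<Longrightarrow> v \<in> sp F x \<Longrightarrow> act F x y h (u + v) = act F x y h u + act F x y h v"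
  and act_scale [simp]: "u \<in> sp F x \<Longrightarrow> act F x y h (s c u) = s c (act F x y h u)"
  and act_out [simp]: "u \<notin> sp F x \<Longrightarrow> act F x y h u = 0"
  and act_zero [simp]: "act F x y h 0 = 0"
  using act_lin[OF xy] linmaps_zero[OF act_lin[OF xy]] by (auto simp: linmaps_def)

lemma act_neg [simp]: "u \<in> sp F x \<Longrightarrow> act F x y h (- u) = - act F x y h u"
  using act_add[of u "- u"] xy by (simp add: eq_neg_iff_add_eq_0 add.commute)

lemma act_diff [simp]: "u \<in> sp F x \<Longrightarrow> v \<in> sp F x \<Longrightarrow> act F x y h (u - v) = act F x y h u - act F x y h v"
  using act_add[of u "- v"] xy by simp

lemma act_sum: "(\<And>i. i \<in> I \<Longrightarrow> u i \<in> sp F x) \<Longrightarrow> act F x y h (sum u I) = (\<Sum>i\<in>I. act F x y h (u i))"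
  by (induction I rule: infinite_finite_induct) (auto simp: xy)

end

lemma act_id [simp]: "x \<in> Ob C \<Longrightarrow> u \<in> sp F x \<Longrightarrow> act F x x (Idn C x) u = u"
  using md by (simp add: is_cmod_def restr_def)

lemma act_comp: "x \<in> Ob C \<Longrightarrow> y \<in> Ob C \<Longrightarrow> z \<in> Ob C \<Longrightarrow> f \<in> Hom C x y \<Longrightarrow> g \<in> Hom C y z \<Longrightarrow>
    act F x z (Cmp C x y z g f) u = act F y z g (act F x y f u)"
  using md by (simp add: is_cmod_def)

sublocale vsp: vector_space s by (rule vs)

end

lemma cmoduleI:
  fixes C :: "('o, 'm) cat"
  assumes "category C" "vector_space s"
    and "\<And>x. x \<in> Ob C \<Longrightarrow> 0 \<in> sp F x"
    and "\<And>x u v. x \<in> Ob C \<Longrightarrow> u \<in> sp F x \<Longrightarrow> v \<in> sp F x \<Longrightarrow> u + v \<in> sp F x"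
    and "\<And>x u c. x \<in> Ob C \<Longrightarrow> u \<in> sp F x \<Longrightarrow> s c u \<in> sp F x"
    and "\<And>x y h u. x \<in> Ob C \<Longrightarrow> y \<in> Ob C \<Longrightarrow> h \<in> Hom C x y \<Longrightarrow> u \<in> sp F x \<Longrightarrow> act F x y h u \<in> sp F y"
    and "\<And>x y h u v. x \<in> Ob C \<Longrightarrow> y \<in> Ob C \<Longrightarrow> h \<in> Hom C x y \<Longrightarrow> u \<in> sp F x \<Longrightarrow> v \<in> sp F x \<Longrightarrow>
      act F x y h (u + v) = act F x y h u + act F x y h v"
    and "\<And>x y h u c. x \<in> Ob C \<Longrightarrow> y \<in> Ob C \<Longrightarrow> h \<in> Hom C x y \<Longrightarrow> u \<in> sp F x \<Longrightarrow>
      act F x y h (s c u) = s c (act F x y h u)"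
    and out: "\<And>x y h u. x \<in> Ob C \<Longrightarrow> y \<in> Ob C \<Longrightarrow> h \<in> Hom C x y \<Longrightarrow> u \<notin> sp F x \<Longrightarrow> act F x y h u = 0"
    and "\<And>x u. x \<in> Ob C \<Longrightarrow> u \<in> sp F x \<Longrightarrow> act F x x (Idn C x) u = u"
    and comp: "\<And>x y z f g u. x \<in> Ob C \<Longrightarrow> y \<in> Ob C \<Longrightarrow> z \<in> Ob C \<Longrightarrow> f \<in> Hom C x y \<Longrightarrow> g \<in> Hom C y z \<Longrightarrow>
      u \<in> sp F x \<Longrightarrow> act F x z (Cmp C x y z g f) u = act F y z g (act F x y f u)"
  shows "cmodule C s F"
proof (rule cmodule.intro)
  have cI: "Idn C x \<in> Hom C x x" "\<And>y z f g. y \<in> Ob C \<Longrightarrow> z \<in> Ob C \<Longrightarrow> f \<in> Hom C x y \<Longrightarrow> g \<in> Hom C y z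
     \<Longrightarrow> Cmp C x y z g f \<in> Hom C x z" if "x \<in> Ob C" for x
    using assms(1) that by (auto simp: category_def)
  have L: "act F x y h \<in> linmaps s (sp F x) s (sp F y)" if "x \<in> Ob C" "y \<in> Ob C" "h \<in> Hom C x y" for x y h
    using assms that by (intro linmapsI) auto
  \<comment> \<open>Outside the carrier both sides are \<open>0\<close>, so the composition law has
    to be assumed for carrier elements only.\<close>
  have "act F x z (Cmp C x y z g f) u = act F y z g (act F x y f u)"
    if "x \<in> Ob C" "y \<in> Ob C" "z \<in> Ob C" "f \<in> Hom C x y" "g \<in> Hom C y z" for x y z f g u
    using that cI comp out linmaps_zero[OF L] by (cases "u \<in> sp F x") auto
  then show "is_cmod C s F"
    unfolding is_cmod_def subspace_iff[OF assms(2)] restr_def using assms cI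
    by (intro conjI ballI allI ext L) auto
qed (rule assms)+

locale nt = F: cmodule C s F + G: cmodule C t G
  for C :: "('o, 'm) cat" and s :: "'k::field \<Rightarrow> 'v::ab_group_add \<Rightarrow> 'v" and F
    and t :: "'k \<Rightarrow> 'w::ab_group_add \<Rightarrow> 'w" and G +
  fixes \<eta> :: "'o \<Rightarrow> 'v \<Rightarrow> 'w"
  assumes nt: "\<eta> \<in> nattrans C s F t G"
begin

lemma lin: "x \<in> Ob C \<Longrightarrow> \<eta> x \<in> linmaps s (sp F x) t (sp G x)"
  using nt by (simp add: nattrans_def)

lemma in_sp [simp, intro]: "x \<in> Ob C \<Longrightarrow> u \<in> sp F x \<Longrightarrow> \<eta> x u \<in> sp G x"
  and add [simp]: "x \<in> Ob C \<Longrightarrow> u \<in> sp F x \<Longrightarrow> v \<in> sp F x \<Longrightarrow> \<eta> x (u + v) = \<eta> x u + \<eta> x v"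
  and scale [simp]: "x \<in> Ob C \<Longrightarrow> u \<in> sp F x \<Longrightarrow> \<eta> x (s c u) = t c (\<eta> x u)"
  and out [simp]: "u \<notin> sp F x \<Longrightarrow> \<eta> x u = 0"
  and out_ob [simp]: "x \<notin> Ob C \<Longrightarrow> \<eta> x u = 0"
  and zero [simp]: "\<eta> x 0 = 0"
proof -
  show o: "\<eta> x u = 0" if "x \<notin> Ob C" for x u using nt that by (simp add: nattrans_def)
  show "\<eta> x u = 0" if "u \<notin> sp F x" using lin[of x] o that by (cases "x \<in> Ob C") (auto simp: linmaps_def)
  show "\<eta> x 0 = 0" using linmaps_zero[OF lin] o by blast
qed (use lin in \<open>auto simp: linmaps_def\<close>)

lemma neg [simp]: "x \<in> Ob C \<Longrightarrow> u \<in> sp F x \<Longrightarrow> \<eta> x (- u) = - \<eta> x u"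
  using add[of x u "- u"] by (simp add: eq_neg_iff_add_eq_0 add.commute)

lemma diff [simp]: "x \<in> Ob C \<Longrightarrow> u \<in> sp F x \<Longrightarrow> v \<in> sp F x \<Longrightarrow> \<eta> x (u - v) = \<eta> x u - \<eta> x v"
  using add[of x u "- v"] by simp

lemma sum: "x \<in> Ob C \<Longrightarrow> (\<And>i. i \<in> I \<Longrightarrow> u i \<in> sp F x) \<Longrightarrow> \<eta> x (sum u I) = (\<Sum>i\<in>I. \<eta> x (u i))"
  by (induction I rule: infinite_finite_induct) auto

lemma natural: "x \<in> Ob C \<Longrightarrow> y \<in> Ob C \<Longrightarrow> h \<in> Hom C x y \<Longrightarrow> \<eta> y (act F x y h u) = act G x y h (\<eta> x u)"
proof -
  assume "x \<in> Ob C" "y \<in> Ob C" "h \<in> Hom C x y"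
  then have "\<eta> y \<circ> act F x y h = act G x y h \<circ> \<eta> x" using nt by (simp add: nattrans_def)
  then show "\<eta> y (act F x y h u) = act G x y h (\<eta> x u)" by (auto dest: fun_cong)
qed

end

lemma nattransI:
  fixes C :: "('o, 'm) cat"
  assumes "cmodule C s F" "cmodule C t G"
    and "\<And>x u. x \<in> Ob C \<Longrightarrow> u \<in> sp F x \<Longrightarrow> \<eta> x u \<in> sp G x"
    and "\<And>x u v. x \<in> Ob C \<Longrightarrow> u \<in> sp F x \<Longrightarrow> v \<in> sp F x \<Longrightarrow> \<eta> x (u + v) = \<eta> x u + \<eta> x v"
    and "\<And>x u c. x \<in> Ob C \<Longrightarrow> u \<in> sp F x \<Longrightarrow> \<eta> x (s c u) = t c (\<eta> x u)"
    and nat: "\<And>x y h u. x \<in> Ob C \<Longrightarrow> y \<in> Ob C \<Longrightarrow> h \<in> Hom C x y \<Longrightarrow> u \<in> sp F x \<Longrightarrow>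
      \<eta> y (act F x y h u) = act G x y h (\<eta> x u)"
    and out: "\<And>x u. x \<in> Ob C \<Longrightarrow> u \<notin> sp F x \<Longrightarrow> \<eta> x u = 0"
    and "\<And>x u. x \<notin> Ob C \<Longrightarrow> \<eta> x u = 0"
  shows "\<eta> \<in> nattrans C s F t G"
proof -
  interpret F: cmodule C s F by fact
  interpret G: cmodule C t G by fact
  have L: "\<eta> x \<in> linmaps s (sp F x) t (sp G x)" if "x \<in> Ob C" for x
    by (intro linmapsI) (use assms that in auto)
  have "\<eta> y (act F x y h u) = act G x y h (\<eta> x u)" if "x \<in> Ob C" "y \<in> Ob C" "h \<in> Hom C x y" for x y h u
    using nat[OF that] out that linmaps_zero[OF L] by (cases "u \<in> sp F x") auto
  then show ?thesis
    using L assms(8) by (auto simp: nattrans_def fun_eq_iff)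
qed

lemma restr_fam_apply [simp]: "x \<in> Ob C \<Longrightarrow> u \<in> sp F x \<Longrightarrow> restr_fam C F \<eta> x u = \<eta> x u"
  "x \<notin> Ob C \<Longrightarrow> restr_fam C F \<eta> x u = 0" "u \<notin> sp F x \<Longrightarrow> restr_fam C F \<eta> x u = 0"
  by (auto simp: restr_fam_def)

lemma nattrans_restrI:
  fixes C :: "('o, 'm) cat"
  assumes "cmodule C s F" "cmodule C t G"
    and "\<And>x u. x \<in> Ob C \<Longrightarrow> u \<in> sp F x \<Longrightarrow> \<eta> x u \<in> sp G x"
    and "\<And>x u v. x \<in> Ob C \<Longrightarrow> u \<in> sp F x \<Longrightarrow> v \<in> sp F x \<Longrightarrow> \<eta> x (u + v) = \<eta> x u + \<eta> x v"
    and "\<And>x u c. x \<in> Ob C \<Longrightarrow> u \<in> sp F x \<Longrightarrow> \<eta> x (s c u) = t c (\<eta> x u)"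
    and "\<And>x y h u. x \<in> Ob C \<Longrightarrow> y \<in> Ob C \<Longrightarrow> h \<in> Hom C x y \<Longrightarrow> u \<in> sp F x \<Longrightarrow>
      \<eta> y (act F x y h u) = act G x y h (\<eta> x u)"
  shows "restr_fam C F \<eta> \<in> nattrans C s F t G"
proof -
  interpret F: cmodule C s F by fact
  interpret G: cmodule C t G by fact
  show ?thesis by (rule nattransI[OF assms(1,2)]) (auto simp: assms)
qed

lemma nattrans_eqI:
  assumes "\<eta> \<in> nattrans C s F t G" "\<theta> \<in> nattrans C s F t G"
    "\<And>x u. x \<in> Ob C \<Longrightarrow> u \<in> sp F x \<Longrightarrow> \<eta> x u = \<theta> x u"
  shows "\<eta> = \<theta>"
proof (intro ext)
  fix x u
  have "x \<notin> Ob C \<or> u \<notin> sp F x \<Longrightarrow> \<eta> x u = \<theta> x u"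
    using assms(1,2) by (cases "x \<in> Ob C") (auto simp: nattrans_def linmaps_def)
  then show "\<eta> x u = \<theta> x u" using assms(3) by blast
qed

lemma nattrans_comp:
  assumes "\<eta> \<in> nattrans C s F t G" "\<theta> \<in> nattrans C t G r H"
  shows "(\<lambda>x. \<theta> x \<circ> \<eta> x) \<in> nattrans C s F r H"
proof -
  have "(\<theta> x \<circ> \<eta> x) \<in> linmaps s (sp F x) r (sp H x)" if x: "x \<in> Ob C" for x
  proof -
    have l: "\<eta> x \<in> linmaps s (sp F x) t (sp G x)" "\<theta> x \<in> linmaps t (sp G x) r (sp H x)"
      using assms x by (auto simp: nattrans_def)
    show ?thesis using l(1) l(2) linmaps_zero[OF l(2)] by (auto simp: linmaps_def)
  qed
  moreover have "(\<theta> x \<circ> \<eta> x) = 0" if "x \<notin> Ob C" for x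
    using assms that by (auto simp: nattrans_def fun_eq_iff)
  moreover have "(\<theta> y \<circ> \<eta> y) \<circ> act F x y f = act H x y f \<circ> (\<theta> x \<circ> \<eta> x)"
    if "x \<in> Ob C" "y \<in> Ob C" "f \<in> Hom C x y" for x y f
  proof -
    have c: "\<eta> y \<circ> act F x y f = act G x y f \<circ> \<eta> x" "\<theta> y \<circ> act G x y f = act H x y f \<circ> \<theta> x"
      using assms that by (simp_all add: nattrans_def)
    show ?thesis using fun_cong[OF c(1)] fun_cong[OF c(2)] by (simp add: fun_eq_iff)
  qed
  ultimately show ?thesis by (simp add: nattrans_def)
qed

context
  fixes C :: "('o, 'm) cat" and s :: "'k::field \<Rightarrow> 'v::ab_group_add \<Rightarrow> 'v" and F
    and t :: "'k \<Rightarrow> 'w::ab_group_add \<Rightarrow> 'w" and G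
  assumes FG: "cmodule C s F" "cmodule C t G"
begin

interpretation F: cmodule C s F by (rule FG)
interpretation G: cmodule C t G by (rule FG)

lemma ntI: "\<eta> \<in> nattrans C s F t G \<Longrightarrow> nt C s F t G \<eta>"
  by unfold_locales

lemma nattrans_zero: "0 \<in> nattrans C s F t G"
  by (rule nattransI[OF FG]) auto

lemma nattrans_add:
  assumes "\<eta> \<in> nattrans C s F t G" "\<theta> \<in> nattrans C s F t G"
  shows "\<eta> + \<theta> \<in> nattrans C s F t G"
proof -
  interpret e: nt C s F t G \<eta> by (rule ntI[OF assms(1)])
  interpret h: nt C s F t G \<theta> by (rule ntI[OF assms(2)])
  show ?thesis
    by (rule nattransI[OF FG]) (simp_all add: e.natural h.natural G.vsp.scale_right_distrib)
qed

lemma nattrans_scale: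
  assumes "\<eta> \<in> nattrans C s F t G"
  shows "(\<lambda>x u. t c (\<eta> x u)) \<in> nattrans C s F t G"
proof -
  interpret e: nt C s F t G \<eta> by (rule ntI[OF assms(1)])
  show ?thesis
    by (rule nattransI[OF FG]) (simp_all add: e.natural G.vsp.scale_right_distrib G.vsp.scale_left_commute)
qed

lemma nattrans_neg:
  assumes "\<eta> \<in> nattrans C s F t G"
  shows "- \<eta> \<in> nattrans C s F t G"
proof -
  interpret e: nt C s F t G \<eta> by (rule ntI[OF assms(1)])
  show ?thesis
    by (rule nattransI[OF FG]) (simp_all add: e.natural G.vsp.scale_minus_right)
qed

lemma nattrans_diff:
  "\<eta> \<in> nattrans C s F t G \<Longrightarrow> \<theta> \<in> nattrans C s F t G \<Longrightarrow> \<eta> - \<theta> \<in> nattrans C s F t G"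
  using nattrans_add[of \<eta> "- \<theta>"] nattrans_neg by simp

lemma nattrans_sum: "(\<And>i. i \<in> I \<Longrightarrow> \<eta> i \<in> nattrans C s F t G) \<Longrightarrow> sum \<eta> I \<in> nattrans C s F t G"
  by (induction I rule: infinite_finite_induct) (auto intro: nattrans_add nattrans_zero)

end

lemma (in cmodule) nattrans_id: "restr_fam C F (\<lambda>x u. u) \<in> nattrans C s F s F"
  by (rule nattrans_restrI[OF cmodule_axioms cmodule_axioms]) auto

section \<open>Complexes, chain maps and homotopies\<close>

locale cplx =
  fixes C :: "('o, 'm) cat" and s :: "'k::field \<Rightarrow> 'v::ab_group_add \<Rightarrow> 'v" and X :: "('o, 'm, 'v) cpx"
  assumes cat: "category C" and vs: "vector_space s" and cx: "is_complex C s X"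
begin

sublocale cmodule C s "cx X n" for n
  by (rule cmodule.intro[OF cat vs]) (use cx in \<open>auto simp: is_complex_def\<close>)

lemma cmod: "cmodule C s (cx X n)" by unfold_locales

sublocale d: nt C s "cx X n" s "cx X (n + 1)" "df X n" for n
  using cx by unfold_locales (auto simp: is_complex_def)

lemma d_in' [simp, intro]: "x \<in> Ob C \<Longrightarrow> u \<in> sp (cx X (n - 1)) x \<Longrightarrow> df X (n - 1) x u \<in> sp (cx X n) x"
  using d.in_sp[of x u "n - 1"] by simp

lemma dd [simp]: "df X (n + 1) x (df X n x u) = 0"
  using cx by (cases "x \<in> Ob C"; cases "u \<in> sp (cx X n) x") (auto simp: is_complex_def)

lemma dd' [simp]: "df X n x (df X (n - 1) x u) = 0"
  using dd[of "n - 1" x u] by simp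

lemma d_nat': "x \<in> Ob C \<Longrightarrow> y \<in> Ob C \<Longrightarrow> h \<in> Hom C x y \<Longrightarrow>
   df X (n - 1) y (act (cx X (n - 1)) x y h u) = act (cx X n) x y h (df X (n - 1) x u)"
  using d.natural[of x y h "n - 1" u] by simp

end

lemma cplxI:
  assumes "category C" "vector_space s" "\<And>n. cmodule C s (cx X n)"
    "\<And>n. df X n \<in> nattrans C s (cx X n) s (cx X (n + 1))"
    "\<And>n x u. x \<in> Ob C \<Longrightarrow> u \<in> sp (cx X n) x \<Longrightarrow> df X (n + 1) x (df X n x u) = 0"
  shows "cplx C s X"
proof (rule cplx.intro)
  show "is_complex C s X" using assms(3-5) by (auto simp: is_complex_def dest: cmodule.md)
qed (rule assms)+

locale chmap = X: cplx C s X + Y: cplx C t Y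
  for C :: "('o, 'm) cat" and s :: "'k::field \<Rightarrow> 'v::ab_group_add \<Rightarrow> 'v" and X
    and t :: "'k \<Rightarrow> 'w::ab_group_add \<Rightarrow> 'w" and Y +
  fixes f :: "int \<Rightarrow> 'o \<Rightarrow> 'v \<Rightarrow> 'w"
  assumes ch: "f \<in> chain_maps C s X t Y"
begin

sublocale nt C s "cx X n" t "cx Y n" "f n" for n
  using ch by unfold_locales (auto simp: chain_maps_def)

lemma d_comm: "f (n + 1) x (df X n x u) = df Y n x (f n x u)"
proof (cases "x \<in> Ob C")
  case True
  then have "(f (n + 1) x \<circ> df X n x) u = (df Y n x \<circ> f n x) u"
    using ch unfolding chain_maps_def by (metis (mono_tags, lifting) mem_Collect_eq)
  then show ?thesis by simp
qed auto

lemma d_comm': "f n x (df X (n - 1) x u) = df Y (n - 1) x (f (n - 1) x u)"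
  using d_comm[of "n - 1" x u] by simp

end

lemma chain_mapsI:
  assumes "cplx C s X" "cplx C t Y" "\<And>n. f n \<in> nattrans C s (cx X n) t (cx Y n)"
    "\<And>n x u. x \<in> Ob C \<Longrightarrow> u \<in> sp (cx X n) x \<Longrightarrow> f (n + 1) x (df X n x u) = df Y n x (f n x u)"
  shows "f \<in> chain_maps C s X t Y"
proof -
  interpret X: cplx C s X by fact
  interpret Y: cplx C t Y by fact
  interpret f: nt C s "cx X n" t "cx Y n" "f n" for n using assms(3) by unfold_locales
  have "f (n + 1) x (df X n x u) = df Y n x (f n x u)" if "x \<in> Ob C" for n x u
    using assms(4) that by (cases "u \<in> sp (cx X n) x") auto
  then show ?thesis using assms(3) by (auto simp: chain_maps_def fun_eq_iff)
qed

lemma chain_maps_eqI: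
  assumes "f \<in> chain_maps C s X t Y" "g \<in> chain_maps C s X t Y"
    "\<And>n x u. x \<in> Ob C \<Longrightarrow> u \<in> sp (cx X n) x \<Longrightarrow> f n x u = g n x u"
  shows "f = g"
  using assms by (intro ext[of f]) (rule nattrans_eqI, auto simp: chain_maps_def)

lemma chain_maps_comp:
  assumes f: "f \<in> chain_maps C s X t Y" and g: "g \<in> chain_maps C t Y r Z"
  shows "chain_comp g f \<in> chain_maps C s X r Z"
proof -
  have "g (n + 1) x (f (n + 1) x (df X n x u)) = df Z n x (g n x (f n x u))" if "x \<in> Ob C" for n x u
  proof -
    have c: "f (n + 1) x \<circ> df X n x = df Y n x \<circ> f n x" "g (n + 1) x \<circ> df Y n x = df Z n x \<circ> g n x"
      using f g that by (simp_all add: chain_maps_def)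
    show ?thesis using fun_cong[OF c(1)] fun_cong[OF c(2)] by simp
  qed
  moreover have "(\<lambda>x. g n x \<circ> f n x) \<in> nattrans C s (cx X n) r (cx Z n)" for n
    using f g by (intro nattrans_comp) (auto simp: chain_maps_def)
  ultimately show ?thesis unfolding chain_maps_def chain_comp_def by (auto simp: fun_eq_iff)
qed

lemma chain_comp_assoc: "chain_comp (chain_comp h g) f = chain_comp h (chain_comp g f)"
  by (simp add: chain_comp_def comp_assoc)

lemma chain_comp_apply [simp]: "chain_comp g f n x u = g n x (f n x u)"
  by (simp add: chain_comp_def)

lemma (in cplx) chain_id_in: "chain_id C X \<in> chain_maps C s X s X"
proof (rule chain_mapsI)
  show "chain_id C X n \<in> nattrans C s (cx X n) s (cx X n)" for n
    unfolding chain_id_def by (rule nattrans_id)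
qed (unfold_locales, auto simp: chain_id_def)

lemma chain_id_apply [simp]: "x \<in> Ob C \<Longrightarrow> u \<in> sp (cx X n) x \<Longrightarrow> chain_id C X n x u = u"
  by (simp add: chain_id_def)

context chmap
begin

lemma id_left: "chain_comp (chain_id C Y) f = f"
  using chain_maps_comp[OF ch Y.chain_id_in] ch by (rule chain_maps_eqI) auto

lemma id_right: "chain_comp f (chain_id C X) = f"
  using chain_maps_comp[OF X.chain_id_in ch] ch by (rule chain_maps_eqI) auto

end

context
  fixes C :: "('o, 'm) cat" and s :: "'k::field \<Rightarrow> 'v::ab_group_add \<Rightarrow> 'v" and X
    and t :: "'k \<Rightarrow> 'w::ab_group_add \<Rightarrow> 'w" and Y
  assumes XY: "cplx C s X" "cplx C t Y"
begin

interpretation X: cplx C s X by (rule XY)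
interpretation Y: cplx C t Y by (rule XY)

lemma chmapI: "f \<in> chain_maps C s X t Y \<Longrightarrow> chmap C s X t Y f"
  by unfold_locales

lemma chain_maps_zero: "0 \<in> chain_maps C s X t Y"
proof (rule chain_mapsI[OF XY])
  fix n show "(0 :: int \<Rightarrow> 'o \<Rightarrow> 'v \<Rightarrow> 'w) n \<in> nattrans C s (cx X n) t (cx Y n)"
    using nattrans_zero[OF X.cmod Y.cmod] by (simp add: zero_fun_def)
qed simp

lemma chain_maps_add:
  assumes "f \<in> chain_maps C s X t Y" "g \<in> chain_maps C s X t Y"
  shows "f + g \<in> chain_maps C s X t Y"
proof -
  interpret f: chmap C s X t Y f by (rule chmapI[OF assms(1)])
  interpret g: chmap C s X t Y g by (rule chmapI[OF assms(2)])
  show ?thesis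
    by (rule chain_mapsI[OF XY])
      (auto simp: f.d_comm g.d_comm intro: nattrans_add[OF X.cmod Y.cmod f.nt g.nt])
qed

lemma chain_maps_scale:
  assumes "f \<in> chain_maps C s X t Y"
  shows "(\<lambda>n x u. t c (f n x u)) \<in> chain_maps C s X t Y"
proof -
  interpret f: chmap C s X t Y f by (rule chmapI[OF assms(1)])
  show ?thesis
    by (rule chain_mapsI[OF XY])
      (auto simp: f.d_comm intro: nattrans_scale[OF X.cmod Y.cmod f.nt])
qed

lemma chain_maps_neg:
  assumes "f \<in> chain_maps C s X t Y"
  shows "- f \<in> chain_maps C s X t Y"
proof -
  interpret f: chmap C s X t Y f by (rule chmapI[OF assms(1)])
  show ?thesis
    by (rule chain_mapsI[OF XY])
      (auto simp: f.d_comm intro: nattrans_neg[OF X.cmod Y.cmod f.nt])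
qed

lemma chain_maps_diff:
  "f \<in> chain_maps C s X t Y \<Longrightarrow> g \<in> chain_maps C s X t Y \<Longrightarrow> f - g \<in> chain_maps C s X t Y"
  using chain_maps_add[of f "- g"] chain_maps_neg by simp

lemma homotopic_refl: "homotopic C s X t Y f f"
  unfolding homotopic_def
proof (intro exI conjI allI ballI)
  show "0 \<in> nattrans C s (cx X n) t (cx Y (n - 1))" for n
    by (rule nattrans_zero[OF X.cmod Y.cmod])
qed (simp add: zero_fun_def)

text \<open>A homotopy involves the two maps only through their difference; this reduces questions
  about homotopic maps to null homotopies.\<close>

lemma homotopic_diff_iff: "homotopic C s X t Y (f - g) 0 \<longleftrightarrow> homotopic C s X t Y f g"
  by (simp add: homotopic_def)

lemma homotopic_sym:
  assumes "homotopic C s X t Y f g"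
  shows "homotopic C s X t Y g f"
proof -
  obtain h where h: "\<And>n. h n \<in> nattrans C s (cx X n) t (cx Y (n - 1))"
    and e: "\<And>n x u. x \<in> Ob C \<Longrightarrow> u \<in> sp (cx X n) x \<Longrightarrow>
      f n x u - g n x u = df Y (n - 1) x (h n x u) + h (n + 1) x (df X n x u)"
    using assms unfolding homotopic_def by blast
  interpret h: nt C s "cx X n" t "cx Y (n - 1)" "h n" for n using h by unfold_locales
  show ?thesis unfolding homotopic_def
  proof (intro exI conjI allI ballI)
    show "- h n \<in> nattrans C s (cx X n) t (cx Y (n - 1))" for n
      by (rule nattrans_neg[OF X.cmod Y.cmod h])
    show "g n x u - f n x u = df Y (n - 1) x ((- h n) x u) + (- h (n + 1)) x (df X n x u)"
      if "x \<in> Ob C" "u \<in> sp (cx X n) x" for n x u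
      using e[OF that] that by (simp add: algebra_simps)
  qed
qed

lemma homotopic_add:
  assumes "homotopic C s X t Y f f'" "homotopic C s X t Y g g'"
  shows "homotopic C s X t Y (f + g) (f' + g')"
proof -
  obtain h where h: "\<And>n. h n \<in> nattrans C s (cx X n) t (cx Y (n - 1))"
    and e: "\<And>n x u. x \<in> Ob C \<Longrightarrow> u \<in> sp (cx X n) x \<Longrightarrow>
      f n x u - f' n x u = df Y (n - 1) x (h n x u) + h (n + 1) x (df X n x u)"
    using assms(1) unfolding homotopic_def by blast
  obtain k where k: "\<And>n. k n \<in> nattrans C s (cx X n) t (cx Y (n - 1))"
    and e': "\<And>n x u. x \<in> Ob C \<Longrightarrow> u \<in> sp (cx X n) x \<Longrightarrow>
      g n x u - g' n x u = df Y (n - 1) x (k n x u) + k (n + 1) x (df X n x u)"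
    using assms(2) unfolding homotopic_def by blast
  interpret h: nt C s "cx X n" t "cx Y (n - 1)" "h n" for n using h by unfold_locales
  interpret k: nt C s "cx X n" t "cx Y (n - 1)" "k n" for n using k by unfold_locales
  show ?thesis unfolding homotopic_def
  proof (intro exI conjI allI ballI)
    show "h n + k n \<in> nattrans C s (cx X n) t (cx Y (n - 1))" for n
      by (rule nattrans_add[OF X.cmod Y.cmod h k])
    show "(f + g) n x u - (f' + g') n x u = df Y (n - 1) x ((h n + k n) x u) + (h (n + 1) + k (n + 1)) x (df X n x u)"
      if "x \<in> Ob C" "u \<in> sp (cx X n) x" for n x u
      using e[OF that] e'[OF that] that by (simp add: algebra_simps)
  qed
qed

lemma homotopic_trans:
  assumes "homotopic C s X t Y f g" "homotopic C s X t Y g h"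
  shows "homotopic C s X t Y f h"
  using homotopic_add[of "f - g" 0 "g - h" 0] assms homotopic_diff_iff[of f g] homotopic_diff_iff[of g h]
    homotopic_diff_iff[of f h] by simp

lemma homotopic_scale:
  assumes "homotopic C s X t Y f f'"
  shows "homotopic C s X t Y (\<lambda>n x u. t c (f n x u)) (\<lambda>n x u. t c (f' n x u))"
proof -
  obtain h where h: "\<And>n. h n \<in> nattrans C s (cx X n) t (cx Y (n - 1))"
    and e: "\<And>n x u. x \<in> Ob C \<Longrightarrow> u \<in> sp (cx X n) x \<Longrightarrow>
      f n x u - f' n x u = df Y (n - 1) x (h n x u) + h (n + 1) x (df X n x u)"
    using assms(1) unfolding homotopic_def by blast
  interpret h: nt C s "cx X n" t "cx Y (n - 1)" "h n" for n using h by unfold_locales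
  show ?thesis unfolding homotopic_def
  proof (intro exI conjI allI ballI)
    show "(\<lambda>x u. t c (h n x u)) \<in> nattrans C s (cx X n) t (cx Y (n - 1))" for n
      by (rule nattrans_scale[OF X.cmod Y.cmod h])
    show "t c (f n x u) - t c (f' n x u) = df Y (n - 1) x (t c (h n x u)) + t c (h (n + 1) x (df X n x u))"
      if "x \<in> Ob C" "u \<in> sp (cx X n) x" for n x u
      using e[OF that] that by (simp add: Y.vsp.scale_right_diff_distrib[symmetric] Y.vsp.scale_right_distrib[symmetric])
  qed
qed

end

lemma homotopic_post:
  assumes XY: "cplx C s X" "cplx C t Y" "cplx C r Z"
    and f: "homotopic C s X t Y f f'" and g: "g \<in> chain_maps C t Y r Z"
    and ff: "f \<in> chain_maps C s X t Y" "f' \<in> chain_maps C s X t Y"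
  shows "homotopic C s X r Z (chain_comp g f) (chain_comp g f')"
proof -
  interpret X: cplx C s X by (rule XY)
  interpret g: chmap C t Y r Z g by (rule chmapI[OF XY(2,3) g])
  interpret f: chmap C s X t Y f by (rule chmapI[OF XY(1,2) ff(1)])
  interpret f': chmap C s X t Y f' by (rule chmapI[OF XY(1,2) ff(2)])
  obtain h where h: "\<And>n. h n \<in> nattrans C s (cx X n) t (cx Y (n - 1))"
    and e: "\<And>n x u. x \<in> Ob C \<Longrightarrow> u \<in> sp (cx X n) x \<Longrightarrow>
      f n x u - f' n x u = df Y (n - 1) x (h n x u) + h (n + 1) x (df X n x u)"
    using f unfolding homotopic_def by blast
  interpret h: nt C s "cx X n" t "cx Y (n - 1)" "h n" for n using h by unfold_locales
  have h1: "h (n + 1) x (df X n x u) \<in> sp (cx Y n) x" if "x \<in> Ob C" "u \<in> sp (cx X n) x" for n x u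
    using h.in_sp[of x "df X n x u" "n + 1"] that by simp
  show ?thesis unfolding homotopic_def
  proof (intro exI conjI allI ballI)
    show "(\<lambda>x. g (n - 1) x \<circ> h n x) \<in> nattrans C s (cx X n) r (cx Z (n - 1))" for n
      by (rule nattrans_comp[OF h g.nt])
    show "chain_comp g f n x u - chain_comp g f' n x u =
      df Z (n - 1) x ((g (n - 1) x \<circ> h n x) u) + (g (n + 1 - 1) x \<circ> h (n + 1) x) (df X n x u)"
      if "x \<in> Ob C" "u \<in> sp (cx X n) x" for n x u
      using arg_cong[OF e[OF that], of "g n x"] that h1[OF that] by (simp add: g.d_comm')
  qed
qed

lemma homotopic_pre:
  assumes XY: "cplx C s X" "cplx C t Y" "cplx C r Z"
    and g: "homotopic C t Y r Z g g'" and f: "f \<in> chain_maps C s X t Y"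
  shows "homotopic C s X r Z (chain_comp g f) (chain_comp g' f)"
proof -
  interpret f: chmap C s X t Y f by (rule chmapI[OF XY(1,2) f])
  obtain h where h: "\<And>n. h n \<in> nattrans C t (cx Y n) r (cx Z (n - 1))"
    and e: "\<And>n x u. x \<in> Ob C \<Longrightarrow> u \<in> sp (cx Y n) x \<Longrightarrow>
      g n x u - g' n x u = df Z (n - 1) x (h n x u) + h (n + 1) x (df Y n x u)"
    using g unfolding homotopic_def by blast
  show ?thesis unfolding homotopic_def
  proof (intro exI conjI allI ballI)
    show "(\<lambda>x. h n x \<circ> f n x) \<in> nattrans C s (cx X n) r (cx Z (n - 1))" for n
      by (rule nattrans_comp[OF f.nt h])
    show "chain_comp g f n x u - chain_comp g' f n x u =
      df Z (n - 1) x ((h n x \<circ> f n x) u) + (h (n + 1) x \<circ> f (n + 1) x) (df X n x u)"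
      if "x \<in> Ob C" "u \<in> sp (cx X n) x" for n x u
      using e[of x "f n x u" n] that by (simp add: f.d_comm)
  qed
qed

section \<open>Cohomology and two out of three for quasi-isomorphisms\<close>

definition hinj :: "('o, 'm) cat \<Rightarrow> ('o, 'm, 'v::ab_group_add) cpx \<Rightarrow> ('o, 'm, 'w::ab_group_add) cpx
    \<Rightarrow> (int \<Rightarrow> 'o \<Rightarrow> 'v \<Rightarrow> 'w) \<Rightarrow> bool" where
  "hinj C X Y f \<longleftrightarrow> (\<forall>n. \<forall>x\<in>Ob C. \<forall>z\<in>cocycles X n x. f n x z \<in> coboundaries Y n x \<longrightarrow> z \<in> coboundaries X n x)"

text \<open>Together with \<open>hinj\<close> this expresses bijectivity on cohomology by cocycles
  and coboundaries, so that two out of three is argued on elements instead of on quotient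
  sets.\<close>

definition hsurj :: "('o, 'm) cat \<Rightarrow> ('o, 'm, 'v::ab_group_add) cpx \<Rightarrow> ('o, 'm, 'w::ab_group_add) cpx
    \<Rightarrow> (int \<Rightarrow> 'o \<Rightarrow> 'v \<Rightarrow> 'w) \<Rightarrow> bool" where
  "hsurj C X Y f \<longleftrightarrow> (\<forall>n. \<forall>x\<in>Ob C. \<forall>w\<in>cocycles Y n x. \<exists>z\<in>cocycles X n x. w - f n x z \<in> coboundaries Y n x)"

context cplx
begin

lemma cobI: "u \<in> sp (cx X (n - 1)) x \<Longrightarrow> a = df X (n - 1) x u \<Longrightarrow> a \<in> coboundaries X n x"
  by (simp add: coboundaries_def)

lemma cobE:
  assumes "a \<in> coboundaries X n x"
  obtains u where "u \<in> sp (cx X (n - 1)) x" "a = df X (n - 1) x u"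
  using assms by (auto simp: coboundaries_def)

lemma cob_add: "x \<in> Ob C \<Longrightarrow> a \<in> coboundaries X n x \<Longrightarrow> b \<in> coboundaries X n x \<Longrightarrow> a + b \<in> coboundaries X n x"
  
proof -
  assume x: "x \<in> Ob C" and "a \<in> coboundaries X n x" "b \<in> coboundaries X n x"
  then obtain u v where "u \<in> sp (cx X (n - 1)) x" "a = df X (n - 1) x u"
    "v \<in> sp (cx X (n - 1)) x" "b = df X (n - 1) x v" by (auto elim!: cobE)
  then show "a + b \<in> coboundaries X n x" using x by (intro cobI[of "u + v"]) auto
qed

lemma cob_neg: "x \<in> Ob C \<Longrightarrow> a \<in> coboundaries X n x \<Longrightarrow> - a \<in> coboundaries X n x"
  by (elim cobE, rule cobI[OF neg_in]) auto

lemma cob_zero: "x \<in> Ob C \<Longrightarrow> 0 \<in> coboundaries X n x"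
  by (rule cobI[OF zero_in]) auto

lemma cob_diff: "x \<in> Ob C \<Longrightarrow> a \<in> coboundaries X n x \<Longrightarrow> b \<in> coboundaries X n x \<Longrightarrow> a - b \<in> coboundaries X n x"
  using cob_add[of x a n "- b"] cob_neg by simp

lemma cob_cocycle: "x \<in> Ob C \<Longrightarrow> a \<in> coboundaries X n x \<Longrightarrow> a \<in> cocycles X n x"
  unfolding coboundaries_def cocycles_def by auto

lemma cls_eq: "x \<in> Ob C \<Longrightarrow> cohomology_class X n x a = cohomology_class X n x b \<longleftrightarrow> a - b \<in> coboundaries X n x"
proof
  assume x: "x \<in> Ob C"
  show "a - b \<in> coboundaries X n x" if "cohomology_class X n x a = cohomology_class X n x b"
  proof -
    have "a \<in> cohomology_class X n x a"
      using cob_zero[OF x] unfolding cohomology_class_def by (auto intro: exI[of _ 0])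
    then show ?thesis unfolding that by (auto simp: cohomology_class_def)
  qed
  assume ab: "a - b \<in> coboundaries X n x"
  have "\<exists>b'. a + c = b + b' \<and> b' \<in> coboundaries X n x" if "c \<in> coboundaries X n x" for c
    by (rule exI[of _ "a - b + c"]) (use cob_add[OF x ab that] in simp)
  moreover have "\<exists>b'. b + c = a + b' \<and> b' \<in> coboundaries X n x" if "c \<in> coboundaries X n x" for c
    by (rule exI[of _ "c - (a - b)"]) (use cob_diff[OF x that ab] in simp)
  ultimately show "cohomology_class X n x a = cohomology_class X n x b"
    by (auto simp: cohomology_class_def)
qed

lemma cls_mem: "x \<in> Ob C \<Longrightarrow> b \<in> cohomology_class X n x a \<longleftrightarrow> b - a \<in> coboundaries X n x"
  unfolding cohomology_class_def by (auto intro: exI[of _ "b - a"])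

end

context chmap
begin

lemma cocycle [simp]: "x \<in> Ob C \<Longrightarrow> z \<in> cocycles X n x \<Longrightarrow> f n x z \<in> cocycles Y n x"
  by (auto simp: cocycles_def d_comm[symmetric])

lemma coboundary [simp]: "x \<in> Ob C \<Longrightarrow> z \<in> coboundaries X n x \<Longrightarrow> f n x z \<in> coboundaries Y n x"
  by (auto simp: coboundaries_def d_comm')

lemma cocycle_diff: "x \<in> Ob C \<Longrightarrow> z \<in> cocycles X n x \<Longrightarrow> w \<in> cocycles X n x \<Longrightarrow>
    z - w \<in> cocycles X n x \<and> f n x (z - w) = f n x z - f n x w"
  by (auto simp: cocycles_def)

text \<open>The induced map on cohomology is written as a union over representatives. All
  representatives of a class contribute the same set, so the union is the class of the image of any
  one of them.\<close>

lemma quasi_iso_iff: "quasi_iso C s X t Y f \<longleftrightarrow> hinj C X Y f \<and> hsurj C X Y f"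
proof -
  have Union_const: "\<Union>\<F> = A" if "\<And>S. S \<in> \<F> \<Longrightarrow> S = A" "A \<in> \<F>" for \<F> and A :: "'w set"
    using that by blast
  have U: "(\<Union>z\<in>cohomology_class X n x a. cohomology_class Y n x (f n x z)) = cohomology_class Y n x (f n x a)"
    if x: "x \<in> Ob C" and a: "a \<in> cocycles X n x" for n x a
  proof (rule Union_const)
    fix S assume "S \<in> (\<lambda>z. cohomology_class Y n x (f n x z)) ` cohomology_class X n x a"
    then obtain z where z: "z - a \<in> coboundaries X n x" "S = cohomology_class Y n x (f n x z)"
      using X.cls_mem[OF x] by auto
    then have c: "z - a \<in> cocycles X n x" using X.cob_cocycle[OF x z(1)] by simp
    have "w + a \<in> cocycles X n x" if "w \<in> cocycles X n x" for w
      using that a x by (auto simp: cocycles_def)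
    from this[OF c] have "z \<in> cocycles X n x" by simp
    then have "f n x z - f n x a \<in> coboundaries Y n x" using coboundary[OF x z(1)] cocycle_diff[OF x _ a] by simp
    then show "S = cohomology_class Y n x (f n x a)" using z Y.cls_eq[OF x] by simp
  qed (use X.cls_mem[OF x] X.cob_zero[OF x] in auto)
  have I: "bij_betw (\<lambda>c. \<Union>z\<in>c. cohomology_class Y n x (f n x z)) (cohomology X n x) (cohomology Y n x) \<longleftrightarrow>
    (\<forall>z\<in>cocycles X n x. f n x z \<in> coboundaries Y n x \<longrightarrow> z \<in> coboundaries X n x) \<and>
    (\<forall>w\<in>cocycles Y n x. \<exists>z\<in>cocycles X n x. w - f n x z \<in> coboundaries Y n x)" (is "?b \<longleftrightarrow> ?i \<and> ?s")
    if x: "x \<in> Ob C" for n x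
  proof -
    let ?g = "\<lambda>c. \<Union>z\<in>c. cohomology_class Y n x (f n x z)"
    have z0: "0 \<in> cocycles X n x" using x by (auto simp: cocycles_def)
    have "inj_on ?g (cohomology X n x) \<longleftrightarrow> (\<forall>a\<in>cocycles X n x. \<forall>b\<in>cocycles X n x.
       f n x a - f n x b \<in> coboundaries Y n x \<longrightarrow> a - b \<in> coboundaries X n x)"
      unfolding inj_on_def cohomology_def by (simp add: U[OF x] Y.cls_eq[OF x] X.cls_eq[OF x])
    also have "\<dots> \<longleftrightarrow> ?i"
      using cocycle_diff[OF x] z0 by (metis diff_zero zero)
    finally have 1: "inj_on ?g (cohomology X n x) \<longleftrightarrow> ?i" .
    have im: "?g ` cohomology X n x = (\<lambda>a. cohomology_class Y n x (f n x a)) ` cocycles X n x"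
      unfolding cohomology_def image_image by (rule image_cong) (simp_all add: U[OF x])
    have "?g ` cohomology X n x = cohomology Y n x \<longleftrightarrow> cohomology Y n x \<subseteq> ?g ` cohomology X n x"
      using cocycle[OF x] unfolding im unfolding cohomology_def by auto
    also have "\<dots> \<longleftrightarrow> (\<forall>w\<in>cocycles Y n x. \<exists>z\<in>cocycles X n x. cohomology_class Y n x w = cohomology_class Y n x (f n x z))"
      unfolding im unfolding cohomology_def by auto
    finally show ?thesis unfolding bij_betw_def using 1 Y.cls_eq[OF x] by simp
  qed
  show ?thesis unfolding quasi_iso_def hinj_def hsurj_def using ch I by blast
qed

end

context
  fixes C :: "('o, 'm) cat" and s :: "'k::field \<Rightarrow> 'v::ab_group_add \<Rightarrow> 'v" and X
    and t :: "'k \<Rightarrow> 'w::ab_group_add \<Rightarrow> 'w" and Y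
    and r :: "'k \<Rightarrow> 'z::ab_group_add \<Rightarrow> 'z" and Z f g
  assumes f: "chmap C s X t Y f" and g: "chmap C t Y r Z g"
begin

interpretation f: chmap C s X t Y f by (rule f)
interpretation g: chmap C t Y r Z g by (rule g)

lemma hinj_comp: "hinj C X Y f \<Longrightarrow> hinj C Y Z g \<Longrightarrow> hinj C X Z (chain_comp g f)"
  using f.cocycle unfolding hinj_def chain_comp_apply by blast

lemma hinj_cancel: "hinj C X Z (chain_comp g f) \<Longrightarrow> hinj C X Y f"
  using g.coboundary unfolding hinj_def chain_comp_apply by blast

lemma hsurj_comp:
  assumes "hsurj C X Y f" "hsurj C Y Z g"
  shows "hsurj C X Z (chain_comp g f)"
  unfolding hsurj_def
proof (intro allI ballI)
  fix n x w assume x: "x \<in> Ob C" and w: "w \<in> cocycles Z n x"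
  obtain y where y: "y \<in> cocycles Y n x" "w - g n x y \<in> coboundaries Z n x"
    using assms(2) x w unfolding hsurj_def by blast
  obtain z where z: "z \<in> cocycles X n x" "y - f n x z \<in> coboundaries Y n x"
    using assms(1) x y unfolding hsurj_def by blast
  have "g n x (y - f n x z) = g n x y - g n x (f n x z)"
    using g.cocycle_diff[OF x y(1) f.cocycle[OF x z(1)]] by simp
  then have "(w - g n x y) + (g n x y - g n x (f n x z)) \<in> coboundaries Z n x"
    using g.Y.cob_add[OF x y(2) g.coboundary[OF x z(2)]] by simp
  then show "\<exists>z\<in>cocycles X n x. w - chain_comp g f n x z \<in> coboundaries Z n x"
    using z by auto
qed

lemma hsurj_cancel: "hsurj C X Z (chain_comp g f) \<Longrightarrow> hsurj C Y Z g"
proof -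
  assume a: "hsurj C X Z (chain_comp g f)"
  have "\<exists>y\<in>cocycles Y n x. w - g n x y \<in> coboundaries Z n x" if x: "x \<in> Ob C" and w: "w \<in> cocycles Z n x" for n x w
  proof -
    obtain z where "z \<in> cocycles X n x" "w - chain_comp g f n x z \<in> coboundaries Z n x"
      using a x w unfolding hsurj_def by blast
    then show ?thesis using f.cocycle[OF x] by (intro bexI[of _ "f n x z"]) simp_all
  qed
  then show "hsurj C Y Z g" unfolding hsurj_def by blast
qed

text \<open>Up to a coboundary every cocycle of \<open>Y\<close> comes from \<open>X\<close>, where
  injectivity of the composite can be applied.\<close>

lemma hinj_right:
  assumes "hsurj C X Y f" "hinj C X Z (chain_comp g f)"
  shows "hinj C Y Z g"
  unfolding hinj_def
proof (intro allI ballI impI)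
  fix n x y assume x: "x \<in> Ob C" and y: "y \<in> cocycles Y n x" "g n x y \<in> coboundaries Z n x"
  obtain z where z: "z \<in> cocycles X n x" "y - f n x z \<in> coboundaries Y n x"
    using assms(1) x y unfolding hsurj_def by blast
  have "g n x (y - f n x z) = g n x y - g n x (f n x z)"
    using g.cocycle_diff[OF x y(1) f.cocycle[OF x z(1)]] by simp
  then have "g n x y - (g n x y - g n x (f n x z)) \<in> coboundaries Z n x"
    using g.Y.cob_diff[OF x y(2) g.coboundary[OF x z(2)]] by simp
  then have "z \<in> coboundaries X n x" using assms(2) x z unfolding hinj_def by simp
  from f.Y.cob_add[OF x f.coboundary[OF x this] z(2)]
  show "y \<in> coboundaries Y n x" by simp
qed

lemma hsurj_left:
  assumes "hinj C Y Z g" "hsurj C X Z (chain_comp g f)"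
  shows "hsurj C X Y f"
  unfolding hsurj_def
proof (intro allI ballI)
  fix n x y assume x: "x \<in> Ob C" and y: "y \<in> cocycles Y n x"
  obtain z where z: "z \<in> cocycles X n x" "g n x y - g n x (f n x z) \<in> coboundaries Z n x"
    using assms(2) x g.cocycle[OF x y] unfolding hsurj_def chain_comp_apply by blast
  have d: "y - f n x z \<in> cocycles Y n x" "g n x (y - f n x z) = g n x y - g n x (f n x z)"
    using g.cocycle_diff[OF x y f.cocycle[OF x z(1)]] by auto
  then have "y - f n x z \<in> coboundaries Y n x"
    using assms(1) x z unfolding hinj_def by simp
  then show "\<exists>z\<in>cocycles X n x. y - f n x z \<in> coboundaries Y n x" using z by blast
qed

lemma chmap_comp: "chmap C s X r Z (chain_comp g f)"
  by unfold_locales (rule chain_maps_comp[OF f.ch g.ch])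

lemma quasi_iso_comp: "quasi_iso C s X t Y f \<Longrightarrow> quasi_iso C t Y r Z g \<Longrightarrow> quasi_iso C s X r Z (chain_comp g f)"
  by (simp add: f.quasi_iso_iff g.quasi_iso_iff chmap.quasi_iso_iff[OF chmap_comp] hinj_comp hsurj_comp)

lemma quasi_iso_cancel:
  "quasi_iso C t Y r Z g \<Longrightarrow> quasi_iso C s X r Z (chain_comp g f) \<Longrightarrow> quasi_iso C s X t Y f"
  unfolding f.quasi_iso_iff g.quasi_iso_iff chmap.quasi_iso_iff[OF chmap_comp]
  using hinj_cancel hsurj_left by blast

end

lemma homotopic_cob:
  fixes C :: "('o, 'm) cat" and s :: "'k::field \<Rightarrow> 'v::ab_group_add \<Rightarrow> 'v" and t :: "'k \<Rightarrow> 'w::ab_group_add \<Rightarrow> 'w"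
  assumes "cplx C s X" "cplx C t Y" "homotopic C s X t Y f g" "x \<in> Ob C" "z \<in> cocycles X n x"
  shows "f n x z - g n x z \<in> coboundaries Y n x"
proof -
  interpret X: cplx C s X by fact
  interpret Y: cplx C t Y by fact
  obtain h where h: "\<And>n. h n \<in> nattrans C s (cx X n) t (cx Y (n - 1))"
    and e: "\<And>n x u. x \<in> Ob C \<Longrightarrow> u \<in> sp (cx X n) x \<Longrightarrow>
      f n x u - g n x u = df Y (n - 1) x (h n x u) + h (n + 1) x (df X n x u)"
    using assms(3) unfolding homotopic_def by blast
  interpret h: nt C s "cx X i" t "cx Y (i - 1)" "h i" for i using h by unfold_locales
  have z: "z \<in> sp (cx X n) x" "df X n x z = 0" using assms(5) unfolding cocycles_def by simp_all
  have "f n x z - g n x z = df Y (n - 1) x (h n x z)" using e[OF assms(4) z(1)] z(2) by simp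
  then show ?thesis using z assms(4) by (intro Y.cobI[of "h n x z"]) auto
qed

lemma quasi_iso_homotopic:
  assumes f: "chmap C s X t Y f" and g: "chmap C s X t Y g"
    and fg: "homotopic C s X t Y f g" and q: "quasi_iso C s X t Y f"
  shows "quasi_iso C s X t Y g"
proof -
  interpret f: chmap C s X t Y f by (rule f)
  interpret g: chmap C s X t Y g by (rule g)
  note b = homotopic_cob[OF f.X.cplx_axioms f.Y.cplx_axioms fg]
  have "hinj C X Y g" unfolding hinj_def
  proof (intro allI ballI impI)
    fix n x z assume z: "x \<in> Ob C" "z \<in> cocycles X n x" "g n x z \<in> coboundaries Y n x"
    then have "(f n x z - g n x z) + g n x z \<in> coboundaries Y n x"
      using b f.Y.cob_add by blast
    then show "z \<in> coboundaries X n x" using q z unfolding f.quasi_iso_iff hinj_def diff_add_cancel by blast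
  qed
  moreover have "hsurj C X Y g" unfolding hsurj_def
  proof (intro allI ballI)
    fix n x w assume w: "x \<in> Ob C" "w \<in> cocycles Y n x"
    then obtain z where z: "z \<in> cocycles X n x" "w - f n x z \<in> coboundaries Y n x"
      using q unfolding f.quasi_iso_iff hsurj_def by blast
    have "(w - f n x z) + (f n x z - g n x z) \<in> coboundaries Y n x"
      using f.Y.cob_add[OF w(1) z(2) b[OF w(1) z(1)]] .
    then show "\<exists>z\<in>cocycles X n x. w - g n x z \<in> coboundaries Y n x" using z by auto
  qed
  ultimately show ?thesis by (simp add: g.quasi_iso_iff)
qed

lemma (in cplx) quasi_iso_id: "quasi_iso C s X s X (chain_id C X)"
proof -
  interpret i: chmap C s X s X "chain_id C X" by unfold_locales (rule chain_id_in)
  have c: "chain_id C X n x z = z" if "x \<in> Ob C" "z \<in> cocycles X n x" for n x z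
    using that by (auto simp: cocycles_def)
  show ?thesis unfolding i.quasi_iso_iff hinj_def hsurj_def
  proof (intro conjI allI ballI impI)
    fix n x z assume x: "x \<in> Ob C" and z: "z \<in> cocycles X n x"
    show "\<exists>w\<in>cocycles X n x. z - chain_id C X n x w \<in> coboundaries X n x"
      by (rule bexI[OF _ z]) (simp add: c[OF x z] cob_zero[OF x])
    show "z \<in> coboundaries X n x" if "chain_id C X n x z \<in> coboundaries X n x"
      using that by (simp add: c[OF x z])
  qed
qed

lemma quasi_iso_inverse:
  assumes f: "chmap C s X t Y f" and g: "chmap C t Y s X g"
    and gf: "chain_comp g f = chain_id C X" and fg: "chain_comp f g = chain_id C Y"
  shows "quasi_iso C s X t Y f"
proof -
  interpret f: chmap C s X t Y f by (rule f)
  interpret g: chmap C t Y s X g by (rule g)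
  have "hinj C X Y f" using hinj_cancel[OF f g] f.X.quasi_iso_id
      chmap.quasi_iso_iff[OF chmap_comp[OF f g]] by (simp add: gf)
  moreover have "hsurj C X Y f" using hsurj_cancel[OF g f] f.Y.quasi_iso_id
      chmap.quasi_iso_iff[OF chmap_comp[OF g f]] by (simp add: fg)
  ultimately show ?thesis by (simp add: f.quasi_iso_iff)
qed

section \<open>Transport along an embedding of ambient spaces\<close>

text \<open>\<open>tin\<close> and \<open>tout\<close> are the mutually inverse isomorphisms between
  a complex and its transported copy, as chain maps between different ambient spaces.\<close>

definition tin :: "('o, 'm) cat \<Rightarrow> ('v \<Rightarrow> 'w::zero) \<Rightarrow> ('o, 'm, 'v) cpx \<Rightarrow> int \<Rightarrow> 'o \<Rightarrow> 'v \<Rightarrow> 'w" where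
  "tin C e X n = restr_fam C (cx X n) (\<lambda>x. e)"

definition tout :: "('o, 'm) cat \<Rightarrow> ('v::zero \<Rightarrow> 'w::zero) \<Rightarrow> ('o, 'm, 'v) cpx \<Rightarrow> int \<Rightarrow> 'o \<Rightarrow> 'w \<Rightarrow> 'v" where
  "tout C e X n = restr_fam C (transport_mod e (cx X n)) (\<lambda>x. inv e)"

locale transp =
  fixes s :: "'k::field \<Rightarrow> 'v::ab_group_add \<Rightarrow> 'v" and t :: "'k \<Rightarrow> 'w::ab_group_add \<Rightarrow> 'w" and e :: "'v \<Rightarrow> 'w"
  assumes lin: "Vector_Spaces.linear s t e" and inj: "inj e"
begin

sublocale l: Vector_Spaces.linear s t e by (rule lin)

lemma inv_e [simp]: "inv e (e u) = u" using inj by simp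

lemma e_eq [simp]: "e u = e v \<longleftrightarrow> u = v" using inj by (auto simp: inj_def)

lemma vs_s: "vector_space s" and vs_t: "vector_space t" by unfold_locales

lemma transport_cmodule:
  assumes "cmodule C s F"
  shows "cmodule C t (transport_mod e F)"
proof -
  interpret F: cmodule C s F by fact
  note [simp] = l.add[symmetric] l.scale[symmetric]
  have "0 \<in> e ` sp F x" if "x \<in> Ob C" for x using that by (intro image_eqI[of _ _ 0]) auto
  then show ?thesis
    by (intro cmoduleI[OF F.cat vs_t]) (auto simp: transport_mod_def restr_def F.act_comp)
qed

lemma transport_sp: "u \<in> sp (transport_mod e F) x \<longleftrightarrow> (\<exists>v\<in>sp F x. u = e v)"
  by (auto simp: transport_mod_def)

lemma transport_e_sp [simp]: "e v \<in> sp (transport_mod e F) x \<longleftrightarrow> v \<in> sp F x"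
  by (auto simp: transport_mod_def)

lemma transport_act [simp]: "v \<in> sp F x \<Longrightarrow> act (transport_mod e F) x y h (e v) = e (act F x y h v)"
  by (auto simp: transport_mod_def restr_def)

context
  fixes C :: "('o, 'm) cat" and X assumes X: "cplx C s X"
begin

interpretation X: cplx C s X by (rule X)

lemma cx_transport [simp]: "cx (transport_cpx C e X) n = transport_mod e (cx X n)"
  by (simp add: transport_cpx_def)

lemma df_transport [simp]: "x \<in> Ob C \<Longrightarrow> u \<in> sp (cx X n) x \<Longrightarrow> df (transport_cpx C e X) n x (e u) = e (df X n x u)"
  by (simp add: transport_cpx_def transport_map_def)

lemma transport_cplx: "cplx C t (transport_cpx C e X)"
proof (rule cplxI[OF X.cat vs_t])
  fix n
  show c: "cmodule C t (cx (transport_cpx C e X) n)" for n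
    unfolding cx_transport by (rule transport_cmodule[OF X.cmod])
  have "transport_map C e X (df X) n \<in> nattrans C t (transport_mod e (cx X n)) t (transport_mod e (cx X (n + 1)))"
    unfolding transport_map_def
    by (rule nattrans_restrI[OF c[unfolded cx_transport] c[unfolded cx_transport]])
      (auto simp: transport_sp X.d.natural l.add[symmetric] l.scale[symmetric])
  then show "df (transport_cpx C e X) n \<in> nattrans C t (cx (transport_cpx C e X) n) t (cx (transport_cpx C e X) (n + 1))"
    by (simp add: transport_cpx_def)
  show "df (transport_cpx C e X) (n + 1) x (df (transport_cpx C e X) n x u) = 0"
    if "x \<in> Ob C" "u \<in> sp (cx (transport_cpx C e X) n) x" for x u
    using that by (auto simp: transport_sp)
qed

lemma tin_apply [simp]: "x \<in> Ob C \<Longrightarrow> u \<in> sp (cx X n) x \<Longrightarrow> tin C e X n x u = e u"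
  by (simp add: tin_def)

lemma tout_apply [simp]: "x \<in> Ob C \<Longrightarrow> u \<in> sp (cx X n) x \<Longrightarrow> tout C e X n x (e u) = u"
  by (simp add: tout_def)

lemma tin_chain: "tin C e X \<in> chain_maps C s X t (transport_cpx C e X)"
proof (rule chain_mapsI[OF X transport_cplx])
  show "tin C e X n \<in> nattrans C s (cx X n) t (cx (transport_cpx C e X) n)" for n
    unfolding tin_def cx_transport
    by (rule nattrans_restrI[OF X.cmod transport_cmodule[OF X.cmod]]) (auto simp: l.add l.scale)
qed simp

lemma tout_chain: "tout C e X \<in> chain_maps C t (transport_cpx C e X) s X"
proof (rule chain_mapsI[OF transport_cplx X])
  show "tout C e X n \<in> nattrans C t (cx (transport_cpx C e X) n) s (cx X n)" for n
    unfolding tout_def cx_transport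
    by (rule nattrans_restrI[OF transport_cmodule[OF X.cmod] X.cmod])
      (auto simp: transport_sp l.add[symmetric] l.scale[symmetric])
qed (auto simp: transport_sp)

lemma tin_chmap: "chmap C s X t (transport_cpx C e X) (tin C e X)"
  by (rule chmapI[OF X transport_cplx tin_chain])

lemma tout_chmap: "chmap C t (transport_cpx C e X) s X (tout C e X)"
  by (rule chmapI[OF transport_cplx X tout_chain])

lemma tout_tin: "chain_comp (tout C e X) (tin C e X) = chain_id C X"
  by (rule chain_maps_eqI[OF chain_maps_comp[OF tin_chain tout_chain] X.chain_id_in]) simp

lemma tin_tout: "chain_comp (tin C e X) (tout C e X) = chain_id C (transport_cpx C e X)"
  by (rule chain_maps_eqI[OF chain_maps_comp[OF tout_chain tin_chain] cplx.chain_id_in[OF transport_cplx]])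
    (auto simp: transport_sp)

lemma tout_qi: "quasi_iso C t (transport_cpx C e X) s X (tout C e X)"
  by (rule quasi_iso_inverse[OF tout_chmap tin_chmap tin_tout tout_tin])

end

text \<open>As a conjugate by \<open>tin\<close> and \<open>tout\<close>, a transported map can be
  handled by composition of chain maps, without reference to elements.\<close>

lemma transport_map_eq:
  assumes X: "cplx C s X" and Y: "cplx C s Y" and g: "g \<in> chain_maps C s X s Y"
  shows "transport_map C e X g = chain_comp (tin C e Y) (chain_comp g (tout C e X))"
proof (intro ext)
  interpret g: chmap C s X s Y g by (rule chmapI[OF X Y g])
  interpret o: chmap C t "transport_cpx C e X" s X "tout C e X" by (rule tout_chmap[OF X])
  interpret i: chmap C s Y t "transport_cpx C e Y" "tin C e Y" by (rule tin_chmap[OF Y])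
  fix n x u
  show "transport_map C e X g n x u = chain_comp (tin C e Y) (chain_comp g (tout C e X)) n x u"
  proof (cases "x \<in> Ob C \<and> u \<in> sp (transport_mod e (cx X n)) x")
    case True
    then show ?thesis by (auto simp: transport_map_def transport_sp tin_def tout_def)
  next
    case False
    then show ?thesis using o.out[of u n x] o.out_ob[of x n u]
      by (auto simp: transport_map_def cx_transport[OF X])
  qed
qed

end

section \<open>Homotopy pullbacks\<close>

definition scale3 :: "('k \<Rightarrow> 'a \<Rightarrow> 'a) \<Rightarrow> ('k \<Rightarrow> 'b \<Rightarrow> 'b) \<Rightarrow> ('k \<Rightarrow> 'c \<Rightarrow> 'c) \<Rightarrow> 'k \<Rightarrow> 'a \<times> 'b \<times> 'c \<Rightarrow> 'a \<times> 'b \<times> 'c" where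
  "scale3 sa sb sc c = (\<lambda>(a, b, d). (sa c a, sb c b, sc c d))"

lemma scale3_apply [simp]: "scale3 sa sb sc c (a, b, d) = (sa c a, sb c b, sc c d)"
  by (simp add: scale3_def)

lemma vector_space_scale3:
  assumes "vector_space sa" "vector_space sb" "vector_space sc"
  shows "vector_space (scale3 sa sb sc)"
proof -
  interpret a: vector_space sa by fact
  interpret b: vector_space sb by fact
  interpret c: vector_space sc by fact
  show ?thesis
    by unfold_locales (auto simp: a.scale_right_distrib b.scale_right_distrib c.scale_right_distrib
      a.scale_left_distrib b.scale_left_distrib c.scale_left_distrib)
qed

definition sum3 :: "('o, 'm, 'a) cmod \<Rightarrow> ('o, 'm, 'b) cmod \<Rightarrow> ('o, 'm, 'c) cmod \<Rightarrow> ('o, 'm, 'a::zero \<times> 'b::zero \<times> 'c::zero) cmod" where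
  "sum3 F G K = \<lparr>sp = (\<lambda>x. sp F x \<times> sp G x \<times> sp K x),
     act = (\<lambda>x y h. restr (sp F x \<times> sp G x \<times> sp K x) (\<lambda>(a, b, c). (act F x y h a, act G x y h b, act K x y h c)))\<rparr>"

lemma sp_sum3 [simp]: "sp (sum3 F G K) x = sp F x \<times> sp G x \<times> sp K x"
  by (simp add: sum3_def)

lemma act_sum3 [simp]: "a \<in> sp F x \<Longrightarrow> b \<in> sp G x \<Longrightarrow> c \<in> sp K x \<Longrightarrow>
   act (sum3 F G K) x y h (a, b, c) = (act F x y h a, act G x y h b, act K x y h c)"
  by (simp add: sum3_def restr_def)

lemma cmodule_sum3:
  assumes "cmodule C sa F" "cmodule C sb G" "cmodule C sc K"
  shows "cmodule C (scale3 sa sb sc) (sum3 F G K)"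
proof -
  interpret F: cmodule C sa F by fact
  interpret G: cmodule C sb G by fact
  interpret K: cmodule C sc K by fact
  show ?thesis
  proof (rule cmoduleI[OF F.cat vector_space_scale3[OF F.vs G.vs K.vs]])
    show "act (sum3 F G K) x y h u = 0" if "u \<notin> sp (sum3 F G K) x" for x y h u
      using that by (simp add: sum3_def restr_def)
  qed (auto simp: zero_prod_def F.act_comp G.act_comp K.act_comp)
qed

text \<open>The homotopy pullback of \<open>f\<close> and \<open>g\<close>: up to signs, the mapping
  cone of the map from the sum of \<open>Z\<close> and \<open>W\<close> to \<open>Y\<close> given by
  \<open>f\<close> and \<open>- g\<close>, shifted so that \<open>Z\<close> and \<open>W\<close>
  keep their degrees. The coordinate in \<open>Y\<close>, one degree lower, records a homotopy
  between the images of the other two.\<close>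

definition hpull :: "('o, 'm) cat \<Rightarrow> ('o, 'm, 'a::ab_group_add) cpx \<Rightarrow> ('o, 'm, 'b::ab_group_add) cpx \<Rightarrow> ('o, 'm, 'c::ab_group_add) cpx
    \<Rightarrow> (int \<Rightarrow> 'o \<Rightarrow> 'a \<Rightarrow> 'c) \<Rightarrow> (int \<Rightarrow> 'o \<Rightarrow> 'b \<Rightarrow> 'c) \<Rightarrow> ('o, 'm, 'a \<times> 'b \<times> 'c) cpx" where
  "hpull C Z W Y f g = \<lparr>cx = (\<lambda>n. sum3 (cx Z n) (cx W n) (cx Y (n - 1))),
     df = (\<lambda>n. restr_fam C (sum3 (cx Z n) (cx W n) (cx Y (n - 1)))
       (\<lambda>x (a, b, c). (df Z n x a, df W n x b, f n x a - g n x b - df Y (n - 1) x c)))\<rparr>"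

locale hpullback = f: chmap C sa Z sc Y f + g: chmap C sb W sc Y g
  for C :: "('o, 'm) cat" and sa :: "'k::field \<Rightarrow> 'a::ab_group_add \<Rightarrow> 'a" and Z
    and sb :: "'k::field \<Rightarrow> 'b::ab_group_add \<Rightarrow> 'b" and W
    and sc :: "'k::field \<Rightarrow> 'c::ab_group_add \<Rightarrow> 'c" and Y and f and g
begin

abbreviation "U \<equiv> hpull C Z W Y f g"
abbreviation "su \<equiv> scale3 sa sb sc"

lemma cxU [simp]: "cx U n = sum3 (cx Z n) (cx W n) (cx Y (n - 1))"
  by (simp add: hpull_def)

lemma dfU [simp]: "x \<in> Ob C \<Longrightarrow> a \<in> sp (cx Z n) x \<Longrightarrow> b \<in> sp (cx W n) x \<Longrightarrow> c \<in> sp (cx Y (n - 1)) x \<Longrightarrow>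
   df U n x (a, b, c) = (df Z n x a, df W n x b, f n x a - g n x b - df Y (n - 1) x c)"
  by (simp add: hpull_def)

lemma U_cmod: "cmodule C su (cx U n)"
  unfolding cxU by (rule cmodule_sum3[OF f.X.cmod g.X.cmod f.Y.cmod])

lemma add3: "(p + p') - (q + q') - (r + r') = (p - q - r) + (p' - q' - r')" for p :: 'c
  by simp

lemma U: "cplx C su U"
proof (rule cplxI[OF f.X.cat vector_space_scale3[OF f.X.vs g.X.vs f.Y.vs] U_cmod])
  show "df U n \<in> nattrans C su (cx U n) su (cx U (n + 1))" for n
  proof -
    have "restr_fam C (cx U n) (\<lambda>x (a, b, c). (df Z n x a, df W n x b, f n x a - g n x b - df Y (n - 1) x c))
      \<in> nattrans C su (cx U n) su (cx U (n + 1))"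
      by (rule nattrans_restrI[OF U_cmod U_cmod])
        (auto simp: f.X.d.natural g.X.d.natural f.natural g.natural f.Y.d_nat' add3
          f.Y.vsp.scale_right_diff_distrib)
    then show ?thesis by (simp add: hpull_def)
  qed
qed (auto simp: f.d_comm g.d_comm zero_prod_def)

definition "p1 n = restr_fam C (cx U n) (\<lambda>x (a, b, c). a)"
definition "p2 n = restr_fam C (cx U n) (\<lambda>x (a, b, c). b)"

lemma p1_apply [simp]: "x \<in> Ob C \<Longrightarrow> a \<in> sp (cx Z n) x \<Longrightarrow> b \<in> sp (cx W n) x \<Longrightarrow> c \<in> sp (cx Y (n - 1)) x \<Longrightarrow>
    p1 n x (a, b, c) = a"
  and p2_apply [simp]: "x \<in> Ob C \<Longrightarrow> a \<in> sp (cx Z n) x \<Longrightarrow> b \<in> sp (cx W n) x \<Longrightarrow> c \<in> sp (cx Y (n - 1)) x \<Longrightarrow>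
    p2 n x (a, b, c) = b"
  by (simp_all add: p1_def p2_def)

lemma p1: "p1 \<in> chain_maps C su U sa Z"
proof (rule chain_mapsI[OF U f.X.cplx_axioms])
  show "p1 n \<in> nattrans C su (cx U n) sa (cx Z n)" for n
    unfolding p1_def by (rule nattrans_restrI[OF U_cmod f.X.cmod]) auto
qed auto

lemma p2: "p2 \<in> chain_maps C su U sb W"
proof (rule chain_mapsI[OF U g.X.cplx_axioms])
  show "p2 n \<in> nattrans C su (cx U n) sb (cx W n)" for n
    unfolding p2_def by (rule nattrans_restrI[OF U_cmod g.X.cmod]) auto
qed auto

lemma p_homotopic: "homotopic C su U sc Y (chain_comp f p1) (chain_comp g p2)"
  unfolding homotopic_def
proof (intro exI conjI allI ballI)
  show "restr_fam C (cx U n) (\<lambda>x (a, b, c). c) \<in> nattrans C su (cx U n) sc (cx Y (n - 1))" for n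
    by (rule nattrans_restrI[OF U_cmod f.Y.cmod]) auto
  show "chain_comp f p1 n x u - chain_comp g p2 n x u =
     df Y (n - 1) x (restr_fam C (cx U n) (\<lambda>x (a, b, c). c) x u) +
     restr_fam C (cx U (n + 1)) (\<lambda>x (a, b, c). c) x (df U n x u)"
    if "x \<in> Ob C" "u \<in> sp (cx U n) x" for n x u using that by auto
qed

text \<open>The kernel of \<open>p1\<close> is, up to sign, the homotopy fibre of \<open>g\<close>,
  which is acyclic; the proof is the corresponding chase on elements.\<close>

lemma p1_qi:
  assumes "quasi_iso C sb W sc Y g"
  shows "quasi_iso C su U sa Z p1"
proof -
  have gq: "hinj C W Y g" "hsurj C W Y g" using assms g.quasi_iso_iff by auto
  have "hinj C U Z p1" unfolding hinj_def
  proof (intro allI ballI impI)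
    fix n x z assume x: "x \<in> Ob C" and "z \<in> cocycles U n x" "p1 n x z \<in> coboundaries Z n x"
    then obtain a b c where z: "z = (a, b, c)" "a \<in> sp (cx Z n) x" "b \<in> sp (cx W n) x" "c \<in> sp (cx Y (n - 1)) x"
      "df W n x b = 0" "f n x a - g n x b - df Y (n - 1) x c = 0" "a \<in> coboundaries Z n x"
      by (auto simp: cocycles_def zero_prod_def)
    then obtain a' where a': "a' \<in> sp (cx Z (n - 1)) x" "a = df Z (n - 1) x a'" by (auto elim: f.X.cobE)
    have "g n x b = f n x a - df Y (n - 1) x c" using z(6) by (simp add: algebra_simps)
    then have "g n x b = df Y (n - 1) x (f (n - 1) x a' - c)" using z(4) a' x by (simp add: f.d_comm')
    then have "g n x b \<in> coboundaries Y n x"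
      using a' z x by (intro f.Y.cobI[of "f (n - 1) x a' - c"]) auto
    then have "b \<in> coboundaries W n x" using gq(1) z x by (auto simp: hinj_def cocycles_def)
    then obtain b' where b': "b' \<in> sp (cx W (n - 1)) x" "b = df W (n - 1) x b'" by (auto elim: g.X.cobE)
    \<comment> \<open>\<open>?v\<close> is a cocycle whose class need not vanish. Adding a cocycle
      \<open>w\<close> to \<open>b'\<close> does not change its boundary, and surjectivity of
      \<open>g\<close> on cohomology provides the \<open>w\<close> that cancels the class of
      \<open>?v\<close>.\<close>
    let ?v = "f (n - 1) x a' - c - g (n - 1) x b'"
    have "?v \<in> cocycles Y (n - 1) x"
      using a' b' z x by (auto simp: cocycles_def f.d_comm' g.d_comm' algebra_simps)
    then obtain w where w: "w \<in> cocycles W (n - 1) x" "?v - g (n - 1) x w \<in> coboundaries Y (n - 1) x"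
      using gq(2) x unfolding hsurj_def by blast
    then obtain c' where c': "c' \<in> sp (cx Y (n - 1 - 1)) x" "?v - g (n - 1) x w = df Y (n - 1 - 1) x c'"
      by (auto elim: f.Y.cobE)
    have w': "w \<in> sp (cx W (n - 1)) x" "df W (n - 1) x w = 0" using w by (auto simp: cocycles_def)
    have "df U (n - 1) x (a', b' + w, c') = (df Z (n - 1) x a', df W (n - 1) x (b' + w),
         f (n - 1) x a' - g (n - 1) x (b' + w) - df Y (n - 1 - 1) x c')"
      by (rule dfU) (use a' b' w' c' x in auto)
    also have "\<dots> = z" using a' b' w' c'(2)[symmetric] x z(1) by simp
    finally show "z \<in> coboundaries U n x"
      using a' b' w' c' x by (intro cplx.cobI[OF U, of "(a', b' + w, c')"]) auto
  qed
  moreover have "hsurj C U Z p1" unfolding hsurj_def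
  proof (intro allI ballI)
    fix n x z assume x: "x \<in> Ob C" and z: "z \<in> cocycles Z n x"
    obtain w where w: "w \<in> cocycles W n x" "f n x z - g n x w \<in> coboundaries Y n x"
      using gq(2) x f.cocycle[OF x z] unfolding hsurj_def by blast
    then obtain y where y: "y \<in> sp (cx Y (n - 1)) x" "f n x z - g n x w = df Y (n - 1) x y" by (auto elim: f.Y.cobE)
    have "(z, w, y) \<in> cocycles U n x" using x z w y by (auto simp: cocycles_def zero_prod_def)
    moreover have "p1 n x (z, w, y) = z" using x z w y by (auto simp: cocycles_def)
    ultimately show "\<exists>z'\<in>cocycles U n x. z - p1 n x z' \<in> coboundaries Z n x"
      using f.X.cob_zero[OF x] by force
  qed
  ultimately show ?thesis by (simp add: chmap.quasi_iso_iff[OF chmapI[OF U f.X.cplx_axioms p1]])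
qed

text \<open>The universal property: a homotopy from \<open>chain_comp f a\<close> to
  \<open>chain_comp g b\<close> is precisely the third coordinate that a chain map into
  \<open>U\<close> needs.\<close>

lemma lift:
  assumes T: "cplx C st T" and a: "a \<in> chain_maps C st T sa Z" and b: "b \<in> chain_maps C st T sb W"
    and "homotopic C st T sc Y (chain_comp f a) (chain_comp g b)"
  shows "\<exists>c\<in>chain_maps C st T su U. chain_comp p1 c = a \<and> chain_comp p2 c = b"
proof -
  interpret T: cplx C st T by fact
  interpret a: chmap C st T sa Z a by (rule chmapI[OF T f.X.cplx_axioms a])
  interpret b: chmap C st T sb W b by (rule chmapI[OF T g.X.cplx_axioms b])
  obtain h where h: "\<And>n. h n \<in> nattrans C st (cx T n) sc (cx Y (n - 1))"
    and e: "\<And>n x u. x \<in> Ob C \<Longrightarrow> u \<in> sp (cx T n) x \<Longrightarrow>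
      f n x (a n x u) - g n x (b n x u) = df Y (n - 1) x (h n x u) + h (n + 1) x (df T n x u)"
    using assms(4) unfolding homotopic_def chain_comp_apply by blast
  interpret h: nt C st "cx T n" sc "cx Y (n - 1)" "h n" for n using h by unfold_locales
  define c where "c = (\<lambda>n x u. (a n x u, b n x u, h n x u))"
  have c: "c \<in> chain_maps C st T su U"
  proof (rule chain_mapsI[OF T U])
    show "c n \<in> nattrans C st (cx T n) su (cx U n)" for n
      by (rule nattransI[OF T.cmod U_cmod]) (auto simp: c_def a.natural b.natural h.natural zero_prod_def)
    show "c (n + 1) x (df T n x u) = df U n x (c n x u)" if "x \<in> Ob C" "u \<in> sp (cx T n) x" for n x u
      using that by (auto simp: c_def a.d_comm b.d_comm e[OF that])
  qed
  moreover have "chain_comp p1 c = a"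
    by (rule chain_maps_eqI[OF chain_maps_comp[OF c p1] a]) (auto simp: c_def)
  moreover have "chain_comp p2 c = b"
    by (rule chain_maps_eqI[OF chain_maps_comp[OF c p2] b]) (auto simp: c_def)
  ultimately show ?thesis by blast
qed

end

section \<open>Homotopy fibres and acyclic complexes\<close>

definition zero_cpx :: "('o, 'm, 'v::zero) cpx" where
  "zero_cpx = \<lparr>cx = (\<lambda>n. \<lparr>sp = (\<lambda>x. {0}), act = (\<lambda>x y h u. 0)\<rparr>), df = (\<lambda>n x u. 0)\<rparr>"

lemma cplx_zero:
  assumes "category C" "vector_space s"
  shows "cplx C s zero_cpx"
proof -
  interpret vector_space s by fact
  have c: "cmodule C s (cx zero_cpx n)" for n
    by (rule cmoduleI[OF assms]) (auto simp: zero_cpx_def)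
  show ?thesis
    by (rule cplxI[OF assms c]) (auto simp: zero_cpx_def intro!: nattransI[OF c[unfolded zero_cpx_def] c[unfolded zero_cpx_def], simplified])
qed

definition acyclic_cpx :: "('o, 'm) cat \<Rightarrow> ('o, 'm, 'v::ab_group_add) cpx \<Rightarrow> bool" where
  "acyclic_cpx C X \<longleftrightarrow> (\<forall>n. \<forall>x\<in>Ob C. cocycles X n x \<subseteq> coboundaries X n x)"

text \<open>Acyclicity mediates between the map to the zero complex, with which a homotopy fibre
  comes, and the map from it, against which an Ore square is formed in
  \<open>cancel_qi\<close>.\<close>

lemma acyclic_iff:
  fixes C :: "('o, 'm) cat" and s :: "'k::field \<Rightarrow> 'v::ab_group_add \<Rightarrow> 'v" and t :: "'k \<Rightarrow> 'w::ab_group_add \<Rightarrow> 'w"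
  assumes "cplx C s X" "cplx C t zero_cpx" "f \<in> chain_maps C s X t zero_cpx"
  shows "quasi_iso C s X t zero_cpx f \<Longrightarrow> acyclic_cpx C X"
    "acyclic_cpx C X \<Longrightarrow> quasi_iso C t zero_cpx s X 0"
proof -
  interpret X: cplx C s X by fact
  interpret O: cplx C t zero_cpx by fact
  interpret f: chmap C s X t zero_cpx f by (rule chmapI[OF assms])
  interpret z: chmap C t zero_cpx s X 0
    by (rule chmapI[OF assms(2,1) chain_maps_zero[OF assms(2,1)]])
  have o: "cocycles (zero_cpx :: ('o, 'm, 'w) cpx) n x = {0}" "coboundaries (zero_cpx :: ('o, 'm, 'w) cpx) n x = {0}" for n x
    by (auto simp: cocycles_def coboundaries_def zero_cpx_def)
  show "acyclic_cpx C X" if "quasi_iso C s X t zero_cpx f"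
    using that f.cocycle unfolding acyclic_cpx_def f.quasi_iso_iff hinj_def o by auto
  show "quasi_iso C t zero_cpx s X 0" if "acyclic_cpx C X"
    using that unfolding acyclic_cpx_def z.quasi_iso_iff hinj_def hsurj_def o by auto
qed

text \<open>The homotopy fibre of \<open>g\<close>, as the homotopy pullback along the zero complex:
  a chain map into it amounts to a chain map to \<open>W\<close> together with a null homotopy of
  its composite with \<open>g\<close>.\<close>

abbreviation hfib :: "('o, 'm) cat \<Rightarrow> ('o, 'm, 'b::ab_group_add) cpx \<Rightarrow> ('o, 'm, 'c::ab_group_add) cpx
    \<Rightarrow> (int \<Rightarrow> 'o \<Rightarrow> 'b \<Rightarrow> 'c) \<Rightarrow> ('o, 'm, 'b \<times> 'b \<times> 'c) cpx" where
  "hfib C W Y g \<equiv> hpull C zero_cpx W Y 0 g"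

text \<open>The projection of the fibre to the zero complex is the pullback of \<open>g\<close>,
  hence a quasi-isomorphism.\<close>

lemma hfib_acyclic:
  assumes g: "chmap C sb W sc Y g" and q: "quasi_iso C sb W sc Y g"
  shows "hpullback C sb zero_cpx sb W sc Y 0 g" "acyclic_cpx C (hfib C W Y g)"
proof -
  interpret g: chmap C sb W sc Y g by (rule g)
  have z: "cplx C sb zero_cpx" by (rule cplx_zero[OF g.X.cat g.X.vs])
  interpret h: hpullback C sb zero_cpx sb W sc Y 0 g
    by (intro hpullback.intro g chmapI z g.Y.cplx_axioms chain_maps_zero)
  show "hpullback C sb zero_cpx sb W sc Y 0 g" by unfold_locales
  show "acyclic_cpx C (hfib C W Y g)" by (rule acyclic_iff(1)[OF h.U z h.p1 h.p1_qi[OF q]])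
qed

text \<open>Degree \<open>n\<close> of a complex sits in degree \<open>n + 1\<close> of the homotopy
  fibre of a map to it. The shift undoes this, and the sign makes the inclusion of the complex into
  the shifted fibre a chain map, as \<open>lift_exists\<close> requires.\<close>

definition shift_cpx :: "('o, 'm, 'v::ab_group_add) cpx \<Rightarrow> ('o, 'm, 'v) cpx" where
  "shift_cpx X = \<lparr>cx = (\<lambda>n. cx X (n + 1)), df = (\<lambda>n. - df X (n + 1))\<rparr>"

lemma (in cplx) shift_cplx: "cplx C s (shift_cpx X)"
proof (rule cplxI[OF cat vs])
  have "- df X (n + 1) \<in> nattrans C s (cx X (n + 1)) s (cx X (n + 1 + 1))" for n
    by (rule nattrans_neg[OF cmod cmod d.nt])
  then show "df (shift_cpx X) n \<in> nattrans C s (cx (shift_cpx X) n) s (cx (shift_cpx X) (n + 1))" for n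
    by (simp only: shift_cpx_def cpx.select_convs)
  show "df (shift_cpx X) (n + 1) x (df (shift_cpx X) n x u) = 0"
    if "x \<in> Ob C" "u \<in> sp (cx (shift_cpx X) n) x" for n x u
    using that d.in_sp[of x u "n + 1"] dd[of "n + 1" x u] d.neg[of x "df X (n + 1) x u" "n + 1 + 1"]
    by (simp only: shift_cpx_def cpx.select_convs uminus_apply) simp
qed (simp add: shift_cpx_def cmod)

lemma (in cplx) shift_acyclic:
  assumes "acyclic_cpx C X"
  shows "acyclic_cpx C (shift_cpx X)"
  unfolding acyclic_cpx_def
proof (intro allI ballI subsetI)
  interpret S: cplx C s "shift_cpx X" by (rule shift_cplx)
  fix n x z assume x: "x \<in> Ob C" and "z \<in> cocycles (shift_cpx X) n x"
  then have "z \<in> cocycles X (n + 1) x" by (auto simp: cocycles_def shift_cpx_def)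
  then have "z \<in> coboundaries X (n + 1) x" using assms x by (auto simp: acyclic_cpx_def)
  then obtain u where u: "u \<in> sp (cx X n) x" "z = df X n x u" by (auto simp: coboundaries_def)
  then show "z \<in> coboundaries (shift_cpx X) n x"
    using x by (intro S.cobI[of "- u"]) (auto simp: shift_cpx_def)
qed

section \<open>The derived category as a category of fractions\<close>

lemma vector_space_pw: "vector_space s \<Longrightarrow> vector_space (pw s)"
proof -
  assume "vector_space s"
  then interpret vector_space s .
  show ?thesis
    by unfold_locales (auto simp: pw_def fun_eq_iff scale_right_distrib scale_left_distrib)
qed

lemma vector_space_mult: "vector_space ((*) :: 'k::field \<Rightarrow> 'k \<Rightarrow> 'k)"
  by unfold_locales (auto simp: algebra_simps)

text \<open>The images under \<open>e\<close> of the delta functions are independent and as numerous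
  as \<open>'i\<close>; a finite basis would bound their number.\<close>

lemma (in vector_space) infinite_basis_of_functions:
  fixes e :: "('i \<Rightarrow> 'a) \<Rightarrow> 'b"
  assumes "infinite (UNIV :: 'i set)" "Vector_Spaces.linear (pw (*)) scale e" "inj e"
    and B: "independent B" "span B = UNIV"
  shows "infinite B"
proof
  assume "finite B"
  interpret p: vector_space "pw (*) :: 'a \<Rightarrow> ('i \<Rightarrow> 'a) \<Rightarrow> _" by (rule vector_space_pw[OF vector_space_mult])
  interpret e: Vector_Spaces.linear "pw (*)" scale e by fact
  define \<delta> :: "'i \<Rightarrow> 'i \<Rightarrow> 'a" where "\<delta> = (\<lambda>i j. if j = i then 1 else 0)"
  have inj: "inj \<delta>" by (rule injI) (metis \<delta>_def one_neq_zero)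
  have "p.independent (range \<delta>)"
    unfolding p.independent_explicit_finite_subsets
  proof (intro allI impI ballI)
    fix S u v assume S: "S \<subseteq> range \<delta>" "finite S" and z: "(\<Sum>v\<in>S. pw (*) (u v) v) = 0" and v: "v \<in> S"
    then obtain i where i: "v = \<delta> i" by blast
    have "(\<Sum>w\<in>S. pw (*) (u w) w) i = (\<Sum>w\<in>S. u w * w i)"
      by (induction S rule: infinite_finite_induct) (auto simp: pw_def)
    also have "\<dots> = (\<Sum>w\<in>S. if w = v then u v else 0)"
    proof (rule sum.cong[OF refl])
      fix w assume "w \<in> S"
      then obtain j where j: "w = \<delta> j" using S by blast
      have "\<delta> j = \<delta> i \<longleftrightarrow> j = i" using inj by (auto dest: injD)
      moreover have "\<delta> j i = (if j = i then 1 else 0)" by (simp add: \<delta>_def)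
      ultimately show "u w * w i = (if w = v then u v else 0)" unfolding i j by simp
    qed
    also have "\<dots> = u v" using S v by simp
    finally show "u v = 0" using z by simp
  qed
  then have "independent (e ` range \<delta>)"
    by (rule e.independent_injective_image) (use assms(3) in \<open>auto intro: inj_on_subset\<close>)
  then have "finite (e ` range \<delta>)"
    using independent_span_bound[OF \<open>finite B\<close>] B by auto
  moreover have "inj (e \<circ> \<delta>)" using inj assms(3) by (rule inj_compose[rotated])
  ultimately show False using assms(1) finite_imageD[of "e \<circ> \<delta>" UNIV] by (simp add: image_comp)
qed

text \<open>An infinite basis \<open>B\<close> is in bijection with \<open>B \<times> B\<close>.
  Sending \<open>B\<close> to its slices at two distinct elements \<open>b0\<close> and
  \<open>b1\<close> embeds two independent copies of the space in itself, and \<open>p\<close>,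
  \<open>q\<close> read off the two components.\<close>

lemma (in vector_space) ex_linear_injection_prod:
  assumes B: "independent B" "span B = UNIV" "infinite B"
  shows "\<exists>f g p q. Vector_Spaces.linear scale scale f \<and> Vector_Spaces.linear scale scale g \<and>
    (\<forall>a b. p (f a + g b) = a) \<and> (\<forall>a b. q (f a + g b) = b)"
proof -
  interpret vs: vector_space_pair scale scale ..
  obtain \<gamma> where \<gamma>: "bij_betw \<gamma> (B \<times> B) B"
    using card_of_Times_same_infinite[OF B(3)] card_of_ordIso by blast
  obtain b0 b1 where b: "b0 \<in> B" "b1 \<in> B" "b0 \<noteq> b1"
    using B(3) by (metis finite.emptyI finite.insertI finite_subset insertCI subsetI)
  have \<gamma>_eq: "\<gamma> (x, y) = \<gamma> (x', y') \<longleftrightarrow> x = x' \<and> y = y'" if "x \<in> B" "y \<in> B" "x' \<in> B" "y' \<in> B" for x y x' y'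
    using \<gamma> that unfolding bij_betw_def by (auto dest: inj_onD)
  have \<gamma>_in: "\<gamma> (x, y) \<in> B" if "x \<in> B" "y \<in> B" for x y using \<gamma> that unfolding bij_betw_def by auto
  define inj_at where "inj_at = (\<lambda>c. vs.construct B (\<lambda>x. \<gamma> (x, c)))"
  \<comment> \<open>A basis vector outside the slice \<open>c\<close> goes to \<open>0\<close>, so
    the projection onto one copy does not see the other.\<close>
  define prj_at where "prj_at = (\<lambda>c. vs.construct B (\<lambda>z. if \<exists>x\<in>B. z = \<gamma> (x, c) then THE x. x \<in> B \<and> z = \<gamma> (x, c) else 0))"
  have lin: "Vector_Spaces.linear scale scale (inj_at c)" "Vector_Spaces.linear scale scale (prj_at c)" for c
    unfolding inj_at_def prj_at_def by (rule vs.linear_construct[OF B(1)])+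
  have ij: "inj_at c x = \<gamma> (x, c)" if "x \<in> B" for c x
    unfolding inj_at_def by (rule vs.construct_basis[OF B(1) that])
  have "prj_at c (inj_at c x) = x" if "x \<in> B" "c \<in> B" for x c
  proof -
    have "(THE x'. x' \<in> B \<and> \<gamma> (x, c) = \<gamma> (x', c)) = x" using that \<gamma>_eq by (intro the_equality) auto
    then show ?thesis unfolding ij[OF that(1)] prj_at_def vs.construct_basis[OF B(1) \<gamma>_in[OF that]] using that by auto
  qed
  moreover have "prj_at c (inj_at d x) = 0" if "x \<in> B" "c \<in> B" "d \<in> B" "c \<noteq> d" for x c d
    unfolding ij[OF that(1)] prj_at_def vs.construct_basis[OF B(1) \<gamma>_in[OF that(1,3)]] using that \<gamma>_eq by auto
  ultimately have 1: "prj_at c (inj_at c a) = a" "d \<in> B \<Longrightarrow> c \<noteq> d \<Longrightarrow> prj_at c (inj_at d a) = 0" if "c \<in> B" for c d a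
  proof -
    have l: "Vector_Spaces.linear scale scale (\<lambda>a. prj_at c (inj_at d a))" for d
      using Vector_Spaces.linear_compose[OF lin] by (simp add: o_def)
    have i: "Vector_Spaces.linear scale scale (\<lambda>a. a)" by (rule linear_ident)
    have o: "Vector_Spaces.linear scale scale (\<lambda>a. 0)" by (rule vs.module_hom_zero)
    show "prj_at c (inj_at c a) = a"
      by (rule vs.linear_eq_on[OF l i, of a B]) (use \<open>\<And>x c. x \<in> B \<Longrightarrow> c \<in> B \<Longrightarrow> prj_at c (inj_at c x) = x\<close> that B(2) in auto)
    show "prj_at c (inj_at d a) = 0" if "d \<in> B" "c \<noteq> d"
      by (rule vs.linear_eq_on[OF l o, of a B])
        (use \<open>\<And>x c d. x \<in> B \<Longrightarrow> c \<in> B \<Longrightarrow> d \<in> B \<Longrightarrow> c \<noteq> d \<Longrightarrow> prj_at c (inj_at d x) = 0\<close> that \<open>c \<in> B\<close> B(2) in auto)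
  qed
  have add: "prj_at c (x + y) = prj_at c x + prj_at c y" for c x y by (rule vs.linear_add[OF lin(2)])
  show ?thesis
    by (intro exI[of _ "inj_at b0"] exI[of _ "inj_at b1"] exI[of _ "prj_at b0"] exI[of _ "prj_at b1"] conjI lin)
      (use b in \<open>auto simp: add 1\<close>)
qed

lemma (in vector_space) ex_transp_scale3:
  fixes e :: "('i \<Rightarrow> 'a) \<Rightarrow> 'b"
  assumes "infinite (UNIV :: 'i set)" "Vector_Spaces.linear (pw (*)) scale e" "inj e"
  shows "\<exists>E. transp (scale3 scale scale scale) scale E"
proof -
  obtain B where B: "independent B" "span B = UNIV"
    using maximal_independent_subset[of UNIV] by (metis UNIV_I subset_UNIV top.extremum_uniqueI)
  obtain f g p q where l: "Vector_Spaces.linear scale scale f" "Vector_Spaces.linear scale scale g"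
    and pq: "\<And>a b. p (f a + g b) = a" "\<And>a b. q (f a + g b) = b"
    using ex_linear_injection_prod[OF B infinite_basis_of_functions[OF assms B]] by blast
  interpret f: Vector_Spaces.linear scale scale f by fact
  interpret g: Vector_Spaces.linear scale scale g by fact
  \<comment> \<open>A triple is stored by nesting the embedding of pairs.\<close>
  let ?E = "\<lambda>(a, b, c). f a + g (f b + g c)"
  have v3: "vector_space (scale3 scale scale scale)" by (intro vector_space_scale3) unfold_locales
  have "Vector_Spaces.linear (scale3 scale scale scale) scale ?E"
    unfolding Vector_Spaces.linear_iff using v3 vector_space_axioms
    by (auto simp: f.add g.add f.scale g.scale scale_right_distrib algebra_simps)
  moreover have "inj ?E"
  proof (rule injI)
    fix u v assume e: "?E u = ?E v"
    obtain a b c a' b' c' where uv: "u = (a, b, c)" "v = (a', b', c')" by (metis prod_cases3)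
    have *: "f a + g (f b + g c) = f a' + g (f b' + g c')" using e uv by simp
    have 1: "a = a'" "f b + g c = f b' + g c'" using arg_cong[OF *, of p] arg_cong[OF *, of q] by (simp_all add: pq)
    have "b = b'" "c = c'" using 1(2) pq by metis+
    then show "u = v" using 1(1) uv by simp
  qed
  ultimately show ?thesis unfolding transp_def by blast
qed

section \<open>The Ore conditions for complexes\<close>

locale derived_setting = E: transp "scale3 s s s" s E
  for C :: "('o, 'm) cat" and s :: "'k::field \<Rightarrow> 'v::ab_group_add \<Rightarrow> 'v" and E +
  assumes cat: "category C"
begin

lemma vs: "vector_space s" by (rule E.vs_t)

lemma cplx_iff: "cplx C s X \<longleftrightarrow> is_complex C s X"
  using cat vs by (auto simp: cplx_def)

text \<open>The homotopy pullback is the required square, but its elements are triples;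
  \<open>E\<close> carries it back into the ambient space of the given complexes.\<close>

lemma ore:
  assumes f: "chmap C s Z s Y f" and g: "chmap C s W s Y g" and q: "quasi_iso C s W s Y g"
  shows "\<exists>U u h. cplx C s U \<and> u \<in> chain_maps C s U s Z \<and> quasi_iso C s U s Z u \<and> h \<in> chain_maps C s U s W \<and>
    homotopic C s U s Y (chain_comp f u) (chain_comp g h)"
proof -
  interpret h: hpullback C s Z s W s Y f g by (rule hpullback.intro[OF f g])
  note U = h.U
  let ?T = "transport_cpx C E h.U" and ?o = "tout C E h.U"
  note T = E.transport_cplx[OF U] and o = E.tout_chain[OF U] and oc = E.tout_chmap[OF U]
  have p: "chmap C (scale3 s s s) h.U s Z h.p1" by (rule chmapI[OF U h.f.X.cplx_axioms h.p1])
  have "quasi_iso C s ?T s Z (chain_comp h.p1 ?o)"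
    by (rule quasi_iso_comp[OF oc p E.tout_qi[OF U] h.p1_qi[OF q]])
  moreover have "homotopic C s ?T s Y (chain_comp f (chain_comp h.p1 ?o)) (chain_comp g (chain_comp h.p2 ?o))"
    using homotopic_pre[OF T U h.f.Y.cplx_axioms h.p_homotopic o] by (simp add: chain_comp_assoc)
  ultimately show ?thesis
    using T chain_maps_comp[OF o h.p1] chain_maps_comp[OF o h.p2] by blast
qed

text \<open>A null homotopy of the composite of \<open>g\<close> with \<open>f - f'\<close> lifts
  \<open>f - f'\<close> to the homotopy fibre of \<open>g\<close>. The fibre is acyclic, so
  \<open>0\<close> is a quasi-isomorphism to it from the zero complex, and the Ore square of the
  lift against this map yields a quasi-isomorphism \<open>u\<close> after which the lift is null
  homotopic.\<close>

lemma cancel_qi: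
  assumes f: "chmap C s Z s W f" and f': "chmap C s Z s W f'" and g: "chmap C s W s Y g"
    and q: "quasi_iso C s W s Y g" and e: "homotopic C s Z s Y (chain_comp g f) (chain_comp g f')"
  shows "\<exists>U u. cplx C s U \<and> u \<in> chain_maps C s U s Z \<and> quasi_iso C s U s Z u \<and>
    homotopic C s U s W (chain_comp f u) (chain_comp f' u)"
proof -
  interpret f: chmap C s Z s W f by (rule f)
  interpret f': chmap C s Z s W f' by (rule f')
  interpret g: chmap C s W s Y g by (rule g)
  interpret h: hpullback C s zero_cpx s W s Y 0 g by (rule hfib_acyclic[OF g q])
  note Z = f.X.cplx_axioms and W = f.Y.cplx_axioms and Y = g.Y.cplx_axioms and O = h.f.X.cplx_axioms
  have d: "f - f' \<in> chain_maps C s Z s W" by (rule chain_maps_diff[OF Z W f.ch f'.ch])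
  have z: "0 \<in> chain_maps C s Z s zero_cpx" by (rule chain_maps_zero[OF Z O])
  have gd: "chain_comp g (f - f') = chain_comp g f - chain_comp g f'"
    by (rule chain_maps_eqI[OF chain_maps_comp[OF d g.ch] chain_maps_diff[OF Z Y]])
      (auto intro: chain_maps_comp f.ch f'.ch g.ch)
  have "homotopic C s Z s Y (chain_comp g (f - f')) 0"
    unfolding gd using e homotopic_diff_iff[OF Z Y] by blast
  then have "homotopic C s Z s Y (chain_comp 0 0) (chain_comp g (f - f'))"
    by (simp add: chain_comp_def homotopic_sym[OF Z Y] zero_fun_def comp_def)
  then obtain c where c: "c \<in> chain_maps C s Z (scale3 s s s) h.U" "chain_comp h.p2 c = f - f'"
    using h.lift[OF Z z d] by blast
  let ?T = "transport_cpx C E h.U"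
  note U = h.U
  note T = E.transport_cplx[OF U]
  have p1: "chmap C (scale3 s s s) h.U s zero_cpx h.p1" by (rule chmapI[OF U O h.p1])
  have "quasi_iso C s ?T s zero_cpx (chain_comp h.p1 (tout C E h.U))"
    by (rule quasi_iso_comp[OF E.tout_chmap[OF U] p1 E.tout_qi[OF U] h.p1_qi[OF q]])
  then have qz: "quasi_iso C s zero_cpx s ?T 0"
    using acyclic_iff[OF T O chain_maps_comp[OF E.tout_chain[OF U] h.p1]] by blast
  define c' where "c' = chain_comp (tin C E h.U) c"
  have c': "c' \<in> chain_maps C s Z s ?T" unfolding c'_def by (rule chain_maps_comp[OF c(1) E.tin_chain[OF U]])
  have "chain_comp (tout C E h.U) c' = chain_comp (chain_comp (tout C E h.U) (tin C E h.U)) c"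
    unfolding c'_def by (rule chain_comp_assoc[symmetric])
  then have "chain_comp (tout C E h.U) c' = c"
    by (simp only: E.tout_tin[OF U] chmap.id_left[OF chmapI[OF Z U c(1)]])
  then have fc: "f - f' = chain_comp (chain_comp h.p2 (tout C E h.U)) c'"
    by (simp only: chain_comp_assoc c(2))
  obtain V u k where V: "cplx C s V" "u \<in> chain_maps C s V s Z" "quasi_iso C s V s Z u"
    "k \<in> chain_maps C s V s zero_cpx" "homotopic C s V s ?T (chain_comp c' u) (chain_comp 0 k)"
    using ore[OF chmapI[OF Z T c'] chmapI[OF O T chain_maps_zero[OF O T]] qz] by blast
  have 0: "chain_comp 0 k = 0" "\<And>r. chain_comp r 0 = (\<lambda>n x u. r n x 0)"
    by (auto simp: chain_comp_def fun_eq_iff)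
  let ?p = "chain_comp h.p2 (tout C E h.U)"
  interpret p: chmap C s ?T s W ?p by (rule chmapI[OF T W chain_maps_comp[OF E.tout_chain[OF U] h.p2]])
  have "homotopic C s V s W (chain_comp ?p (chain_comp c' u)) (chain_comp ?p (chain_comp 0 k))"
    by (rule homotopic_post[OF V(1) T W V(5) p.ch chain_maps_comp[OF V(2) c']])
      (simp add: 0 chain_maps_zero[OF V(1) T])
  moreover have "chain_comp ?p (chain_comp 0 k) = 0" using p.zero by (auto simp: 0 fun_eq_iff)
  moreover have "chain_comp ?p (chain_comp c' u) = chain_comp f u - chain_comp f' u"
    unfolding chain_comp_assoc[of ?p c' u, symmetric] fc[symmetric]
    by (auto simp: fun_eq_iff)
  ultimately have "homotopic C s V s W (chain_comp f u) (chain_comp f' u)"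
    using homotopic_diff_iff[OF V(1) W] by simp
  then show ?thesis using V by blast
qed

sublocale fractions "{X. is_complex C s X}" "\<lambda>X Y. chain_maps C s X s Y" chain_comp "chain_id C"
  "\<lambda>X Y. homotopic C s X s Y" "\<lambda>X Y. quasi_iso C s X s Y" "\<lambda>c f n x u. s c (f n x u)"
proof -
  interpret D: fraction_data "{X. is_complex C s X}" "\<lambda>X Y. chain_maps C s X s Y" chain_comp "chain_id C"
    "\<lambda>X Y. homotopic C s X s Y" "\<lambda>X Y. quasi_iso C s X s Y" "\<lambda>c f n x u. s c (f n x u)" .
  have Ar: "D.Ar X Y f \<longleftrightarrow> chmap C s X s Y f" for X Y f
    by (auto simp: D.Ar_def chmap_def chmap_axioms_def cplx_iff)
  have H: "D.H X Y f g \<longleftrightarrow> chmap C s X s Y f \<and> chmap C s X s Y g \<and> homotopic C s X s Y f g" for X Y f g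
    by (simp add: D.H_def Ar)
  have Q: "D.Q X Y f \<longleftrightarrow> chmap C s X s Y f \<and> quasi_iso C s X s Y f" for X Y f
    by (simp add: D.Q_def Ar)
  note cI = chmapI[OF chmap.axioms(1,2)]
  show "fractions {X. is_complex C s X} (\<lambda>X Y. chain_maps C s X s Y) chain_comp (chain_id C)
    (\<lambda>X Y. homotopic C s X s Y) (\<lambda>X Y. quasi_iso C s X s Y) (\<lambda>c f n x u. s c (f n x u))"
    unfolding fractions_def Ar H Q
  proof (intro conjI allI impI; (elim conjE)?)
    fix X Y f assume "quasi_iso C s X s Y f"
    then show "f \<in> chain_maps C s X s Y" by (simp add: quasi_iso_def)
  next
    fix X Y Z f g assume "chmap C s X s Y f" "chmap C s Y s Z g"
    then show "chmap C s X s Z (chain_comp g f)" by (rule chmap_comp)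
  next
    fix X assume "X \<in> {X. is_complex C s X}"
    then interpret X: cplx C s X by (simp add: cplx_iff)
    show "chmap C s X s X (chain_id C X)" by unfold_locales (rule X.chain_id_in)
    then show "chmap C s X s X (chain_id C X)" .
    show "quasi_iso C s X s X (chain_id C X)" by (rule X.quasi_iso_id)
  next
    fix X Y assume "X \<in> {X. is_complex C s X}" "Y \<in> {X. is_complex C s X}"
    then have c: "cplx C s X" "cplx C s Y" by (simp_all add: cplx_iff)
    show "chmap C s X s Y 0" by (rule chmapI[OF c chain_maps_zero[OF c]])
  next
    fix X Y f g assume f: "chmap C s X s Y f" and g: "chmap C s X s Y g"
    note c = chmap.axioms(1,2)[OF f]
    show "chmap C s X s Y (f + g)" by (rule chmapI[OF c chain_maps_add[OF c chmap.ch[OF f] chmap.ch[OF g]]])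
  next
    fix X Y f c assume f: "chmap C s X s Y f"
    note c = chmap.axioms(1,2)[OF f]
    show "chmap C s X s Y (\<lambda>n x u. s c (f n x u))" by (rule chmapI[OF c chain_maps_scale[OF c chmap.ch[OF f]]])
  next
    fix h g f :: "int \<Rightarrow> 'o \<Rightarrow> 'v \<Rightarrow> 'v"
    show "chain_comp (chain_comp h g) f = chain_comp h (chain_comp g f)" by (rule chain_comp_assoc)
  next
    fix X Y f assume f: "chmap C s X s Y f"
    show "chain_comp (chain_id C Y) f = f" by (rule chmap.id_left[OF f])
    show "chain_comp f (chain_id C X) = f" by (rule chmap.id_right[OF f])
    show "homotopic C s X s Y f f" by (rule homotopic_refl[OF chmap.axioms(1,2)[OF f]])
  next
    fix X Y Z f f' g assume "chmap C s X s Y f" "chmap C s X s Y f'" "chmap C s Y s Z g"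
    then interpret f: chmap C s X s Y f + f': chmap C s X s Y f' + g: chmap C s Y s Z g .
    note c = f.X.cplx_axioms f.Y.cplx_axioms g.Y.cplx_axioms
    show "chain_comp g (f + f') = chain_comp g f + chain_comp g f'"
      by (rule chain_maps_eqI[OF chain_maps_comp[OF chain_maps_add[OF c(1,2) f.ch f'.ch] g.ch]
        chain_maps_add[OF c(1,3) chain_maps_comp[OF f.ch g.ch] chain_maps_comp[OF f'.ch g.ch]]]) simp
  next
    fix g g' f :: "int \<Rightarrow> 'o \<Rightarrow> 'v \<Rightarrow> 'v"
    show "chain_comp (g + g') f = chain_comp g f + chain_comp g' f" by (simp add: fun_eq_iff)
  next
    fix X Y Z f g c assume "chmap C s X s Y f" "chmap C s Y s Z g"
    then interpret f: chmap C s X s Y f + g: chmap C s Y s Z g .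
    note c = f.X.cplx_axioms f.Y.cplx_axioms g.Y.cplx_axioms
    show "chain_comp g (\<lambda>n x u. s c (f n x u)) = (\<lambda>n x u. s c (chain_comp g f n x u))"
      by (rule chain_maps_eqI[OF chain_maps_comp[OF chain_maps_scale[OF c(1,2) f.ch] g.ch]
        chain_maps_scale[OF c(1,3) chain_maps_comp[OF f.ch g.ch]]]) simp
  next
    fix c :: 'k and g f :: "int \<Rightarrow> 'o \<Rightarrow> 'v \<Rightarrow> 'v"
    show "chain_comp (\<lambda>n x u. s c (g n x u)) f = (\<lambda>n x u. s c (chain_comp g f n x u))" by (simp add: fun_eq_iff)
  next
    show "vector_space (\<lambda>c f n x u. s c (f n x u))"
      using vs unfolding vector_space_def by (simp add: fun_eq_iff)
  next
    fix X Y f g assume "chmap C s X s Y f" "chmap C s X s Y g" and h: "homotopic C s X s Y f g"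
    then show "homotopic C s X s Y g f" using homotopic_sym[OF chmap.axioms(1,2)] by blast
    fix h assume "homotopic C s X s Y g h"
    with h show "homotopic C s X s Y f h"
      using homotopic_trans[OF chmap.axioms(1,2)] \<open>chmap C s X s Y f\<close> by blast
  next
    fix X Y f f' Z g g' assume "chmap C s X s Y f" "chmap C s X s Y f'" "chmap C s Y s Z g" "chmap C s Y s Z g'"
      and h: "homotopic C s X s Y f f'" "homotopic C s Y s Z g g'"
    then interpret f: chmap C s X s Y f + f': chmap C s X s Y f' + g: chmap C s Y s Z g + g': chmap C s Y s Z g' by -
    note c = f.X.cplx_axioms f.Y.cplx_axioms g.Y.cplx_axioms
    show "homotopic C s X s Z (chain_comp g f) (chain_comp g' f')"
      by (rule homotopic_trans[OF c(1,3) homotopic_post[OF c h(1) g.ch f.ch f'.ch] homotopic_pre[OF c h(2) f'.ch]])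
    show "chmap C s X s Z (chain_comp g f)" "chmap C s X s Z (chain_comp g' f')"
      by (rule chmap_comp; unfold_locales)+
  next
    fix X Y f f' g g' assume f: "chmap C s X s Y f" "chmap C s X s Y f'" "chmap C s X s Y g" "chmap C s X s Y g'"
      and h: "homotopic C s X s Y f f'" "homotopic C s X s Y g g'"
    note c = chmap.axioms(1,2)[OF f(1)]
    show "homotopic C s X s Y (f + g) (f' + g')" by (rule homotopic_add[OF c h])
    show "chmap C s X s Y (f + g)" "chmap C s X s Y (f' + g')"
      by (rule chmapI[OF c chain_maps_add[OF c]]; rule f[THEN chmap.ch])+
  next
    fix X Y f f' c assume f: "chmap C s X s Y f" "chmap C s X s Y f'" and h: "homotopic C s X s Y f f'"
    note c = chmap.axioms(1,2)[OF f(1)]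
    show "homotopic C s X s Y (\<lambda>n x u. s c (f n x u)) (\<lambda>n x u. s c (f' n x u))" by (rule homotopic_scale[OF c h])
    show "chmap C s X s Y (\<lambda>n x u. s c (f n x u))" "chmap C s X s Y (\<lambda>n x u. s c (f' n x u))"
      by (rule chmapI[OF c chain_maps_scale[OF c]]; rule f[THEN chmap.ch])+
  next
    fix X Y f Z g assume "chmap C s X s Y f" "chmap C s Y s Z g" "quasi_iso C s X s Y f" "quasi_iso C s Y s Z g"
    then show "quasi_iso C s X s Z (chain_comp g f)" "chmap C s X s Z (chain_comp g f)"
      by (rule quasi_iso_comp, rule_tac chmap_comp)
  next
    fix X Y f Z g assume "chmap C s X s Y f" "chmap C s Y s Z g" "quasi_iso C s Y s Z g"
     "quasi_iso C s X s Z (chain_comp g f)"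
    then show "quasi_iso C s X s Y f" by (rule quasi_iso_cancel)
  next
    fix X Y f g assume "chmap C s X s Y f" "chmap C s X s Y g" "homotopic C s X s Y f g" "quasi_iso C s X s Y f"
    then show "quasi_iso C s X s Y g" by (rule quasi_iso_homotopic)
  next
    fix Z Y f W g assume f: "chmap C s Z s Y f" and g: "chmap C s W s Y g" and q: "quasi_iso C s W s Y g"
    obtain U u h where U: "cplx C s U" "u \<in> chain_maps C s U s Z" "quasi_iso C s U s Z u" "h \<in> chain_maps C s U s W"
      "homotopic C s U s Y (chain_comp f u) (chain_comp g h)" using ore[OF f g q] by blast
    have u: "chmap C s U s Z u" "chmap C s U s W h"
      using chmapI[OF U(1)] U chmap.axioms(1)[OF f] chmap.axioms(1)[OF g] by auto
    show "\<exists>U u h. (chmap C s U s Z u \<and> quasi_iso C s U s Z u) \<and> chmap C s U s W h \<and>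
      chmap C s U s Y (chain_comp f u) \<and> chmap C s U s Y (chain_comp g h) \<and>
      homotopic C s U s Y (chain_comp f u) (chain_comp g h)"
      using U u chmap_comp[OF u(1) f] chmap_comp[OF u(2) g] by blast
  next
    fix Z W f f' Y g assume f: "chmap C s Z s W f" and f': "chmap C s Z s W f'" and g: "chmap C s W s Y g"
      and q: "quasi_iso C s W s Y g" "homotopic C s Z s Y (chain_comp g f) (chain_comp g f')"
    obtain U u where U: "cplx C s U" "u \<in> chain_maps C s U s Z" "quasi_iso C s U s Z u"
      "homotopic C s U s W (chain_comp f u) (chain_comp f' u)" using cancel_qi[OF f f' g q] by blast
    have u: "chmap C s U s Z u" using chmapI[OF U(1)] U chmap.axioms(1)[OF f] by auto
    show "\<exists>U u. (chmap C s U s Z u \<and> quasi_iso C s U s Z u) \<and> chmap C s U s W (chain_comp f u) \<and>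
      chmap C s U s W (chain_comp f' u) \<and> homotopic C s U s W (chain_comp f u) (chain_comp f' u)"
      using U u chmap_comp[OF u f] chmap_comp[OF u f'] by blast
  qed
qed

lemma roofs_eq: "roofs C s = rfs"
  by (intro ext) (auto simp: roofs_def rfs_def)

lemma roof_rel_eq: "roof_rel C s = rel"
  unfolding roof_rel_def rel_def roofs_eq by (intro ext) auto

lemma roof_class_eq: "roof_class C s = cls"
  by (intro ext) (simp add: roof_class_def cls_def roof_rel_eq)

lemma loc_eq: "loc C s = floc"
  by (intro ext) (simp add: loc_def floc_def roof_class_eq)

lemma derived_comp_eq: "derived_comp C s = fcomp"
  unfolding derived_comp_def fcomp_def roof_class_eq by (intro ext) auto

lemma derived_add_eq: "derived_add C s = fadd"
  unfolding derived_add_def fadd_def roof_class_eq by (intro ext) auto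

lemma derived_smul_eq: "derived_smul C s = fsmul"
  unfolding derived_smul_def fsmul_def roof_class_eq by (intro ext) auto

lemma derived_eq: "derived C s = fcat"
  unfolding derived_def fcat_def roofs_eq roof_rel_eq loc_eq derived_comp_eq derived_add_eq derived_smul_eq ..

end

lemma sp_zero_cpx [simp]: "sp (cx zero_cpx n) x = {0}"
  by (simp add: zero_cpx_def)

section \<open>Standard projectives\<close>

lemma sum_fun_apply: "(\<Sum>i\<in>I. f i) x = (\<Sum>i\<in>I. f i x)"
  by (induction I rule: infinite_finite_induct) auto

text \<open>Finitely supported functions on \<open>'m\<close> form the free module on
  \<open>'m\<close>; this is the value at \<open>p\<close> of the linear extension of
  \<open>F\<close>, a map given on basis elements.\<close>

definition lin :: "('k::field \<Rightarrow> 'v \<Rightarrow> 'v) \<Rightarrow> ('m \<Rightarrow> 'k) \<Rightarrow> ('m \<Rightarrow> 'v::ab_group_add) \<Rightarrow> 'v" where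
  "lin t p F = (\<Sum>h | p h \<noteq> 0. t (p h) (F h))"

abbreviation fsupp :: "('m \<Rightarrow> 'k::field) \<Rightarrow> bool" where
  "fsupp p \<equiv> finite {h. p h \<noteq> 0}"

lemma lin_cong: "(\<And>h. p h \<noteq> 0 \<Longrightarrow> F h = G h) \<Longrightarrow> lin t p F = lin t p G"
  unfolding lin_def by (rule sum.cong) auto

lemma supp_add: "{h. (p + q) h \<noteq> (0 :: 'k::field)} \<subseteq> {h. p h \<noteq> 0} \<union> {h. q h \<noteq> 0}"
  by auto

lemma fsupp_add: "fsupp p \<Longrightarrow> fsupp q \<Longrightarrow> fsupp (p + q)"
  by (rule finite_subset[OF supp_add finite_UnI])

lemma fsupp_scale: "fsupp p \<Longrightarrow> fsupp (pw (*) c p)"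
  by (rule finite_subset[of _ "{h. p h \<noteq> 0}"]) (auto simp: pw_def)

context vector_space
begin

lemma lin_superset: "finite S \<Longrightarrow> {h. p h \<noteq> 0} \<subseteq> S \<Longrightarrow> lin scale p F = (\<Sum>h\<in>S. scale (p h) (F h))"
  unfolding lin_def by (rule sum.mono_neutral_left) auto

lemma lin_add: "fsupp p \<Longrightarrow> fsupp q \<Longrightarrow> lin scale (p + q) F = lin scale p F + lin scale q F"
  using lin_superset[of "{h. p h \<noteq> 0} \<union> {h. q h \<noteq> 0}" p F] lin_superset[of "{h. p h \<noteq> 0} \<union> {h. q h \<noteq> 0}" q F]
    lin_superset[of "{h. p h \<noteq> 0} \<union> {h. q h \<noteq> 0}" "p + q" F] supp_add[of p q]
  by (simp add: sum.distrib scale_left_distrib)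

lemma lin_scale: "fsupp p \<Longrightarrow> lin scale (pw (*) c p) F = scale c (lin scale p F)"
  using lin_superset[of "{h. p h \<noteq> 0}" p F] lin_superset[of "{h. p h \<noteq> 0}" "pw (*) c p" F]
  by (auto simp: pw_def scale_sum_right)

lemma lin_zero [simp]: "lin scale 0 F = 0"
  by (simp add: lin_def)

lemma lin_add_right: "lin scale p (\<lambda>h. F h + G h) = lin scale p F + lin scale p G"
  by (simp add: lin_def scale_right_distrib sum.distrib)

lemma lin_scale_right: "lin scale p (\<lambda>h. scale c (F h)) = scale c (lin scale p F)"
  by (simp add: lin_def scale_sum_right scale_left_commute mult.commute)

lemma lin_push:
  assumes "fsupp p"
  shows "lin scale (push \<alpha> p) F = lin scale p (\<lambda>h. F (\<alpha> h))"
proof -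
  let ?S = "{h. p h \<noteq> 0}"
  have s: "{m. push \<alpha> p m \<noteq> 0} \<subseteq> \<alpha> ` ?S"
  proof
    fix m assume "m \<in> {m. push \<alpha> p m \<noteq> 0}"
    then have "{h. p h \<noteq> 0 \<and> \<alpha> h = m} \<noteq> {}" unfolding push_def by (metis (mono_tags, lifting) mem_Collect_eq sum.empty)
    then show "m \<in> \<alpha> ` ?S" by blast
  qed
  have "lin scale (push \<alpha> p) F = (\<Sum>m\<in>\<alpha> ` ?S. \<Sum>h\<in>{h \<in> ?S. \<alpha> h = m}. scale (p h) (F (\<alpha> h)))"
    unfolding lin_superset[OF finite_imageI[OF assms] s] by (simp add: push_def scale_sum_left)
  also have "\<dots> = lin scale p (\<lambda>h. F (\<alpha> h))"
    unfolding lin_def by (rule sum.image_gen[OF assms, symmetric])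
  finally show ?thesis .
qed

end

lemma push_supp: "{m. push \<alpha> p m \<noteq> 0} \<subseteq> \<alpha> ` {h. p h \<noteq> 0}"
proof
  fix m assume "m \<in> {m. push \<alpha> p m \<noteq> 0}"
  then have "{h. p h \<noteq> 0 \<and> \<alpha> h = m} \<noteq> {}" unfolding push_def by (metis (mono_tags, lifting) mem_Collect_eq sum.empty)
  then show "m \<in> \<alpha> ` {h. p h \<noteq> 0}" by blast
qed

lemma fsupp_push: "fsupp p \<Longrightarrow> fsupp (push \<alpha> p)"
  using push_supp finite_imageI finite_subset by metis

text \<open>\<open>push\<close> is itself a linear extension, so its linearity and functoriality
  reduce to those of \<open>lin\<close>.\<close>

lemma push_eq_lin: "fsupp p \<Longrightarrow> push \<alpha> p m = lin (*) p (\<lambda>h. if \<alpha> h = m then 1 else 0)"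
proof -
  assume "fsupp p"
  then have "(\<Sum>h | p h \<noteq> 0. p h * (if \<alpha> h = m then 1 else 0)) = (\<Sum>h | p h \<noteq> 0 \<and> \<alpha> h = m. p h)"
    by (intro sum.mono_neutral_cong_right) auto
  then show ?thesis by (simp add: push_def lin_def)
qed

interpretation mult: vector_space "(*) :: 'k::field \<Rightarrow> 'k \<Rightarrow> 'k"
  by (rule vector_space_mult)

interpretation pwm: vector_space "pw (*) :: 'k::field \<Rightarrow> ('m \<Rightarrow> 'k) \<Rightarrow> 'm \<Rightarrow> 'k"
  by (rule vector_space_pw[OF vector_space_mult])

lemma push_add: "fsupp p \<Longrightarrow> fsupp q \<Longrightarrow> push \<alpha> (p + q) = push \<alpha> p + push \<alpha> q"
proof
  fix m assume f: "fsupp p" "fsupp q"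
  have "fsupp (p + q)" by (rule finite_subset[OF _ finite_UnI[OF f]]) auto
  then show "push \<alpha> (p + q) m = (push \<alpha> p + push \<alpha> q) m" using f by (simp add: push_eq_lin mult.lin_add)
qed

lemma push_scale: "fsupp p \<Longrightarrow> push \<alpha> (pw (*) c p) = pw (*) c (push \<alpha> p)"
proof
  fix m assume f: "fsupp p"
  have "fsupp (pw (*) c p)" by (rule finite_subset[OF _ f]) (auto simp: pw_def)
  then show "push \<alpha> (pw (*) c p) m = pw (*) c (push \<alpha> p) m"
    using f by (simp add: push_eq_lin mult.lin_scale) (simp add: pw_def push_eq_lin)
qed

lemma push_zero [simp]: "push \<alpha> 0 = 0"
  by (simp add: push_def fun_eq_iff)

lemma push_cong: "(\<And>h. p h \<noteq> 0 \<Longrightarrow> \<alpha> h = \<beta> h) \<Longrightarrow> push \<alpha> p = push \<beta> p"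
  unfolding push_def by (intro ext sum.cong) auto

lemma push_push: "fsupp p \<Longrightarrow> push \<beta> (push \<alpha> p) = push (\<lambda>h. \<beta> (\<alpha> h)) p"
proof
  fix m assume p: "fsupp p"
  show "push \<beta> (push \<alpha> p) m = push (\<lambda>h. \<beta> (\<alpha> h)) p m"
    unfolding push_eq_lin[OF fsupp_push[OF p]] mult.lin_push[OF p] push_eq_lin[OF p, of "\<lambda>h. \<beta> (\<alpha> h)"] ..
qed

lemma push_id: "push (\<lambda>h. h) p = p"
proof
  fix m
  have "{h. p h \<noteq> 0 \<and> h = m} = (if p m = 0 then {} else {m})" by auto
  then show "push (\<lambda>h. h) p m = p m" by (simp add: push_def)
qed

lemma sp_std_proj [simp]: "p \<in> sp (std_proj C x) y \<longleftrightarrow> fsupp p \<and> {h. p h \<noteq> 0} \<subseteq> Hom C x y"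
  by (simp add: std_proj_def)

lemma act_std_proj [simp]: "p \<in> sp (std_proj C x) y \<Longrightarrow> act (std_proj C x) y z g p = push (\<lambda>h. Cmp C x y z g h) p"
  by (simp add: std_proj_def restr_def)

section \<open>The Yoneda lemma for standard projectives\<close>

definition gen :: "('o, 'm) cat \<Rightarrow> 'o \<Rightarrow> 'm \<Rightarrow> 'k::field" where
  "gen C x = (\<lambda>h. if h = Idn C x then 1 else 0)"

text \<open>The Yoneda correspondence: the map from the standard projective at \<open>x\<close> to
  \<open>G\<close> that sends the identity of \<open>x\<close> to \<open>q\<close>.\<close>

definition yon :: "('o, 'm) cat \<Rightarrow> ('k::field \<Rightarrow> 'v \<Rightarrow> 'v) \<Rightarrow> ('o, 'm, 'v::ab_group_add) cmod \<Rightarrow> 'o \<Rightarrow> 'v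
    \<Rightarrow> 'o \<Rightarrow> ('m \<Rightarrow> 'k) \<Rightarrow> 'v" where
  "yon C t G x q = restr_fam C (std_proj C x) (\<lambda>z p. lin t p (\<lambda>h. act G x z h q))"

locale category_loc = fixes C :: "('o, 'm) cat" assumes cat: "category C"
begin

lemma Idn_in [simp]: "x \<in> Ob C \<Longrightarrow> Idn C x \<in> Hom C x x"
  and Cmp_in [simp]: "x \<in> Ob C \<Longrightarrow> y \<in> Ob C \<Longrightarrow> z \<in> Ob C \<Longrightarrow> f \<in> Hom C x y \<Longrightarrow> g \<in> Hom C y z \<Longrightarrow> Cmp C x y z g f \<in> Hom C x z"
  and Cmp_id [simp]: "x \<in> Ob C \<Longrightarrow> y \<in> Ob C \<Longrightarrow> f \<in> Hom C x y \<Longrightarrow> Cmp C x x y f (Idn C x) = f"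
    "x \<in> Ob C \<Longrightarrow> y \<in> Ob C \<Longrightarrow> f \<in> Hom C x y \<Longrightarrow> Cmp C x y y (Idn C y) f = f"
  and Cmp_assoc: "w \<in> Ob C \<Longrightarrow> x \<in> Ob C \<Longrightarrow> y \<in> Ob C \<Longrightarrow> z \<in> Ob C \<Longrightarrow> f \<in> Hom C w x \<Longrightarrow> g \<in> Hom C x y \<Longrightarrow> h \<in> Hom C y z \<Longrightarrow>
    Cmp C w x z (Cmp C x y z h g) f = Cmp C w y z h (Cmp C w x y g f)"
  using cat unfolding category_def by auto

lemma push_Cmp_in:
  assumes "x \<in> Ob C" "y \<in> Ob C" "z \<in> Ob C" "g \<in> Hom C y z" "p \<in> sp (std_proj C x) y"
  shows "push (\<lambda>h. Cmp C x y z g h) p \<in> sp (std_proj C x) z"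
proof -
  have "{m. push (\<lambda>h. Cmp C x y z g h) p m \<noteq> 0} \<subseteq> Hom C x z"
    by (rule order_trans[OF push_supp]) (use assms in auto)
  then show ?thesis using assms(5) by (simp add: fsupp_push)
qed

lemma cmodule_std_proj: "x \<in> Ob C \<Longrightarrow> cmodule C (pw (*)) (std_proj C x :: ('o, 'm, 'm \<Rightarrow> 'k::field) cmod)"
proof (rule cmoduleI[OF cat pwm.vector_space_axioms])
  fix y u v assume x: "x \<in> Ob C" and y: "y \<in> Ob C"
    and u: "u \<in> sp (std_proj C x :: ('o, 'm, 'm \<Rightarrow> 'k) cmod) y" and v: "v \<in> sp (std_proj C x :: ('o, 'm, 'm \<Rightarrow> 'k) cmod) y"
  show uv: "u + v \<in> sp (std_proj C x) y"
    using u v fsupp_add[of u v] supp_add[of u v] unfolding sp_std_proj by (meson Un_least order_trans)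
  fix z h assume z: "z \<in> Ob C" and h: "h \<in> Hom C y z"
  show "act (std_proj C x) y z h (u + v) = act (std_proj C x) y z h u + act (std_proj C x) y z h v"
    unfolding act_std_proj[OF uv] act_std_proj[OF u] act_std_proj[OF v] using u v by (simp add: push_add)
next
  fix y u and c :: 'k assume x: "x \<in> Ob C" and y: "y \<in> Ob C"
    and u: "u \<in> sp (std_proj C x :: ('o, 'm, 'm \<Rightarrow> 'k) cmod) y"
  show cu: "pw (*) c u \<in> sp (std_proj C x) y" using u by (auto simp: fsupp_scale) (auto simp: pw_def)
  show "act (std_proj C x) y y (Idn C y) u = u" unfolding act_std_proj[OF u]
  proof -
    have "push (\<lambda>h. Cmp C x y y (Idn C y) h) u = push (\<lambda>h. h) u"
      by (rule push_cong) (use u x y in auto)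
    then show "push (\<lambda>h. Cmp C x y y (Idn C y) h) u = u" by (simp only: push_id)
  qed
  fix z h assume z: "z \<in> Ob C" and h: "h \<in> Hom C y z"
  show "act (std_proj C x) y z h u \<in> sp (std_proj C x) z"
    unfolding act_std_proj[OF u] by (rule push_Cmp_in[OF x y z h u])
  show "act (std_proj C x) y z h (pw (*) c u) = pw (*) c (act (std_proj C x) y z h u)"
    unfolding act_std_proj[OF cu] act_std_proj[OF u] using u by (simp add: push_scale)
next
  fix y z w f g u assume o: "x \<in> Ob C" "y \<in> Ob C" "z \<in> Ob C" "w \<in> Ob C" "f \<in> Hom C y z" "g \<in> Hom C z w"
    and u: "u \<in> sp (std_proj C x :: ('o, 'm, 'm \<Rightarrow> 'k) cmod) y"
  have fu: "push (\<lambda>h. Cmp C x y z f h) u \<in> sp (std_proj C x) z" by (rule push_Cmp_in[OF o(1,2,3,5) u])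
  have "push (\<lambda>h. Cmp C x y w (Cmp C y z w g f) h) u = push (\<lambda>h. Cmp C x z w g (Cmp C x y z f h)) u"
    by (rule push_cong) (use u o Cmp_assoc in auto)
  then show "act (std_proj C x) y w (Cmp C y z w g f) u = act (std_proj C x) z w g (act (std_proj C x) y z f u)"
    unfolding act_std_proj[OF u] act_std_proj[OF fu] using u by (simp add: push_push)
qed (auto simp: std_proj_def restr_def)

lemma gen_in [simp]: "x \<in> Ob C \<Longrightarrow> gen C x \<in> sp (std_proj C x) x"
  by (auto simp: gen_def)

lemma push_gen: "push \<alpha> (gen C x :: 'm \<Rightarrow> 'k::field) = (\<lambda>m. if m = \<alpha> (Idn C x) then 1 else 0)"
proof
  fix m
  have "{h. (gen C x :: 'm \<Rightarrow> 'k) h \<noteq> 0 \<and> \<alpha> h = m} = (if m = \<alpha> (Idn C x) then {Idn C x} else {})"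
    by (auto simp: gen_def)
  then show "push \<alpha> (gen C x :: 'm \<Rightarrow> 'k) m = (if m = \<alpha> (Idn C x) then 1 else 0)"
    by (simp add: push_def gen_def)
qed

lemma std_proj_expand:
  assumes x: "x \<in> Ob C" and y: "y \<in> Ob C" and p: "p \<in> sp (std_proj C x) y"
  shows "p = lin (pw (*)) p (\<lambda>h. act (std_proj C x) x y h (gen C x))"
proof -
  have "lin (pw (*)) p (\<lambda>h. act (std_proj C x) x y h (gen C x)) = lin (pw (*)) p (\<lambda>h m. if m = h then 1 else 0)"
    by (rule lin_cong) (use x y p in \<open>auto simp: act_std_proj[OF gen_in] push_gen subset_iff\<close>)
  also have "\<dots> = p"
  proof
    fix m
    have "lin (pw (*)) p (\<lambda>h m. if m = h then 1 else 0) m = (\<Sum>h | p h \<noteq> 0. if h = m then p h else 0)"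
      by (auto simp: lin_def sum_fun_apply pw_def intro!: sum.cong)
    also have "\<dots> = p m" using p by (subst sum.delta) auto
    finally show "lin (pw (*)) p (\<lambda>h m. if m = h then 1 else 0) m = p m" .
  qed
  finally show ?thesis ..
qed

lemma yoneda_map_nt:
  assumes "x \<in> Ob C" "y \<in> Ob C" "f \<in> Hom C x y"
  shows "(yoneda_map C x y f :: 'o \<Rightarrow> ('m \<Rightarrow> 'k::field) \<Rightarrow> _) \<in> nattrans C (pw (*)) (std_proj C y) (pw (*)) (std_proj C x)"
  unfolding yoneda_map_def
proof (rule nattrans_restrI[OF cmodule_std_proj cmodule_std_proj])
  have in_sp: "push (\<lambda>h. Cmp C x y z h f) u \<in> sp (std_proj C x) z"
    if "z \<in> Ob C" "u \<in> sp (std_proj C y :: ('o, 'm, 'm \<Rightarrow> 'k) cmod) z" for z u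
  proof -
    have "{m. push (\<lambda>h. Cmp C x y z h f) u m \<noteq> 0} \<subseteq> Hom C x z"
      by (rule order_trans[OF push_supp]) (use assms that in auto)
    then show ?thesis using that(2) by (simp add: fsupp_push)
  qed
  fix z u assume z: "z \<in> Ob C" and u: "u \<in> sp (std_proj C y :: ('o, 'm, 'm \<Rightarrow> 'k) cmod) z"
  show "push (\<lambda>h. Cmp C x y z h f) u \<in> sp (std_proj C x) z" by (rule in_sp[OF z u])
  show "push (\<lambda>h. Cmp C x y z h f) (pw (*) c u) = pw (*) c (push (\<lambda>h. Cmp C x y z h f) u)" for c
    using u by (simp add: push_scale)
  show "push (\<lambda>h. Cmp C x y z h f) (u + v) = push (\<lambda>h. Cmp C x y z h f) u + push (\<lambda>h. Cmp C x y z h f) v"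
    if "v \<in> sp (std_proj C y :: ('o, 'm, 'm \<Rightarrow> 'k) cmod) z" for v using u that by (simp add: push_add)
  fix w h assume w: "w \<in> Ob C" and h: "h \<in> Hom C z w"
  have "push (\<lambda>k. Cmp C x y w (Cmp C y z w h k) f) u = push (\<lambda>k. Cmp C x z w h (Cmp C x y z k f)) u"
    by (rule push_cong) (use u assms z w h Cmp_assoc in auto)
  then show "push (\<lambda>h. Cmp C x y w h f) (act (std_proj C y) z w h u)
     = act (std_proj C x) z w h (push (\<lambda>h. Cmp C x y z h f) u)"
    unfolding act_std_proj[OF u] act_std_proj[OF in_sp[OF z u]] using u by (simp add: push_push)
qed (rule assms)+

end

sublocale cmodule \<subseteq> category_loc C by (unfold_locales, rule cat)

context cmodule
begin

lemma yon_apply: "x \<in> Ob C \<Longrightarrow> z \<in> Ob C \<Longrightarrow> p \<in> sp (std_proj C x) z \<Longrightarrow> yon C s F x q z p = lin s p (\<lambda>h. act F x z h q)"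
  by (simp add: yon_def)

lemma lin_in: "x \<in> Ob C \<Longrightarrow> (\<And>h. p h \<noteq> 0 \<Longrightarrow> G h \<in> sp F x) \<Longrightarrow> lin s p G \<in> sp F x"
  unfolding lin_def by (intro sum_in) auto

lemma act_lin_comb: "x \<in> Ob C \<Longrightarrow> y \<in> Ob C \<Longrightarrow> g \<in> Hom C x y \<Longrightarrow> (\<And>h. p h \<noteq> 0 \<Longrightarrow> G h \<in> sp F x) \<Longrightarrow>
   act F x y g (lin s p G) = lin s p (\<lambda>h. act F x y g (G h))"
  unfolding lin_def by (subst act_sum) auto

lemma yon_nt:
  assumes x: "x \<in> Ob C" and q: "q \<in> sp F x"
  shows "yon C s F x q \<in> nattrans C (pw (*)) (std_proj C x) s F"
  unfolding yon_def
proof (rule nattrans_restrI[OF cmodule_std_proj[OF x] cmodule_axioms])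
  fix z p assume z: "z \<in> Ob C" and p: "p \<in> sp (std_proj C x :: ('o, 'm, 'm \<Rightarrow> 'k) cmod) z"
  have i: "act F x z h q \<in> sp F z" if "p h \<noteq> 0" for h using that p x z q by auto
  show "lin s p (\<lambda>h. act F x z h q) \<in> sp F z" by (rule lin_in[OF z i])
  show "lin s (p + p') (\<lambda>h. act F x z h q) = lin s p (\<lambda>h. act F x z h q) + lin s p' (\<lambda>h. act F x z h q)"
    if "p' \<in> sp (std_proj C x :: ('o, 'm, 'm \<Rightarrow> 'k) cmod) z" for p' using p that by (simp add: vsp.lin_add)
  show "lin s (pw (*) c p) (\<lambda>h. act F x z h q) = s c (lin s p (\<lambda>h. act F x z h q))" for c
    using p by (simp add: vsp.lin_scale)
  fix w g assume w: "w \<in> Ob C" and g: "g \<in> Hom C z w"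
  show "lin s (act (std_proj C x) z w g p) (\<lambda>h. act F x w h q) = act F z w g (lin s p (\<lambda>h. act F x z h q))"
  proof -
    have "lin s p (\<lambda>h. act F x w (Cmp C x z w g h) q) = lin s p (\<lambda>h. act F z w g (act F x z h q))"
      by (rule lin_cong) (use p x z w g in \<open>auto simp: act_comp\<close>)
    also have "\<dots> = act F z w g (lin s p (\<lambda>h. act F x z h q))"
      by (rule act_lin_comb[OF z w g i, symmetric])
    finally show ?thesis unfolding act_std_proj[OF p] using p by (simp add: vsp.lin_push)
  qed
qed

text \<open>Both sides expand to the same combination, since acting by a composite is acting twice.
  This is the naturality of the Yoneda correspondence in \<open>x\<close>, on which the naturality
  of \<open>rank1\<close> rests.\<close>

lemma yon_act:
  assumes x: "x \<in> Ob C" and y: "y \<in> Ob C" and h: "h \<in> Hom C x y" and q: "q \<in> sp F x"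
    and z: "z \<in> Ob C" and p: "p \<in> sp (std_proj C y) z"
  shows "yon C s F y (act F x y h q) z p = yon C s F x q z (yoneda_map C x y h z p)"
proof -
  interpret y: nt C "pw (*)" "std_proj C y" "pw (*)" "std_proj C x" "yoneda_map C x y h :: 'o \<Rightarrow> ('m \<Rightarrow> 'k) \<Rightarrow> _"
    by (rule ntI[OF cmodule_std_proj[OF y] cmodule_std_proj[OF x] yoneda_map_nt[OF x y h]])
  have e: "yoneda_map C x y h z p = push (\<lambda>k. Cmp C x y z k h) p" using z p by (simp add: yoneda_map_def)
  have i: "push (\<lambda>k. Cmp C x y z k h) p \<in> sp (std_proj C x) z" using y.in_sp[OF z p] e by simp
  show ?thesis unfolding e yon_apply[OF y z p] yon_apply[OF x z i] using p
    by (simp add: vsp.lin_push) (rule lin_cong, use p x y z h in \<open>auto simp: act_comp\<close>)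
qed

lemma yon_out: "z \<notin> Ob C \<or> p \<notin> sp (std_proj C x) z \<Longrightarrow> yon C s F x q z p = 0"
  by (auto simp: yon_def restr_fam_def)

lemma yon_add:
  assumes x: "x \<in> Ob C" and q: "q \<in> sp F x" "q' \<in> sp F x"
  shows "yon C s F x (q + q') z p = yon C s F x q z p + yon C s F x q' z p"
proof (cases "z \<in> Ob C \<and> p \<in> sp (std_proj C x) z")
  case True
  have "lin s p (\<lambda>h. act F x z h (q + q')) = lin s p (\<lambda>h. act F x z h q + act F x z h q')"
    by (rule lin_cong) (use True x q in \<open>auto simp: subset_iff\<close>)
  then show ?thesis using True x by (simp add: yon_apply vsp.lin_add_right)
qed (use yon_out in auto)

lemma yon_scale:
  assumes x: "x \<in> Ob C" and q: "q \<in> sp F x"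
  shows "yon C s F x (s c q) z p = s c (yon C s F x q z p)"
proof (cases "z \<in> Ob C \<and> p \<in> sp (std_proj C x) z")
  case True
  have "lin s p (\<lambda>h. act F x z h (s c q)) = lin s p (\<lambda>h. s c (act F x z h q))"
    by (rule lin_cong) (use True x q in \<open>auto simp: subset_iff\<close>)
  then show ?thesis using True x by (simp add: yon_apply vsp.lin_scale_right)
qed (use yon_out in auto)

end

context nt
begin

lemma map_lin: "x \<in> Ob C \<Longrightarrow> (\<And>h. p h \<noteq> 0 \<Longrightarrow> u h \<in> sp F x) \<Longrightarrow> \<eta> x (lin s p u) = lin t p (\<lambda>h. \<eta> x (u h))"
  unfolding lin_def by (subst sum) auto

lemma map_yon:
  assumes x: "x \<in> Ob C" and q: "q \<in> sp F x"
  shows "\<eta> z (yon C s F x q z p) = yon C t G x (\<eta> x q) z p"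
proof (cases "z \<in> Ob C \<and> p \<in> sp (std_proj C x) z")
  case True
  have "\<eta> z (lin s p (\<lambda>h. act F x z h q)) = lin t p (\<lambda>h. \<eta> z (act F x z h q))"
    by (rule map_lin) (use True x q in auto)
  also have "\<dots> = lin t p (\<lambda>h. act G x z h (\<eta> x q))"
    by (rule lin_cong) (use True x q natural in \<open>auto simp: subset_iff\<close>)
  finally show ?thesis using True x by (simp add: F.yon_apply G.yon_apply)
qed (use F.yon_out G.yon_out in auto)

end

text \<open>Every element of the standard projective is a combination of translates of
  \<open>gen C x\<close>, and naturality fixes the values on those by the value at
  \<open>gen C x\<close>.\<close>

lemma yon_unique:
  assumes x: "x \<in> Ob C" and G: "cmodule C t G" and \<xi>: "\<xi> \<in> nattrans C (pw (*)) (std_proj C x) t G"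
  shows "\<xi> = yon C t G x (\<xi> x (gen C x))"
proof -
  interpret G: cmodule C t G by fact
  have P: "cmodule C (pw (*)) (std_proj C x :: ('a, 'b, 'b \<Rightarrow> 'c) cmod)" by (rule G.cmodule_std_proj[OF x])
  interpret \<xi>: nt C "pw (*)" "std_proj C x" t G \<xi> by (rule ntI[OF P G \<xi>])
  show ?thesis
  proof (rule nattrans_eqI[OF \<xi> G.yon_nt[OF x]])
    show "\<xi> x (gen C x) \<in> sp G x" by (rule \<xi>.in_sp[OF x G.gen_in[OF x]])
    fix z p assume z: "z \<in> Ob C" and p: "p \<in> sp (std_proj C x :: ('a, 'b, 'b \<Rightarrow> 'c) cmod) z"
    have "\<xi> z (lin (pw (*)) p (\<lambda>h. act (std_proj C x) x z h (gen C x))) = lin t p (\<lambda>h. \<xi> z (act (std_proj C x) x z h (gen C x)))"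
      by (rule \<xi>.map_lin[OF z], rule \<xi>.F.act_in[OF x z _ G.gen_in[OF x]]) (use p in auto)
    also have "\<dots> = lin t p (\<lambda>h. act G x z h (\<xi> x (gen C x)))"
      by (rule lin_cong, rule \<xi>.natural[OF x z]) (use p in auto)
    finally show "\<xi> z p = yon C t G x (\<xi> x (gen C x)) z p"
      using G.std_proj_expand[OF x z p] G.yon_apply[OF x z p] by simp
  qed
qed

section \<open>Finitely generated projectives\<close>

text \<open>The dual basis form of finitely generated projectivity: generators \<open>pe j\<close>
  at objects \<open>xs j\<close>, and coordinates \<open>ie j\<close> with values in standard
  projectives. Unlike \<open>projective\<close>, which tests against modules in a single ambient
  space, these data can be used with modules in any ambient space.\<close>

locale dual_basis = cmodule C s F
  for C :: "('o, 'm) cat" and s :: "'k::field \<Rightarrow> 'v::ab_group_add \<Rightarrow> 'v" and F +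
  fixes N :: nat and xs :: "nat \<Rightarrow> 'o" and pe :: "nat \<Rightarrow> 'v" and ie :: "nat \<Rightarrow> 'o \<Rightarrow> 'v \<Rightarrow> 'm \<Rightarrow> 'k"
  assumes xs: "j < N \<Longrightarrow> xs j \<in> Ob C" and pe: "j < N \<Longrightarrow> pe j \<in> sp F (xs j)"
    and ie: "j < N \<Longrightarrow> ie j \<in> nattrans C s F (pw (*)) (std_proj C (xs j))"
    and expand: "x \<in> Ob C \<Longrightarrow> u \<in> sp F x \<Longrightarrow> u = (\<Sum>j<N. yon C s F (xs j) (pe j) x (ie j x u))"
begin

lemma ie_nt: "j < N \<Longrightarrow> nt C s F (pw (*)) (std_proj C (xs j)) (ie j)"
  by (rule ntI[OF cmodule_axioms cmodule_std_proj[OF xs] ie])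

lemma nattrans_expand:
  assumes G: "cmodule C t G" and f: "f \<in> nattrans C s F t G"
  shows "f x u = (\<Sum>j<N. yon C t G (xs j) (f (xs j) (pe j)) x (ie j x u))"
proof -
  interpret f: nt C s F t G f by (rule ntI[OF cmodule_axioms G f])
  show ?thesis
  proof (cases "x \<in> Ob C \<and> u \<in> sp F x")
    case True
    have "f x u = f x (\<Sum>j<N. yon C s F (xs j) (pe j) x (ie j x u))" using expand[of x u] True by simp
    also have "\<dots> = (\<Sum>j<N. f x (yon C s F (xs j) (pe j) x (ie j x u)))"
    proof (rule f.sum)
      fix j assume "j \<in> {..<N}"
      then have j: "j < N" by simp
      interpret y: nt C "pw (*)" "std_proj C (xs j)" s F "yon C s F (xs j) (pe j)"
        by (rule ntI[OF cmodule_std_proj[OF xs[OF j]] cmodule_axioms yon_nt[OF xs[OF j] pe[OF j]]])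
      interpret i: nt C s F "pw (*)" "std_proj C (xs j)" "ie j" by (rule ie_nt[OF j])
      show "yon C s F (xs j) (pe j) x (ie j x u) \<in> sp F x" using True by (intro y.in_sp i.in_sp) auto
    qed (use True in simp)
    also have "\<dots> = (\<Sum>j<N. yon C t G (xs j) (f (xs j) (pe j)) x (ie j x u))"
      by (rule sum.cong) (use f.map_yon xs pe in auto)
    finally show ?thesis .
  next
    case False
    then have "ie j x u = 0" if "j < N" for j
    proof -
      interpret i: nt C s F "pw (*)" "std_proj C (xs j)" "ie j" by (rule ie_nt[OF that])
      show ?thesis using False by auto
    qed
    moreover have "yon C t G y q x 0 = 0" for y q
    proof -
      interpret G: cmodule C t G by fact
      show ?thesis by (simp add: yon_def restr_fam_def)
    qed
    ultimately show ?thesis using False by auto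
  qed
qed

lemma comb_nt:
  assumes G: "cmodule C t G" and a: "\<And>j. j < N \<Longrightarrow> a j \<in> sp G (xs j)"
  shows "(\<Sum>j<N. (\<lambda>x. yon C t G (xs j) (a j) x \<circ> ie j x)) \<in> nattrans C s F t G"
proof (rule nattrans_sum[OF cmodule_axioms G])
  interpret G: cmodule C t G by fact
  fix j assume "j \<in> {..<N}"
  then have j: "j < N" by simp
  show "(\<lambda>x. yon C t G (xs j) (a j) x \<circ> ie j x) \<in> nattrans C s F t G"
    by (rule nattrans_comp[OF ie[OF j] G.yon_nt[OF xs[OF j] a[OF j]]])
qed

text \<open>Only the finitely many values of \<open>f\<close> on the generators have to be lifted;
  the coordinates spread the choice over \<open>F\<close>. The modules may live in different ambient
  spaces, and the condition concerns the image of \<open>f\<close> alone;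
  \<open>null_homotopic\<close> applies it with a differential for \<open>g\<close>.\<close>

lemma lifting:
  assumes g: "nt C t A r B g" and f: "f \<in> nattrans C s F r B"
    and im: "\<And>x u. x \<in> Ob C \<Longrightarrow> u \<in> sp F x \<Longrightarrow> f x u \<in> g x ` sp A x"
  shows "\<exists>h\<in>nattrans C s F t A. \<forall>x\<in>Ob C. \<forall>u\<in>sp F x. g x (h x u) = f x u"
proof -
  interpret g: nt C t A r B g by (rule g)
  have "\<exists>a. a \<in> sp A (xs j) \<and> g (xs j) a = f (xs j) (pe j)" if "j < N" for j
    using im[OF xs[OF that] pe[OF that]] by (metis imageE)
  then obtain a where a: "\<And>j. j < N \<Longrightarrow> a j \<in> sp A (xs j)" "\<And>j. j < N \<Longrightarrow> g (xs j) (a j) = f (xs j) (pe j)"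
    by metis
  \<comment> \<open>\<open>h\<close> need not take the value \<open>a j\<close> at
    \<open>pe j\<close>, since the generators may satisfy relations; its composite with
    \<open>g\<close> is nevertheless \<open>f\<close>, because \<open>f\<close> respects
    them.\<close>
  define h where "h = (\<Sum>j<N. (\<lambda>x. yon C t A (xs j) (a j) x \<circ> ie j x))"
  have h: "h x u = (\<Sum>j<N. yon C t A (xs j) (a j) x (ie j x u))" for x u
    by (simp add: h_def sum_fun_apply)
  have "g x (h x u) = f x u" if x: "x \<in> Ob C" and u: "u \<in> sp F x" for x u
  proof -
    have "g x (h x u) = (\<Sum>j<N. g x (yon C t A (xs j) (a j) x (ie j x u)))"
      unfolding h
    proof (rule g.sum[OF x])
      fix j assume "j \<in> {..<N}"
      then have j: "j < N" by simp
      interpret y: nt C "pw (*)" "std_proj C (xs j)" t A "yon C t A (xs j) (a j)"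
        by (rule ntI[OF cmodule_std_proj[OF xs[OF j]] g.F.cmodule_axioms g.F.yon_nt[OF xs[OF j] a(1)[OF j]]])
      interpret i: nt C s F "pw (*)" "std_proj C (xs j)" "ie j" by (rule ie_nt[OF j])
      show "yon C t A (xs j) (a j) x (ie j x u) \<in> sp A x" using x u by (intro y.in_sp i.in_sp) auto
    qed
    also have "\<dots> = (\<Sum>j<N. yon C r B (xs j) (f (xs j) (pe j)) x (ie j x u))"
      by (rule sum.cong) (use g.map_yon xs a in auto)
    also have "\<dots> = f x u" by (rule nattrans_expand[OF g.G.cmodule_axioms f, symmetric])
    finally show ?thesis .
  qed
  moreover have "h \<in> nattrans C s F t A" unfolding h_def by (rule comb_nt[OF g.F.cmodule_axioms a(1)])
  ultimately show ?thesis by blast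
qed

lemma projective: "projective C s F"
  unfolding projective_def
proof (intro conjI md allI impI; elim conjE)
  fix M N' p g assume M: "is_cmod C s M" and N: "is_cmod C s N'" and p: "p \<in> nattrans C s M s N'"
    and su: "surjective C M N' p" and g: "g \<in> nattrans C s F s N'"
  have MN: "cmodule C s M" "cmodule C s N'" using M N cat vs by (auto intro: cmodule.intro)
  interpret p: nt C s M s N' p by (rule ntI[OF MN p])
  interpret g: nt C s F s N' g by (rule ntI[OF cmodule_axioms MN(2) g])
  obtain h where h: "h \<in> nattrans C s F s M" "\<forall>x\<in>Ob C. \<forall>u\<in>sp F x. p x (h x u) = g x u"
    using lifting[OF p.nt_axioms g] su g.in_sp unfolding surjective_def by blast
  interpret h: nt C s F s M h by (rule ntI[OF cmodule_axioms MN(1) h(1)])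
  have "p x (h x u) = g x u" if "x \<in> Ob C" for x u
    using h(2) that by (cases "u \<in> sp F x") auto
  then show "\<exists>h\<in>nattrans C s F s M. \<forall>x\<in>Ob C. p x \<circ> h x = g x" using h(1) by (auto simp: fun_eq_iff)
qed

end

section \<open>Bounded complexes of finitely generated projectives\<close>

definition fgproj :: "('o, 'm) cat \<Rightarrow> ('k::field \<Rightarrow> 'v \<Rightarrow> 'v) \<Rightarrow> ('o, 'm, 'v::ab_group_add) cmod \<Rightarrow> bool" where
  "fgproj C s F \<longleftrightarrow> (\<exists>N xs pe ie. dual_basis C s F N xs pe ie)"

text \<open>The bound is not strict: \<open>P\<close> vanishes in degrees \<open>M\<close> and
  \<open>- M\<close> as well. An induction can therefore start at \<open>M\<close>, and the boundary
  terms of alternating sums over \<open>{-M..M}\<close> vanish.\<close>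

locale bfp = cplx C s P
  for C :: "('o, 'm) cat" and s :: "'k::field \<Rightarrow> 'v::ab_group_add \<Rightarrow> 'v" and P +
  fixes M :: int
  assumes fgproj: "fgproj C s (cx P n)"
    and bounded: "\<bar>n\<bar> \<ge> M \<Longrightarrow> x \<in> Ob C \<Longrightarrow> u \<in> sp (cx P n) x \<Longrightarrow> u = 0"
    and M: "M \<ge> 0"
begin

text \<open>Descending induction from degree \<open>M\<close>, from which on \<open>P\<close> is
  zero. Given the homotopy in degrees above \<open>l\<close>, the difference of \<open>c\<close> and
  the part already accounted for is a cocycle in degree \<open>l\<close>, hence a coboundary since
  \<open>A\<close> is acyclic, and projectivity lifts it along the differential.\<close>

lemma null_homotopic:
  assumes A: "cplx C t A" and ac: "acyclic_cpx C A" and c: "c \<in> chain_maps C s P t A"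
  shows "homotopic C s P t A c 0"
proof -
  interpret A: cplx C t A by fact
  interpret c: chmap C s P t A c by (rule chmapI[OF cplx_axioms A c])
  have "\<exists>k. (\<forall>n. k n \<in> nattrans C s (cx P n) t (cx A (n - 1))) \<and>
     (\<forall>n\<ge>M - int m. \<forall>x\<in>Ob C. \<forall>u\<in>sp (cx P n) x. c n x u = df A (n - 1) x (k n x u) + k (n + 1) x (df P n x u))" for m
  proof (induction m)
    case 0
    have "c n x u = 0 \<and> df P n x u = 0" if "n \<ge> M" "x \<in> Ob C" "u \<in> sp (cx P n) x" for n x u
      using bounded[of n x u] that M by auto
    then show ?case by (intro exI[of _ "\<lambda>n. 0"] conjI allI nattrans_zero[OF cmod A.cmod]) auto
  next
    case (Suc m)
    then obtain k where k: "\<And>n. k n \<in> nattrans C s (cx P n) t (cx A (n - 1))"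
      and e: "\<And>n x u. n \<ge> M - int m \<Longrightarrow> x \<in> Ob C \<Longrightarrow> u \<in> sp (cx P n) x \<Longrightarrow>
        c n x u = df A (n - 1) x (k n x u) + k (n + 1) x (df P n x u)" by blast
    define l where "l = M - int (Suc m)"
    interpret k: nt C s "cx P i" t "cx A (i - 1)" "k i" for i
      by (rule ntI[OF cmod A.cmod k])
    have l1: "l + 1 \<ge> M - int m" by (simp add: l_def)
    define w where "w = c l - (\<lambda>x. k (l + 1) x \<circ> df P l x)"
    have kd: "(\<lambda>x. k (l + 1) x \<circ> df P l x) \<in> nattrans C s (cx P l) t (cx A l)"
      using nattrans_comp[OF d.nt k, of l] by simp
    have w: "w \<in> nattrans C s (cx P l) t (cx A l)"
      unfolding w_def by (rule nattrans_diff[OF cmod A.cmod c.nt kd])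
    interpret w: nt C s "cx P l" t "cx A l" w by (rule ntI[OF cmod A.cmod w])
    interpret kd: nt C s "cx P l" t "cx A l" "\<lambda>x. k (l + 1) x \<circ> df P l x" by (rule ntI[OF cmod A.cmod kd])
    have "w x u \<in> df A (l - 1) x ` sp (cx A (l - 1)) x" if x: "x \<in> Ob C" and u: "u \<in> sp (cx P l) x" for x u
    proof -
      have "c (l + 1) x (df P l x u) = df A l x (k (l + 1) x (df P l x u))"
        using e[OF l1 x d.in_sp[OF x u]] by simp
      then have "df A l x (w x u) = 0" using x u kd.in_sp[OF x u] by (simp add: w_def c.d_comm)
      then have "w x u \<in> cocycles A l x" using w.in_sp[OF x u] by (simp add: cocycles_def)
      then show ?thesis using ac x unfolding acyclic_cpx_def coboundaries_def by blast
    qed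
    moreover have dA: "nt C t (cx A (l - 1)) t (cx A l) (df A (l - 1))"
      by (rule ntI[OF A.cmod A.cmod]) (use A.d.nt[of "l - 1"] in simp)
    moreover obtain N xs pe ie where "dual_basis C s (cx P l) N xs pe ie" using fgproj unfolding fgproj_def by blast
    ultimately obtain h where h: "h \<in> nattrans C s (cx P l) t (cx A (l - 1))"
      "\<And>x u. x \<in> Ob C \<Longrightarrow> u \<in> sp (cx P l) x \<Longrightarrow> df A (l - 1) x (h x u) = w x u"
      using dual_basis.lifting[OF _ dA w] by blast
    show ?case
    proof (intro exI[of _ "k(l := h)"] conjI allI ballI impI)
      show "(k(l := h)) n \<in> nattrans C s (cx P n) t (cx A (n - 1))" for n using k h(1) by auto
      show "c n x u = df A (n - 1) x ((k(l := h)) n x u) + (k(l := h)) (n + 1) x (df P n x u)"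
        if "n \<ge> M - int (Suc m)" "x \<in> Ob C" "u \<in> sp (cx P n) x" for n x u
      proof (cases "n = l")
        case True
        then show ?thesis using h(2)[of x u] that by (simp add: w_def)
      next
        case False
        then have "n \<ge> M - int m" using that by (simp add: l_def)
        then show ?thesis using e[of n x u] that False by (auto simp: l_def)
      qed
    qed
  qed
  \<comment> \<open>After \<open>2 * M\<close> steps the induction reaches \<open>- M\<close>; from
    there downwards \<open>P\<close> is zero again.\<close>
  moreover have "M - int (nat (2 * M)) = - M" using M by simp
  ultimately obtain k where k: "\<And>n. k n \<in> nattrans C s (cx P n) t (cx A (n - 1))"
      and e: "\<And>n x u. n \<ge> - M \<Longrightarrow> x \<in> Ob C \<Longrightarrow> u \<in> sp (cx P n) x \<Longrightarrow>
        c n x u = df A (n - 1) x (k n x u) + k (n + 1) x (df P n x u)"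
    by metis
  interpret k: nt C s "cx P i" t "cx A (i - 1)" "k i" for i
    by (rule ntI[OF cmod A.cmod k])
  show ?thesis unfolding homotopic_def
  proof (intro exI[of _ k] conjI allI ballI k)
    fix n x u assume xu: "x \<in> Ob C" "u \<in> sp (cx P n) x"
    show "c n x u - 0 n x u = df A (n - 1) x (k n x u) + k (n + 1) x (df P n x u)"
    proof (cases "n \<ge> - M")
      case True
      then show ?thesis using e[OF True xu] by simp
    next
      case False
      then have "u = 0" using bounded[of n x u] xu M by auto
      then show ?thesis by simp
    qed
  qed
qed

text \<open>The difference of the lifts, with the null homotopy of its image, is a map into the
  homotopy fibre of \<open>\<sigma>\<close>. The fibre is acyclic, so \<open>null_homotopic\<close>
  applies.\<close>

lemma lift_unique:
  assumes \<sigma>: "chmap C t Z r X \<sigma>" and q: "quasi_iso C t Z r X \<sigma>"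
    and h: "h \<in> chain_maps C s P t Z" and h': "h' \<in> chain_maps C s P t Z"
    and e: "homotopic C s P r X (chain_comp \<sigma> h) (chain_comp \<sigma> h')"
  shows "homotopic C s P t Z h h'"
proof -
  interpret \<sigma>: chmap C t Z r X \<sigma> by (rule \<sigma>)
  interpret F: hpullback C t zero_cpx t Z r X 0 \<sigma> by (rule hfib_acyclic(1)[OF \<sigma> q])
  note ac = hfib_acyclic(2)[OF \<sigma> q]
  note Z = \<sigma>.X.cplx_axioms and X = \<sigma>.Y.cplx_axioms and O = F.f.X.cplx_axioms
  note P = cplx_axioms
  have d: "h - h' \<in> chain_maps C s P t Z" by (rule chain_maps_diff[OF P Z h h'])
  have z: "0 \<in> chain_maps C s P t zero_cpx" by (rule chain_maps_zero[OF P O])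
  have gd: "chain_comp \<sigma> (h - h') = chain_comp \<sigma> h - chain_comp \<sigma> h'"
  proof -
    interpret h: chmap C s P t Z h by (rule chmapI[OF P Z h])
    interpret h': chmap C s P t Z h' by (rule chmapI[OF P Z h'])
    show ?thesis
      by (rule chain_maps_eqI[OF chain_maps_comp[OF d \<sigma>.ch] chain_maps_diff[OF P X]])
        (auto intro: chain_maps_comp h h' \<sigma>.ch)
  qed
  have "homotopic C s P r X (chain_comp \<sigma> (h - h')) 0"
    unfolding gd using e homotopic_diff_iff[OF P X] by blast
  then have "homotopic C s P r X (chain_comp 0 0) (chain_comp \<sigma> (h - h'))"
    by (simp add: chain_comp_def homotopic_sym[OF P X] zero_fun_def comp_def)
  then obtain c where c: "c \<in> chain_maps C s P F.su F.U" "chain_comp F.p2 c = h - h'"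
    using F.lift[OF P z d] by blast
  have "homotopic C s P t Z (chain_comp F.p2 c) (chain_comp F.p2 0)"
    by (rule homotopic_post[OF P F.U Z null_homotopic[OF F.U ac c(1)] F.p2 c(1) chain_maps_zero[OF P F.U]])
  moreover have "chain_comp F.p2 (0 :: int \<Rightarrow> 'o \<Rightarrow> 'v \<Rightarrow> _) = 0"
    using nt.zero[OF ntI[OF F.U_cmod \<sigma>.X.cmod]] F.p2
    by (fastforce simp: fun_eq_iff chain_maps_def simp del: F.cxU)
  ultimately show ?thesis using c(2) homotopic_diff_iff[OF P Z, of h h'] by (simp only:)
qed

text \<open>The map \<open>f\<close> is read as a map into the shifted homotopy fibre of
  \<open>\<sigma>\<close>, which is acyclic. In a null homotopy of it, the component in
  \<open>Z\<close> is the lift, and the component in \<open>X\<close> is a homotopy between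
  \<open>f\<close> and the image of the lift under \<open>\<sigma>\<close>.\<close>

lemma lift_exists:
  fixes \<sigma> :: "int \<Rightarrow> 'o \<Rightarrow> 'z::ab_group_add \<Rightarrow> 'x::ab_group_add"
  assumes \<sigma>: "chmap C t Z r X \<sigma>" and q: "quasi_iso C t Z r X \<sigma>"
    and f: "f \<in> chain_maps C s P r X"
  shows "\<exists>h\<in>chain_maps C s P t Z. homotopic C s P r X (chain_comp \<sigma> h) f"
proof -
  interpret \<sigma>: chmap C t Z r X \<sigma> by (rule \<sigma>)
  note Z = \<sigma>.X.cplx_axioms and X = \<sigma>.Y.cplx_axioms
  note P = cplx_axioms
  interpret f: chmap C s P r X f by (rule chmapI[OF P X f])
  interpret F: hpullback C t zero_cpx t Z r X 0 \<sigma> by (rule hfib_acyclic(1)[OF \<sigma> q])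
  let ?S = "shift_cpx F.U"
  interpret U: cplx C F.su F.U by (rule F.U)
  interpret S: cplx C F.su ?S by (rule U.shift_cplx)
  have ac: "acyclic_cpx C ?S" by (rule U.shift_acyclic[OF hfib_acyclic(2)[OF \<sigma> q]])
  have cS: "cx ?S n = sum3 (cx zero_cpx (n + 1)) (cx Z (n + 1)) (cx X n)" for n
    by (simp add: shift_cpx_def)
  have dS: "df ?S n x (0, b, c) = (0, - df Z (n + 1) x b, \<sigma> (n + 1) x b + df X n x c)"
    if "x \<in> Ob C" "b \<in> sp (cx Z (n + 1)) x" "c \<in> sp (cx X n) x" for n x b c
    using F.dfU[of x 0 "n + 1" b c] that by (simp add: shift_cpx_def F.f.X.zero_in)
  define c where "c = (\<lambda>n x u. (0 :: 'z, 0 :: 'z, f n x u))"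
  have c: "c \<in> chain_maps C s P F.su ?S"
  proof (rule chain_mapsI[OF P S.cplx_axioms])
    show "c n \<in> nattrans C s (cx P n) F.su (cx ?S n)" for n
      by (rule nattransI[OF cmod S.cmod])
        (auto simp: c_def cS f.natural zero_prod_def F.f.X.zero_in)
    show "c (n + 1) x (df P n x u) = df ?S n x (c n x u)" if "x \<in> Ob C" "u \<in> sp (cx P n) x" for n x u
      using that by (simp add: c_def dS F.f.X.zero_in f.d_comm)
  qed
  obtain k where k: "\<And>n. k n \<in> nattrans C s (cx P n) F.su (cx ?S (n - 1))"
    and e: "\<And>n x u. x \<in> Ob C \<Longrightarrow> u \<in> sp (cx P n) x \<Longrightarrow>
      c n x u = df ?S (n - 1) x (k n x u) + k (n + 1) x (df P n x u)"
    using null_homotopic[OF S.cplx_axioms ac c] unfolding homotopic_def zero_fun_apply diff_zero by metis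
  have cS': "cx ?S (n - 1) = sum3 (cx zero_cpx n) (cx Z n) (cx X (n - 1))" for n
    using cS[of "n - 1"] by simp
  interpret k: nt C s "cx P i" F.su "cx ?S (i - 1)" "k i" for i
    by (rule ntI[OF cmod S.cmod k])
  define a where "a = (\<lambda>n x u. fst (snd (k n x u)))"
  define b where "b = (\<lambda>n x u. snd (snd (k n x u)))"
  have kin: "k n x u = (0, a n x u, b n x u)" "a n x u \<in> sp (cx Z n) x" "b n x u \<in> sp (cx X (n - 1)) x"
    if "x \<in> Ob C" "u \<in> sp (cx P n) x" for n x u
    using k.in_sp[OF that] by (auto simp: a_def b_def cS')
  have nat: "a n y (act (cx P n) x y h u) = act (cx Z n) x y h (a n x u)"
      "b n y (act (cx P n) x y h u) = act (cx X (n - 1)) x y h (b n x u)"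
    if o: "x \<in> Ob C" "y \<in> Ob C" "h \<in> Hom C x y" and u: "u \<in> sp (cx P n) x" for n x y h u
  proof -
    have "k n y (act (cx P n) x y h u) = act (cx ?S (n - 1)) x y h (0, a n x u, b n x u)"
      using k.natural[OF o] kin(1)[OF o(1) u] by simp
    also have "\<dots> = (act (cx zero_cpx n) x y h 0, act (cx Z n) x y h (a n x u), act (cx X (n - 1)) x y h (b n x u))"
      unfolding cS' by (rule act_sum3) (use kin[OF o(1) u] in auto)
    finally show "a n y (act (cx P n) x y h u) = act (cx Z n) x y h (a n x u)"
      "b n y (act (cx P n) x y h u) = act (cx X (n - 1)) x y h (b n x u)"
      by (simp_all add: a_def b_def)
  qed
  have a: "a n \<in> nattrans C s (cx P n) t (cx Z n)" for n
    by (rule nattransI[OF cmod \<sigma>.X.cmod])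
      (simp_all add: kin nat, simp_all add: a_def scale3_def split: prod.splits)
  have b: "b n \<in> nattrans C s (cx P n) r (cx X (n - 1))" for n
    by (rule nattransI[OF cmod \<sigma>.Y.cmod])
      (simp_all add: kin nat, simp_all add: b_def scale3_def split: prod.splits)
  have eq: "(0, 0, f n x u) = (0, - df Z n x (a n x u) + a (n + 1) x (df P n x u),
     \<sigma> n x (a n x u) + df X (n - 1) x (b n x u) + b (n + 1) x (df P n x u))"
    if xu: "x \<in> Ob C" "u \<in> sp (cx P n) x" for n x u
  proof -
    have du: "df P n x u \<in> sp (cx P (n + 1)) x" using xu by simp
    show ?thesis
      using e[OF xu] dS[of x "a n x u" "n - 1" "b n x u"] xu kin[OF xu] kin[OF xu(1) du]
      by (simp add: c_def F.f.X.zero_in zero_prod_def)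
  qed
  have ach: "a \<in> chain_maps C s P t Z"
    by (rule chain_mapsI[OF P Z a]) (use eq in auto)
  moreover have "homotopic C s P r X f (chain_comp \<sigma> a)"
    unfolding homotopic_def
    by (rule exI[of _ b]) (use b eq in \<open>auto simp: algebra_simps\<close>)
  ultimately show ?thesis using homotopic_sym[OF P X] by blast
qed

end

section \<open>Finite sums of standard projectives and their retracts\<close>

definition comp_at :: "nat \<Rightarrow> (nat \<times> 'm \<Rightarrow> 'k::field) \<Rightarrow> 'm \<Rightarrow> 'k" where
  "comp_at i p = (\<lambda>h. p (i, h))"

definition inc_at :: "nat \<Rightarrow> ('m \<Rightarrow> 'k::field) \<Rightarrow> nat \<times> 'm \<Rightarrow> 'k" where
  "inc_at j p = (\<lambda>(i, h). if i = j then p h else 0)"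

lemma comp_at_add [simp]: "comp_at i (u + v) = comp_at i u + comp_at i v"
  and comp_at_scale [simp]: "comp_at i (pw (*) c w) = pw (*) c (comp_at i w)"
  and comp_at_zero [simp]: "comp_at i 0 = 0"
  by (auto simp: comp_at_def pw_def fun_eq_iff)

lemma comp_at_eqI: "(\<And>i. comp_at i u = comp_at i v) \<Longrightarrow> u = v"
  by (auto simp: comp_at_def fun_eq_iff)

lemma comp_at_sum: "comp_at i (\<Sum>j\<in>I. f j) = (\<Sum>j\<in>I. comp_at i (f j))"
  by (simp add: comp_at_def fun_eq_iff sum_fun_apply)

lemma comp_at_inc_at [simp]: "comp_at i (inc_at j p) = (if i = j then p else 0)"
  by (auto simp: comp_at_def inc_at_def fun_eq_iff)

lemma inc_at_add: "inc_at j (p + q) = inc_at j p + inc_at j q"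
  and inc_at_scale: "inc_at j (pw (*) c r) = pw (*) c (inc_at j r)"
  by (auto simp: inc_at_def pw_def fun_eq_iff)

lemma sp_std_sum: "p \<in> sp (std_sum C xs) y \<longleftrightarrow>
    (\<forall>i. if i < length xs then comp_at i p \<in> sp (std_proj C (xs ! i)) y else comp_at i p = 0)"
  by (auto simp: std_sum_def comp_at_def fun_eq_iff)

lemma comp_at_act: "p \<in> sp (std_sum C xs) y \<Longrightarrow>
   comp_at i (act (std_sum C xs) y z g p) = (if i < length xs then act (std_proj C (xs ! i)) y z g (comp_at i p) else 0)"
proof -
  assume "p \<in> sp (std_sum C xs) y"
  then have "act (std_sum C xs) y z g p =
    (\<lambda>(i, m). if i < length xs then act (std_proj C (xs ! i)) y z g (\<lambda>h. p (i, h)) m else 0)"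
    by (simp add: std_sum_def Let_def restr_def del: sp_std_proj)
  then show "comp_at i (act (std_sum C xs) y z g p) = (if i < length xs then act (std_proj C (xs ! i)) y z g (comp_at i p) else 0)"
    by (auto simp: comp_at_def fun_eq_iff)
qed

lemma restr_out: "u \<notin> V \<Longrightarrow> restr V g u = 0"
  by (simp add: restr_def)

lemma act_std_sum_out: "p \<notin> sp (std_sum C xs) y \<Longrightarrow> act (std_sum C xs) y z g p = 0"
  unfolding std_sum_def Let_def cmod.select_convs by (rule restr_out)

lemma (in category_loc) cmodule_std_sum:
  assumes xs: "set xs \<subseteq> Ob C"
  shows "cmodule C (pw (*)) (std_sum C xs :: ('o, 'm, nat \<times> 'm \<Rightarrow> 'k::field) cmod)"
proof -
  have P: "cmodule C (pw (*)) (std_proj C (xs ! i) :: ('o, 'm, 'm \<Rightarrow> 'k) cmod)" if "i < length xs" for i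
    by (rule cmodule_std_proj) (use xs that in auto)
  show ?thesis
  proof (rule cmoduleI[OF cat pwm.vector_space_axioms])
    fix y assume y: "y \<in> Ob C"
    note z = cmodule.zero_in[OF P y] and a = cmodule.add_in[OF P y] and c = cmodule.scale_in[OF P y]
    show "0 \<in> sp (std_sum C xs :: ('o, 'm, nat \<times> 'm \<Rightarrow> 'k) cmod) y"
      using z by (simp add: sp_std_sum del: sp_std_proj)
    fix u assume u: "u \<in> sp (std_sum C xs :: ('o, 'm, nat \<times> 'm \<Rightarrow> 'k) cmod) y"
    show cu: "pw (*) k u \<in> sp (std_sum C xs) y" for k
      using u c by (auto simp add: sp_std_sum split: if_splits simp del: sp_std_proj)
    show "act (std_sum C xs) y y (Idn C y) u = u"
      by (rule comp_at_eqI)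
        (use u y cmodule.act_id[OF P y] in \<open>auto simp: comp_at_act[OF u] sp_std_sum simp del: sp_std_proj act_std_proj split: if_splits\<close>)
    show uv: "u + v \<in> sp (std_sum C xs) y" if "v \<in> sp (std_sum C xs) y" for v
      using u that a by (auto simp add: sp_std_sum split: if_splits simp del: sp_std_proj)
    fix w h assume w: "w \<in> Ob C" and h: "h \<in> Hom C y w"
    show h_in: "act (std_sum C xs) y w h u \<in> sp (std_sum C xs) w"
      using u cmodule.act_in[OF P y w h]
      unfolding sp_std_sum[of "act (std_sum C xs) y w h u"] comp_at_act[OF u]
      by (auto simp add: sp_std_sum split: if_splits simp del: sp_std_proj act_std_proj)
    show "act (std_sum C xs) y w h (u + v) = act (std_sum C xs) y w h u + act (std_sum C xs) y w h v"
      if v: "v \<in> sp (std_sum C xs) y" for v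
      by (rule comp_at_eqI)
       (use u v cmodule.act_add[OF P y w h] in \<open>auto simp: comp_at_act[OF u] comp_at_act[OF v] comp_at_act[OF uv[OF v]] sp_std_sum
          simp del: sp_std_proj act_std_proj split: if_splits\<close>)
    show "act (std_sum C xs) y w h (pw (*) k u) = pw (*) k (act (std_sum C xs) y w h u)" for k
      by (rule comp_at_eqI)
       (use u cmodule.act_scale[OF P y w h] in \<open>auto simp: comp_at_act[OF u] comp_at_act[OF cu] sp_std_sum
          simp del: sp_std_proj act_std_proj split: if_splits\<close>)
    show "act (std_sum C xs) y x' (Cmp C y w x' g h) u = act (std_sum C xs) w x' g (act (std_sum C xs) y w h u)"
      if "x' \<in> Ob C" "g \<in> Hom C w x'" for x' g
      by (rule comp_at_eqI)
       (use u cmodule.act_comp[OF P y w that(1) h that(2)] in \<open>auto simp: comp_at_act[OF u] comp_at_act[OF h_in] 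
          simp del: sp_std_proj act_std_proj split: if_splits\<close>)
  qed (rule act_std_sum_out)
qed

context category_loc
begin

context
  fixes xs :: "'o list" assumes xs: "set xs \<subseteq> Ob C"
begin

lemma xs_Ob: "j < length xs \<Longrightarrow> xs ! j \<in> Ob C"
  using xs by auto

definition prj :: "nat \<Rightarrow> 'o \<Rightarrow> (nat \<times> 'm \<Rightarrow> 'k::field) \<Rightarrow> 'm \<Rightarrow> 'k" where
  "prj j = restr_fam C (std_sum C xs) (\<lambda>x. comp_at j)"

definition inj :: "nat \<Rightarrow> 'o \<Rightarrow> ('m \<Rightarrow> 'k::field) \<Rightarrow> nat \<times> 'm \<Rightarrow> 'k" where
  "inj j = restr_fam C (std_proj C (xs ! j)) (\<lambda>x. inc_at j)"

lemma prj_nt: "j < length xs \<Longrightarrow> prj j \<in> nattrans C (pw (*)) (std_sum C xs) (pw (*)) (std_proj C (xs ! j) :: ('o, 'm, 'm \<Rightarrow> 'k::field) cmod)"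
  unfolding prj_def
  by (rule nattrans_restrI[OF cmodule_std_sum[OF xs] cmodule_std_proj[OF xs_Ob]])
    (auto simp: comp_at_act sp_std_sum[of _ C xs] simp del: sp_std_proj act_std_proj)

lemma inj_nt: 
  assumes j: "j < length xs"
  shows "inj j \<in> nattrans C (pw (*)) (std_proj C (xs ! j)) (pw (*)) (std_sum C xs :: ('o, 'm, nat \<times> 'm \<Rightarrow> 'k::field) cmod)"
proof -
  have z: "0 \<in> sp (std_proj C (xs ! i) :: ('o, 'm, 'm \<Rightarrow> 'k) cmod) x" for i x by auto
  have i: "inc_at j u \<in> sp (std_sum C xs) x" if "u \<in> sp (std_proj C (xs ! j) :: ('o, 'm, 'm \<Rightarrow> 'k) cmod) x" for x u
    unfolding sp_std_sum using that z j by (auto simp del: sp_std_proj)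
  have p0: "act (std_proj C (xs ! i)) x y h 0 = (0 :: 'm \<Rightarrow> 'k)" for i x y h
    using act_std_proj[OF z[of i x]] by simp
  show ?thesis
    unfolding inj_def
  proof (rule nattrans_restrI[OF cmodule_std_proj[OF xs_Ob[OF j]] cmodule_std_sum[OF xs]])
    fix x y h u assume "u \<in> sp (std_proj C (xs ! j) :: ('o, 'm, 'm \<Rightarrow> 'k) cmod) x"
    then show "inc_at j (act (std_proj C (xs ! j)) x y h u) = act (std_sum C xs) x y h (inc_at j u)"
      using j by (intro comp_at_eqI) (auto simp: comp_at_act[OF i] p0 simp del: act_std_proj sp_std_proj)
  qed (auto simp: i inc_at_add inc_at_scale simp del: sp_std_proj)
qed

lemma sum_inj_prj:
  assumes x: "x \<in> Ob C" and w: "w \<in> sp (std_sum C xs :: ('o, 'm, nat \<times> 'm \<Rightarrow> 'k::field) cmod) x"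
  shows "w = (\<Sum>j<length xs. inj j x (prj j x w))"
proof (rule comp_at_eqI)
  fix i
  have "inj j x (prj j x w) = inc_at j (comp_at j w)" if "j < length xs" for j
    using that x w unfolding inj_def prj_def sp_std_sum[of w] by (auto simp: sp_std_sum[of w] simp del: sp_std_proj)
  then have "comp_at i (\<Sum>j<length xs. inj j x (prj j x w)) = (\<Sum>j<length xs. if i = j then comp_at j w else 0)"
    by (simp add: comp_at_sum)
  also have "\<dots> = comp_at i w" using w by (auto simp: sp_std_sum)
  finally show "comp_at i w = comp_at i (\<Sum>j<length xs. inj j x (prj j x w))" ..
qed

text \<open>The images of the standard generators under \<open>\<eta>\<close> and the coordinates of
  \<open>h\<close> form a dual basis: applying \<open>\<eta>\<close> to the decomposition of
  \<open>h x u\<close> in the sum expands \<open>u\<close>.\<close>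

lemma fgproj_retract:
  fixes F :: "('o, 'm, 'v::ab_group_add) cmod" and s :: "'k::field \<Rightarrow> 'v \<Rightarrow> 'v"
  assumes F: "cmodule C s F" and \<eta>: "\<eta> \<in> nattrans C (pw (*)) (std_sum C xs) s F"
    and h: "h \<in> nattrans C s F (pw (*)) (std_sum C xs)"
    and e: "\<And>x u. x \<in> Ob C \<Longrightarrow> u \<in> sp F x \<Longrightarrow> \<eta> x (h x u) = u"
  shows "fgproj C s F"
proof -
  interpret F: cmodule C s F by (rule F)
  note S = cmodule_std_sum[OF xs, where 'k = 'k]
  interpret \<eta>: nt C "pw (*)" "std_sum C xs" s F \<eta> by (rule ntI[OF S F \<eta>])
  interpret h: nt C s F "pw (*)" "std_sum C xs" h by (rule ntI[OF F S h])
  have i: "nt C (pw (*)) (std_proj C (xs ! j)) (pw (*)) (std_sum C xs) (inj j :: 'o \<Rightarrow> ('m \<Rightarrow> 'k) \<Rightarrow> _)" if "j < length xs" for j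
    by (rule ntI[OF cmodule_std_proj[OF xs_Ob[OF that]] S inj_nt[OF that]])
  have p: "nt C (pw (*)) (std_sum C xs) (pw (*)) (std_proj C (xs ! j)) (prj j :: 'o \<Rightarrow> (nat \<times> 'm \<Rightarrow> 'k) \<Rightarrow> _)" if "j < length xs" for j
    by (rule ntI[OF S cmodule_std_proj[OF xs_Ob[OF that]] prj_nt[OF that]])
  have "dual_basis C s F (length xs) ((!) xs) (\<lambda>j. \<eta> (xs ! j) (inj j (xs ! j) (gen C (xs ! j)))) (\<lambda>j x. prj j x \<circ> h x)"
  proof (rule dual_basis.intro[OF F dual_basis_axioms.intro])
    fix j assume j: "j < length xs"
    show x: "xs ! j \<in> Ob C" by (rule xs_Ob[OF j])
    show "\<eta> (xs ! j) (inj j (xs ! j) (gen C (xs ! j))) \<in> sp F (xs ! j)"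
      by (intro \<eta>.in_sp x nt.in_sp[OF i[OF j]] gen_in)
    show "(\<lambda>x. prj j x \<circ> h x) \<in> nattrans C s F (pw (*)) (std_proj C (xs ! j))"
      by (rule nattrans_comp[OF h prj_nt[OF j]])
  next
    fix x u assume x: "x \<in> Ob C" and u: "u \<in> sp F x"
    have hw: "h x u \<in> sp (std_sum C xs) x" by (rule h.in_sp[OF x u])
    have "u = \<eta> x (\<Sum>j<length xs. inj j x (prj j x (h x u)))" using e[OF x u] sum_inj_prj[OF x hw] by simp
    also have "\<dots> = (\<Sum>j<length xs. \<eta> x (inj j x (prj j x (h x u))))"
      by (rule \<eta>.sum[OF x]) (intro nt.in_sp[OF i] nt.in_sp[OF p] x hw, auto)
    also have "\<dots> = (\<Sum>j<length xs. yon C s F (xs ! j) (\<eta> (xs ! j) (inj j (xs ! j) (gen C (xs ! j)))) x ((prj j x \<circ> h x) u))"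
    proof (rule sum.cong[OF refl])
      fix j assume "j \<in> {..<length xs}"
      then have j: "j < length xs" by simp
      show "\<eta> x (inj j x (prj j x (h x u))) = yon C s F (xs ! j) (\<eta> (xs ! j) (inj j (xs ! j) (gen C (xs ! j)))) x ((prj j x \<circ> h x) u)"
        using fun_cong[OF fun_cong[OF yon_unique[OF xs_Ob[OF j] F nattrans_comp[OF inj_nt[OF j] \<eta>]]], of x "prj j x (h x u)"]
        by (simp only: o_apply)
    qed
    finally show "u = (\<Sum>j<length xs. yon C s F (xs ! j) (\<eta> (xs ! j) (inj j (xs ! j) (gen C (xs ! j)))) x ((prj j x \<circ> h x) u))" .
  qed
  then show ?thesis unfolding fgproj_def by blast
qed

end

end

text \<open>\<open>projective\<close> solves lifting problems inside the ambient space
  \<open>'v\<close>, whereas the covering sum of standard projectives consists of functions on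
  \<open>nat \<times> 'm\<close>. The embedding \<open>e\<close> moves this sum into
  \<open>'v\<close>, where the cover can be split.\<close>

lemma fgproj_of_projective:
  fixes F :: "('o, 'm, 'v::ab_group_add) cmod" and s :: "'k::field \<Rightarrow> 'v \<Rightarrow> 'v"
    and e :: "(nat \<times> 'm \<Rightarrow> 'k) \<Rightarrow> 'v"
  assumes cat: "category C" and e: "transp (pw (*)) s e" and p: "projective C s F" and f: "finite_type C s F"
  shows "fgproj C s F"
proof -
  interpret category_loc C by (unfold_locales, rule cat)
  interpret e: transp "pw (*)" s e by (rule e)
  have F: "cmodule C s F" using p unfolding projective_def by (intro cmodule.intro cat e.vs_t) blast
  interpret F: cmodule C s F by (rule F)
  obtain xs \<eta> where xs: "set xs \<subseteq> Ob C" and \<eta>: "\<eta> \<in> nattrans C (pw (*)) (std_sum C xs) s F"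
    and su: "surjective C (std_sum C xs) F \<eta>" using f unfolding finite_type_def by blast
  note S = cmodule_std_sum[OF xs, where 'k = 'k]
  interpret \<eta>: nt C "pw (*)" "std_sum C xs" s F \<eta> by (rule ntI[OF S F \<eta>])
  let ?M = "transport_mod e (std_sum C xs)"
  interpret M: cmodule C s ?M by (rule e.transport_cmodule[OF S])
  define out where "out = restr_fam C ?M (\<lambda>x. inv e)"
  have out_e: "out x (e u) = u" if "x \<in> Ob C" "u \<in> sp (std_sum C xs) x" for x u
    using that by (simp add: out_def)
  have out: "out \<in> nattrans C s ?M (pw (*)) (std_sum C xs)"
    unfolding out_def
    by (rule nattrans_restrI[OF M.cmodule_axioms S])
      (auto simp: e.transport_sp e.l.add[symmetric] e.l.scale[symmetric] simp del: sp_std_sum)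
  interpret out: nt C s ?M "pw (*)" "std_sum C xs" out by (rule ntI[OF M.cmodule_axioms S out])
  have q: "(\<lambda>x. \<eta> x \<circ> out x) \<in> nattrans C s ?M s F" by (rule nattrans_comp[OF out \<eta>])
  have "surjective C ?M F (\<lambda>x. \<eta> x \<circ> out x)" unfolding surjective_def
  proof (intro ballI equalityI subsetI)
    fix x y assume x: "x \<in> Ob C" and "y \<in> sp F x"
    then obtain w where "w \<in> sp (std_sum C xs) x" "y = \<eta> x w" using su unfolding surjective_def by blast
    then show "y \<in> (\<eta> x \<circ> out x) ` sp ?M x" using x by (intro image_eqI[of _ _ "e w"]) (auto simp: out_e)
  qed (use \<eta>.in_sp out.in_sp in auto)
  then obtain h where h: "h \<in> nattrans C s F s ?M" "\<And>x. x \<in> Ob C \<Longrightarrow> (\<eta> x \<circ> out x) \<circ> h x = restr_fam C F (\<lambda>x u. u) x"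
    using p M.md F.md q F.nattrans_id unfolding projective_def by blast
  show ?thesis
  proof (rule fgproj_retract[OF xs F \<eta> nattrans_comp[OF h(1) out]])
    fix x u assume "x \<in> Ob C" "u \<in> sp F x"
    then show "\<eta> x ((out x \<circ> h x) u) = u" using fun_cong[OF h(2), of x u] by simp
  qed
qed

context dual_basis
begin

text \<open>Conversely, a dual basis exhibits \<open>F\<close> as a retract of a finite sum: the
  generators give \<open>cover\<close>, the coordinates give \<open>sect\<close>.\<close>

definition cover :: "'o \<Rightarrow> (nat \<times> 'm \<Rightarrow> 'k) \<Rightarrow> 'v" where
  "cover = (\<Sum>j<N. (\<lambda>x. yon C s F (xs j) (pe j) x \<circ> prj (map xs [0..<N]) j x))"

definition sect :: "'o \<Rightarrow> 'v \<Rightarrow> nat \<times> 'm \<Rightarrow> 'k" where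
  "sect x u = (\<lambda>(j, h). if j < N then ie j x u h else 0)"

lemma xs_list: "set (map xs [0..<N]) \<subseteq> Ob C"
  using xs by auto

lemma cover_nt: "cover \<in> nattrans C (pw (*)) (std_sum C (map xs [0..<N])) s F"
  unfolding cover_def
proof (rule nattrans_sum[OF cmodule_std_sum[OF xs_list] cmodule_axioms])
  fix j assume "j \<in> {..<N}"
  then have j: "j < N" by simp
  show "(\<lambda>x. yon C s F (xs j) (pe j) x \<circ> prj (map xs [0..<N]) j x) \<in> nattrans C (pw (*)) (std_sum C (map xs [0..<N])) s F"
    using prj_nt[OF xs_list, of j] j by (intro nattrans_comp[OF _ yon_nt[OF xs[OF j] pe[OF j]]]) simp
qed

lemma comp_sect: "comp_at j (sect x u) = (if j < N then ie j x u else 0)"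
  by (auto simp: comp_at_def sect_def fun_eq_iff)

lemma sect_nt: "sect \<in> nattrans C s F (pw (*)) (std_sum C (map xs [0..<N]))"
proof -
  have i: "sect x u \<in> sp (std_sum C (map xs [0..<N])) x" if "x \<in> Ob C" "u \<in> sp F x" for x u
    unfolding sp_std_sum comp_sect using nt.in_sp[OF ie_nt that] by (simp del: sp_std_proj)
  show ?thesis
  proof (rule nattransI[OF cmodule_axioms cmodule_std_sum[OF xs_list]])
    fix x y h u assume xy: "x \<in> Ob C" "y \<in> Ob C" "h \<in> Hom C x y" and u: "u \<in> sp F x"
    show "sect y (act F x y h u) = act (std_sum C (map xs [0..<N])) x y h (sect x u)"
      by (rule comp_at_eqI) (simp add: comp_sect comp_at_act[OF i[OF xy(1) u]] nt.natural[OF ie_nt xy] del: act_std_proj)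
  next
    fix x u v assume "x \<in> Ob C" "u \<in> sp F x" "v \<in> sp F x"
    then show "sect x (u + v) = sect x u + sect x v"
      by (intro comp_at_eqI) (simp add: comp_sect nt.add[OF ie_nt])
  next
    fix x u c assume "x \<in> Ob C" "u \<in> sp F x"
    then show "sect x (s c u) = pw (*) c (sect x u)"
      by (intro comp_at_eqI) (simp add: comp_sect nt.scale[OF ie_nt])
  next
    fix x u assume "x \<in> Ob C" "u \<notin> sp F x"
    then show "sect x u = 0"
      by (intro comp_at_eqI) (simp add: comp_sect nt.out[OF ie_nt])
  next
    fix x u assume "x \<notin> Ob C"
    then show "sect x u = 0"
      by (intro comp_at_eqI) (simp add: comp_sect nt.out_ob[OF ie_nt])
  qed (rule i)
qed

lemma cover_sect:
  assumes "x \<in> Ob C" "u \<in> sp F x"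
  shows "cover x (sect x u) = u"
proof -
  interpret se: nt C s F "pw (*)" "std_sum C (map xs [0..<N])" sect
    by (rule ntI[OF cmodule_axioms cmodule_std_sum[OF xs_list] sect_nt])
  have "prj (map xs [0..<N]) j x (sect x u) = ie j x u" if "j < N" for j
    unfolding prj_def[OF xs_list] using that assms se.in_sp[OF assms] by (simp add: comp_sect)
  then show ?thesis using expand[OF assms] by (simp add: cover_def sum_fun_apply)
qed

lemma finite_type: "finite_type C s F"
  unfolding finite_type_def
proof (intro conjI md exI[of _ "map xs [0..<N]"] bexI[OF _ cover_nt] xs_list)
  interpret se: nt C s F "pw (*)" "std_sum C (map xs [0..<N])" sect
    by (rule ntI[OF cmodule_axioms cmodule_std_sum[OF xs_list] sect_nt])
  interpret co: nt C "pw (*)" "std_sum C (map xs [0..<N])" s F cover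
    by (rule ntI[OF cmodule_std_sum[OF xs_list] cmodule_axioms cover_nt])
  show "surjective C (std_sum C (map xs [0..<N])) F cover"
    unfolding surjective_def
  proof (intro ballI equalityI subsetI)
    fix x u assume "x \<in> Ob C" "u \<in> sp F x"
    then show "u \<in> cover x ` sp (std_sum C (map xs [0..<N])) x"
      by (intro image_eqI[of _ _ "sect x u"]) (auto simp: cover_sect se.in_sp)
  qed (use co.in_sp in auto)
qed

end

section \<open>The bidual\<close>

abbreviation bidual :: "('o, 'm) cat \<Rightarrow> ('k::field \<Rightarrow> 'v \<Rightarrow> 'v) \<Rightarrow> ('o, 'm, 'v::ab_group_add) cmod
    \<Rightarrow> ('o, 'm, ('o \<Rightarrow> 'v \<Rightarrow> 'm \<Rightarrow> 'k) \<Rightarrow> 'k) cmod" where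
  "bidual C s F \<equiv> dual_mod Dscale (D_mod C s F)"

abbreviation Dsp :: "('o, 'm) cat \<Rightarrow> ('k::field \<Rightarrow> 'v \<Rightarrow> 'v) \<Rightarrow> ('o, 'm, 'v::ab_group_add) cmod
    \<Rightarrow> 'o \<Rightarrow> ('o \<Rightarrow> 'v \<Rightarrow> 'm \<Rightarrow> 'k) set" where
  "Dsp C s F x \<equiv> nattrans C s F (pw (*)) (std_proj C x)"

lemma sp_D_mod [simp]: "sp (D_mod C s F) x = Dsp C s F x"
  by (simp add: D_mod_def Let_def)

lemma act_D_mod [simp]: "\<xi> \<in> Dsp C s F x \<Longrightarrow> act (D_mod C s F) x y f \<xi> = (\<lambda>z. yoneda_map C y x f z \<circ> \<xi> z)"
  by (simp add: D_mod_def Let_def restr_def)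

lemma act_D_mod_out: "\<xi> \<notin> Dsp C s F x \<Longrightarrow> act (D_mod C s F) x y f \<xi> = 0"
  by (simp add: D_mod_def Let_def restr_def)

lemma sp_bidual: "sp (bidual C s F) x = linmaps Dscale (Dsp C s F x) (*) UNIV"
  by (simp add: dual_mod_def Let_def)

lemma act_bidual: "\<phi> \<in> sp (bidual C s F) x \<Longrightarrow> act (bidual C s F) x y f \<phi> = \<phi> \<circ> act (D_mod C s F) y x f"
  by (simp add: dual_mod_def Let_def restr_def)

lemma act_bidual_out: "\<phi> \<notin> sp (bidual C s F) x \<Longrightarrow> act (bidual C s F) x y f \<phi> = 0"
  by (simp add: dual_mod_def Let_def restr_def)

lemma bidualD:
  assumes "\<phi> \<in> sp (bidual C s F) x"
  shows "\<xi> \<in> Dsp C s F x \<Longrightarrow> \<zeta> \<in> Dsp C s F x \<Longrightarrow> \<phi> (\<xi> + \<zeta>) = \<phi> \<xi> + \<phi> \<zeta>"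
    and "\<xi> \<in> Dsp C s F x \<Longrightarrow> \<phi> (Dscale c \<xi>) = c * \<phi> \<xi>"
    and "\<xi> \<notin> Dsp C s F x \<Longrightarrow> \<phi> \<xi> = 0"
    and "\<phi> 0 = 0"
  using assms linmaps_zero[OF assms[unfolded sp_bidual]] unfolding sp_bidual by (auto simp: linmaps_def)

lemma bidualI:
  assumes "\<And>\<xi> \<zeta>. \<xi> \<in> Dsp C s F x \<Longrightarrow> \<zeta> \<in> Dsp C s F x \<Longrightarrow> \<phi> (\<xi> + \<zeta>) = \<phi> \<xi> + \<phi> \<zeta>"
    and "\<And>\<xi> c. \<xi> \<in> Dsp C s F x \<Longrightarrow> \<phi> (Dscale c \<xi>) = c * \<phi> \<xi>"
    and "\<And>\<xi>. \<xi> \<notin> Dsp C s F x \<Longrightarrow> \<phi> \<xi> = 0"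
  shows "\<phi> \<in> sp (bidual C s F) x"
  unfolding sp_bidual by (rule linmapsI) (use assms in auto)

lemma Dscale_apply: "Dscale c \<xi> = (\<lambda>x u. pw (*) c (\<xi> x u))"
  by (simp add: Dscale_def pw_def)

context cmodule
begin

lemma yon_sum:
  assumes x: "x \<in> Ob C" and q: "\<And>i. i \<in> I \<Longrightarrow> q i \<in> sp F x"
  shows "yon C s F x (sum q I) z p = (\<Sum>i\<in>I. yon C s F x (q i) z p)"
proof -
  have 0: "yon C s F x 0 z p = 0" using yon_scale[OF x zero_in[OF x], of 0 z p] by simp
  show ?thesis using q
  proof (induction I rule: infinite_finite_induct)
    case (insert a I)
    have "yon C s F x (q a + sum q I) z p = yon C s F x (q a) z p + yon C s F x (sum q I) z p"
      by (rule yon_add[OF x _ sum_in[OF x]]) (use insert in auto)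
    moreover have "yon C s F x (sum q I) z p = (\<Sum>i\<in>I. yon C s F x (q i) z p)"
      by (rule insert.IH) (use insert.prems in blast)
    ultimately show ?case unfolding sum.insert[OF insert.hyps(1,2)] by (simp only:)
  qed (simp_all add: 0)
qed

lemma Dsp_add: "x \<in> Ob C \<Longrightarrow> \<xi> \<in> Dsp C s F x \<Longrightarrow> \<zeta> \<in> Dsp C s F x \<Longrightarrow> \<xi> + \<zeta> \<in> Dsp C s F x"
  by (rule nattrans_add[OF cmodule_axioms cmodule_std_proj])

lemma Dsp_scale: "x \<in> Ob C \<Longrightarrow> \<xi> \<in> Dsp C s F x \<Longrightarrow> Dscale c \<xi> \<in> Dsp C s F x"
  unfolding Dscale_apply by (rule nattrans_scale[OF cmodule_axioms cmodule_std_proj])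

lemma Dsp_yoneda: "x \<in> Ob C \<Longrightarrow> y \<in> Ob C \<Longrightarrow> f \<in> Hom C x y \<Longrightarrow> \<xi> \<in> Dsp C s F y \<Longrightarrow>
    (\<lambda>z. yoneda_map C x y f z \<circ> \<xi> z) \<in> Dsp C s F x"
  by (rule nattrans_comp[OF _ yoneda_map_nt])

lemma Dsp_sum: "x \<in> Ob C \<Longrightarrow> (\<And>i. i \<in> I \<Longrightarrow> \<xi> i \<in> Dsp C s F x) \<Longrightarrow> sum \<xi> I \<in> Dsp C s F x"
  by (rule nattrans_sum[OF cmodule_axioms cmodule_std_proj])

lemma bidual_sum:
  assumes x: "x \<in> Ob C" and \<phi>: "\<phi> \<in> sp (bidual C s F) x" and i: "\<And>i. i \<in> I \<Longrightarrow> \<xi> i \<in> Dsp C s F x"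
  shows "\<phi> (sum \<xi> I) = (\<Sum>i\<in>I. \<phi> (\<xi> i))"
  using i
proof (induction I rule: infinite_finite_induct)
  case (insert a I)
  have "\<phi> (\<xi> a + sum \<xi> I) = \<phi> (\<xi> a) + \<phi> (sum \<xi> I)"
    by (rule bidualD(1)[OF \<phi> _ Dsp_sum[OF x]]) (use insert in auto)
  moreover have "\<phi> (sum \<xi> I) = (\<Sum>i\<in>I. \<phi> (\<xi> i))" by (rule insert.IH) (use insert.prems in blast)
  ultimately show ?case unfolding sum.insert[OF insert.hyps(1,2)] by (simp only:)
qed (simp_all add: bidualD(4)[OF \<phi>])

text \<open>The module laws are checked for the composite of \<open>D\<close> and the dual at once,
  without modules over the opposite category in between.\<close>

lemma cmodule_bidual: "cmodule C (pw (*)) (bidual C s F)"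
proof (rule cmoduleI[OF cat pwm.vector_space_axioms])
  fix x assume x: "x \<in> Ob C"
  show "0 \<in> sp (bidual C s F) x" by (rule bidualI) auto
  fix \<phi> assume \<phi>: "\<phi> \<in> sp (bidual C s F) x"
  note p = bidualD[OF \<phi>]
  show s\<phi>: "pw (*) c \<phi> \<in> sp (bidual C s F) x" for c
  proof (rule bidualI)
    show "pw (*) c \<phi> (\<xi> + \<zeta>) = pw (*) c \<phi> \<xi> + pw (*) c \<phi> \<zeta>"
      if "\<xi> \<in> Dsp C s F x" "\<zeta> \<in> Dsp C s F x" for \<xi> \<zeta>
      using p(1)[OF that] by (simp only: pw_def distrib_left)
    show "pw (*) c \<phi> (Dscale d \<xi>) = d * pw (*) c \<phi> \<xi>" if "\<xi> \<in> Dsp C s F x" for d \<xi>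
      using p(2)[OF that] by (simp only: pw_def mult.left_commute)
    show "pw (*) c \<phi> \<xi> = 0" if "\<xi> \<notin> Dsp C s F x" for \<xi>
      using p(3)[OF that] by (simp only: pw_def mult_zero_right)
  qed
  show a\<phi>: "\<phi> + \<psi> \<in> sp (bidual C s F) x" if "\<psi> \<in> sp (bidual C s F) x" for \<psi>
  proof (rule bidualI)
    note r = bidualD[OF that]
    show "(\<phi> + \<psi>) (\<xi> + \<zeta>) = (\<phi> + \<psi>) \<xi> + (\<phi> + \<psi>) \<zeta>"
      if "\<xi> \<in> Dsp C s F x" "\<zeta> \<in> Dsp C s F x" for \<xi> \<zeta>
      using p(1)[OF that] r(1)[OF that] by (simp only: plus_fun_apply ac_simps)
    show "(\<phi> + \<psi>) (Dscale d \<xi>) = d * (\<phi> + \<psi>) \<xi>" if "\<xi> \<in> Dsp C s F x" for d \<xi>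
      using p(2)[OF that] r(2)[OF that] by (simp only: plus_fun_apply distrib_left)
    show "(\<phi> + \<psi>) \<xi> = 0" if "\<xi> \<notin> Dsp C s F x" for \<xi>
      using p(3)[OF that] r(3)[OF that] by (simp only: plus_fun_apply add_0)
  qed
  show "act (bidual C s F) x x (Idn C x) \<phi> = \<phi>"
  proof
    fix \<xi>
    show "act (bidual C s F) x x (Idn C x) \<phi> \<xi> = \<phi> \<xi>"
    proof (cases "\<xi> \<in> Dsp C s F x")
      case True
      interpret \<xi>: nt C s F "pw (*)" "std_proj C x" \<xi> by (rule ntI[OF cmodule_axioms cmodule_std_proj[OF x] True])
      have "yoneda_map C x x (Idn C x) z (\<xi> z u) = \<xi> z u" for z u
      proof (cases "z \<in> Ob C \<and> u \<in> sp F z")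
        case zu: True
        then have i: "\<xi> z u \<in> sp (std_proj C x) z" by (intro \<xi>.in_sp) auto
        have "push (\<lambda>h. Cmp C x x z h (Idn C x)) (\<xi> z u) = push (\<lambda>h. h) (\<xi> z u)"
          by (rule push_cong) (use i zu x in auto)
        then show ?thesis using i zu by (simp add: yoneda_map_def push_id)
      next
        case False
        then have "\<xi> z u = 0" by auto
        then show ?thesis by (simp add: yoneda_map_def restr_fam_def)
      qed
      then have "(\<lambda>z. yoneda_map C x x (Idn C x) z \<circ> \<xi> z) = \<xi>" by (simp add: fun_eq_iff)
      then show ?thesis using True by (simp add: act_bidual[OF \<phi>])
    qed (simp add: act_bidual[OF \<phi>] act_D_mod_out p)
  qed
  fix y f assume y: "y \<in> Ob C" and f: "f \<in> Hom C x y"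
  have ya: "(\<lambda>z. yoneda_map C x y f z \<circ> (\<xi> + \<zeta>) z) = (\<lambda>z. yoneda_map C x y f z \<circ> \<xi> z) + (\<lambda>z. yoneda_map C x y f z \<circ> \<zeta> z)"
    if "\<xi> \<in> Dsp C s F y" "\<zeta> \<in> Dsp C s F y" for \<xi> \<zeta>
  proof (rule nattrans_eqI[OF Dsp_yoneda[OF x y f Dsp_add[OF y that]] Dsp_add[OF x Dsp_yoneda[OF x y f that(1)] Dsp_yoneda[OF x y f that(2)]]])
    interpret yo: nt C "pw (*)" "std_proj C y" "pw (*)" "std_proj C x" "yoneda_map C x y f"
      by (rule ntI[OF cmodule_std_proj[OF y] cmodule_std_proj[OF x] yoneda_map_nt[OF x y f]])
    fix z u assume z: "z \<in> Ob C" and u: "u \<in> sp F z"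
    have "\<xi> z u \<in> sp (std_proj C y) z" "\<zeta> z u \<in> sp (std_proj C y) z"
      using nt.in_sp[OF ntI[OF cmodule_axioms cmodule_std_proj[OF y]] z u] that by auto
    then show "(yoneda_map C x y f z \<circ> (\<xi> + \<zeta>) z) u =
       ((\<lambda>z. yoneda_map C x y f z \<circ> \<xi> z) + (\<lambda>z. yoneda_map C x y f z \<circ> \<zeta> z)) z u"
      using yo.add[OF z] by (simp del: sp_std_proj)
  qed
  have ys: "(\<lambda>z. yoneda_map C x y f z \<circ> Dscale c \<xi> z) = Dscale c (\<lambda>z. yoneda_map C x y f z \<circ> \<xi> z)"
    if "\<xi> \<in> Dsp C s F y" for \<xi> c
  proof (rule nattrans_eqI[OF Dsp_yoneda[OF x y f Dsp_scale[OF y that]] Dsp_scale[OF x Dsp_yoneda[OF x y f that]]])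
    interpret yo: nt C "pw (*)" "std_proj C y" "pw (*)" "std_proj C x" "yoneda_map C x y f"
      by (rule ntI[OF cmodule_std_proj[OF y] cmodule_std_proj[OF x] yoneda_map_nt[OF x y f]])
    fix z u assume z: "z \<in> Ob C" and u: "u \<in> sp F z"
    have "\<xi> z u \<in> sp (std_proj C y) z"
      using nt.in_sp[OF ntI[OF cmodule_axioms cmodule_std_proj[OF y]] z u] that by auto
    then show "(yoneda_map C x y f z \<circ> Dscale c \<xi> z) u = Dscale c (\<lambda>z. yoneda_map C x y f z \<circ> \<xi> z) z u"
      using yo.scale[OF z] by (simp add: Dscale_apply del: sp_std_proj)
  qed
  have af: "act (bidual C s F) x y f \<psi> \<xi> = (if \<xi> \<in> Dsp C s F y then \<psi> (\<lambda>z. yoneda_map C x y f z \<circ> \<xi> z) else 0)"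
    if "\<psi> \<in> sp (bidual C s F) x" for \<psi> \<xi>
    by (simp add: act_bidual[OF that] act_D_mod_out bidualD[OF that])
  show f\<phi>: "act (bidual C s F) x y f \<phi> \<in> sp (bidual C s F) y"
  proof (rule bidualI)
    fix \<xi> assume \<xi>: "\<xi> \<in> Dsp C s F y"
    show "act (bidual C s F) x y f \<phi> (\<xi> + \<zeta>) = act (bidual C s F) x y f \<phi> \<xi> + act (bidual C s F) x y f \<phi> \<zeta>"
      if \<zeta>: "\<zeta> \<in> Dsp C s F y" for \<zeta>
      using \<xi> \<zeta> by (simp only: af[OF \<phi>] Dsp_add[OF y] if_True ya p(1)[OF Dsp_yoneda[OF x y f \<xi>] Dsp_yoneda[OF x y f \<zeta>]])
    show "act (bidual C s F) x y f \<phi> (Dscale c \<xi>) = c * act (bidual C s F) x y f \<phi> \<xi>" for c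
      using \<xi> by (simp only: af[OF \<phi>] Dsp_scale[OF y] if_True ys p(2)[OF Dsp_yoneda[OF x y f \<xi>]])
  qed (simp only: af[OF \<phi>] if_False)
  show "act (bidual C s F) x y f (\<phi> + \<psi>) = act (bidual C s F) x y f \<phi> + act (bidual C s F) x y f \<psi>"
    if "\<psi> \<in> sp (bidual C s F) x" for \<psi>
    by (rule ext) (simp add: af[OF \<phi>] af[OF that] af[OF a\<phi>[OF that]])
  show "act (bidual C s F) x y f (pw (*) c \<phi>) = pw (*) c (act (bidual C s F) x y f \<phi>)" for c
    by (rule ext) (simp add: af[OF \<phi>] af[OF s\<phi>], simp add: pw_def af[OF \<phi>])
  fix w g assume w: "w \<in> Ob C" and g: "g \<in> Hom C y w"
  have gf: "Cmp C x y w g f \<in> Hom C x w" using x y w f g by simp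
  have c: "(\<lambda>z. yoneda_map C x w (Cmp C x y w g f) z \<circ> \<xi> z) = (\<lambda>z. yoneda_map C x y f z \<circ> (yoneda_map C y w g z \<circ> \<xi> z))"
    if "\<xi> \<in> Dsp C s F w" for \<xi>
  proof (rule nattrans_eqI[OF Dsp_yoneda[OF x w gf that] Dsp_yoneda[OF x y f Dsp_yoneda[OF y w g that]]])
    interpret yo: nt C "pw (*)" "std_proj C w" "pw (*)" "std_proj C y" "yoneda_map C y w g"
      by (rule ntI[OF cmodule_std_proj[OF w] cmodule_std_proj[OF y] yoneda_map_nt[OF y w g]])
    fix z u assume z: "z \<in> Ob C" and u: "u \<in> sp F z"
    have i: "\<xi> z u \<in> sp (std_proj C w) z"
      using nt.in_sp[OF ntI[OF cmodule_axioms cmodule_std_proj[OF w]] z u] that by auto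
    have j: "yoneda_map C y w g z (\<xi> z u) \<in> sp (std_proj C y) z" by (rule yo.in_sp[OF z i])
    have e: "yoneda_map C y w g z (\<xi> z u) = push (\<lambda>h. Cmp C y w z h g) (\<xi> z u)"
      unfolding yoneda_map_def by (rule restr_fam_apply(1)[OF z i])
    have "yoneda_map C x y f z (yoneda_map C y w g z (\<xi> z u)) = push (\<lambda>h. Cmp C x y z (Cmp C y w z h g) f) (\<xi> z u)"
      unfolding yoneda_map_def[of C x y f] e restr_fam_apply(1)[OF z j[unfolded e]] using i by (simp add: push_push)
    also have "\<dots> = push (\<lambda>h. Cmp C x w z h (Cmp C x y w g f)) (\<xi> z u)"
      by (rule push_cong) (use i x y w z f g Cmp_assoc in auto)
    also have "\<dots> = yoneda_map C x w (Cmp C x y w g f) z (\<xi> z u)"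
      unfolding yoneda_map_def[of C x w] restr_fam_apply(1)[OF z i] ..
    finally show "(yoneda_map C x w (Cmp C x y w g f) z \<circ> \<xi> z) u = (yoneda_map C x y f z \<circ> (yoneda_map C y w g z \<circ> \<xi> z)) u"
      by simp
  qed
  show "act (bidual C s F) x w (Cmp C x y w g f) \<phi> = act (bidual C s F) y w g (act (bidual C s F) x y f \<phi>)"
  proof
    fix \<xi>
    show "act (bidual C s F) x w (Cmp C x y w g f) \<phi> \<xi> = act (bidual C s F) y w g (act (bidual C s F) x y f \<phi>) \<xi>"
    proof (cases "\<xi> \<in> Dsp C s F w")
      case True
      have 1: "act (bidual C s F) y w g (act (bidual C s F) x y f \<phi>) \<xi> =
          act (bidual C s F) x y f \<phi> (\<lambda>z. yoneda_map C y w g z \<circ> \<xi> z)"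
        using True by (simp only: act_bidual[OF f\<phi>] o_apply act_D_mod)
      have 2: "act (bidual C s F) x w (Cmp C x y w g f) \<phi> \<xi> = \<phi> (\<lambda>z. yoneda_map C x w (Cmp C x y w g f) z \<circ> \<xi> z)"
        using True by (simp only: act_bidual[OF \<phi>] o_apply act_D_mod)
      show ?thesis unfolding 1 2 af[OF \<phi>] c[OF True] using Dsp_yoneda[OF y w g True] by (simp only: if_True)
    next
      case False
      then have "act (bidual C s F) y w g (act (bidual C s F) x y f \<phi>) \<xi> = 0"
        by (simp only: act_bidual[OF f\<phi>] o_apply act_D_mod_out not_False_eq_True bidualD(4)[OF f\<phi>])
      moreover have "act (bidual C s F) x w (Cmp C x y w g f) \<phi> \<xi> = 0"
        using False by (simp only: act_bidual[OF \<phi>] o_apply act_D_mod_out not_False_eq_True p(4))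
      ultimately show ?thesis by simp
    qed
  qed
qed (rule act_bidual_out)

end

lemma act_bidual_apply:
  assumes "\<phi> \<in> sp (bidual C s F) x"
  shows "act (bidual C s F) x y f \<phi> \<xi> = (if \<xi> \<in> Dsp C s F y then \<phi> (\<lambda>z. yoneda_map C x y f z \<circ> \<xi> z) else 0)"
  by (simp add: act_bidual[OF assms] act_D_mod_out bidualD[OF assms])

section \<open>The trace pairing\<close>

context dual_basis
begin

context
  fixes t :: "'k \<Rightarrow> 'w::ab_group_add \<Rightarrow> 'w" and G and \<tau>
  assumes \<tau>: "nt C t G (pw (*)) (bidual C s F) \<tau>"
begin

interpretation \<tau>: nt C t G "pw (*)" "bidual C s F" \<tau> by (rule \<tau>)

text \<open>Maps of this form span all maps \<open>F \<rightarrow> G\<close>, because \<open>F\<close> has a dual basis.\<close>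

lemma trace_rank_one:
  assumes x: "x \<in> Ob C" and q: "q \<in> sp G x" and \<xi>: "\<xi> \<in> Dsp C s F x"
  shows "(\<Sum>j<N. \<tau> (xs j) (yon C t G x q (xs j) (\<xi> (xs j) (pe j))) (ie j)) = \<tau> x q \<xi>"
proof -
  note P = cmodule_std_proj[OF x, where 'k = 'k]
  interpret P: cmodule C "pw (*)" "std_proj C x :: ('o, 'm, 'm \<Rightarrow> 'k) cmod" by (rule P)
  interpret \<xi>: nt C s F "pw (*)" "std_proj C x" \<xi> by (rule ntI[OF cmodule_axioms cmodule_std_proj[OF x] \<xi>])
  note b = bidualD[OF \<tau>.in_sp[OF x q]]
  have y: "(\<lambda>z. yon C (pw (*)) (std_proj C x) (xs j) c z \<circ> ie j z) \<in> Dsp C s F x"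
    if "j < N" "c \<in> sp (std_proj C x) (xs j)" for j c
    by (rule nattrans_comp[OF ie[OF that(1)] P.yon_nt[OF xs[OF that(1)] that(2)]])
  \<comment> \<open>Naturality of \<open>\<tau>\<close> turns the action of \<open>h\<close> on
    \<open>q\<close> into precomposition of the functional with \<open>yoneda_map\<close>, so each
    summand becomes \<open>\<tau> x q\<close> evaluated on a map through the coordinate
    \<open>ie j\<close>.\<close>
  have 1: "\<tau> (xs j) (yon C t G x q (xs j) c) (ie j) = \<tau> x q (\<lambda>z. yon C (pw (*)) (std_proj C x) (xs j) c z \<circ> ie j z)"
    if j: "j < N" and c: "c \<in> sp (std_proj C x) (xs j)" for j c
  proof -
    note xj = xs[OF j]
    have h: "h \<in> Hom C x (xs j)" if "c h \<noteq> 0" for h using c that by auto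
    have g: "gen C x \<in> sp (std_proj C x :: ('o, 'm, 'm \<Rightarrow> 'k) cmod) x" by (rule gen_in[OF x])
    have "\<tau> (xs j) (lin t c (\<lambda>h. act G x (xs j) h q)) = lin (pw (*)) c (\<lambda>h. \<tau> (xs j) (act G x (xs j) h q))"
      by (rule \<tau>.map_lin[OF xj]) (use h x xj q in auto)
    then have "\<tau> (xs j) (yon C t G x q (xs j) c) (ie j) = lin (pw (*)) c (\<lambda>h. act (bidual C s F) x (xs j) h (\<tau> x q)) (ie j)"
      unfolding \<tau>.F.yon_apply[OF x xj c]
      by (simp only:) (rule fun_cong[OF lin_cong], use h x xj \<tau>.natural in auto)
    also have "\<dots> = (\<Sum>h | c h \<noteq> 0. c h * \<tau> x q (\<lambda>z. yoneda_map C x (xs j) h z \<circ> ie j z))"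
      using ie[OF j] unfolding lin_def sum_fun_apply
      by (intro sum.cong) (simp_all add: pw_def act_bidual_apply[OF \<tau>.in_sp[OF x q]])
    also have "\<dots> = (\<Sum>h | c h \<noteq> 0. \<tau> x q (Dscale (c h) (\<lambda>z. yoneda_map C x (xs j) h z \<circ> ie j z)))"
      by (rule sum.cong) (use b(2) Dsp_yoneda[OF x xj h ie[OF j]] in auto)
    also have "\<dots> = \<tau> x q (\<Sum>h | c h \<noteq> 0. Dscale (c h) (\<lambda>z. yoneda_map C x (xs j) h z \<circ> ie j z))"
    proof -
      have "Dscale (c h) (\<lambda>z. yoneda_map C x (xs j) h z \<circ> ie j z) \<in> Dsp C s F x" if "h \<in> {h. c h \<noteq> 0}" for h
        using Dsp_scale[OF x Dsp_yoneda[OF x xj h ie[OF j]]] that by auto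
      from bidual_sum[OF x \<tau>.in_sp[OF x q], symmetric, OF this] show ?thesis .
    qed
    also have "(\<Sum>h | c h \<noteq> 0. Dscale (c h) (\<lambda>z. yoneda_map C x (xs j) h z \<circ> ie j z)) =
        (\<lambda>z. yon C (pw (*)) (std_proj C x) (xs j) c z \<circ> ie j z)"
    proof (rule nattrans_eqI[OF Dsp_sum[OF x] y[OF j c]])
      show "Dscale (c h) (\<lambda>z. yoneda_map C x (xs j) h z \<circ> ie j z) \<in> Dsp C s F x" if "h \<in> {h. c h \<noteq> 0}" for h
        using Dsp_scale[OF x Dsp_yoneda[OF x xj h ie[OF j]]] that by auto
      fix z u assume z: "z \<in> Ob C" and u: "u \<in> sp F z"
      have d: "ie j z u \<in> sp (std_proj C (xs j)) z" by (rule nt.in_sp[OF ie_nt[OF j] z u])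
      have "yon C (pw (*)) (std_proj C x) (xs j) (act (std_proj C x) x (xs j) h (gen C x)) z (ie j z u) =
         yoneda_map C x (xs j) h z (ie j z u)" if "c h \<noteq> 0" for h
      proof -
        have i: "yoneda_map C x (xs j) h z (ie j z u) \<in> sp (std_proj C x) z"
          by (rule nt.in_sp[OF ntI[OF cmodule_std_proj[OF xj] P yoneda_map_nt[OF x xj h[OF that]]] z d])
        have "yon C (pw (*)) (std_proj C x) x (gen C x) z p = p" if "p \<in> sp (std_proj C x) z" for p :: "'m \<Rightarrow> 'k"
          using std_proj_expand[OF x z that] P.yon_apply[OF x z that] by simp
        then show ?thesis using P.yon_act[OF x xj h[OF that] g z d] i by simp
      qed
      then have "(\<Sum>h | c h \<noteq> 0. pw (*) (c h) (yoneda_map C x (xs j) h z (ie j z u))) =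
        lin (pw (*)) c (\<lambda>h. yon C (pw (*)) (std_proj C x) (xs j) (act (std_proj C x) x (xs j) h (gen C x)) z (ie j z u))"
        unfolding lin_def by (intro sum.cong) auto
      also have "\<dots> = yon C (pw (*)) (std_proj C x) (xs j) c z (ie j z u)"
      proof -
        have a: "act (std_proj C x) x (xs j) h (gen C x :: 'm \<Rightarrow> 'k) \<in> sp (std_proj C x) (xs j)" if "c h \<noteq> 0" for h
          by (rule P.act_in[OF x xj h[OF that] g])
        have i: "pw (*) (c h) (act (std_proj C x) x (xs j) h (gen C x)) \<in> sp (std_proj C x) (xs j)" if "h \<in> {h. c h \<noteq> 0}" for h
          by (rule P.scale_in[OF xj a]) (use that in auto)
        have "yon C (pw (*)) (std_proj C x) (xs j) (\<Sum>h | c h \<noteq> 0. pw (*) (c h) (act (std_proj C x) x (xs j) h (gen C x))) z (ie j z u)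
          = (\<Sum>h | c h \<noteq> 0. yon C (pw (*)) (std_proj C x) (xs j) (pw (*) (c h) (act (std_proj C x) x (xs j) h (gen C x))) z (ie j z u))"
          by (rule P.yon_sum[OF xj i])
        also have "\<dots> = (\<Sum>h | c h \<noteq> 0. pw (*) (c h) (yon C (pw (*)) (std_proj C x) (xs j) (act (std_proj C x) x (xs j) h (gen C x)) z (ie j z u)))"
          by (rule sum.cong[OF refl], rule P.yon_scale[OF xj a]) simp
        finally have l: "yon C (pw (*)) (std_proj C x) (xs j) (\<Sum>h | c h \<noteq> 0. pw (*) (c h) (act (std_proj C x) x (xs j) h (gen C x))) z (ie j z u)
          = (\<Sum>h | c h \<noteq> 0. pw (*) (c h) (yon C (pw (*)) (std_proj C x) (xs j) (act (std_proj C x) x (xs j) h (gen C x)) z (ie j z u)))" .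
        have "lin (pw (*)) c (\<lambda>h. act (std_proj C x) x (xs j) h (gen C x)) = c"
          by (rule std_proj_expand[OF x xj c, symmetric])
        then show ?thesis using l unfolding lin_def by (simp only:)
      qed
      finally show "(\<Sum>h | c h \<noteq> 0. Dscale (c h) (\<lambda>z. yoneda_map C x (xs j) h z \<circ> ie j z)) z u =
          (yon C (pw (*)) (std_proj C x) (xs j) c z \<circ> ie j z) u"
        by (simp add: sum_fun_apply Dscale_apply)
    qed
    finally show ?thesis .
  qed
  have "(\<Sum>j<N. \<tau> (xs j) (yon C t G x q (xs j) (\<xi> (xs j) (pe j))) (ie j)) =
    (\<Sum>j<N. \<tau> x q (\<lambda>z. yon C (pw (*)) (std_proj C x) (xs j) (\<xi> (xs j) (pe j)) z \<circ> ie j z))"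
    by (rule sum.cong) (use 1 \<xi>.in_sp xs pe in auto)
  also have "\<dots> = \<tau> x q (\<Sum>j<N. (\<lambda>z. yon C (pw (*)) (std_proj C x) (xs j) (\<xi> (xs j) (pe j)) z \<circ> ie j z))"
  proof -
    have "(\<lambda>z. yon C (pw (*)) (std_proj C x) (xs j) (\<xi> (xs j) (pe j)) z \<circ> ie j z) \<in> Dsp C s F x" if "j \<in> {..<N}" for j
      by (rule y) (use that \<xi>.in_sp[OF xs pe] in auto)
    from bidual_sum[OF x \<tau>.in_sp[OF x q], symmetric, OF this] show ?thesis .
  qed
  \<comment> \<open>This is the dual basis expansion of \<open>\<xi>\<close>.\<close>
  also have "(\<Sum>j<N. (\<lambda>z. yon C (pw (*)) (std_proj C x) (xs j) (\<xi> (xs j) (pe j)) z \<circ> ie j z)) = \<xi>"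
    by (intro ext) (simp add: sum_fun_apply nattrans_expand[OF P \<xi>, symmetric])
  finally show ?thesis .
qed

end

text \<open>The expansion of \<open>f\<close> in the dual basis reduces an additive functional to
  maps that factor through one standard projective; on such maps \<open>trace_rank_one\<close>
  evaluates the trace.\<close>

lemma functional_expand:
  assumes G: "cmodule C t G" and f: "f \<in> nattrans C s F t G"
    and add: "\<And>g h. g \<in> nattrans C s F t G \<Longrightarrow> h \<in> nattrans C s F t G \<Longrightarrow> T (g + h) = T g + (T h :: 'k)"
    and zero: "T 0 = 0"
  shows "T f = (\<Sum>j<N. T (\<lambda>z. yon C t G (xs j) (f (xs j) (pe j)) z \<circ> ie j z))"
proof -
  interpret G: cmodule C t G by (rule G)
  interpret f: nt C s F t G f by (rule ntI[OF cmodule_axioms G f])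
  have i: "(\<lambda>z. yon C t G (xs j) (f (xs j) (pe j)) z \<circ> ie j z) \<in> nattrans C s F t G" if "j < N" for j
    by (rule nattrans_comp[OF ie[OF that] G.yon_nt[OF xs[OF that] f.in_sp[OF xs[OF that] pe[OF that]]]])
  have 1: "T (\<Sum>j<n. (\<lambda>z. yon C t G (xs j) (f (xs j) (pe j)) z \<circ> ie j z)) =
      (\<Sum>j<n. T (\<lambda>z. yon C t G (xs j) (f (xs j) (pe j)) z \<circ> ie j z))" if "n \<le> N" for n using that
  proof (induction n)
    case (Suc n)
    have "(\<Sum>j<n. (\<lambda>z. yon C t G (xs j) (f (xs j) (pe j)) z \<circ> ie j z)) \<in> nattrans C s F t G"
      by (rule nattrans_sum[OF cmodule_axioms G i]) (use Suc in auto)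
    from add[OF this i[of n]] show ?case using Suc by (simp only: sum.lessThan_Suc Suc_leD)
  qed (simp add: zero)
  have 2: "(\<Sum>j<N. (\<lambda>z. yon C t G (xs j) (f (xs j) (pe j)) z \<circ> ie j z)) = f"
    by (intro ext) (simp add: sum_fun_apply nattrans_expand[OF G f, symmetric])
  show ?thesis using 1[OF order_refl] unfolding 2 .
qed

end

section \<open>The trace\<close>

definition the_basis :: "('o, 'm) cat \<Rightarrow> ('k::field \<Rightarrow> 'v \<Rightarrow> 'v) \<Rightarrow> ('o, 'm, 'v::ab_group_add) cmod
    \<Rightarrow> nat \<times> (nat \<Rightarrow> 'o) \<times> (nat \<Rightarrow> 'v) \<times> (nat \<Rightarrow> 'o \<Rightarrow> 'v \<Rightarrow> 'm \<Rightarrow> 'k)" where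
  "the_basis C s F = (SOME (N, xs, pe, ie). dual_basis C s F N xs pe ie)"

text \<open>The trace of \<open>\<tau>\<close> composed with \<open>f\<close>, computed in a chosen
  dual basis. It does not depend on the choice: by \<open>trace_yon\<close> and
  \<open>trace_functional\<close> it is the unique additive functional with value
  \<open>\<tau> x q \<xi>\<close> on the map through \<open>q\<close> and
  \<open>\<xi>\<close>.\<close>

definition trace :: "('o, 'm) cat \<Rightarrow> ('k::field \<Rightarrow> 'v \<Rightarrow> 'v) \<Rightarrow> ('o, 'm, 'v::ab_group_add) cmod
    \<Rightarrow> ('o \<Rightarrow> 'w \<Rightarrow> ('o \<Rightarrow> 'v \<Rightarrow> 'm \<Rightarrow> 'k) \<Rightarrow> 'k) \<Rightarrow> ('o \<Rightarrow> 'v \<Rightarrow> 'w) \<Rightarrow> 'k" where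
  "trace C s F \<tau> f = (case the_basis C s F of (N, xs, pe, ie) \<Rightarrow>
     (\<Sum>j<N. \<tau> (xs j) (f (xs j) (pe j)) (ie j)))"

lemma the_basis:
  assumes "fgproj C s F"
  obtains N xs pe ie where "dual_basis C s F N xs pe ie" "the_basis C s F = (N, xs, pe, ie)"
proof -
  have "\<exists>b. case b of (N, xs, pe, ie) \<Rightarrow> dual_basis C s F N xs pe ie" using assms by (auto simp: fgproj_def)
  from someI_ex[OF this] that show ?thesis unfolding the_basis_def by (auto split: prod.splits)
qed

lemma trace_eq: "the_basis C s F = (N, xs, pe, ie) \<Longrightarrow> trace C s F \<tau> f = (\<Sum>j<N. \<tau> (xs j) (f (xs j) (pe j)) (ie j))"
  by (simp add: trace_def)

context
  fixes C :: "('o, 'm) cat" and s :: "'k::field \<Rightarrow> 'v::ab_group_add \<Rightarrow> 'v" and F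
    and t :: "'k \<Rightarrow> 'w::ab_group_add \<Rightarrow> 'w" and G and \<tau>
  assumes F: "cmodule C s F" and fg: "fgproj C s F" and \<tau>: "nt C t G (pw (*)) (bidual C s F) \<tau>"
begin

interpretation F: cmodule C s F by (rule F)
interpretation \<tau>: nt C t G "pw (*)" "bidual C s F" \<tau> by (rule \<tau>)

lemma trace_yon: "x \<in> Ob C \<Longrightarrow> q \<in> sp G x \<Longrightarrow> \<xi> \<in> Dsp C s F x \<Longrightarrow>
   trace C s F \<tau> (\<lambda>z. yon C t G x q z \<circ> \<xi> z) = \<tau> x q \<xi>"
  by (rule the_basis[OF fg]) (simp add: trace_eq dual_basis.trace_rank_one[OF _ \<tau>])

lemma trace_add: "f \<in> nattrans C s F t G \<Longrightarrow> g \<in> nattrans C s F t G \<Longrightarrow>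
   trace C s F \<tau> (f + g) = trace C s F \<tau> f + trace C s F \<tau> g"
proof (rule the_basis[OF fg])
  fix N xs pe ie assume b: "dual_basis C s F N xs pe ie"
    and the: "the_basis C s F = (N, xs, pe, ie)"
    and f: "f \<in> nattrans C s F t G" and g: "g \<in> nattrans C s F t G"
  interpret dual_basis C s F N xs pe ie by (rule b)
  have "f (xs j) (pe j) \<in> sp G (xs j)" "g (xs j) (pe j) \<in> sp G (xs j)" if "j < N" for j
    using nt.in_sp[OF ntI[OF F \<tau>.F.cmodule_axioms] xs[OF that] pe[OF that]] f g by auto
  then show ?thesis by (simp add: trace_eq[OF the] xs sum.distrib)
qed

lemma trace_scale: "f \<in> nattrans C s F t G \<Longrightarrow>
   trace C s F \<tau> (\<lambda>x u. t c (f x u)) = c * trace C s F \<tau> f"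
proof (rule the_basis[OF fg])
  fix N xs pe ie assume b: "dual_basis C s F N xs pe ie"
    and the: "the_basis C s F = (N, xs, pe, ie)"
    and f: "f \<in> nattrans C s F t G"
  interpret dual_basis C s F N xs pe ie by (rule b)
  have "f (xs j) (pe j) \<in> sp G (xs j)" if "j < N" for j
    using nt.in_sp[OF ntI[OF F \<tau>.F.cmodule_axioms] xs[OF that] pe[OF that]] f by auto
  then show ?thesis by (simp add: trace_eq[OF the] xs sum_distrib_left pw_def)
qed

lemma trace_zero: "trace C s F \<tau> 0 = 0"
  by (rule the_basis[OF fg]) (simp add: trace_eq)

lemma trace_functional:
  assumes f: "f \<in> nattrans C s F t G"
    and add: "\<And>g h. g \<in> nattrans C s F t G \<Longrightarrow> h \<in> nattrans C s F t G \<Longrightarrow> T (g + h) = T g + T h"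
    and zero: "T 0 = 0"
    and yon: "\<And>x q \<xi>. x \<in> Ob C \<Longrightarrow> q \<in> sp G x \<Longrightarrow> \<xi> \<in> Dsp C s F x \<Longrightarrow> T (\<lambda>z. yon C t G x q z \<circ> \<xi> z) = \<tau> x q \<xi>"
  shows "T f = trace C s F \<tau> f"
proof (rule the_basis[OF fg])
  fix N xs pe ie assume b: "dual_basis C s F N xs pe ie"
    and the: "the_basis C s F = (N, xs, pe, ie)"
  interpret dual_basis C s F N xs pe ie by (rule b)
  interpret f: nt C s F t G f by (rule ntI[OF F \<tau>.F.cmodule_axioms f])
  have "T f = (\<Sum>j<N. T (\<lambda>z. yon C t G (xs j) (f (xs j) (pe j)) z \<circ> ie j z))"
    by (rule functional_expand[OF \<tau>.F.cmodule_axioms f]) (rule add zero; assumption)+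
  also have "\<dots> = trace C s F \<tau> f" unfolding trace_eq[OF the]
    by (rule sum.cong) (use yon xs pe ie f.in_sp in auto)
  finally show ?thesis .
qed

text \<open>Both sides are additive in \<open>f\<close>, so the dual basis of \<open>F'\<close>
  reduces the claim to maps through one standard projective. There \<open>trace_yon\<close>
  evaluates the left side, and hypothesis \<open>e\<close>, the compatibility of
  \<open>\<tau>\<close> and \<open>\<tau>'\<close> with \<open>d\<close> and \<open>g\<close>, turns
  the value into a term of the right side.\<close>

lemma trace_cyclic:
  fixes F' :: "('o, 'm, 'a::ab_group_add) cmod" and s' :: "'k \<Rightarrow> 'a \<Rightarrow> 'a"
    and t' :: "'k \<Rightarrow> 'b::ab_group_add \<Rightarrow> 'b"
  assumes F': "cmodule C s' F'" and fg': "fgproj C s' F'" and \<tau>': "nt C t' G' (pw (*)) (bidual C s' F') \<tau>'"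
    and g: "g \<in> nattrans C s F s' F'" and d: "d \<in> nattrans C t G t' G'"
    and e: "\<And>x q \<xi>. x \<in> Ob C \<Longrightarrow> q \<in> sp G x \<Longrightarrow> \<xi> \<in> Dsp C s' F' x \<Longrightarrow>
      \<tau>' x (d x q) \<xi> = \<tau> x q (\<lambda>z. \<xi> z \<circ> g z)"
    and f: "f \<in> nattrans C s' F' t G"
  shows "trace C s F \<tau> (\<lambda>x. f x \<circ> g x) = trace C s' F' \<tau>' (\<lambda>x. d x \<circ> f x)"
proof (rule the_basis[OF fg'])
  fix N xs pe ie assume b: "dual_basis C s' F' N xs pe ie"
    and the: "the_basis C s' F' = (N, xs, pe, ie)"
  interpret b: dual_basis C s' F' N xs pe ie by (rule b)
  interpret f: nt C s' F' t G f by (rule ntI[OF F' \<tau>.F.cmodule_axioms f])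
  have fg_in: "(\<lambda>x. h x \<circ> g x) \<in> nattrans C s F t G" if "h \<in> nattrans C s' F' t G" for h
    by (rule nattrans_comp[OF g that])
  have "trace C s F \<tau> (\<lambda>x. f x \<circ> g x) = (\<Sum>j<N. trace C s F \<tau> (\<lambda>x. (yon C t G (xs j) (f (xs j) (pe j)) x \<circ> ie j x) \<circ> g x))"
  proof (rule b.functional_expand[OF \<tau>.F.cmodule_axioms f, where T = "\<lambda>f. trace C s F \<tau> (\<lambda>x. f x \<circ> g x)"])
    fix h k assume "h \<in> nattrans C s' F' t G" "k \<in> nattrans C s' F' t G"
    then have "trace C s F \<tau> ((\<lambda>x. h x \<circ> g x) + (\<lambda>x. k x \<circ> g x)) = trace C s F \<tau> (\<lambda>x. h x \<circ> g x) + trace C s F \<tau> (\<lambda>x. k x \<circ> g x)"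
      using trace_add fg_in by blast
    moreover have "(\<lambda>x. h x \<circ> g x) + (\<lambda>x. k x \<circ> g x) = (\<lambda>x. (h + k) x \<circ> g x)" by (simp add: fun_eq_iff)
    ultimately show "trace C s F \<tau> (\<lambda>x. (h + k) x \<circ> g x) = trace C s F \<tau> (\<lambda>x. h x \<circ> g x) + trace C s F \<tau> (\<lambda>x. k x \<circ> g x)"
      by simp
  next
    have "(\<lambda>x. (0 :: 'o \<Rightarrow> 'a \<Rightarrow> 'w) x \<circ> g x) = 0" by (simp add: fun_eq_iff)
    then show "trace C s F \<tau> (\<lambda>x. (0 :: 'o \<Rightarrow> 'a \<Rightarrow> 'w) x \<circ> g x) = 0" by (simp add: trace_zero)
  qed
  also have "\<dots> = (\<Sum>j<N. \<tau> (xs j) (f (xs j) (pe j)) (\<lambda>z. ie j z \<circ> g z))"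
  proof (rule sum.cong[OF refl])
    fix j assume "j \<in> {..<N}"
    then have j: "j < N" by simp
    show "trace C s F \<tau> (\<lambda>x. (yon C t G (xs j) (f (xs j) (pe j)) x \<circ> ie j x) \<circ> g x) = \<tau> (xs j) (f (xs j) (pe j)) (\<lambda>z. ie j z \<circ> g z)"
      using trace_yon[OF b.xs[OF j] f.in_sp[OF b.xs[OF j] b.pe[OF j]] nattrans_comp[OF g b.ie[OF j]]]
      by (simp add: comp_assoc)
  qed
  also have "\<dots> = trace C s' F' \<tau>' (\<lambda>x. d x \<circ> f x)" unfolding trace_eq[OF the]
    by (rule sum.cong) (use e b.xs b.pe b.ie f.in_sp in auto)
  finally show ?thesis .
qed

end

text \<open>Here it matters that the scalars form a field: a functional is prescribed on a basis of
  the image of \<open>L\<close> and extended to the whole space. With the identity for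
  \<open>L\<close>, the lemma extends functionals from chain maps to all graded families.\<close>

lemma functional_factor:
  fixes L :: "'a::ab_group_add \<Rightarrow> 'b::ab_group_add" and \<Phi> :: "'a \<Rightarrow> 'k::field"
  assumes sb: "vector_space sb"
    and V: "0 \<in> V" "\<And>u v. u \<in> V \<Longrightarrow> v \<in> V \<Longrightarrow> u + v \<in> V" "\<And>c u. u \<in> V \<Longrightarrow> sa c u \<in> V"
    and L: "\<And>u v. u \<in> V \<Longrightarrow> v \<in> V \<Longrightarrow> L (u + v) = L u + L v" "\<And>c u. u \<in> V \<Longrightarrow> L (sa c u) = sb c (L u)"
    and \<Phi>: "\<And>u v. u \<in> V \<Longrightarrow> v \<in> V \<Longrightarrow> \<Phi> (u + v) = \<Phi> u + \<Phi> v" "\<And>c u. u \<in> V \<Longrightarrow> \<Phi> (sa c u) = c * \<Phi> u"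
    and ker: "\<And>u. u \<in> V \<Longrightarrow> L u = 0 \<Longrightarrow> \<Phi> u = 0"
  shows "\<exists>\<psi>. Vector_Spaces.linear sb (*) \<psi> \<and> (\<forall>v\<in>V. \<psi> (L v) = \<Phi> v)"
proof -
  interpret b: vector_space sb by (rule sb)
  interpret p: vector_space_pair sb "(*) :: 'k \<Rightarrow> _" by unfold_locales
  obtain B where B: "B \<subseteq> L ` V" "b.independent B" "L ` V \<subseteq> b.span B"
    using b.maximal_independent_subset by blast
  define g where "g = (\<lambda>b. \<Phi> (SOME v. v \<in> V \<and> L v = b))"
  define \<psi> where "\<psi> = p.construct B g"
  have lin: "Vector_Spaces.linear sb (*) \<psi>" unfolding \<psi>_def by (rule p.linear_construct[OF B(2)])
  have "\<Phi> 0 + \<Phi> 0 = \<Phi> 0" using \<Phi>(1)[OF V(1) V(1)] by (simp only: add_0)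
  then have "\<Phi> 0 = 0" by (metis add_cancel_left_left)
  moreover have "L 0 = 0" using L(1)[OF V(1) V(1)] by simp
  ultimately have 00: "L 0 = 0" "\<Phi> 0 = 0" by simp_all
  have *: "\<exists>v\<in>V. L v = w \<and> \<psi> w = \<Phi> v" if "w \<in> b.span B" for w
    using that
  proof (induction rule: b.span_induct_alt)
    case base
    show ?case by (rule bexI[OF _ V(1)]) (simp only: 00 p.linear_0[OF lin] simp_thms)
  next
    case (step c x y)
    then obtain v where v: "v \<in> V" "L v = y" "\<psi> y = \<Phi> v" by blast
    define u where "u = (SOME v. v \<in> V \<and> L v = x)"
    have "\<exists>v. v \<in> V \<and> L v = x" using B(1) step by blast
    then have u: "u \<in> V" "L u = x" unfolding u_def by (metis (mono_tags, lifting) someI_ex)+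
    have "\<psi> x = \<Phi> u" unfolding \<psi>_def p.construct_basis[OF B(2) step(1)] g_def u_def ..
    then have "\<psi> (sb c x + y) = \<Phi> (sa c u + v)"
      using v u V \<Phi> by (simp add: p.linear_add[OF lin] p.linear_scale[OF lin])
    then show ?case using v u V L by (intro bexI[of _ "sa c u + v"]) auto
  qed
  have "\<psi> (L v) = \<Phi> v" if v: "v \<in> V" for v
  proof -
    obtain v' where v': "v' \<in> V" "L v' = L v" "\<psi> (L v) = \<Phi> v'" using * v B(3) by blast
    have m: "L (sa (-1) v) = - L v" "\<Phi> (sa (-1) v) = - \<Phi> v" using L(2)[OF v] \<Phi>(2)[OF v] by simp_all
    have "L (v' + sa (-1) v) = 0" "\<Phi> (v' + sa (-1) v) = \<Phi> v' - \<Phi> v"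
      using L(1)[OF v'(1) V(3)[OF v]] \<Phi>(1)[OF v'(1) V(3)[OF v]] m v' by simp_all
    then show ?thesis using ker[OF V(2)[OF v'(1) V(3)[OF v]]] v' by simp
  qed
  then show ?thesis using lin by blast
qed

section \<open>Functoriality of the bidual\<close>

text \<open>The two contravariant functors composed and applied to \<open>g\<close>: precomposition
  with \<open>g\<close> on \<open>D\<close>, dualised, is covariant in \<open>g\<close>.\<close>

definition bidual_map :: "('o, 'm) cat \<Rightarrow> ('k::field \<Rightarrow> 'v \<Rightarrow> 'v) \<Rightarrow> ('o, 'm, 'v::ab_group_add) cmod
    \<Rightarrow> ('k \<Rightarrow> 'w \<Rightarrow> 'w) \<Rightarrow> ('o, 'm, 'w::ab_group_add) cmod \<Rightarrow> ('o \<Rightarrow> 'v \<Rightarrow> 'w)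
    \<Rightarrow> 'o \<Rightarrow> (('o \<Rightarrow> 'v \<Rightarrow> 'm \<Rightarrow> 'k) \<Rightarrow> 'k) \<Rightarrow> ('o \<Rightarrow> 'w \<Rightarrow> 'm \<Rightarrow> 'k) \<Rightarrow> 'k" where
  "bidual_map C s F t G g = restr_fam C (bidual C s F)
     (\<lambda>x \<phi> \<xi>. if \<xi> \<in> Dsp C t G x then \<phi> (\<lambda>z. \<xi> z \<circ> g z) else 0)"

lemma bidual_map_apply:
  "x \<in> Ob C \<Longrightarrow> \<phi> \<in> sp (bidual C s F) x \<Longrightarrow>
    bidual_map C s F t G g x \<phi> \<xi> = (if \<xi> \<in> Dsp C t G x then \<phi> (\<lambda>z. \<xi> z \<circ> g z) else 0)"
  by (simp add: bidual_map_def)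

lemma Dsp_pre: "g \<in> nattrans C s F t G \<Longrightarrow> \<xi> \<in> Dsp C t G x \<Longrightarrow> (\<lambda>z. \<xi> z \<circ> g z) \<in> Dsp C s F x"
  by (rule nattrans_comp)

lemma bidual_map_nt:
  assumes F: "cmodule C s F" and G: "cmodule C t G" and g: "g \<in> nattrans C s F t G"
  shows "bidual_map C s F t G g \<in> nattrans C (pw (*)) (bidual C s F) (pw (*)) (bidual C t G)"
  unfolding bidual_map_def
proof (rule nattrans_restrI[OF cmodule.cmodule_bidual[OF F] cmodule.cmodule_bidual[OF G]])
  interpret F: cmodule C s F by (rule F)
  interpret G: cmodule C t G by (rule G)
  fix x \<phi> assume x: "x \<in> Ob C" and \<phi>: "\<phi> \<in> sp (bidual C s F) x"
  note p = bidualD[OF \<phi>]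
  let ?b = "\<lambda>x (\<phi> :: ('a \<Rightarrow> 'd \<Rightarrow> 'b \<Rightarrow> 'c) \<Rightarrow> 'c) \<xi>. if \<xi> \<in> Dsp C t G x then \<phi> (\<lambda>z. \<xi> z \<circ> g z) else 0"
  show b: "?b x \<phi> \<in> sp (bidual C t G) x"
  proof (rule bidualI)
    fix \<xi> assume \<xi>: "\<xi> \<in> Dsp C t G x"
    show "?b x \<phi> (\<xi> + \<zeta>) = ?b x \<phi> \<xi> + ?b x \<phi> \<zeta>" if \<zeta>: "\<zeta> \<in> Dsp C t G x" for \<zeta>
    proof -
      have "(\<lambda>z. (\<xi> + \<zeta>) z \<circ> g z) = (\<lambda>z. \<xi> z \<circ> g z) + (\<lambda>z. \<zeta> z \<circ> g z)" by (simp add: fun_eq_iff)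
      then show ?thesis using \<xi> \<zeta> G.Dsp_add[OF x \<xi> \<zeta>] p(1)[OF Dsp_pre[OF g \<xi>] Dsp_pre[OF g \<zeta>]] by (simp only: if_True)
    qed
    show "?b x \<phi> (Dscale c \<xi>) = c * ?b x \<phi> \<xi>" for c
    proof -
      have "(\<lambda>z. Dscale c \<xi> z \<circ> g z) = Dscale c (\<lambda>z. \<xi> z \<circ> g z)" by (simp add: fun_eq_iff Dscale_apply)
      then show ?thesis using \<xi> G.Dsp_scale[OF x \<xi>] p(2)[OF Dsp_pre[OF g \<xi>]] by (simp only: if_True)
    qed
  qed simp
  show "?b x (\<phi> + \<psi>) = ?b x \<phi> + ?b x \<psi>" for \<psi> by (simp add: fun_eq_iff)
  show "?b x (pw (*) c \<phi>) = pw (*) c (?b x \<phi>)" for c by (simp add: fun_eq_iff pw_def)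
  fix y h assume y: "y \<in> Ob C" and h: "h \<in> Hom C x y"
  show "?b y (act (bidual C s F) x y h \<phi>) = act (bidual C t G) x y h (?b x \<phi>)"
  proof
    fix \<xi>
    show "?b y (act (bidual C s F) x y h \<phi>) \<xi> = act (bidual C t G) x y h (?b x \<phi>) \<xi>"
    proof (cases "\<xi> \<in> Dsp C t G y")
      case True
      then show ?thesis
        unfolding act_bidual_apply[OF b] act_bidual_apply[OF \<phi>]
        using Dsp_pre[OF g True] G.Dsp_yoneda[OF x y h True] by (simp only: if_True comp_assoc)
    next
      case False
      then show ?thesis unfolding act_bidual_apply[OF b] by (simp only: if_False)
    qed
  qed
qed

lemma bidual_map_comp:
  assumes x: "x \<in> Ob C" and F: "cmodule C s F" and G: "cmodule C t G" and f: "f \<in> nattrans C s F t G" and g: "g \<in> nattrans C t G r H"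
    and \<phi>: "\<phi> \<in> sp (bidual C s F) x"
  shows "bidual_map C t G r H g x (bidual_map C s F t G f x \<phi>) = bidual_map C s F r H (\<lambda>z. g z \<circ> f z) x \<phi>"
proof
  fix \<xi>
  have b: "bidual_map C s F t G f x \<phi> \<in> sp (bidual C t G) x"
    using nt.in_sp[OF ntI[OF cmodule.cmodule_bidual[OF F] cmodule.cmodule_bidual[OF G] bidual_map_nt[OF F G f]] x \<phi>] .
  show "bidual_map C t G r H g x (bidual_map C s F t G f x \<phi>) \<xi> = bidual_map C s F r H (\<lambda>z. g z \<circ> f z) x \<phi> \<xi>"
    unfolding bidual_map_apply[OF x b] bidual_map_apply[OF x \<phi>] using Dsp_pre[OF g] by (simp add: comp_assoc)
qed

definition bic :: "('o, 'm) cat \<Rightarrow> ('k::field \<Rightarrow> 'v \<Rightarrow> 'v) \<Rightarrow> ('o, 'm, 'v::ab_group_add) cpx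
    \<Rightarrow> ('o, 'm, ('o \<Rightarrow> 'v \<Rightarrow> 'm \<Rightarrow> 'k) \<Rightarrow> 'k) cpx" where
  "bic C s P = dual_cpx C Dscale (D_cpx C s P)"

definition bic_map :: "('o, 'm) cat \<Rightarrow> ('k::field \<Rightarrow> 'v \<Rightarrow> 'v) \<Rightarrow> ('o, 'm, 'v::ab_group_add) cpx \<Rightarrow> ('o, 'm, 'v) cpx
    \<Rightarrow> (int \<Rightarrow> 'o \<Rightarrow> 'v \<Rightarrow> 'v) \<Rightarrow> int \<Rightarrow> 'o \<Rightarrow> (('o \<Rightarrow> 'v \<Rightarrow> 'm \<Rightarrow> 'k) \<Rightarrow> 'k) \<Rightarrow> ('o \<Rightarrow> 'v \<Rightarrow> 'm \<Rightarrow> 'k) \<Rightarrow> 'k" where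
  "bic_map C s P Q g = dual_map C Dscale (D_cpx C s P) (D_map C s Q g)"

lemma cx_bic [simp]: "cx (bic C s P) n = bidual C s (cx P n)"
  by (simp add: bic_def dual_cpx_def D_cpx_def)

lemma dual_of_D:
  "restr_fam C (bidual C s F) (\<lambda>x \<phi>. \<phi> \<circ> restr_fam C (D_mod C t G) (\<lambda>x \<eta> z. \<eta> z \<circ> g z) x) = bidual_map C s F t G g"
proof (intro ext)
  fix x \<phi> \<xi>
  show "restr_fam C (bidual C s F) (\<lambda>x \<phi>. \<phi> \<circ> restr_fam C (D_mod C t G) (\<lambda>x \<eta> z. \<eta> z \<circ> g z) x) x \<phi> \<xi> = bidual_map C s F t G g x \<phi> \<xi>"
  proof (cases "x \<in> Ob C \<and> \<phi> \<in> sp (bidual C s F) x")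
    case True
    then have *: "x \<in> Ob C" "\<phi> \<in> sp (bidual C s F) x" by auto
    show ?thesis unfolding bidual_map_apply[OF *] restr_fam_apply(1)[OF *] o_apply
      using * bidualD(4)[OF *(2)] by (cases "\<xi> \<in> Dsp C t G x") (simp_all add: restr_fam_def)
  qed (auto simp: bidual_map_def restr_fam_def)
qed

text \<open>The degree reversals of \<open>D_cpx\<close> and \<open>dual_cpx\<close> cancel, so the
  terms and differentials of the bidual complex keep the degrees of \<open>P\<close>, without
  signs.\<close>

lemma df_bic: "df (bic C s P) n = bidual_map C s (cx P n) s (cx P (n + 1)) (df P n)"
proof -
  have i: "- (- (n + 1) + 1) = n" "- (- (n + 1)) = n + 1" "- (- n) = n" by simp_all
  show ?thesis unfolding bic_def dual_cpx_def D_cpx_def cpx.select_convs i by (rule dual_of_D)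
qed

lemma bic_map_eq: "bic_map C s P Q g n = bidual_map C s (cx P n) s (cx Q n) (g n)"
proof -
  have i: "- (- n) = n" by simp
  show ?thesis unfolding bic_map_def dual_map_def D_map_def D_cpx_def cpx.select_convs i by (rule dual_of_D)
qed

context cplx
begin

lemma cplx_bic: "cplx C (pw (*)) (bic C s X)"
proof (rule cplxI[OF cat pwm.vector_space_axioms])
  show c: "cmodule C (pw (*)) (cx (bic C s X) n)" for n unfolding cx_bic by (rule cmodule_bidual)
  show "df (bic C s X) n \<in> nattrans C (pw (*)) (cx (bic C s X) n) (pw (*)) (cx (bic C s X) (n + 1))" for n
    unfolding cx_bic df_bic by (rule bidual_map_nt[OF cmod cmod d.nt])
  fix n x \<phi> assume x: "x \<in> Ob C" and "\<phi> \<in> sp (cx (bic C s X) n) x"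
  then have \<phi>: "\<phi> \<in> sp (bidual C s (cx X n)) x" by simp
  have "(\<lambda>z. df X (n + 1) z \<circ> df X n z) = (\<lambda>z. (0 :: 'v \<Rightarrow> 'v))" by (simp add: fun_eq_iff)
  then have "df (bic C s X) (n + 1) x (df (bic C s X) n x \<phi>) = bidual_map C s (cx X n) s (cx X (n + 1 + 1)) (\<lambda>z. 0) x \<phi>"
    unfolding df_bic bidual_map_comp[OF x cmod cmod d.nt d.nt \<phi>] by (simp only:)
  also have "\<dots> = 0"
  proof
    fix \<xi>
    show "bidual_map C s (cx X n) s (cx X (n + 1 + 1)) (\<lambda>z. 0) x \<phi> \<xi> = 0 \<xi>"
    proof (cases "\<xi> \<in> Dsp C s (cx X (n + 1 + 1)) x")
      case True
      have "\<xi> z 0 = 0" for z by (rule nt.zero[OF ntI[OF cmod cmodule_std_proj[OF x] True]])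
      then have "(\<lambda>z. \<xi> z \<circ> (0 :: 'v \<Rightarrow> 'v)) = 0" by (simp add: fun_eq_iff)
      then show ?thesis unfolding bidual_map_apply[OF x \<phi>] using bidualD(4)[OF \<phi>] by (simp only: if_cancel zero_fun_apply)
    qed (simp add: bidual_map_apply[OF x \<phi>])
  qed
  finally show "df (bic C s X) (n + 1) x (df (bic C s X) n x \<phi>) = 0" .
qed

end

lemma bic_map_chain:
  assumes P: "cplx C s P" and Q: "cplx C s Q" and g: "g \<in> chain_maps C s P s Q"
  shows "bic_map C s P Q g \<in> chain_maps C (pw (*)) (bic C s P) (pw (*)) (bic C s Q)"
proof (rule chain_mapsI[OF cplx.cplx_bic[OF P] cplx.cplx_bic[OF Q]])
  interpret g: chmap C s P s Q g by (rule chmapI[OF P Q g])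
  show "bic_map C s P Q g n \<in> nattrans C (pw (*)) (cx (bic C s P) n) (pw (*)) (cx (bic C s Q) n)" for n
    unfolding cx_bic bic_map_eq by (rule bidual_map_nt[OF g.X.cmod g.Y.cmod g.nt])
  fix n x \<phi> assume x: "x \<in> Ob C" and "\<phi> \<in> sp (cx (bic C s P) n) x"
  then have \<phi>: "\<phi> \<in> sp (bidual C s (cx P n)) x" by simp
  have "(\<lambda>z. g (n + 1) z \<circ> df P n z) = (\<lambda>z. df Q n z \<circ> g n z)" by (simp add: fun_eq_iff g.d_comm)
  then show "bic_map C s P Q g (n + 1) x (df (bic C s P) n x \<phi>) = df (bic C s Q) n x (bic_map C s P Q g n x \<phi>)"
    unfolding bic_map_eq df_bic bidual_map_comp[OF x g.X.cmod g.X.cmod g.X.d.nt g.nt \<phi>]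
      bidual_map_comp[OF x g.X.cmod g.Y.cmod g.nt g.Y.d.nt \<phi>] by (simp only:)
qed

lemma bic_map_comp:
  assumes P: "cplx C s P" and Q: "cplx C s Q" and R: "cplx C s R"
    and g: "g \<in> chain_maps C s P s Q" and h: "h \<in> chain_maps C s Q s R"
  shows "bic_map C s P R (chain_comp h g) = chain_comp (bic_map C s Q R h) (bic_map C s P Q g)"
proof (rule chain_maps_eqI[OF bic_map_chain[OF P R chain_maps_comp[OF g h]]
    chain_maps_comp[OF bic_map_chain[OF P Q g] bic_map_chain[OF Q R h]]])
  interpret g: chmap C s P s Q g by (rule chmapI[OF P Q g])
  interpret h: chmap C s Q s R h by (rule chmapI[OF Q R h])
  fix n x \<phi> assume x: "x \<in> Ob C" and "\<phi> \<in> sp (cx (bic C s P) n) x"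
  then have \<phi>: "\<phi> \<in> sp (bidual C s (cx P n)) x" by simp
  show "bic_map C s P R (chain_comp h g) n x \<phi> = chain_comp (bic_map C s Q R h) (bic_map C s P Q g) n x \<phi>"
  proof -
    have e: "chain_comp h g n = (\<lambda>z. h n z \<circ> g n z)" by (simp add: chain_comp_def)
    show ?thesis
      unfolding chain_comp_apply bic_map_eq bidual_map_comp[OF x g.X.cmod g.Y.cmod g.nt h.nt \<phi>] e ..
  qed
qed

lemma bic_map_id:
  assumes P: "cplx C s P"
  shows "bic_map C s P P (chain_id C P) = chain_id C (bic C s P)"
proof (rule chain_maps_eqI[OF bic_map_chain[OF P P cplx.chain_id_in[OF P]] cplx.chain_id_in[OF cplx.cplx_bic[OF P]]])
  interpret P: cplx C s P by (rule P)
  fix n x \<phi> assume x: "x \<in> Ob C" and p: "\<phi> \<in> sp (cx (bic C s P) n) x"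
  then have \<phi>: "\<phi> \<in> sp (bidual C s (cx P n)) x" by simp
  show "bic_map C s P P (chain_id C P) n x \<phi> = chain_id C (bic C s P) n x \<phi>"
    unfolding chain_id_apply[OF x p] bic_map_eq
  proof
    fix \<xi>
    show "bidual_map C s (cx P n) s (cx P n) (chain_id C P n) x \<phi> \<xi> = \<phi> \<xi>"
    proof (cases "\<xi> \<in> Dsp C s (cx P n) x")
      case True
      interpret \<xi>: nt C s "cx P n" "pw (*)" "std_proj C x" \<xi> by (rule ntI[OF P.cmod P.cmodule_std_proj[OF x] True])
      have "\<xi> z (chain_id C P n z u) = \<xi> z u" for z u
        by (cases "z \<in> Ob C \<and> u \<in> sp (cx P n) z") (auto simp: chain_id_def restr_fam_def)
      then have "(\<lambda>z. \<xi> z \<circ> chain_id C P n z) = \<xi>" by (simp add: fun_eq_iff)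
      then show ?thesis unfolding bidual_map_apply[OF x \<phi>] using True by (simp only: if_True)
    qed (simp add: bidual_map_apply[OF x \<phi>] bidualD(3)[OF \<phi>])
  qed
qed

section \<open>Representing functionals\<close>

text \<open>The inverse of taking traces: it recovers a transformation from a functional
  \<open>T\<close> by evaluating \<open>T\<close> on maps through one standard projective, as
  \<open>trace_yon\<close> dictates.\<close>

definition rank1 :: "('o, 'm) cat \<Rightarrow> ('k::field \<Rightarrow> 'v \<Rightarrow> 'v) \<Rightarrow> ('o, 'm, 'v::ab_group_add) cmod
    \<Rightarrow> ('k \<Rightarrow> 'w \<Rightarrow> 'w) \<Rightarrow> ('o, 'm, 'w::ab_group_add) cmod \<Rightarrow> (('o \<Rightarrow> 'v \<Rightarrow> 'w) \<Rightarrow> 'k)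
    \<Rightarrow> 'o \<Rightarrow> 'w \<Rightarrow> ('o \<Rightarrow> 'v \<Rightarrow> 'm \<Rightarrow> 'k) \<Rightarrow> 'k" where
  "rank1 C s F t G T = restr_fam C G (\<lambda>x q \<xi>. if \<xi> \<in> Dsp C s F x then T (\<lambda>z. yon C t G x q z \<circ> \<xi> z) else 0)"

lemma rank1_apply: "x \<in> Ob C \<Longrightarrow> q \<in> sp G x \<Longrightarrow> \<xi> \<in> Dsp C s F x \<Longrightarrow>
    rank1 C s F t G T x q \<xi> = T (\<lambda>z. yon C t G x q z \<circ> \<xi> z)"
  by (simp add: rank1_def)

lemma rank1_nt:
  assumes F: "cmodule C s F" and G: "cmodule C t G"
    and add: "\<And>f g. f \<in> nattrans C s F t G \<Longrightarrow> g \<in> nattrans C s F t G \<Longrightarrow> T (f + g) = T f + T g"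
    and scale: "\<And>c f. f \<in> nattrans C s F t G \<Longrightarrow> T (\<lambda>x u. t c (f x u)) = c * T f"
  shows "rank1 C s F t G T \<in> nattrans C t G (pw (*)) (bidual C s F)"
  unfolding rank1_def
proof (rule nattrans_restrI[OF G cmodule.cmodule_bidual[OF F]])
  interpret F: cmodule C s F by (rule F)
  interpret G: cmodule C t G by (rule G)
  let ?r = "\<lambda>x q \<xi>. if \<xi> \<in> Dsp C s F x then T (\<lambda>z. yon C t G x q z \<circ> \<xi> z) else 0"
  fix x q assume x: "x \<in> Ob C" and q: "q \<in> sp G x"
  interpret y: nt C "pw (*)" "std_proj C x" t G "yon C t G x q" by (rule ntI[OF F.cmodule_std_proj[OF x] G G.yon_nt[OF x q]])
  have i: "(\<lambda>z. yon C t G x q z \<circ> \<xi> z) \<in> nattrans C s F t G" if "\<xi> \<in> Dsp C s F x" "q \<in> sp G x" for \<xi> q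
    by (rule nattrans_comp[OF that(1) G.yon_nt[OF x that(2)]])
  have \<xi>_in: "\<xi> z u \<in> sp (std_proj C x) z" if "\<xi> \<in> Dsp C s F x" "z \<in> Ob C" "u \<in> sp F z" for \<xi> z u
    by (rule nt.in_sp[OF ntI[OF F F.cmodule_std_proj[OF x] that(1)] that(2,3)])
  show b: "?r x q \<in> sp (bidual C s F) x"
  proof (rule bidualI)
    fix \<xi> assume \<xi>: "\<xi> \<in> Dsp C s F x"
    show "?r x q (\<xi> + \<zeta>) = ?r x q \<xi> + ?r x q \<zeta>" if \<zeta>: "\<zeta> \<in> Dsp C s F x" for \<zeta>
    proof -
      have "(\<lambda>z. yon C t G x q z \<circ> (\<xi> + \<zeta>) z) = (\<lambda>z. yon C t G x q z \<circ> \<xi> z) + (\<lambda>z. yon C t G x q z \<circ> \<zeta> z)"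
        by (rule nattrans_eqI[OF i[OF F.Dsp_add[OF x \<xi> \<zeta>] q] nattrans_add[OF F G i[OF \<xi> q] i[OF \<zeta> q]]])
          (use y.add \<xi>_in[OF \<xi>] \<xi>_in[OF \<zeta>] in \<open>simp del: sp_std_proj\<close>)
      then show ?thesis using \<xi> \<zeta> F.Dsp_add[OF x \<xi> \<zeta>] add[OF i[OF \<xi> q] i[OF \<zeta> q]] by (simp only: if_True)
    qed
    show "?r x q (Dscale c \<xi>) = c * ?r x q \<xi>" for c
    proof -
      have "(\<lambda>z. yon C t G x q z \<circ> Dscale c \<xi> z) = (\<lambda>z u. t c ((yon C t G x q z \<circ> \<xi> z) u))"
        by (rule nattrans_eqI[OF i[OF F.Dsp_scale[OF x \<xi>] q] nattrans_scale[OF F G i[OF \<xi> q]]])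
          (use y.scale \<xi>_in[OF \<xi>] in \<open>simp add: Dscale_apply del: sp_std_proj\<close>)
      then show ?thesis using \<xi> F.Dsp_scale[OF x \<xi>] scale[OF i[OF \<xi> q]] by (simp only: if_True)
    qed
  qed (simp only: if_False)
  show "?r x (q + q') = ?r x q + ?r x q'" if q': "q' \<in> sp G x" for q'
  proof
    fix \<xi>
    show "?r x (q + q') \<xi> = (?r x q + ?r x q') \<xi>"
    proof (cases "\<xi> \<in> Dsp C s F x")
      case True
      have "(\<lambda>z. yon C t G x (q + q') z \<circ> \<xi> z) = (\<lambda>z. yon C t G x q z \<circ> \<xi> z) + (\<lambda>z. yon C t G x q' z \<circ> \<xi> z)"
        by (simp add: fun_eq_iff G.yon_add[OF x q q'])
      then show ?thesis using True add[OF i[OF True q] i[OF True q']] by (simp only: if_True plus_fun_apply)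
    qed simp
  qed
  show "?r x (t c q) = pw (*) c (?r x q)" for c
  proof
    fix \<xi>
    show "?r x (t c q) \<xi> = pw (*) c (?r x q) \<xi>"
    proof (cases "\<xi> \<in> Dsp C s F x")
      case True
      have "(\<lambda>z. yon C t G x (t c q) z \<circ> \<xi> z) = (\<lambda>z u. t c ((yon C t G x q z \<circ> \<xi> z) u))"
        by (simp add: fun_eq_iff G.yon_scale[OF x q])
      then show ?thesis using True scale[OF i[OF True q]] by (simp only: if_True pw_def)
    qed (simp add: pw_def)
  qed
  fix y h assume y: "y \<in> Ob C" and h: "h \<in> Hom C x y"
  show "?r y (act G x y h q) = act (bidual C s F) x y h (?r x q)"
  proof
    fix \<xi>
    show "?r y (act G x y h q) \<xi> = act (bidual C s F) x y h (?r x q) \<xi>"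
    proof (cases "\<xi> \<in> Dsp C s F y")
      case True
      have "(\<lambda>z. yon C t G y (act G x y h q) z \<circ> \<xi> z) = (\<lambda>z. yon C t G x q z \<circ> (yoneda_map C x y h z \<circ> \<xi> z))"
      proof (rule nattrans_eqI[OF nattrans_comp[OF True G.yon_nt[OF y G.act_in[OF x y h q]]] i[OF F.Dsp_yoneda[OF x y h True] q]])
        fix z u assume z: "z \<in> Ob C" and u: "u \<in> sp F z"
        have "\<xi> z u \<in> sp (std_proj C y) z" by (rule nt.in_sp[OF ntI[OF F F.cmodule_std_proj[OF y] True] z u])
        then show "(yon C t G y (act G x y h q) z \<circ> \<xi> z) u = (yon C t G x q z \<circ> (yoneda_map C x y h z \<circ> \<xi> z)) u"
          unfolding o_apply by (rule G.yon_act[OF x y h q z])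
      qed
      then show ?thesis unfolding act_bidual_apply[OF b] using True F.Dsp_yoneda[OF x y h True] by (simp only: if_True)
    next
      case False
      then show ?thesis unfolding act_bidual_apply[OF b] by (simp only: if_False)
    qed
  qed
qed

section \<open>The pairing of chain maps\<close>

definition sg :: "int \<Rightarrow> 'k::field" where
  "sg n = (if even n then 1 else - 1)"

lemma sg_succ: "sg (n + 1) = - sg n"
  by (simp add: sg_def)

lemma sg_sq [simp]: "sg n * (sg n * a) = a" "sg n * sg n = 1"
  by (simp_all add: sg_def)

lemma telescope:
  fixes A :: "int \<Rightarrow> 'k::field"
  assumes "a \<le> b"
  shows "(\<Sum>n=a..b. sg n * (A n + A (n + 1))) = sg a * A a + sg b * A (b + 1)"
  using assms
proof (induction b rule: int_ge_induct)
  case (step b)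
  have "{a..b + 1} = insert (b + 1) {a..b}" using step by auto
  then have "(\<Sum>n=a..b + 1. sg n * (A n + A (n + 1))) = sg (b + 1) * (A (b + 1) + A (b + 1 + 1)) + (sg a * A a + sg b * A (b + 1))"
    using step by simp
  then show ?case unfolding sg_succ by (simp add: distrib_left)
qed (simp add: distrib_left)

text \<open>The sum runs over the degrees in which \<open>P\<close> is nonzero and not over an
  interval, so that its value involves no choice of a bound.\<close>

definition Tr :: "('o, 'm) cat \<Rightarrow> ('k::field \<Rightarrow> 'v \<Rightarrow> 'v) \<Rightarrow> ('o, 'm, 'v::ab_group_add) cpx
    \<Rightarrow> (int \<Rightarrow> 'o \<Rightarrow> 'w \<Rightarrow> ('o \<Rightarrow> 'v \<Rightarrow> 'm \<Rightarrow> 'k) \<Rightarrow> 'k) \<Rightarrow> (int \<Rightarrow> 'o \<Rightarrow> 'v \<Rightarrow> 'w) \<Rightarrow> 'k" where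
  "Tr C s P \<tau> f = (\<Sum>n | \<exists>x\<in>Ob C. \<exists>u\<in>sp (cx P n) x. u \<noteq> 0. sg n * trace C s (cx P n) (\<tau> n) (f n))"

lemma Tr_comp: "Tr C s P (chain_comp \<tau> v) f = Tr C s P \<tau> (chain_comp v f)"
  by (simp add: Tr_def trace_def chain_comp_def)

lemma Tr_add_left: "Tr C s P (\<tau> + \<tau>') f = Tr C s P \<tau> f + Tr C s P \<tau>' f"
  by (simp add: Tr_def trace_def case_prod_unfold sum.distrib distrib_left)

lemma Tr_scale_left: "Tr C s P (\<lambda>n x u. pw (*) c (\<tau> n x u)) f = c * Tr C s P \<tau> f"
proof -
  have "trace C s (cx P n) (\<lambda>x u. pw (*) c (\<tau> n x u)) (f n) = c * trace C s (cx P n) (\<tau> n) (f n)" for n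
    by (simp only: trace_def case_prod_unfold pw_def sum_distrib_left)
  then show ?thesis by (simp only: Tr_def sum_distrib_left mult.left_commute)
qed

lemma Tr_diff_left: "Tr C s P (\<tau> - \<tau>') f = Tr C s P \<tau> f - Tr C s P \<tau>' f"
  using Tr_add_left[of C s P "\<tau> - \<tau>'" \<tau>' f] by simp

definition single :: "int \<Rightarrow> 'a \<Rightarrow> int \<Rightarrow> 'a::zero" where
  "single n g = (\<lambda>m. if m = n then g else 0)"

lemma single_add: "single n (g + h) = single n g + (single n h :: int \<Rightarrow> 'a::monoid_add)"
  by (simp add: single_def fun_eq_iff)

text \<open>\<open>Y\<close> is any complex in any ambient space; \<open>bm_homotopic\<close> takes
  it to be a bidual complex.\<close>

locale pairing = bfp C s P M + Y: cplx C t Y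
  for C :: "('o, 'm) cat" and s :: "'k::field \<Rightarrow> 'v::ab_group_add \<Rightarrow> 'v" and P and M
    and t :: "'k \<Rightarrow> 'w::ab_group_add \<Rightarrow> 'w" and Y
begin

text \<open>Graded families that need not commute with the differentials. Functionals are extended
  to these because, unlike chain maps, they split into components of a single degree.\<close>

abbreviation "Nf f \<equiv> (\<forall>n. f n \<in> nattrans C s (cx P n) t (cx Y n))"
abbreviation "Nt \<tau> \<equiv> (\<forall>n. \<tau> n \<in> nattrans C t (cx Y n) (pw (*)) (bidual C s (cx P n)))"

lemma Nt_nt: "Nt \<tau> \<Longrightarrow> nt C t (cx Y n) (pw (*)) (bidual C s (cx P n)) (\<tau> n)"
  by (rule ntI[OF Y.cmod cmodule_bidual]) blast

lemma vanish:
  assumes n: "\<bar>n\<bar> \<ge> M" and G: "cmodule C r G" and f: "f \<in> nattrans C s (cx P n) r G"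
  shows "f = 0"
proof (rule nattrans_eqI[OF f nattrans_zero[OF cmod G]])
  interpret f: nt C s "cx P n" r G f by (rule ntI[OF cmod G f])
  show "f x u = 0 x u" if "x \<in> Ob C" "u \<in> sp (cx P n) x" for x u
    using bounded[OF n that] by simp
qed

lemma trace_vanish:
  assumes "\<bar>n\<bar> \<ge> M" "Nt \<tau>" "f \<in> nattrans C s (cx P n) t (cx Y n)"
  shows "trace C s (cx P n) (\<tau> n) f = 0"
  using vanish[OF assms(1) Y.cmod assms(3)] trace_zero[OF cmod fgproj Nt_nt[OF assms(2)]] by simp

lemma Tr_eq:
  assumes \<tau>: "Nt \<tau>" and f: "Nf f"
  shows "Tr C s P \<tau> f = (\<Sum>n=-M..M. sg n * trace C s (cx P n) (\<tau> n) (f n))"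
  unfolding Tr_def
proof (rule sum.mono_neutral_left)
  show "{n. \<exists>x\<in>Ob C. \<exists>u\<in>sp (cx P n) x. u \<noteq> 0} \<subseteq> {-M..M}"
  proof
    fix n assume "n \<in> {n. \<exists>x\<in>Ob C. \<exists>u\<in>sp (cx P n) x. u \<noteq> 0}"
    then have "\<not> \<bar>n\<bar> \<ge> M" using bounded by blast
    then show "n \<in> {-M..M}" by auto
  qed
  show "\<forall>n\<in>{-M..M} - {n. \<exists>x\<in>Ob C. \<exists>u\<in>sp (cx P n) x. u \<noteq> 0}. sg n * trace C s (cx P n) (\<tau> n) (f n) = 0"
  proof
    fix n assume "n \<in> {-M..M} - {n. \<exists>x\<in>Ob C. \<exists>u\<in>sp (cx P n) x. u \<noteq> 0}"
    then have z: "u = 0" if "x \<in> Ob C" "u \<in> sp (cx P n) x" for x u using that by blast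
    interpret f: nt C s "cx P n" t "cx Y n" "f n" by (rule ntI[OF cmod Y.cmod]) (use f in blast)
    have "f n = 0"
    proof (rule nattrans_eqI[OF f.nt nattrans_zero[OF cmod Y.cmod]])
      show "f n x u = 0 x u" if "x \<in> Ob C" "u \<in> sp (cx P n) x" for x u using z[OF that] by simp
    qed
    then show "sg n * trace C s (cx P n) (\<tau> n) (f n) = 0"
      using trace_zero[OF cmod fgproj Nt_nt[OF \<tau>]] by simp
  qed
qed simp

lemma Tr_add_right: "Nt \<tau> \<Longrightarrow> Nf f \<Longrightarrow> Nf g \<Longrightarrow> Tr C s P \<tau> (f + g) = Tr C s P \<tau> f + Tr C s P \<tau> g"
proof -
  assume \<tau>: "Nt \<tau>" and f: "Nf f" and g: "Nf g"
  have fg: "Nf (f + g)" using nattrans_add[OF cmod Y.cmod] f g by (simp only: plus_fun_apply) blast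
  have "trace C s (cx P n) (\<tau> n) ((f + g) n) = trace C s (cx P n) (\<tau> n) (f n) + trace C s (cx P n) (\<tau> n) (g n)" for n
  proof -
    have "f n \<in> nattrans C s (cx P n) t (cx Y n)" "g n \<in> nattrans C s (cx P n) t (cx Y n)" using f g by blast+
    then show ?thesis using trace_add[OF cmod fgproj Nt_nt[OF \<tau>]] by (simp only: plus_fun_apply[of f g])
  qed
  then show ?thesis unfolding Tr_eq[OF \<tau> f] Tr_eq[OF \<tau> g] Tr_eq[OF \<tau> fg] by (simp add: distrib_left sum.distrib)
qed

lemma Tr_scale_right: "Nt \<tau> \<Longrightarrow> Nf f \<Longrightarrow> Tr C s P \<tau> (\<lambda>n x u. t c (f n x u)) = c * Tr C s P \<tau> f"
proof -
  assume \<tau>: "Nt \<tau>" and f: "Nf f"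
  have cf: "Nf (\<lambda>n x u. t c (f n x u))" using nattrans_scale[OF cmod Y.cmod] f by blast
  have "trace C s (cx P n) (\<tau> n) (\<lambda>x u. t c (f n x u)) = c * trace C s (cx P n) (\<tau> n) (f n)" for n
    by (rule trace_scale[OF cmod fgproj Nt_nt[OF \<tau>]]) (use f in blast)
  then show ?thesis unfolding Tr_eq[OF \<tau> f] Tr_eq[OF \<tau> cf] by (simp only: sum_distrib_left mult.left_commute)
qed

lemma single_Nf: "g \<in> nattrans C s (cx P n) t (cx Y n) \<Longrightarrow> Nf (single n g)"
  using nattrans_zero[OF cmod Y.cmod] by (simp add: single_def)

lemma Tr_single:
  assumes \<tau>: "Nt \<tau>" and g: "g \<in> nattrans C s (cx P n) t (cx Y n)"
  shows "Tr C s P \<tau> (single n g) = sg n * trace C s (cx P n) (\<tau> n) g"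
proof -
  have "sg m * trace C s (cx P m) (\<tau> m) (single n g m) = (if m = n then sg n * trace C s (cx P n) (\<tau> n) g else 0)" for m
    using trace_zero[OF cmod fgproj Nt_nt[OF \<tau>]] by (simp add: single_def)
  then have "Tr C s P \<tau> (single n g) = (\<Sum>m=-M..M. if m = n then sg n * trace C s (cx P n) (\<tau> n) g else 0)"
    unfolding Tr_eq[OF \<tau> single_Nf[OF g]] by simp
  also have "\<dots> = sg n * trace C s (cx P n) (\<tau> n) g"
  proof (cases "n \<in> {-M..M}")
    case False
    then have "trace C s (cx P n) (\<tau> n) g = 0" by (intro trace_vanish \<tau> g) auto
    then show ?thesis by simp
  qed simp
  finally show ?thesis .
qed

lemma chain_Nf: "f \<in> chain_maps C s P t Y \<Longrightarrow> Nf f"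
  by (simp add: chain_maps_def)

lemma chain_Nt: "\<tau> \<in> chain_maps C t Y (pw (*)) (bic C s P) \<Longrightarrow> Nt \<tau>"
  by (simp add: chain_maps_def)

lemma df_bic_apply: "x \<in> Ob C \<Longrightarrow> \<phi> \<in> sp (bidual C s (cx P n)) x \<Longrightarrow> \<xi> \<in> Dsp C s (cx P (n + 1)) x \<Longrightarrow>
   df (bic C s P) n x \<phi> \<xi> = \<phi> (\<lambda>z. \<xi> z \<circ> df P n z)"
  by (simp add: df_bic bidual_map_apply)

lemma boundary_nt:
  assumes h: "\<And>n. h n \<in> nattrans C s (cx P n) t (cx Y (n - 1))"
  shows "(\<lambda>x. df Y (n - 1) x \<circ> h n x) \<in> nattrans C s (cx P n) t (cx Y n)"
    "(\<lambda>x. h (n + 1) x \<circ> df P n x) \<in> nattrans C s (cx P n) t (cx Y n)"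
  using nattrans_comp[OF h Y.d.nt[of "n - 1"]] nattrans_comp[OF d.nt h[of "n + 1"]] by simp_all

lemma Tr_null:
  assumes \<tau>: "\<tau> \<in> chain_maps C t Y (pw (*)) (bic C s P)" and f: "f \<in> chain_maps C s P t Y"
    and e: "homotopic C s P t Y f 0"
  shows "Tr C s P \<tau> f = 0"
proof -
  interpret f: chmap C s P t Y f by (rule chmapI[OF cplx_axioms Y.cplx_axioms f])
  interpret \<tau>: chmap C t Y "pw (*)" "bic C s P" \<tau> by (rule chmapI[OF Y.cplx_axioms cplx_bic \<tau>])
  note N\<tau> = chain_Nt[OF \<tau>]
  obtain h where h: "\<And>n. h n \<in> nattrans C s (cx P n) t (cx Y (n - 1))"
    and eq: "\<And>n x u. x \<in> Ob C \<Longrightarrow> u \<in> sp (cx P n) x \<Longrightarrow>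
      f n x u - 0 n x u = df Y (n - 1) x (h n x u) + h (n + 1) x (df P n x u)"
    using e unfolding homotopic_def by blast
  \<comment> \<open>\<open>A n\<close> is the contribution of the differential of \<open>Y\<close>
    after \<open>h\<close> in degree \<open>n\<close>; by cyclicity, \<open>h\<close> after the
    differential of \<open>P\<close> contributes \<open>A (n + 1)\<close> in that degree.\<close>
  define A where "A = (\<lambda>n. trace C s (cx P n) (\<tau> n) (\<lambda>x. df Y (n - 1) x \<circ> h n x))"
  note b = boundary_nt[OF h]
  have "trace C s (cx P n) (\<tau> n) (f n) = A n + A (n + 1)" for n
  proof -
    have "f n = (\<lambda>x. df Y (n - 1) x \<circ> h n x) + (\<lambda>x. h (n + 1) x \<circ> df P n x)"
      by (rule nattrans_eqI[OF f.nt nattrans_add[OF cmod Y.cmod b]]) (use eq in simp)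
    then have "trace C s (cx P n) (\<tau> n) (f n) = A n + trace C s (cx P n) (\<tau> n) (\<lambda>x. h (n + 1) x \<circ> df P n x)"
      unfolding A_def using trace_add[OF cmod fgproj Nt_nt[OF N\<tau>] b] by (simp only:)
    also have "trace C s (cx P n) (\<tau> n) (\<lambda>x. h (n + 1) x \<circ> df P n x) =
      trace C s (cx P (n + 1)) (\<tau> (n + 1)) (\<lambda>x. df Y n x \<circ> h (n + 1) x)"
    proof (rule trace_cyclic[OF cmod fgproj Nt_nt[OF N\<tau>] cmod fgproj Nt_nt[OF N\<tau>] d.nt Y.d.nt])
      show "h (n + 1) \<in> nattrans C s (cx P (n + 1)) t (cx Y n)" using h[of "n + 1"] by simp
      fix x q \<xi> assume x: "x \<in> Ob C" and q: "q \<in> sp (cx Y n) x" and \<xi>: "\<xi> \<in> Dsp C s (cx P (n + 1)) x"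
      show "\<tau> (n + 1) x (df Y n x q) \<xi> = \<tau> n x q (\<lambda>z. \<xi> z \<circ> df P n z)"
        unfolding \<tau>.d_comm by (rule df_bic_apply[OF x _ \<xi>]) (use \<tau>.in_sp[OF x q] in simp)
    qed
    also have "\<dots> = A (n + 1)" by (simp add: A_def)
    finally show ?thesis .
  qed
  then have "Tr C s P \<tau> f = sg (-M) * A (-M) + sg M * A (M + 1)"
    unfolding Tr_eq[OF N\<tau> chain_Nf[OF f]] using telescope[of "-M" M A] M by simp
  moreover have "A (-M) = 0" "A (M + 1) = 0"
    unfolding A_def by (rule trace_vanish[OF _ N\<tau> b(1)], use M in simp)+
  ultimately show ?thesis by simp
qed

lemma Tr_null_left:
  assumes \<tau>: "\<tau> \<in> chain_maps C t Y (pw (*)) (bic C s P)" and f: "f \<in> chain_maps C s P t Y"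
    and e: "homotopic C t Y (pw (*)) (bic C s P) \<tau> 0"
  shows "Tr C s P \<tau> f = 0"
proof -
  interpret f: chmap C s P t Y f by (rule chmapI[OF cplx_axioms Y.cplx_axioms f])
  interpret B: cplx C "pw (*)" "bic C s P" by (rule cplx_bic)
  interpret \<tau>: chmap C t Y "pw (*)" "bic C s P" \<tau> by (rule chmapI[OF Y.cplx_axioms cplx_bic \<tau>])
  note N\<tau> = chain_Nt[OF \<tau>]
  obtain k where k: "\<And>n. k n \<in> nattrans C t (cx Y n) (pw (*)) (cx (bic C s P) (n - 1))"
    and eq: "\<And>n x u. x \<in> Ob C \<Longrightarrow> u \<in> sp (cx Y n) x \<Longrightarrow>
      \<tau> n x u - 0 n x u = df (bic C s P) (n - 1) x (k n x u) + k (n + 1) x (df Y n x u)"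
    using e unfolding homotopic_def by blast
  have k': "nt C t (cx Y n) (pw (*)) (bidual C s (cx P (n - 1))) (k n)" for n
    by (rule ntI[OF Y.cmod cmodule_bidual]) (use k[of n] in simp)
  have dk: "(\<lambda>x. df (bic C s P) (n - 1) x \<circ> k n x) \<in> nattrans C t (cx Y n) (pw (*)) (bidual C s (cx P n))" for n
    using nattrans_comp[OF k B.d.nt[of "n - 1"]] by simp
  have kd: "(\<lambda>x. k (n + 1) x \<circ> df Y n x) \<in> nattrans C t (cx Y n) (pw (*)) (bidual C s (cx P n))" for n
    using nattrans_comp[OF Y.d.nt k[of "n + 1"]] by simp
  have d': "df P (n - 1) \<in> nattrans C s (cx P (n - 1)) s (cx P n)" for n using d.nt[of "n - 1"] by simp
  \<comment> \<open>The homotopy is now on the side of \<open>\<tau>\<close>, so \<open>A n\<close>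
    is a trace over degree \<open>n - 1\<close> of \<open>P\<close>. The summand with
    \<open>k\<close> after the differential contributes \<open>A (n + 1)\<close> because
    \<open>f\<close> is a chain map, the other one contributes \<open>A n\<close> by
    cyclicity.\<close>
  define A where "A = (\<lambda>n. trace C s (cx P (n - 1)) (k n) (\<lambda>x. f n x \<circ> df P (n - 1) x))"
  have "trace C s (cx P n) (\<tau> n) (f n) = A n + A (n + 1)" for n
  proof -
    have "\<tau> n = (\<lambda>x. df (bic C s P) (n - 1) x \<circ> k n x) + (\<lambda>x. k (n + 1) x \<circ> df Y n x)"
      by (rule nattrans_eqI[OF _ nattrans_add[OF Y.cmod cmodule_bidual dk kd]]) (use N\<tau> eq in \<open>blast, simp\<close>)
    then have "trace C s (cx P n) (\<tau> n) (f n) = trace C s (cx P n) (\<lambda>x. df (bic C s P) (n - 1) x \<circ> k n x) (f n)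
        + trace C s (cx P n) (\<lambda>x. k (n + 1) x \<circ> df Y n x) (f n)"
      by (simp add: trace_def case_prod_unfold sum.distrib)
    also have "trace C s (cx P n) (\<lambda>x. k (n + 1) x \<circ> df Y n x) (f n) = A (n + 1)"
      by (simp add: trace_def A_def f.d_comm)
    also have "trace C s (cx P n) (\<lambda>x. df (bic C s P) (n - 1) x \<circ> k n x) (f n) = A n"
    proof -
      interpret Yi: nt C t "cx Y n" t "cx Y n" "restr_fam C (cx Y n) (\<lambda>x u. u)"
        by (rule ntI[OF Y.cmod Y.cmod Y.nattrans_id])
      have "A n = trace C s (cx P n) (\<lambda>x. df (bic C s P) (n - 1) x \<circ> k n x) (\<lambda>x. restr_fam C (cx Y n) (\<lambda>x u. u) x \<circ> f n x)"
        unfolding A_def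
      proof (rule trace_cyclic[OF cmod fgproj k' cmod fgproj ntI[OF Y.cmod cmodule_bidual dk] d' Y.nattrans_id _ f.nt])
        fix x q \<xi> assume x: "x \<in> Ob C" and q: "q \<in> sp (cx Y n) x" and \<xi>: "\<xi> \<in> Dsp C s (cx P n) x"
        have "df (bic C s P) (n - 1) x (k n x q) \<xi> = k n x q (\<lambda>z. \<xi> z \<circ> df P (n - 1) z)"
          by (rule df_bic_apply[OF x nt.in_sp[OF k' x q]]) (use \<xi> in simp)
        then show "(df (bic C s P) (n - 1) x \<circ> k n x) (restr_fam C (cx Y n) (\<lambda>x u. u) x q) \<xi> =
            k n x q (\<lambda>z. \<xi> z \<circ> df P (n - 1) z)" using x q by simp
      qed
      moreover have "(\<lambda>x. restr_fam C (cx Y n) (\<lambda>x u. u) x \<circ> f n x) = f n"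
      proof (rule nattrans_eqI[OF nattrans_comp[OF f.nt Y.nattrans_id] f.nt])
        show "(restr_fam C (cx Y n) (\<lambda>x u. u) x \<circ> f n x) u = f n x u" if "x \<in> Ob C" "u \<in> sp (cx P n) x" for x u
          using f.in_sp[OF that] that by simp
      qed
      ultimately show ?thesis by simp
    qed
    finally show ?thesis .
  qed
  then have "Tr C s P \<tau> f = sg (-M) * A (-M) + sg M * A (M + 1)"
    unfolding Tr_eq[OF N\<tau> chain_Nf[OF f]] using telescope[of "-M" M A] M by simp
  moreover have "A n = 0" if "\<bar>n\<bar> \<ge> M" for n
  proof -
    have "f n = 0" by (rule vanish[OF that Y.cmod f.nt])
    then have "(\<lambda>x. f n x \<circ> df P (n - 1) x) = 0" by (simp add: fun_eq_iff)
    then show ?thesis unfolding A_def using trace_zero[OF cmod fgproj k'[of n]] by simp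
  qed
  ultimately show ?thesis using M by simp
qed

lemma Tr_homotopic:
  assumes "\<tau> \<in> chain_maps C t Y (pw (*)) (bic C s P)" "f \<in> chain_maps C s P t Y" "g \<in> chain_maps C s P t Y"
    and e: "homotopic C s P t Y f g"
  shows "Tr C s P \<tau> f = Tr C s P \<tau> g"
proof -
  note c = chain_maps_diff[OF cplx_axioms Y.cplx_axioms assms(2,3)]
  have "Tr C s P \<tau> (f - g) = 0"
    by (rule Tr_null[OF assms(1) c]) (use e homotopic_diff_iff[OF cplx_axioms Y.cplx_axioms] in blast)
  moreover have "Tr C s P \<tau> (f - g + g) = Tr C s P \<tau> (f - g) + Tr C s P \<tau> g"
    by (rule Tr_add_right[OF chain_Nt[OF assms(1)] chain_Nf[OF c] chain_Nf[OF assms(3)]])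
  moreover have "f - g + g = f" by (rule diff_add_cancel)
  ultimately show ?thesis by (simp only: add_0)
qed

lemma Tr_homotopic_left:
  assumes "\<tau> \<in> chain_maps C t Y (pw (*)) (bic C s P)" "\<tau>' \<in> chain_maps C t Y (pw (*)) (bic C s P)"
    and f: "f \<in> chain_maps C s P t Y" and e: "homotopic C t Y (pw (*)) (bic C s P) \<tau> \<tau>'"
  shows "Tr C s P \<tau> f = Tr C s P \<tau>' f"
proof -
  have "Tr C s P (\<tau> - \<tau>') f = 0"
    by (rule Tr_null_left[OF chain_maps_diff[OF Y.cplx_axioms cplx_bic assms(1,2)] f])
      (use e homotopic_diff_iff[OF Y.cplx_axioms cplx_bic] in blast)
  then show ?thesis unfolding Tr_diff_left by simp
qed

lemma Nf_closed: "Nf 0" "Nf f \<Longrightarrow> Nf g \<Longrightarrow> Nf (f + g)" "Nf f \<Longrightarrow> Nf (\<lambda>n x u. t c (f n x u))"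
  using nattrans_zero[OF cmod Y.cmod] nattrans_add[OF cmod Y.cmod] nattrans_scale[OF cmod Y.cmod]
  by (simp_all only: plus_fun_apply zero_fun_apply simp_thms) blast?

lemma vs_fam: "vector_space (\<lambda>c (f :: int \<Rightarrow> 'o \<Rightarrow> 'v \<Rightarrow> 'w) n x u. t c (f n x u))"
  using Y.vs unfolding vector_space_def by (simp add: fun_eq_iff)

lemma single_scale: "single n (\<lambda>x u. t c (g x u)) = (\<lambda>m x u. t c (single n g m x u))"
  by (simp add: single_def fun_eq_iff)

lemma rank_single_nt:
  assumes T: "Vector_Spaces.linear (\<lambda>c (f :: int \<Rightarrow> 'o \<Rightarrow> 'v \<Rightarrow> 'w) n x u. t c (f n x u)) (*) T"
  shows "rank1 C s (cx P m) t (cx Y l) (\<lambda>g. c * T (single j g)) \<in> nattrans C t (cx Y l) (pw (*)) (bidual C s (cx P m))"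
proof (rule rank1_nt[OF cmod Y.cmod])
  interpret T: Vector_Spaces.linear "\<lambda>c (f :: int \<Rightarrow> 'o \<Rightarrow> 'v \<Rightarrow> 'w) n x u. t c (f n x u)" "(*)" T by (rule T)
  show "c * T (single j (f + g)) = c * T (single j f) + c * T (single j g)" for f g :: "'o \<Rightarrow> 'v \<Rightarrow> 'w"
    unfolding single_add T.add distrib_left ..
  show "c * T (single j (\<lambda>x u. t d (f x u))) = d * (c * T (single j f))" for d and f :: "'o \<Rightarrow> 'v \<Rightarrow> 'w"
    unfolding single_scale T.scale by (simp add: mult.left_commute)
qed

text \<open>\<open>L f\<close> measures the failure of \<open>f\<close> to be a chain map, so by
  hypothesis the pairing with \<open>\<tau>\<close> vanishes on the kernel of \<open>L\<close> and
  factors through \<open>L\<close> as a functional \<open>\<psi>\<close>. Evaluating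
  \<open>\<psi>\<close> on maps through one standard projective gives the homotopy \<open>k\<close>;
  testing the factorisation on families in a single degree shows that \<open>k\<close> is
  one.\<close>

theorem Tr_injective:
  assumes \<tau>: "\<tau> \<in> chain_maps C t Y (pw (*)) (bic C s P)"
    and z: "\<And>f. f \<in> chain_maps C s P t Y \<Longrightarrow> Tr C s P \<tau> f = 0"
  shows "homotopic C t Y (pw (*)) (bic C s P) \<tau> 0"
proof -
  interpret \<tau>: chmap C t Y "pw (*)" "bic C s P" \<tau> by (rule chmapI[OF Y.cplx_axioms cplx_bic \<tau>])
  note N\<tau> = chain_Nt[OF \<tau>]
  define L where "L = (\<lambda>(f :: int \<Rightarrow> 'o \<Rightarrow> 'v \<Rightarrow> 'w) n x u. f (n + 1) x (df P n x u) - df Y n x (f n x u))"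
  let ?sc = "\<lambda>c (f :: int \<Rightarrow> 'o \<Rightarrow> 'v \<Rightarrow> 'w) n x u. t c (f n x u)"
  have dY: "df Y n x (f n x u + g n x u) = df Y n x (f n x u) + df Y n x (g n x u)"
      "df Y n x (t c (f n x u)) = t c (df Y n x (f n x u))" if f: "Nf f" and g: "Nf g" for f g n x u c
  proof -
    interpret f: nt C s "cx P n" t "cx Y n" "f n" by (rule ntI[OF cmod Y.cmod]) (use f in blast)
    interpret g: nt C s "cx P n" t "cx Y n" "g n" by (rule ntI[OF cmod Y.cmod]) (use g in blast)
    have i: "f n x u \<in> sp (cx Y n) x" "g n x u \<in> sp (cx Y n) x" if "x \<in> Ob C"
      using that by (cases "u \<in> sp (cx P n) x"; auto)+
    show "df Y n x (f n x u + g n x u) = df Y n x (f n x u) + df Y n x (g n x u)"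
      "df Y n x (t c (f n x u)) = t c (df Y n x (f n x u))"
      using i by (cases "x \<in> Ob C"; simp)+
  qed
  obtain \<psi> where \<psi>: "Vector_Spaces.linear ?sc (*) \<psi>" and e: "\<And>f. Nf f \<Longrightarrow> \<psi> (L f) = Tr C s P \<tau> f"
  proof -
    have "\<exists>\<psi>. Vector_Spaces.linear ?sc (*) \<psi> \<and> (\<forall>f\<in>{f. Nf f}. \<psi> (L f) = Tr C s P \<tau> f)"
    proof (rule functional_factor[OF vs_fam, where sa = ?sc])
      fix f g assume fg: "f \<in> {f. Nf f}" "g \<in> {f. Nf f}"
      show "L (f + g) = L f + L g" using dY(1)[of f g] fg by (simp add: L_def fun_eq_iff)
      show "Tr C s P \<tau> (f + g) = Tr C s P \<tau> f + Tr C s P \<tau> g" using Tr_add_right[OF N\<tau>] fg by blast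
      show "f + g \<in> {f. Nf f}" using Nf_closed(2) fg by blast
    next
      fix c f assume f: "f \<in> {f. Nf f}"
      show "L (?sc c f) = ?sc c (L f)" using dY(2)[of f f] f by (simp add: L_def fun_eq_iff Y.vsp.scale_right_diff_distrib)
      show "Tr C s P \<tau> (?sc c f) = c * Tr C s P \<tau> f" using Tr_scale_right[OF N\<tau>] f by blast
      show "?sc c f \<in> {f. Nf f}" using Nf_closed(3) f by blast
    next
      fix f assume f: "f \<in> {f. Nf f}" and L0: "L f = 0"
      have "f (n + 1) x (df P n x u) = df Y n x (f n x u)" for n x u
        using fun_cong[OF fun_cong[OF fun_cong[OF L0]], of n x u] unfolding L_def by simp
      then have "f \<in> chain_maps C s P t Y" using f by (intro chain_mapsI[OF cplx_axioms Y.cplx_axioms]) auto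
      then show "Tr C s P \<tau> f = 0" by (rule z)
    qed (use Nf_closed(1) in blast)
    then show ?thesis using that by blast
  qed
  interpret \<psi>: Vector_Spaces.linear ?sc "(*)" \<psi> by (rule \<psi>)
  \<comment> \<open>A value of \<open>L\<close> has in position \<open>n - 1\<close> a map from
    \<open>P\<close> in degree \<open>n - 1\<close> to \<open>Y\<close> in degree \<open>n\<close>;
    on such an argument \<open>k n\<close> evaluates \<open>\<psi>\<close>. The sign is that of
    degree \<open>n\<close> in \<open>Tr\<close>.\<close>
  define k where "k = (\<lambda>n. rank1 C s (cx P (n - 1)) t (cx Y n) (\<lambda>g. sg n * \<psi> (single (n - 1) g)))"
  have k: "k n \<in> nattrans C t (cx Y n) (pw (*)) (bidual C s (cx P (n - 1)))" for n
    unfolding k_def by (rule rank_single_nt[OF \<psi>])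
  have k_apply: "k n x q \<xi> = sg n * \<psi> (single (n - 1) (\<lambda>z. yon C t (cx Y n) x q z \<circ> \<xi> z))"
    if "x \<in> Ob C" "q \<in> sp (cx Y n) x" "\<xi> \<in> Dsp C s (cx P (n - 1)) x" for n x q \<xi>
    unfolding k_def by (rule rank1_apply[OF that])
  have kn: "nt C t (cx Y n) (pw (*)) (bidual C s (cx P (n - 1))) (k n)" for n
    by (rule ntI[OF Y.cmod cmodule_bidual k])
  have main: "\<tau> n x q \<xi> = k n x q (\<lambda>z. \<xi> z \<circ> df P (n - 1) z) + k (n + 1) x (df Y n x q) \<xi>"
    if x: "x \<in> Ob C" and q: "q \<in> sp (cx Y n) x" and \<xi>: "\<xi> \<in> Dsp C s (cx P n) x" for n x q \<xi>
  proof -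
    interpret Z: cmodule C t "cx Y n" by (rule Y.cmod)
    let ?g = "\<lambda>z. yon C t (cx Y n) x q z \<circ> \<xi> z"
    have g: "?g \<in> nattrans C s (cx P n) t (cx Y n)" by (rule nattrans_comp[OF \<xi> Y.yon_nt[OF x q]])
    interpret g: nt C s "cx P n" t "cx Y n" ?g by (rule ntI[OF cmod Y.cmod g])
    have \<xi>d: "(\<lambda>z. \<xi> z \<circ> df P (n - 1) z) \<in> Dsp C s (cx P (n - 1)) x"
      using Dsp_pre[OF d.nt[of "n - 1"], of \<xi> x] \<xi> by simp
    \<comment> \<open>\<open>L\<close> of a family in degree \<open>n\<close> has a component in
      position \<open>n - 1\<close> and, with a minus sign, one in position \<open>n\<close>; they
      produce the two terms of the homotopy relation.\<close>
    have Lg: "L (single n ?g) + single n (\<lambda>z. yon C t (cx Y (n + 1)) x (df Y n x q) z \<circ> \<xi> z)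
      = single (n - 1) (\<lambda>z. yon C t (cx Y n) x q z \<circ> (\<xi> z \<circ> df P (n - 1) z))"
    proof (intro ext)
      fix m z u
      have a: "df Y n z (yon C t (cx Y n) x q z p) = yon C t (cx Y (n + 1)) x (df Y n x q) z p" for p
        by (rule Y.d.map_yon[OF x q])
      have b: "df Y l z 0 = 0" for l by simp
      show "(L (single n ?g) + single n (\<lambda>z. yon C t (cx Y (n + 1)) x (df Y n x q) z \<circ> \<xi> z)) m z u
        = single (n - 1) (\<lambda>z. yon C t (cx Y n) x q z \<circ> (\<xi> z \<circ> df P (n - 1) z)) m z u"
        unfolding L_def single_def plus_fun_apply by (auto simp: a)
    qed
    have e1: "sg n * \<tau> n x q \<xi> = \<psi> (L (single n ?g))"
      unfolding e[OF single_Nf[OF g]] Tr_single[OF N\<tau> g] trace_yon[OF cmod fgproj Nt_nt[OF N\<tau>] x q \<xi>] ..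
    have e2: "\<psi> (L (single n ?g)) + \<psi> (single n (\<lambda>z. yon C t (cx Y (n + 1)) x (df Y n x q) z \<circ> \<xi> z))
       = \<psi> (single (n - 1) (\<lambda>z. yon C t (cx Y n) x q z \<circ> (\<xi> z \<circ> df P (n - 1) z)))"
      unfolding \<psi>.add[symmetric] Lg ..
    have e3: "k n x q (\<lambda>z. \<xi> z \<circ> df P (n - 1) z) = sg n * \<psi> (single (n - 1) (\<lambda>z. yon C t (cx Y n) x q z \<circ> (\<xi> z \<circ> df P (n - 1) z)))"
      by (rule k_apply[OF x q \<xi>d])
    have e4: "k (n + 1) x (df Y n x q) \<xi> = - sg n * \<psi> (single n (\<lambda>z. yon C t (cx Y (n + 1)) x (df Y n x q) z \<circ> \<xi> z))"
      using k_apply[OF x Y.d.in_sp[OF x q], of \<xi>] \<xi> by (simp add: sg_succ)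
    have "sg n * A = sg n * C + - sg n * B" if "A + B = C" for A B C :: 'k
      using that by (auto simp: distrib_left)
    from this[OF e2] have "sg n * (sg n * \<tau> n x q \<xi>) = k n x q (\<lambda>z. \<xi> z \<circ> df P (n - 1) z) + k (n + 1) x (df Y n x q) \<xi>"
      unfolding e1 e3 e4 .
    then show ?thesis by simp
  qed
  show ?thesis unfolding homotopic_def
  proof (intro exI[of _ k] conjI allI ballI)
    show "k n \<in> nattrans C t (cx Y n) (pw (*)) (cx (bic C s P) (n - 1))" for n using k by simp
    fix n x q assume x: "x \<in> Ob C" and q: "q \<in> sp (cx Y n) x"
    have kq: "k n x q \<in> sp (bidual C s (cx P (n - 1))) x" by (rule nt.in_sp[OF kn x q])
    have kq': "k (n + 1) x (df Y n x q) \<in> sp (bidual C s (cx P n)) x"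
      using nt.in_sp[OF kn x Y.d.in_sp[OF x q]] by simp
    have \<tau>q: "\<tau> n x q \<in> sp (bidual C s (cx P n)) x" using \<tau>.in_sp[OF x q] by simp
    show "\<tau> n x q - 0 n x q = df (bic C s P) (n - 1) x (k n x q) + k (n + 1) x (df Y n x q)"
    proof
      fix \<xi>
      show "(\<tau> n x q - 0 n x q) \<xi> = (df (bic C s P) (n - 1) x (k n x q) + k (n + 1) x (df Y n x q)) \<xi>"
      proof (cases "\<xi> \<in> Dsp C s (cx P n) x")
        case True
        have "df (bic C s P) (n - 1) x (k n x q) \<xi> = k n x q (\<lambda>z. \<xi> z \<circ> df P (n - 1) z)"
          by (rule df_bic_apply[OF x kq]) (use True in simp)
        then show ?thesis using main[OF x q True] by simp
      next
        case False
        have "df (bic C s P) (n - 1) x (k n x q) \<xi> = 0"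
          unfolding df_bic bidual_map_apply[OF x kq] using False by simp
        then show ?thesis using False bidualD(3)[OF \<tau>q] bidualD(3)[OF kq'] by simp
      qed
    qed
  qed
qed

text \<open>The functional is extended from chain maps to all graded families, where it splits by
  degree, and \<open>rank1\<close> turns each component, up to sign, into a component of
  \<open>\<tau>\<close>. That \<open>\<tau>\<close> is a chain map is tested on null homotopic
  families, which the functional kills.\<close>

theorem Tr_surjective:
  assumes add: "\<And>f g. f \<in> chain_maps C s P t Y \<Longrightarrow> g \<in> chain_maps C s P t Y \<Longrightarrow> \<Phi> (f + g) = \<Phi> f + (\<Phi> g :: 'k)"
    and scale: "\<And>c f. f \<in> chain_maps C s P t Y \<Longrightarrow> \<Phi> (\<lambda>n x u. t c (f n x u)) = c * \<Phi> f"
    and null: "\<And>f. f \<in> chain_maps C s P t Y \<Longrightarrow> homotopic C s P t Y f 0 \<Longrightarrow> \<Phi> f = 0"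
  shows "\<exists>\<tau>\<in>chain_maps C t Y (pw (*)) (bic C s P). \<forall>f\<in>chain_maps C s P t Y. Tr C s P \<tau> f = \<Phi> f"
proof -
  let ?sc = "\<lambda>c (f :: int \<Rightarrow> 'o \<Rightarrow> 'v \<Rightarrow> 'w) n x u. t c (f n x u)"
  note c0 = chain_maps_zero[OF cplx_axioms Y.cplx_axioms]
  have \<Phi>0: "\<Phi> 0 = 0" by (rule null[OF c0 homotopic_refl[OF cplx_axioms Y.cplx_axioms]])
  have "\<exists>T. Vector_Spaces.linear ?sc (*) T \<and> (\<forall>f\<in>chain_maps C s P t Y. T f = \<Phi> f)"
    by (rule functional_factor[OF vs_fam, where sa = ?sc and L = "\<lambda>f. f"])
      (use c0 chain_maps_add[OF cplx_axioms Y.cplx_axioms] chain_maps_scale[OF cplx_axioms Y.cplx_axioms] add scale \<Phi>0 in blast)+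
  then obtain T where T: "Vector_Spaces.linear ?sc (*) T" and T\<Phi>: "\<And>f. f \<in> chain_maps C s P t Y \<Longrightarrow> T f = \<Phi> f" by blast
  interpret T: Vector_Spaces.linear ?sc "(*)" T by (rule T)
  define \<tau> where "\<tau> = (\<lambda>n. rank1 C s (cx P n) t (cx Y n) (\<lambda>g. sg n * T (single n g)))"
  have N\<tau>: "Nt \<tau>" unfolding \<tau>_def using rank_single_nt[OF T] by blast
  have \<tau>_apply: "\<tau> n x q \<xi> = sg n * T (single n (\<lambda>z. yon C t (cx Y n) x q z \<circ> \<xi> z))"
    if "x \<in> Ob C" "q \<in> sp (cx Y n) x" "\<xi> \<in> Dsp C s (cx P n) x" for n x q \<xi>
    unfolding \<tau>_def by (rule rank1_apply[OF that])
  have \<tau>n: "nt C t (cx Y n) (pw (*)) (bidual C s (cx P n)) (\<tau> n)" for n by (rule Nt_nt[OF N\<tau>])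
  have main: "\<tau> (n + 1) x (df Y n x q) \<xi> = \<tau> n x q (\<lambda>z. \<xi> z \<circ> df P n z)"
    if x: "x \<in> Ob C" and q: "q \<in> sp (cx Y n) x" and \<xi>: "\<xi> \<in> Dsp C s (cx P (n + 1)) x" for n x q \<xi>
  proof -
    let ?g = "\<lambda>z. yon C t (cx Y n) x q z \<circ> \<xi> z"
    have g: "?g \<in> nattrans C s (cx P (n + 1)) t (cx Y n)" by (rule nattrans_comp[OF \<xi> Y.yon_nt[OF x q]])
    \<comment> \<open>A homotopy with a single component, through \<open>q\<close> and
      \<open>\<xi>\<close>. The chain map that it bounds is concentrated in degrees \<open>n\<close>
      and \<open>n + 1\<close>, and that \<open>T\<close> kills it is the chain map identity for
      \<open>\<tau>\<close> at \<open>q\<close> and \<open>\<xi>\<close>.\<close>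
    define h where "h = single (n + 1) ?g"
    have h: "h m \<in> nattrans C s (cx P m) t (cx Y (m - 1))" for m
      using g nattrans_zero[OF cmod Y.cmod] by (simp add: h_def single_def)
    interpret h: nt C s "cx P i" t "cx Y (i - 1)" "h i" for i by (rule ntI[OF cmod Y.cmod h])
    define f where "f = (\<lambda>m. (\<lambda>z. df Y (m - 1) z \<circ> h m z) + (\<lambda>z. h (m + 1) z \<circ> df P m z))"
    have f: "f m \<in> nattrans C s (cx P m) t (cx Y m)" for m
      unfolding f_def by (rule nattrans_add[OF cmod Y.cmod boundary_nt[OF h]])
    have hd: "h (m + 1) z (df P m z u) \<in> sp (cx Y m) z" if "z \<in> Ob C" "u \<in> sp (cx P m) z" for m z u
      using h.in_sp[OF that(1) d.in_sp[OF that]] by simp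
    have fc: "f \<in> chain_maps C s P t Y"
      by (rule chain_mapsI[OF cplx_axioms Y.cplx_axioms f]) (simp add: f_def hd)
    have fh: "homotopic C s P t Y f 0"
      unfolding homotopic_def by (rule exI[of _ h]) (simp add: h f_def)
    have feq: "f = single (n + 1) (\<lambda>z. yon C t (cx Y (n + 1)) x (df Y n x q) z \<circ> \<xi> z)
        + single n (\<lambda>z. yon C t (cx Y n) x q z \<circ> (\<xi> z \<circ> df P n z))"
    proof (intro ext)
      fix m z u
      have a: "df Y n z (yon C t (cx Y n) x q z p) = yon C t (cx Y (n + 1)) x (df Y n x q) z p" for p
        by (rule Y.d.map_yon[OF x q])
      show "f m z u = (single (n + 1) (\<lambda>z. yon C t (cx Y (n + 1)) x (df Y n x q) z \<circ> \<xi> z)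
        + single n (\<lambda>z. yon C t (cx Y n) x q z \<circ> (\<xi> z \<circ> df P n z))) m z u"
        unfolding f_def h_def single_def plus_fun_apply by (auto simp: a)
    qed
    have Tf: "T f = 0" unfolding T\<Phi>[OF fc] by (rule null[OF fc fh])
    have "T (single (n + 1) (\<lambda>z. yon C t (cx Y (n + 1)) x (df Y n x q) z \<circ> \<xi> z))
        + T (single n (\<lambda>z. yon C t (cx Y n) x q z \<circ> (\<xi> z \<circ> df P n z))) = 0"
      unfolding T.add[symmetric] feq[symmetric] by (rule Tf)
    moreover have "\<tau> (n + 1) x (df Y n x q) \<xi> = - sg n * T (single (n + 1) (\<lambda>z. yon C t (cx Y (n + 1)) x (df Y n x q) z \<circ> \<xi> z))"
      using \<tau>_apply[OF x Y.d.in_sp[OF x q] \<xi>] by (simp add: sg_succ)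
    moreover have "\<tau> n x q (\<lambda>z. \<xi> z \<circ> df P n z) = sg n * T (single n (\<lambda>z. yon C t (cx Y n) x q z \<circ> (\<xi> z \<circ> df P n z)))"
      by (rule \<tau>_apply[OF x q Dsp_pre[OF d.nt \<xi>]])
    ultimately show ?thesis by (simp add: eq_neg_iff_add_eq_0[symmetric])
  qed
  have \<tau>c: "\<tau> \<in> chain_maps C t Y (pw (*)) (bic C s P)"
  proof (rule chain_mapsI[OF Y.cplx_axioms cplx_bic])
    show "\<tau> n \<in> nattrans C t (cx Y n) (pw (*)) (cx (bic C s P) n)" for n using N\<tau> by simp
    fix n x q assume x: "x \<in> Ob C" and q: "q \<in> sp (cx Y n) x"
    have \<tau>q: "\<tau> n x q \<in> sp (bidual C s (cx P n)) x" by (rule nt.in_sp[OF \<tau>n x q])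
    have \<tau>q': "\<tau> (n + 1) x (df Y n x q) \<in> sp (bidual C s (cx P (n + 1))) x" by (rule nt.in_sp[OF \<tau>n x Y.d.in_sp[OF x q]])
    show "\<tau> (n + 1) x (df Y n x q) = df (bic C s P) n x (\<tau> n x q)"
    proof
      fix \<xi>
      show "\<tau> (n + 1) x (df Y n x q) \<xi> = df (bic C s P) n x (\<tau> n x q) \<xi>"
        using main[OF x q] bidualD(3)[OF \<tau>q'] unfolding df_bic bidual_map_apply[OF x \<tau>q]
        by (cases "\<xi> \<in> Dsp C s (cx P (n + 1)) x") simp_all
    qed
  qed
  moreover have "Tr C s P \<tau> f = \<Phi> f" if f: "f \<in> chain_maps C s P t Y" for f
  proof -
    have s0: "single n (0 :: 'o \<Rightarrow> 'v \<Rightarrow> 'w) = 0" for n by (simp add: single_def fun_eq_iff)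
    have "sg n * trace C s (cx P n) (\<tau> n) (f n) = T (single n (f n))" for n
    proof -
      have "sg n * T (single n (f n)) = trace C s (cx P n) (\<tau> n) (f n)"
      proof (rule trace_functional[OF cmod fgproj \<tau>n, where T = "\<lambda>g. sg n * T (single n g)"])
        show "f n \<in> nattrans C s (cx P n) t (cx Y n)" using chain_Nf[OF f] by blast
        show "sg n * T (single n (g + h)) = sg n * T (single n g) + sg n * T (single n h)" for g h :: "'o \<Rightarrow> 'v \<Rightarrow> 'w"
          unfolding single_add T.add distrib_left ..
        show "sg n * T (single n 0) = 0" unfolding s0 T.zero by simp
      qed (simp add: \<tau>_apply)
      then show ?thesis by (metis sg_sq(1))
    qed
    then have "Tr C s P \<tau> f = (\<Sum>n=-M..M. T (single n (f n)))" unfolding Tr_eq[OF N\<tau> chain_Nf[OF f]] by simp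
    also have "\<dots> = T (\<Sum>n=-M..M. single n (f n))" by (rule T.sum[symmetric])
    \<comment> \<open>\<open>f\<close> vanishes outside \<open>{-M..M}\<close> because
      \<open>P\<close> does.\<close>
    also have "(\<Sum>n=-M..M. single n (f n)) = f"
    proof
      fix m
      have "(\<Sum>n=-M..M. single n (f n)) m = (\<Sum>n=-M..M. if n = m then f m else 0)"
        unfolding sum_fun_apply[of _ _ m] by (rule sum.cong) (auto simp: single_def)
      also have "\<dots> = f m"
      proof (cases "m \<in> {-M..M}")
        case False
        then have "f m = 0" using chain_Nf[OF f] by (intro vanish[OF _ Y.cmod]) auto
        then show ?thesis by simp
      qed simp
      finally show "(\<Sum>n=-M..M. single n (f n)) m = f m" .
    qed
    finally show ?thesis using T\<Phi>[OF f] by simp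
  qed
  ultimately show ?thesis by blast
qed

end

text \<open>By cyclicity in each degree, \<open>bic_map\<close> is adjoint to precomposition under
  the pairing.\<close>

lemma Tr_bic_map:
  assumes P: "pairing C s P M t Y" and Q: "bfp C s Q M'" and g: "g \<in> chain_maps C s P s Q"
    and \<tau>: "\<tau> \<in> chain_maps C t Y (pw (*)) (bic C s P)" and f: "f \<in> chain_maps C s Q t Y"
  shows "Tr C s Q (chain_comp (bic_map C s P Q g) \<tau>) f = Tr C s P \<tau> (chain_comp f g)"
proof -
  interpret P: pairing C s P M t Y by (rule P)
  interpret Q: bfp C s Q M' by (rule Q)
  \<comment> \<open>A common bound lets the two sums be compared degree by degree.\<close>
  let ?N = "max M M'"
  interpret P': pairing C s P ?N t Y
    by unfold_locales (use P.fgproj P.bounded P.M in auto)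
  interpret Q': pairing C s Q ?N t Y
    by unfold_locales (use Q.fgproj Q.bounded Q.M in auto)
  interpret g: chmap C s P s Q g by (rule chmapI[OF P.cplx_axioms Q.cplx_axioms g])
  interpret f: chmap C s Q t Y f by (rule chmapI[OF Q.cplx_axioms P.Y.cplx_axioms f])
  have \<tau>': "chain_comp (bic_map C s P Q g) \<tau> \<in> chain_maps C t Y (pw (*)) (bic C s Q)"
    by (rule chain_maps_comp[OF \<tau> bic_map_chain[OF P.cplx_axioms Q.cplx_axioms g]])
  note N\<tau> = P'.chain_Nt[OF \<tau>] and N\<tau>' = Q'.chain_Nt[OF \<tau>']
  have "trace C s (cx P n) (\<tau> n) (chain_comp f g n) = trace C s (cx Q n) (chain_comp (bic_map C s P Q g) \<tau> n) (f n)" for n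
  proof -
    have "trace C s (cx P n) (\<tau> n) (\<lambda>x. f n x \<circ> g n x) =
      trace C s (cx Q n) (chain_comp (bic_map C s P Q g) \<tau> n) (\<lambda>x. restr_fam C (cx Y n) (\<lambda>x u. u) x \<circ> f n x)"
    proof (rule trace_cyclic[OF P.cmod P.fgproj P'.Nt_nt[OF N\<tau>] Q.cmod Q.fgproj Q'.Nt_nt[OF N\<tau>'] g.nt P.Y.nattrans_id _ f.nt])
      fix x q \<xi> assume x: "x \<in> Ob C" and q: "q \<in> sp (cx Y n) x" and \<xi>: "\<xi> \<in> Dsp C s (cx Q n) x"
      have \<tau>q: "\<tau> n x q \<in> sp (bidual C s (cx P n)) x" by (rule nt.in_sp[OF P'.Nt_nt[OF N\<tau>] x q])
      show "chain_comp (bic_map C s P Q g) \<tau> n x (restr_fam C (cx Y n) (\<lambda>x u. u) x q) \<xi> = \<tau> n x q (\<lambda>z. \<xi> z \<circ> g n z)"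
        unfolding chain_comp_apply restr_fam_apply(1)[OF x q] bic_map_eq bidual_map_apply[OF x \<tau>q] using \<xi> by simp
    qed
    moreover have "(\<lambda>x. restr_fam C (cx Y n) (\<lambda>x u. u) x \<circ> f n x) = f n"
    proof (rule nattrans_eqI[OF nattrans_comp[OF f.nt P.Y.nattrans_id] f.nt])
      show "(restr_fam C (cx Y n) (\<lambda>x u. u) x \<circ> f n x) u = f n x u" if "x \<in> Ob C" "u \<in> sp (cx Q n) x" for x u
        using f.in_sp[OF that] that by simp
    qed
    ultimately show ?thesis by (simp add: chain_comp_def)
  qed
  then show ?thesis
    unfolding P'.Tr_eq[OF N\<tau> P'.chain_Nf[OF chain_maps_comp[OF g f]]] Q'.Tr_eq[OF N\<tau>' Q'.chain_Nf[OF f]] by simp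
qed

section \<open>Resolutions of perfect complexes\<close>

lemma bfp_of_bounded_ft_projective:
  fixes C :: "('o, 'm) cat" and s :: "'k::field \<Rightarrow> 'v::ab_group_add \<Rightarrow> 'v" and e :: "(nat \<times> 'm \<Rightarrow> 'k) \<Rightarrow> 'v"
  assumes cat: "category C" and e: "transp (pw (*)) s e" and P: "bounded_ft_projective C s P"
  shows "\<exists>M. bfp C s P M"
proof -
  obtain N where N: "\<And>n x. \<bar>n\<bar> > N \<Longrightarrow> x \<in> Ob C \<Longrightarrow> sp (cx P n) x = {0}"
    using P unfolding bounded_ft_projective_def by blast
  have "bfp C s P (max 0 (N + 1))"
  proof (intro bfp.intro bfp_axioms.intro)
    show "cplx C s P" using P cat transp.vs_t[OF e] by (simp add: cplx_def bounded_ft_projective_def)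
    show "fgproj C s (cx P n)" for n
      using fgproj_of_projective[OF cat e] P unfolding bounded_ft_projective_def by blast
    show "u = 0" if "max 0 (N + 1) \<le> \<bar>n\<bar>" "x \<in> Ob C" "u \<in> sp (cx P n) x" for n x u
      using N[of n x] that by simp
  qed simp
  then show ?thesis by blast
qed

lemma (in bfp) bounded_ft_projective: "bounded_ft_projective C s P"
  unfolding bounded_ft_projective_def
proof (intro conjI allI exI[of _ M] impI ballI)
  show "is_complex C s P" by (rule cx)
  fix n
  obtain N xs pe ie where "dual_basis C s (cx P n) N xs pe ie" using fgproj unfolding fgproj_def by blast
  then interpret dual_basis C s "cx P n" N xs pe ie .
  show "projective C s (cx P n)" by (rule projective)
  show "finite_type C s (cx P n)" by (rule finite_type)
next
  fix n :: int and x assume "M < \<bar>n\<bar>" "x \<in> Ob C"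
  then show "sp (cx P n) x = {0}" using bounded[of n x] zero_in[of x n] by auto
qed

text \<open>A finitely generated projective is isomorphic to its image under a section into a sum of
  standard projectives, hence it is realised in the ambient space of that sum.\<close>

lemma fgproj_realize:
  fixes s :: "'k::field \<Rightarrow> 'v::ab_group_add \<Rightarrow> 'v" and C :: "('o, 'm) cat"
  assumes "fgproj C s F"
  obtains G :: "('o, 'm, nat \<times> 'm \<Rightarrow> 'k) cmod" and i j where
    "fgproj C (pw (*)) G" "cmodule C (pw (*)) G"
    "i \<in> nattrans C (pw (*)) G s F" "j \<in> nattrans C s F (pw (*)) G"
    "\<And>x u. x \<in> Ob C \<Longrightarrow> u \<in> sp G x \<Longrightarrow> j x (i x u) = u"
    "\<And>x u. x \<in> Ob C \<Longrightarrow> u \<in> sp F x \<Longrightarrow> i x (j x u) = u"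
proof -
  obtain N xs pe ie where "dual_basis C s F N xs pe ie" using assms unfolding fgproj_def by blast
  then interpret dual_basis C s F N xs pe ie .
  let ?S = "std_sum C (map xs [0..<N]) :: ('o, 'm, nat \<times> 'm \<Rightarrow> 'k) cmod"
  have S: "cmodule C (pw (*)) ?S" by (rule cmodule_std_sum[OF xs_list])
  interpret S: cmodule C "pw (*)" ?S by (rule S)
  interpret se: nt C s F "pw (*)" ?S sect by (rule ntI[OF cmodule_axioms S sect_nt])
  interpret co: nt C "pw (*)" ?S s F cover by (rule ntI[OF S cmodule_axioms cover_nt])
  define G where "G = \<lparr>sp = (\<lambda>x. sect x ` sp F x), act = (\<lambda>x y h. restr (sect x ` sp F x) (act ?S x y h))\<rparr>"
  have spG: "sp G x = sect x ` sp F x" for x by (simp add: G_def)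
  have actG: "act G x y h (sect x u) = sect y (act F x y h u)"
    if "x \<in> Ob C" "y \<in> Ob C" "h \<in> Hom C x y" "u \<in> sp F x" for x y h u
    using that se.natural[OF that(1-3), of u] by (simp add: G_def restr_def)
  have G: "cmodule C (pw (*)) G"
  proof (rule cmoduleI[OF cat S.vs])
    show "0 \<in> sp G x" if "x \<in> Ob C" for x
      unfolding spG by (rule image_eqI[of _ _ 0]) (use that in auto)
    show "u + v \<in> sp G x" if x: "x \<in> Ob C" and uv: "u \<in> sp G x" "v \<in> sp G x" for x u v
    proof -
      obtain a b where "a \<in> sp F x" "u = sect x a" "b \<in> sp F x" "v = sect x b" using uv unfolding spG by blast
      then show ?thesis unfolding spG by (intro image_eqI[of _ _ "a + b"]) (use x in auto)
    qed
    show "pw (*) c u \<in> sp G x" if x: "x \<in> Ob C" and u: "u \<in> sp G x" for x u c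
    proof -
      obtain a where "a \<in> sp F x" "u = sect x a" using u unfolding spG by blast
      then show ?thesis unfolding spG by (intro image_eqI[of _ _ "s c a"]) (use x in auto)
    qed
  next
    fix x y h u assume xy: "x \<in> Ob C" "y \<in> Ob C" "h \<in> Hom C x y" and "u \<in> sp G x"
    then obtain a where a: "a \<in> sp F x" "u = sect x a" unfolding spG by blast
    show "act G x y h u \<in> sp G y" unfolding a(2) actG[OF xy a(1)] unfolding spG using xy a(1) by blast
    show "act G x y h (pw (*) c u) = pw (*) c (act G x y h u)" for c
      unfolding a(2) se.scale[OF xy(1) a(1), symmetric] actG[OF xy a(1)] actG[OF xy scale_in[OF xy(1) a(1)]]
      using xy a(1) by simp
  next
    fix x y h u v assume xy: "x \<in> Ob C" "y \<in> Ob C" "h \<in> Hom C x y" and u: "u \<in> sp G x" and v: "v \<in> sp G x"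
    obtain a where a: "a \<in> sp F x" "u = sect x a" using u unfolding spG by blast
    obtain b where b: "b \<in> sp F x" "v = sect x b" using v unfolding spG by blast
    have "act G x y h (sect x (a + b)) = sect y (act F x y h a + act F x y h b)"
      unfolding actG[OF xy add_in[OF xy(1) a(1) b(1)]] act_add[OF xy a(1) b(1)] ..
    also have "\<dots> = act G x y h (sect x a) + act G x y h (sect x b)"
      unfolding actG[OF xy a(1)] actG[OF xy b(1)]
      by (rule se.add[OF xy(2) act_in[OF xy a(1)] act_in[OF xy b(1)]])
    finally show "act G x y h (u + v) = act G x y h u + act G x y h v"
      unfolding a(2) b(2) se.add[OF xy(1) a(1) b(1)] .
  next
    fix x y h u assume "x \<in> Ob C" "y \<in> Ob C" "h \<in> Hom C x y" "u \<notin> sp G x"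
    then show "act G x y h u = 0" by (simp add: G_def restr_def)
  next
    fix x u assume x: "x \<in> Ob C" and "u \<in> sp G x"
    then obtain a where a: "a \<in> sp F x" "u = sect x a" unfolding spG by blast
    show "act G x x (Idn C x) u = u" unfolding a(2) actG[OF x x Idn_in[OF x] a(1)] using x a(1) by simp
  next
    fix x y z f g u assume xyz: "x \<in> Ob C" "y \<in> Ob C" "z \<in> Ob C" "f \<in> Hom C x y" "g \<in> Hom C y z" and "u \<in> sp G x"
    then obtain a where a: "a \<in> sp F x" "u = sect x a" unfolding spG by blast
    show "act G x z (Cmp C x y z g f) u = act G y z g (act G x y f u)"
      unfolding a(2) actG[OF xyz(1,3) Cmp_in[OF xyz] a(1)] actG[OF xyz(1,2,4) a(1)]
        actG[OF xyz(2,3,5) act_in[OF xyz(1,2,4) a(1)]] act_comp[OF xyz] ..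
  qed
  have sub: "u \<in> sp ?S x" if "x \<in> Ob C" "u \<in> sp G x" for x u using that unfolding spG by blast
  define i where "i = restr_fam C G cover"
  have i_apply: "i x (sect x u) = u" if "x \<in> Ob C" "u \<in> sp F x" for x u
    using that cover_sect[OF that] by (simp add: i_def spG)
  have i: "i \<in> nattrans C (pw (*)) G s F"
    unfolding i_def
  proof (rule nattrans_restrI[OF G cmodule_axioms])
    fix x y h u assume xy: "x \<in> Ob C" "y \<in> Ob C" "h \<in> Hom C x y" and u: "u \<in> sp G x"
    obtain a where a: "a \<in> sp F x" "u = sect x a" using u unfolding spG by blast
    show "cover y (act G x y h u) = act F x y h (cover x u)"
      unfolding a(2) actG[OF xy a(1)] cover_sect[OF xy(1) a(1)] cover_sect[OF xy(2) act_in[OF xy a(1)]] ..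
  qed (use sub in auto)
  have j: "sect \<in> nattrans C s F (pw (*)) G"
  proof (rule nattransI[OF cmodule_axioms G])
    fix x y h u assume "x \<in> Ob C" "y \<in> Ob C" "h \<in> Hom C x y" "u \<in> sp F x"
    then show "sect y (act F x y h u) = act G x y h (sect x u)" by (simp add: actG)
  qed (auto simp: spG)
  have fg: "fgproj C (pw (*)) G"
  proof (rule fgproj_retract[OF xs_list G nattrans_comp[OF cover_nt j] nattrans_comp[OF i sect_nt]])
    fix x u assume x: "x \<in> Ob C" and "u \<in> sp G x"
    then obtain a where a: "a \<in> sp F x" "u = sect x a" unfolding spG by blast
    show "(sect x \<circ> cover x) ((sect x \<circ> i x) u) = u"
      unfolding a(2) using cover_sect[OF x a(1)] i_apply[OF x a(1)] by simp
  qed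
  have ji: "sect x (i x u) = u" if x: "x \<in> Ob C" and u: "u \<in> sp G x" for x u
  proof -
    obtain a where a: "a \<in> sp F x" "u = sect x a" using u unfolding spG by blast
    show ?thesis unfolding a(2) i_apply[OF x a(1)] ..
  qed
  show ?thesis by (rule that[OF fg G i j ji i_apply])
qed

text \<open>The differentials are conjugated by the isomorphisms of \<open>fgproj_realize\<close>.
  The new ambient space is the one in which \<open>resolution\<close> makes its choice.\<close>

lemma (in bfp) realize:
  "\<exists>P' a. bfp C (pw (*)) (P' :: ('o, 'm, nat \<times> 'm \<Rightarrow> 'k) cpx) M \<and> quasi_iso C (pw (*)) P' s P a"
proof -
  have "\<exists>G i j. fgproj C (pw (*)) (G :: ('o, 'm, nat \<times> 'm \<Rightarrow> 'k) cmod) \<and> cmodule C (pw (*)) G \<and>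
    i \<in> nattrans C (pw (*)) G s (cx P n) \<and> j \<in> nattrans C s (cx P n) (pw (*)) G \<and>
    (\<forall>x u. x \<in> Ob C \<longrightarrow> u \<in> sp G x \<longrightarrow> j x (i x u) = u) \<and>
    (\<forall>x u. x \<in> Ob C \<longrightarrow> u \<in> sp (cx P n) x \<longrightarrow> i x (j x u) = u)" for n
    by (rule fgproj_realize[OF fgproj[of n]], intro exI conjI allI impI)
  then obtain G :: "int \<Rightarrow> ('o, 'm, nat \<times> 'm \<Rightarrow> 'k) cmod" and i j
    where "\<forall>n. fgproj C (pw (*)) (G n) \<and> cmodule C (pw (*)) (G n) \<and>
    i n \<in> nattrans C (pw (*)) (G n) s (cx P n) \<and> j n \<in> nattrans C s (cx P n) (pw (*)) (G n) \<and>
    (\<forall>x u. x \<in> Ob C \<longrightarrow> u \<in> sp (G n) x \<longrightarrow> j n x (i n x u) = u) \<and>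
    (\<forall>x u. x \<in> Ob C \<longrightarrow> u \<in> sp (cx P n) x \<longrightarrow> i n x (j n x u) = u)"
    by metis
  then have G: "\<And>n. fgproj C (pw (*)) (G n)" "\<And>n. cmodule C (pw (*)) (G n)"
    and i: "\<And>n. i n \<in> nattrans C (pw (*)) (G n) s (cx P n)"
    and j: "\<And>n. j n \<in> nattrans C s (cx P n) (pw (*)) (G n)"
    and ji: "\<And>n x u. x \<in> Ob C \<Longrightarrow> u \<in> sp (G n) x \<Longrightarrow> j n x (i n x u) = u"
    and ij: "\<And>n x u. x \<in> Ob C \<Longrightarrow> u \<in> sp (cx P n) x \<Longrightarrow> i n x (j n x u) = u"
    by blast+
  interpret i: nt C "pw (*)" "G l" s "cx P l" "i l" for l by (rule ntI[OF G(2) cmod i])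
  interpret j: nt C s "cx P l" "pw (*)" "G l" "j l" for l by (rule ntI[OF cmod G(2) j])
  define P' where "P' = \<lparr>cx = G, df = (\<lambda>n x. j (n + 1) x \<circ> (df P n x \<circ> i n x))\<rparr>"
  have cxP: "cx P' n = G n" for n by (simp add: P'_def)
  have dfP: "df P' n x u = j (n + 1) x (df P n x (i n x u))" for n x u by (simp add: P'_def)
  have d: "df P' n \<in> nattrans C (pw (*)) (G n) (pw (*)) (G (n + 1))" for n
    using nattrans_comp[OF nattrans_comp[OF i d.nt] j] by (simp add: P'_def)
  have P': "cplx C (pw (*)) P'"
  proof (rule cplxI[OF cat G(2)[THEN cmodule.vs]])
    show "cmodule C (pw (*)) (cx P' n)" for n using G(2) by (simp add: cxP)
    show "df P' n \<in> nattrans C (pw (*)) (cx P' n) (pw (*)) (cx P' (n + 1))" for n using d by (simp add: cxP)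
    fix n x u assume x: "x \<in> Ob C" and "u \<in> sp (cx P' n) x"
    then have u: "u \<in> sp (G n) x" by (simp add: cxP)
    show "df P' (n + 1) x (df P' n x u) = 0"
      unfolding dfP ij[OF x d.in_sp[OF x i.in_sp[OF x u]]] dd j.zero ..
  qed
  have ic: "i \<in> chain_maps C (pw (*)) P' s P"
  proof (rule chain_mapsI[OF P' cplx_axioms])
    show "i n \<in> nattrans C (pw (*)) (cx P' n) s (cx P n)" for n using i by (simp add: cxP)
    fix n x u assume x: "x \<in> Ob C" and "u \<in> sp (cx P' n) x"
    then have u: "u \<in> sp (G n) x" by (simp add: cxP)
    show "i (n + 1) x (df P' n x u) = df P n x (i n x u)"
      unfolding dfP by (rule ij[OF x d.in_sp[OF x i.in_sp[OF x u]]])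
  qed
  have jc: "j \<in> chain_maps C s P (pw (*)) P'"
  proof (rule chain_mapsI[OF cplx_axioms P'])
    show "j n \<in> nattrans C s (cx P n) (pw (*)) (cx P' n)" for n using j by (simp add: cxP)
    fix n x u assume x: "x \<in> Ob C" and u: "u \<in> sp (cx P n) x"
    show "j (n + 1) x (df P n x u) = df P' n x (j n x u)" unfolding dfP ij[OF x u] ..
  qed
  have "quasi_iso C (pw (*)) P' s P i"
  proof (rule quasi_iso_inverse[OF chmapI[OF P' cplx_axioms ic] chmapI[OF cplx_axioms P' jc]])
    show "chain_comp j i = chain_id C P'"
    proof (rule chain_maps_eqI[OF chain_maps_comp[OF ic jc] cplx.chain_id_in[OF P']])
      fix n x u assume "x \<in> Ob C" "u \<in> sp (cx P' n) x"
      then show "chain_comp j i n x u = chain_id C P' n x u" by (simp add: ji cxP)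
    qed
    show "chain_comp i j = chain_id C P"
      by (rule chain_maps_eqI[OF chain_maps_comp[OF jc ic] chain_id_in]) (simp add: ij)
  qed
  moreover have "bfp C (pw (*)) P' M"
  proof (intro bfp.intro[OF P'] bfp_axioms.intro)
    show "fgproj C (pw (*)) (cx P' n)" for n using G(1) by (simp add: cxP)
    fix n x u assume n: "M \<le> \<bar>n\<bar>" and x: "x \<in> Ob C" and "u \<in> sp (cx P' n) x"
    then have u: "u \<in> sp (G n) x" by (simp add: cxP)
    have "i n x u = 0" by (rule bounded[OF n x i.in_sp[OF x u]])
    then show "u = 0" using ji[OF x u] by simp
  qed (rule M)
  ultimately show ?thesis by blast
qed

section \<open>From isomorphisms in the derived category to quasi-isomorphisms\<close>

context derived_setting
begin

abbreviation (input) chain_cp (infixl "\<cdot>" 75) where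
  "g \<cdot> f \<equiv> chain_comp g f"

lemma ch_iff: "Ar X Y f \<longleftrightarrow> cplx C s X \<and> cplx C s Y \<and> f \<in> chain_maps C s X s Y"
  by (simp add: Ar_def cplx_iff)

lemma H_iff: "H X Y f g \<longleftrightarrow> Ar X Y f \<and> Ar X Y g \<and> homotopic C s X s Y f g"
  by (simp add: H_def)

lemma Q_iff: "Q X Y f \<longleftrightarrow> Ar X Y f \<and> quasi_iso C s X s Y f"
  by (simp add: Q_def)

lemma Ar_chmap: "Ar X Y f \<Longrightarrow> chmap C s X s Y f"
  unfolding ch_iff using chmapI by blast

lemma bfp_lift:
  assumes P: "bfp C s P M" and f: "Ar P X f" and \<sigma>: "Q Z X \<sigma>"
  obtains h where "Ar P Z h" "H P X (\<sigma> \<cdot> h) f"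
proof -
  interpret bfp C s P M by (rule P)
  have q: "quasi_iso C s Z s X \<sigma>" and A: "Ar Z X \<sigma>" using \<sigma> by (simp_all add: Q_iff)
  have f': "f \<in> chain_maps C s P s X" using f by (simp add: ch_iff)
  obtain h where h: "h \<in> chain_maps C s P s Z" "homotopic C s P s X (chain_comp \<sigma> h) f"
    using lift_exists[OF Ar_chmap[OF A] q f'] by blast
  have "Ar P Z h" using h(1) A cplx_axioms by (simp add: ch_iff)
  then show ?thesis using that h(2) Ar_comp[OF _ A] f by (simp add: H_iff)
qed

text \<open>\<open>Perf\<close> speaks of isomorphisms in the derived category. As maps from
  \<open>P\<close> lift along quasi-isomorphisms, the isomorphism is the class of a chain map
  \<open>?a\<close>; the right inverse makes \<open>?a\<close> surjective on cohomology and the left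
  inverse makes it injective.\<close>

lemma iso_quasi_iso:
  assumes P: "bfp C s P M" and X: "cplx C s X" and iso: "isomorphic (derived C s) P X"
  shows "\<exists>a. quasi_iso C s P s X a"
proof -
  interpret P: bfp C s P M by (rule P)
  have PX: "P \<in> {X. is_complex C s X}" "X \<in> {X. is_complex C s X}" using X P.cplx_axioms by (simp_all add: cplx_iff)
  obtain \<alpha> \<beta> where \<alpha>: "\<alpha> \<in> Hm P X" and \<beta>: "\<beta> \<in> Hm X P"
    and c1: "fcomp P X P \<beta> \<alpha> = floc P P (chain_id C P)" and c2: "fcomp X P X \<alpha> \<beta> = floc X X (chain_id C X)"
    using iso unfolding isomorphic_def derived_eq fcat_def Hm_def by auto
  obtain Z \<sigma> f where z: "Q Z P \<sigma>" "Ar Z X f" "\<alpha> = fr P X Z \<sigma> f" by (rule Hm_cases[OF PX \<alpha>])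
  obtain W \<tau> g where w: "Q W X \<tau>" "Ar W P g" "\<beta> = fr X P W \<tau> g" by (rule Hm_cases[OF PX(2,1) \<beta>])
  obtain h where h: "Ar P Z h" "H P P (\<sigma> \<cdot> h) (chain_id C P)"
    by (rule bfp_lift[OF P Ar_id[OF PX(1)] z(1)])
  have qh: "Q P P (\<sigma> \<cdot> h)" by (rule Q_H[OF H_sym[OF h(2)] Q_id[OF PX(1)]])
  obtain k where k: "Ar P W k" "H P X (\<tau> \<cdot> k) (f \<cdot> h)"
    by (rule bfp_lift[OF P Ar_comp[OF h(1) z(2)] w(1)])
  let ?a = "\<tau> \<cdot> k"
  have a: "Ar P X ?a" using k(2) by (simp add: H_iff)
  have "\<alpha> = fr P X P (\<sigma> \<cdot> h) (f \<cdot> h)" using fr_refine'[OF z(1,2) h(1) qh] z(3) by simp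
  also have "\<dots> = fr P X P (chain_id C P) ?a" by (rule fr_H[OF qh h(2) H_sym[OF k(2)]])
  finally have \<alpha>a: "\<alpha> = floc P X ?a" by (simp add: floc_def)
  have "fr X X W \<tau> (?a \<cdot> g) = fr X X W \<tau> (chain_id C X \<cdot> \<tau>)"
    using c2 unfolding \<alpha>a w(3) fcomp_floc_left[OF w(1,2) a] floc_fr[OF Ar_id[OF PX(2)] w(1)] .
  then obtain V p where p: "Q V W p" "H V X (?a \<cdot> g \<cdot> p) (chain_id C X \<cdot> \<tau> \<cdot> p)"
    using fr_eqD[OF w(1) Ar_comp[OF w(2) a] Ar_comp[OF QD[OF w(1)] Ar_id[OF PX(2)]]] by blast
  have "Q V X (?a \<cdot> g \<cdot> p)"
    by (rule Q_H[OF H_sym[OF p(2)]]) (rule Q_comp[OF p(1) Q_comp[OF w(1) Q_id[OF PX(2)]]])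
  then have q1: "Q V X (?a \<cdot> (g \<cdot> p))" by (simp only: assoc)
  have gp: "Ar V P (g \<cdot> p)" by (rule Ar_comp[OF QD[OF p(1)] w(2)])
  have "hsurj C V X (?a \<cdot> (g \<cdot> p))"
    using q1 chmap.quasi_iso_iff[OF Ar_chmap[OF QD[OF q1]]] by (simp add: Q_iff)
  then have su: "hsurj C P X ?a" by (rule hsurj_cancel[OF Ar_chmap[OF gp] Ar_chmap[OF a]])
  have gk: "Ar P P (g \<cdot> k)" by (rule Ar_comp[OF k(1) w(2)])
  have "floc P P (g \<cdot> k) = floc P P (chain_id C P)"
    using c1 unfolding \<alpha>a w(3) fcomp_floc_right[OF k(1) w(1,2)] .
  then obtain U q where q: "Q U P q" "H U P (g \<cdot> k \<cdot> q) (chain_id C P \<cdot> q)"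
    using floc_eqD[OF gk Ar_id[OF PX(1)]] by blast
  have q2: "Q U P (g \<cdot> k \<cdot> q)" by (rule Q_H[OF H_sym[OF q(2)] Q_comp[OF q(1) Q_id[OF PX(1)]]])
  have "hinj C U P (g \<cdot> k \<cdot> q)" using q2 chmap.quasi_iso_iff[OF Ar_chmap[OF QD[OF q2]]] by (simp add: Q_iff)
  moreover have "hsurj C U P q" using q(1) chmap.quasi_iso_iff[OF Ar_chmap[OF QD[OF q(1)]]] by (simp add: Q_iff)
  ultimately have "hinj C P P (g \<cdot> k)" by (rule hinj_right[OF Ar_chmap[OF QD[OF q(1)]] Ar_chmap[OF gk], rotated])
  then have "hinj C P W k" by (rule hinj_cancel[OF Ar_chmap[OF k(1)] Ar_chmap[OF w(2)]])
  moreover have "hinj C W X \<tau>" using w(1) chmap.quasi_iso_iff[OF Ar_chmap[OF QD[OF w(1)]]] by (simp add: Q_iff)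
  ultimately have "hinj C P X ?a" by (rule hinj_comp[OF Ar_chmap[OF k(1)] Ar_chmap[OF QD[OF w(1)]]])
  then show ?thesis using su chmap.quasi_iso_iff[OF Ar_chmap[OF a]] by blast
qed

end

section \<open>Full subcategories\<close>

lemma full_subcat_sel:
  "Hom (full_subcat A P) = Hom A" "Idn (full_subcat A P) = Idn A" "Cmp (full_subcat A P) = Cmp A"
  "Add (full_subcat A P) = Add A" "Smul (full_subcat A P) = Smul A"
  for A :: "('o, 'm, 'k) lincat"
  by (simp_all add: full_subcat_def)

lemma klinear_full_subcat:
  assumes "klinear_category A"
  shows "klinear_category (full_subcat A P)"
proof -
  have Ob: "Ob (full_subcat A P) \<subseteq> Ob A" by (auto simp: full_subcat_def)
  note k = assms[unfolded klinear_category_def category_def]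
  note k1 = k[THEN conjunct1, THEN conjunct1] k[THEN conjunct1, THEN conjunct2, THEN conjunct1]
    k[THEN conjunct1, THEN conjunct2, THEN conjunct2, THEN conjunct1]
    k[THEN conjunct1, THEN conjunct2, THEN conjunct2, THEN conjunct2]
    k[THEN conjunct2, THEN conjunct1] k[THEN conjunct2, THEN conjunct2]
  show ?thesis
    unfolding klinear_category_def category_def full_subcat_sel
  proof (intro conjI)
    let ?O = "Ob (full_subcat A P)"
    show "\<forall>x\<in>?O. Idn A x \<in> Hom A x x" using k1(1) Ob by blast
    show "\<forall>x\<in>?O. \<forall>y\<in>?O. \<forall>z\<in>?O. \<forall>f\<in>Hom A x y. \<forall>g\<in>Hom A y z. Cmp A x y z g f \<in> Hom A x z"
      by (rule ballI, rule ballI, rule ballI, rule bspec[OF bspec[OF bspec[OF k1(2)]]]; erule subsetD[OF Ob])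
  qed ((rule ballI, rule ballI, rule bspec[OF bspec[OF k1(3)]]; erule subsetD[OF Ob]),
      (rule ballI, rule ballI, rule ballI, rule ballI, rule bspec[OF bspec[OF bspec[OF bspec[OF k1(4)]]]]; erule subsetD[OF Ob]),
      (rule ballI, rule ballI, rule bspec[OF bspec[OF k1(5)]]; erule subsetD[OF Ob]),
      (rule ballI, rule ballI, rule ballI, rule bspec[OF bspec[OF bspec[OF k1(6)]]]; erule subsetD[OF Ob]))
qed

lemma serre_duality_full_subcat:
  fixes A :: "('o, 'm, 'k::field) lincat"
  assumes "relative_serre_duality A P So Sm" and P: "\<forall>X\<in>P. So X \<in> P"
  shows "serre_duality (full_subcat A P) So Sm"
proof -
  have k: "klinear_category A" and sub: "P \<subseteq> Ob A" and f: "is_functor (full_subcat A P) A So Sm"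
    and "\<exists>\<eta>. serre_iso A P So Sm \<eta>"
    using assms(1) unfolding relative_serre_duality_def by blast+
  then obtain \<eta> where \<eta>: "serre_iso A P So Sm \<eta>" by blast
  have Ob: "Ob (full_subcat A P) = P" using sub by (auto simp: full_subcat_def)
  have "serre_iso (full_subcat A P) P So Sm \<eta>"
    using \<eta> unfolding serre_iso_def hom_dual_def full_subcat_sel .
  moreover have "is_functor (full_subcat A P) (full_subcat A P) So Sm"
    using f P unfolding is_functor_def Ob full_subcat_sel by blast
  ultimately show ?thesis unfolding serre_duality_def Ob using klinear_full_subcat[OF k] by blast
qed

section \<open>The duality\<close>

text \<open>Evaluations at different indices are told apart by a delta function. The injection shows
  that the index type of the bidual space is infinite, and it lets \<open>e\<close> embed the space
  of the resolutions as well.\<close>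

lemma pspace_index_injection:
  "\<exists>j :: nat \<times> 'm \<Rightarrow> 'o \<Rightarrow> ('m, 'k::field) pspace \<Rightarrow> 'm \<Rightarrow> 'k. inj j"
proof
  show "inj (\<lambda>p (x :: 'o) (u :: ('m, 'k) pspace) (m :: 'm). u p)"
  proof (rule injI)
    fix p q :: "nat \<times> 'm"
    assume e: "(\<lambda>(x :: 'o) (u :: ('m, 'k) pspace) (m :: 'm). u p) = (\<lambda>x u m. u q)"
    have "u p = u q" for u :: "('m, 'k) pspace" using fun_cong[OF fun_cong[OF fun_cong[OF e]]] by blast
    from this[of "\<lambda>r. if r = p then 1 else 0"] show "p = q" by (simp split: if_splits)
  qed
qed

text \<open>A left inverse of \<open>j\<close> is surjective, so composing with it embeds the
  functions on \<open>'a\<close> in the functions on \<open>'i\<close>.\<close>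

lemma transp_reindex:
  fixes e :: "('i \<Rightarrow> 'k::field) \<Rightarrow> 'v::ab_group_add" and j :: "'a \<Rightarrow> 'i"
  assumes e: "transp (pw (*)) s e" and j: "inj j"
  shows "transp (pw (*)) s (\<lambda>f :: 'a \<Rightarrow> 'k. e (\<lambda>i. f (inv j i)))"
proof (rule transp.intro)
  interpret e: transp "pw (*)" s e by (rule e)
  have "e (\<lambda>i. (f + g) (inv j i)) = e (\<lambda>i. f (inv j i)) + e (\<lambda>i. g (inv j i))" for f g :: "'a \<Rightarrow> 'k"
    unfolding e.l.add[symmetric] by (rule arg_cong[of _ _ e]) (simp add: fun_eq_iff)
  moreover have "e (\<lambda>i. pw (*) c f (inv j i)) = s c (e (\<lambda>i. f (inv j i)))" for c and f :: "'a \<Rightarrow> 'k"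
    unfolding e.l.scale[symmetric] by (rule arg_cong[of _ _ e]) (simp add: fun_eq_iff pw_def)
  ultimately show "Vector_Spaces.linear (pw (*)) s (\<lambda>f :: 'a \<Rightarrow> 'k. e (\<lambda>i. f (inv j i)))"
    unfolding Vector_Spaces.linear_iff using vector_space_pw[OF vector_space_mult] e.vs_t by blast
  show "inj (\<lambda>f :: 'a \<Rightarrow> 'k. e (\<lambda>i. f (inv j i)))"
  proof (rule injI)
    fix f g :: "'a \<Rightarrow> 'k"
    assume "e (\<lambda>i. f (inv j i)) = e (\<lambda>i. g (inv j i))"
    then have "(\<lambda>i. f (inv j i)) = (\<lambda>i. g (inv j i))" by simp
    then have "f (inv j (j a)) = g (inv j (j a))" for a by (rule fun_cong)
    then show "f = g" using j by (simp add: fun_eq_iff)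
  qed
qed

text \<open>Three embeddings into \<open>'v\<close>: \<open>E\<close> for homotopy pullbacks,
  \<open>e\<close> for bidual complexes, and \<open>e0\<close> for resolutions, so that a resolution
  can be the apex of a roof.\<close>

locale serre_setting = derived_setting C s E + e: transp "pw (*)" s e + e0: transp "pw (*)" s e0
  for C :: "('o, 'm) cat" and s :: "'k::field \<Rightarrow> 'v::ab_group_add \<Rightarrow> 'v" and E
    and e :: "('o, 'm, 'k) bidual_space \<Rightarrow> 'v" and e0 :: "('m, 'k) pspace \<Rightarrow> 'v"
begin

abbreviation "PP X \<equiv> fst (resolution C s X)"
abbreviation "rr X \<equiv> snd (resolution C s X)"
abbreviation "cP X Y \<equiv> chain_maps C (pw (*)) (PP X) s Y"
abbreviation "hP X Y \<equiv> homotopic C (pw (*)) (PP X) s Y"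
abbreviation "TT X \<equiv> transport_cpx C e0 (PP X)"
abbreviation "rho X \<equiv> tout C e0 (PP X)"
abbreviation "RR X \<equiv> rr X \<cdot> rho X"
abbreviation "BB X \<equiv> bic C (pw (*)) (PP X)"
abbreviation "SS X \<equiv> RD_dual C s e X"
abbreviation "tinB X \<equiv> tin C e (BB X)"
abbreviation "toutB X \<equiv> tout C e (BB X)"
abbreviation "cB Y X \<equiv> chain_maps C s Y (pw (*)) (BB X)"
abbreviation "hB Y X \<equiv> homotopic C s Y (pw (*)) (BB X)"
abbreviation "trP X \<equiv> Tr C (pw (*)) (PP X)"

text \<open>The fraction with the resolution of \<open>X\<close>, moved into \<open>'v\<close>, as
  apex and \<open>f\<close> as numerator. It identifies morphisms out of a perfect complex with
  homotopy classes of chain maps from its resolution, by \<open>Psi_cases\<close>,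
  \<open>Psi_eqI\<close> and \<open>Psi_eqD\<close>.\<close>

definition Psi where
  "Psi X Y f = fr X Y (TT X) (RR X) (f \<cdot> rho X)"

section \<open>Morphisms out of a perfect complex as homotopy classes\<close>

lemma Perf_cplx: "X \<in> Perf C s \<Longrightarrow> cplx C s X"
  by (simp add: Perf_def cplx_iff)

text \<open>This gives meaning to the choice in \<open>resolution\<close>: a perfect complex
  receives a quasi-isomorphism from some bounded complex of projectives in \<open>'v\<close>, which
  is then realised in \<open>pspace\<close>.\<close>

lemma resolution:
  assumes X: "X \<in> Perf C s"
  shows "bounded_ft_projective C (pw (*)) (PP X) \<and> quasi_iso C (pw (*)) (PP X) s X (rr X)"
proof -
  obtain P where P: "bounded_ft_projective C s P" and i: "isomorphic (derived C s) P X"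
    using X unfolding Perf_def by blast
  obtain M where bfp: "bfp C s P M"
    using bfp_of_bounded_ft_projective[OF cat e0.transp_axioms P] by blast
  obtain a where a: "quasi_iso C s P s X a" using iso_quasi_iso[OF bfp Perf_cplx[OF X] i] by blast
  interpret bfp C s P M by (rule bfp)
  obtain P' :: "('o, 'm, ('m, 'k) pspace) cpx" and b
    where P': "bfp C (pw (*)) P' M" and b: "quasi_iso C (pw (*)) P' s P b"
    using realize by blast
  interpret P': bfp C "pw (*)" P' M by (rule P')
  have ac: "chmap C s P s X a" using a by (intro chmapI[OF cplx_axioms Perf_cplx[OF X]]) (simp add: quasi_iso_def)
  have bc: "chmap C (pw (*)) P' s P b" using b by (intro chmapI[OF P'.cplx_axioms cplx_axioms]) (simp add: quasi_iso_def)
  have "case (P', a \<cdot> b) of (P, r) \<Rightarrow> bounded_ft_projective C (pw (*)) P \<and> quasi_iso C (pw (*)) P s X r"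
    using P'.bounded_ft_projective quasi_iso_comp[OF bc ac b a] by simp
  from someI[of "\<lambda>(P, r). bounded_ft_projective C (pw (*)) P \<and> quasi_iso C (pw (*)) P s X r", OF this]
  show ?thesis unfolding resolution_def[symmetric] by (simp add: case_prod_unfold)
qed

text \<open>The identity is the embedding that \<open>bfp_of_bounded_ft_projective\<close> asks for,
  since resolutions already live in \<open>pspace\<close>.\<close>

lemma pw_transp: "transp (pw (*)) (pw (*)) (\<lambda>x :: ('m, 'k) pspace. x)"
  by (intro transp.intro inj_on_id2) (simp add: Vector_Spaces.linear_iff vector_space_pw vector_space_mult)

lemma P_bfp: "X \<in> Perf C s \<Longrightarrow> \<exists>M. bfp C (pw (*)) (PP X) M"
  using bfp_of_bounded_ft_projective[OF cat pw_transp] resolution by blast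

lemma P_cplx: "X \<in> Perf C s \<Longrightarrow> cplx C (pw (*)) (PP X)"
  using P_bfp bfp.axioms(1) by blast

lemma r_qi: "X \<in> Perf C s \<Longrightarrow> quasi_iso C (pw (*)) (PP X) s X (rr X)"
  using resolution by blast

lemma r_chain: "X \<in> Perf C s \<Longrightarrow> rr X \<in> cP X X"
  using r_qi by (simp add: quasi_iso_def)

lemma r_chmap: "X \<in> Perf C s \<Longrightarrow> chmap C (pw (*)) (PP X) s X (rr X)"
  by (rule chmapI[OF P_cplx Perf_cplx r_chain])

lemma T_cplx: "X \<in> Perf C s \<Longrightarrow> cplx C s (TT X)"
  by (rule e0.transport_cplx[OF P_cplx])

lemmas rho_chain = e0.tout_chain[OF P_cplx]
lemmas rho_chmap = e0.tout_chmap[OF P_cplx]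
lemmas rho_qi = e0.tout_qi[OF P_cplx]

lemma Ar_rho: "X \<in> Perf C s \<Longrightarrow> cplx C s Y \<Longrightarrow> f \<in> cP X Y \<Longrightarrow> Ar (TT X) Y (f \<cdot> rho X)"
  unfolding ch_iff using T_cplx chain_maps_comp[OF rho_chain] by blast

lemma R_Q: "X \<in> Perf C s \<Longrightarrow> Q (TT X) X (RR X)"
  unfolding Q_iff using Ar_rho[OF _ Perf_cplx r_chain] quasi_iso_comp[OF rho_chmap r_chmap rho_qi r_qi] by blast

lemma P_lift:
  assumes X: "X \<in> Perf C s" and \<sigma>: "Q Z Y \<sigma>" and f: "f \<in> cP X Y"
  obtains h where "h \<in> cP X Z" "hP X Y (\<sigma> \<cdot> h) f"
proof -
  obtain M where M: "bfp C (pw (*)) (PP X) M" using P_bfp[OF X] by blast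
  interpret bfp C "pw (*)" "PP X" M by (rule M)
  show ?thesis using lift_exists[OF Ar_chmap[OF QD[OF \<sigma>]] _ f] \<sigma> that unfolding Q_iff by blast
qed

lemma P_lift_unique:
  assumes X: "X \<in> Perf C s" and \<sigma>: "Q Z Y \<sigma>" and h: "h \<in> cP X Z" "h' \<in> cP X Z"
    and e: "hP X Y (\<sigma> \<cdot> h) (\<sigma> \<cdot> h')"
  shows "hP X Z h h'"
proof -
  obtain M where M: "bfp C (pw (*)) (PP X) M" using P_bfp[OF X] by blast
  interpret bfp C "pw (*)" "PP X" M by (rule M)
  show ?thesis by (rule lift_unique[OF Ar_chmap[OF QD[OF \<sigma>]] _ h e]) (use \<sigma> in \<open>simp add: Q_iff\<close>)
qed

lemma Q_ch: "Q Z Y \<sigma> \<Longrightarrow> \<sigma> \<in> chain_maps C s Z s Y"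
  and Q_cplx: "Q Z Y \<sigma> \<Longrightarrow> cplx C s Z" "Q Z Y \<sigma> \<Longrightarrow> cplx C s Y"
  by (simp_all add: Q_iff ch_iff)

lemma Ar_ch: "Ar Z Y f \<Longrightarrow> f \<in> chain_maps C s Z s Y"
  and Ar_cplx: "Ar Z Y f \<Longrightarrow> cplx C s Z" "Ar Z Y f \<Longrightarrow> cplx C s Y"
  by (simp_all add: ch_iff)

lemma H_rho:
  assumes X: "X \<in> Perf C s" and Y: "cplx C s Y" and f: "f \<in> cP X Y" "g \<in> cP X Y" and e: "hP X Y f g"
  shows "H (TT X) Y (f \<cdot> rho X) (g \<cdot> rho X)"
  unfolding H_iff using Ar_rho[OF X Y f(1)] Ar_rho[OF X Y f(2)]
    homotopic_pre[OF T_cplx[OF X] P_cplx[OF X] Y e rho_chain[OF X]] by blast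

lemma Psi_in: "X \<in> Perf C s \<Longrightarrow> cplx C s Y \<Longrightarrow> f \<in> cP X Y \<Longrightarrow> Psi X Y f \<in> Hm X Y"
  unfolding Psi_def by (rule fr_in[OF R_Q Ar_rho])

lemma Psi_eqI:
  "X \<in> Perf C s \<Longrightarrow> cplx C s Y \<Longrightarrow> f \<in> cP X Y \<Longrightarrow> g \<in> cP X Y \<Longrightarrow> hP X Y f g \<Longrightarrow> Psi X Y f = Psi X Y g"
  unfolding Psi_def using fr_H[OF R_Q H_refl[OF QD[OF R_Q]] H_rho] by blast

text \<open>Lifting the resolution through the denominator replaces an arbitrary roof by one whose
  apex is the resolution.\<close>

lemma fr_Psi:
  assumes X: "X \<in> Perf C s" and \<sigma>: "Q Z X \<sigma>" and f: "Ar Z Y f" and h: "h \<in> cP X Z"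
    and e: "hP X X (\<sigma> \<cdot> h) (rr X)"
  shows "fr X Y Z \<sigma> f = Psi X Y (f \<cdot> h)"
proof -
  have hr: "Ar (TT X) Z (h \<cdot> rho X)" by (rule Ar_rho[OF X Q_cplx(1)[OF \<sigma>] h])
  have \<sigma>h: "H (TT X) X (\<sigma> \<cdot> (h \<cdot> rho X)) (RR X)"
    unfolding chain_comp_assoc[symmetric]
    by (rule H_rho[OF X Perf_cplx[OF X] chain_maps_comp[OF h Q_ch[OF \<sigma>]] r_chain[OF X] e])
  have q: "Q (TT X) X (\<sigma> \<cdot> (h \<cdot> rho X))" by (rule Q_H[OF H_sym[OF \<sigma>h] R_Q[OF X]])
  have "fr X Y Z \<sigma> f = fr X Y (TT X) (\<sigma> \<cdot> (h \<cdot> rho X)) (f \<cdot> (h \<cdot> rho X))"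
    by (rule fr_refine'[OF \<sigma> f hr q, symmetric])
  also have "\<dots> = fr X Y (TT X) (RR X) (f \<cdot> (h \<cdot> rho X))"
    by (rule fr_H[OF q \<sigma>h H_refl[OF Ar_comp[OF hr f]]])
  finally show ?thesis unfolding Psi_def chain_comp_assoc .
qed

lemma Psi_cases:
  assumes X: "X \<in> Perf C s" and Y: "cplx C s Y" and \<alpha>: "\<alpha> \<in> Hm X Y"
  obtains f where "f \<in> cP X Y" "\<alpha> = Psi X Y f"
proof -
  obtain Z \<sigma> f where z: "Q Z X \<sigma>" "Ar Z Y f" "\<alpha> = fr X Y Z \<sigma> f"
    by (rule Hm_cases[OF _ _ \<alpha>]) (use Perf_cplx[OF X] Y in \<open>simp_all add: cplx_iff\<close>)
  obtain h where h: "h \<in> cP X Z" "hP X X (\<sigma> \<cdot> h) (rr X)" by (rule P_lift[OF X z(1) r_chain[OF X]])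
  show ?thesis by (rule that[OF chain_maps_comp[OF h(1) Ar_ch[OF z(2)]]]) (simp only: z(3) fr_Psi[OF X z(1,2) h])
qed

text \<open>Equality of fractions gives a homotopy only after a quasi-isomorphism to the resolution.
  By \<open>lift_exists\<close> this quasi-isomorphism has a section up to homotopy, and
  precomposing with the section removes it.\<close>

lemma Psi_eqD:
  assumes X: "X \<in> Perf C s" and Y: "cplx C s Y" and f: "f \<in> cP X Y" "g \<in> cP X Y"
    and e: "Psi X Y f = Psi X Y g"
  shows "hP X Y f g"
proof -
  obtain W p where p: "Q W (TT X) p" "H W Y (f \<cdot> rho X \<cdot> p) (g \<cdot> rho X \<cdot> p)"
    using fr_eqD[OF R_Q[OF X] Ar_rho[OF X Y f(1)] Ar_rho[OF X Y f(2)] e[unfolded Psi_def]] by blast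
  note P = P_cplx[OF X] and W = Q_cplx(1)[OF p(1)]
  have qi: "quasi_iso C s W (pw (*)) (PP X) (rho X \<cdot> p)"
    using quasi_iso_comp[OF Ar_chmap[OF QD[OF p(1)]] rho_chmap[OF X] _ rho_qi[OF X]] p(1) by (simp add: Q_iff)
  then have qc: "rho X \<cdot> p \<in> chain_maps C s W (pw (*)) (PP X)" by (simp add: quasi_iso_def)
  obtain M where M: "bfp C (pw (*)) (PP X) M" using P_bfp[OF X] by blast
  interpret bfp C "pw (*)" "PP X" M by (rule M)
  obtain h where h: "h \<in> cP X W"
      "homotopic C (pw (*)) (PP X) (pw (*)) (PP X) (rho X \<cdot> p \<cdot> h) (chain_id C (PP X))"
    using lift_exists[OF chmapI[OF W P qc] qi chain_id_in] by blast
  have *: "hP X Y (k \<cdot> rho X \<cdot> p \<cdot> h) k" if k: "k \<in> cP X Y" for k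
    using homotopic_post[OF P P Y h(2) k chain_maps_comp[OF h(1) qc] chain_id_in] chmap.id_right[OF chmapI[OF P Y k]]
    by (simp add: chain_comp_assoc)
  have "hP X Y (f \<cdot> rho X \<cdot> p \<cdot> h) (g \<cdot> rho X \<cdot> p \<cdot> h)"
    by (rule homotopic_pre[OF P W Y _ h(1)]) (use p(2) in \<open>simp add: H_iff\<close>)
  then show ?thesis
    using homotopic_trans[OF P Y] homotopic_sym[OF P Y *[OF f(1)]] *[OF f(2)] by blast
qed

lemma Psi_add: "X \<in> Perf C s \<Longrightarrow> cplx C s Y \<Longrightarrow> f \<in> cP X Y \<Longrightarrow> g \<in> cP X Y \<Longrightarrow>
    fadd X Y (Psi X Y f) (Psi X Y g) = Psi X Y (f + g)"
proof -
  assume "X \<in> Perf C s" "cplx C s Y" "f \<in> cP X Y" "g \<in> cP X Y"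
  moreover have "(f + g) \<cdot> rho X = f \<cdot> rho X + g \<cdot> rho X" by (simp add: fun_eq_iff)
  ultimately show ?thesis unfolding Psi_def using fadd_fr[OF R_Q Ar_rho Ar_rho, of X Y f g] by (simp only:)
qed

lemma Psi_scale: "X \<in> Perf C s \<Longrightarrow> cplx C s Y \<Longrightarrow> f \<in> cP X Y \<Longrightarrow>
    fsmul X Y c (Psi X Y f) = Psi X Y (\<lambda>n x u. s c (f n x u))"
proof -
  assume "X \<in> Perf C s" "cplx C s Y" "f \<in> cP X Y"
  moreover have "(\<lambda>n x u. s c (f n x u)) \<cdot> rho X = (\<lambda>n x u. s c ((f \<cdot> rho X) n x u))" by (simp add: fun_eq_iff)
  ultimately show ?thesis unfolding Psi_def using fsmul_fr[OF R_Q Ar_rho, of X Y f c] by (simp only:)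
qed

lemma Psi_post:
  assumes X: "X \<in> Perf C s" and \<tau>: "Q W Y \<tau>" and w: "Ar W V w" and f: "f \<in> cP X W"
  shows "fcomp X Y V (fr Y V W \<tau> w) (Psi X Y (\<tau> \<cdot> f)) = Psi X V (w \<cdot> f)"
  unfolding Psi_def chain_comp_assoc by (rule fcomp_direct[OF R_Q[OF X] Ar_rho[OF X Q_cplx(1)[OF \<tau>] f] \<tau> w])

abbreviation "cPP X Y \<equiv> chain_maps C (pw (*)) (PP X) (pw (*)) (PP Y)"
abbreviation "hPP X Y \<equiv> homotopic C (pw (*)) (PP X) (pw (*)) (PP Y)"

text \<open>The lift \<open>g\<close> is moved into the copy of the resolution of \<open>X'\<close>
  in \<open>'v\<close>, the apex of the second roof, so that \<open>Psi_post\<close>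
  applies.\<close>

lemma Psi_pre:
  assumes X: "X \<in> Perf C s" and X': "X' \<in> Perf C s" and Y: "cplx C s Y" and g: "g \<in> cPP X X'" and f: "f \<in> cP X' Y"
  shows "fcomp X X' Y (Psi X' Y f) (Psi X X' (rr X' \<cdot> g)) = Psi X Y (f \<cdot> g)"
proof -
  let ?t = "tin C e0 (PP X')"
  note P = P_cplx[OF X] and P' = P_cplx[OF X']
  have t: "?t \<in> chain_maps C (pw (*)) (PP X') s (TT X')" by (rule e0.tin_chain[OF P'])
  have tg: "?t \<cdot> g \<in> cP X (TT X')" by (rule chain_maps_comp[OF g t])
  have id: "rho X' \<cdot> (?t \<cdot> g) = g"
    unfolding chain_comp_assoc[symmetric] e0.tout_tin[OF P'] by (rule chmap.id_left[OF chmapI[OF P P' g]])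
  have "fcomp X X' Y (fr X' Y (TT X') (RR X') (f \<cdot> rho X')) (Psi X X' (RR X' \<cdot> (?t \<cdot> g))) = Psi X Y (f \<cdot> rho X' \<cdot> (?t \<cdot> g))"
    by (rule Psi_post[OF X R_Q[OF X'] Ar_rho[OF X' Y f] tg])
  then show ?thesis unfolding chain_comp_assoc id Psi_def[of X'] .
qed

text \<open>In terms of \<open>Psi\<close> a lift no longer mentions roofs, so existence and
  uniqueness up to homotopy of lifts follow from \<open>lift_exists\<close> and
  \<open>lift_unique\<close>.\<close>

lemma is_lift_iff:
  assumes X: "X \<in> Perf C s" and Y: "Y \<in> Perf C s" and \<alpha>: "\<alpha> \<in> Hm X Y"
  shows "is_lift C s X Y \<alpha> g \<longleftrightarrow> g \<in> cPP X Y \<and> \<alpha> = Psi X Y (rr Y \<cdot> g)"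
proof -
  have l: "is_lift C s X Y \<alpha> g \<longleftrightarrow> g \<in> cPP X Y \<and> (\<exists>Z \<sigma> f. (Z, \<sigma>, f) \<in> \<alpha> \<and>
      (\<exists>h\<in>cP X Z. hP X X (\<sigma> \<cdot> h) (rr X) \<and> hP X Y (f \<cdot> h) (rr Y \<cdot> g)))"
    by (simp add: is_lift_def case_prod_unfold Let_def)
  note XO = Perf_cplx[OF X] and YO = Perf_cplx[OF Y]
  have O: "X \<in> {X. is_complex C s X}" "Y \<in> {X. is_complex C s X}" using XO YO by (simp_all add: cplx_iff)
  show ?thesis unfolding l
  proof (intro conj_cong iffI refl)
    assume g: "g \<in> cPP X Y" and "\<exists>Z \<sigma> f. (Z, \<sigma>, f) \<in> \<alpha> \<and>
      (\<exists>h\<in>cP X Z. hP X X (\<sigma> \<cdot> h) (rr X) \<and> hP X Y (f \<cdot> h) (rr Y \<cdot> g))"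
    then obtain Z \<sigma> f h where z: "(Z, \<sigma>, f) \<in> \<alpha>" and h: "h \<in> cP X Z" "hP X X (\<sigma> \<cdot> h) (rr X)"
      "hP X Y (f \<cdot> h) (rr Y \<cdot> g)" by blast
    have \<alpha>': "Q Z X \<sigma>" "Ar Z Y f" "\<alpha> = fr X Y Z \<sigma> f" using Hm_mem[OF O \<alpha> z] by simp_all
    show "\<alpha> = Psi X Y (rr Y \<cdot> g)"
      unfolding \<alpha>'(3) fr_Psi[OF X \<alpha>'(1,2) h(1,2)]
      by (rule Psi_eqI[OF X YO chain_maps_comp[OF h(1) Ar_ch[OF \<alpha>'(2)]] chain_maps_comp[OF g r_chain[OF Y]] h(3)])
  next
    assume g: "g \<in> cPP X Y" and a: "\<alpha> = Psi X Y (rr Y \<cdot> g)"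
    let ?t = "tin C e0 (PP X)"
    note rg = chain_maps_comp[OF g r_chain[OF Y]]
    have id: "rho X \<cdot> ?t = chain_id C (PP X)" by (rule e0.tout_tin[OF P_cplx[OF X]])
    \<comment> \<open>The roof that defines \<open>Psi\<close> serves as representative, with the
      embedding of the resolution into its copy as the required map to the apex.\<close>
    have "(TT X, RR X, rr Y \<cdot> g \<cdot> rho X) \<in> \<alpha>"
      unfolding a Psi_def using R_Q[OF X] Ar_rho[OF X YO rg] by (subst mem_cls) simp_all
    moreover have "RR X \<cdot> ?t = rr X" "rr Y \<cdot> g \<cdot> rho X \<cdot> ?t = rr Y \<cdot> g"
      using chmap.id_right[OF r_chmap[OF X]] chmap.id_right[OF chmapI[OF P_cplx[OF X] YO rg]]
      by (simp_all only: chain_comp_assoc id)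
    ultimately show "\<exists>Z \<sigma> f. (Z, \<sigma>, f) \<in> \<alpha> \<and> (\<exists>h\<in>cP X Z. hP X X (\<sigma> \<cdot> h) (rr X) \<and> hP X Y (f \<cdot> h) (rr Y \<cdot> g))"
      using e0.tin_chain[OF P_cplx[OF X]] homotopic_refl[OF P_cplx[OF X] XO] homotopic_refl[OF P_cplx[OF X] YO]
      by (intro exI[of _ "TT X"] exI[of _ "RR X"] exI[of _ "rr Y \<cdot> g \<cdot> rho X"] conjI bexI[of _ ?t]) simp_all
  qed
qed

lemma lift_ex:
  assumes X: "X \<in> Perf C s" and Y: "Y \<in> Perf C s" and \<alpha>: "\<alpha> \<in> Hm X Y"
  obtains g where "g \<in> cPP X Y" "\<alpha> = Psi X Y (rr Y \<cdot> g)"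
proof -
  note YO = Perf_cplx[OF Y]
  obtain f where f: "f \<in> cP X Y" "\<alpha> = Psi X Y f" by (rule Psi_cases[OF X YO \<alpha>])
  obtain M where M: "bfp C (pw (*)) (PP X) M" using P_bfp[OF X] by blast
  interpret bfp C "pw (*)" "PP X" M by (rule M)
  obtain g where g: "g \<in> cPP X Y" "hP X Y (rr Y \<cdot> g) f" using lift_exists[OF r_chmap[OF Y] r_qi[OF Y] f(1)] by blast
  show ?thesis
    by (rule that[OF g(1)]) (simp only: f(2) Psi_eqI[OF X YO chain_maps_comp[OF g(1) r_chain[OF Y]] f(1) g(2)])
qed

lemma lift_unique_homotopic:
  assumes X: "X \<in> Perf C s" and Y: "Y \<in> Perf C s" and g: "g \<in> cPP X Y" "g' \<in> cPP X Y"
    and e: "Psi X Y (rr Y \<cdot> g) = Psi X Y (rr Y \<cdot> g')"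
  shows "hPP X Y g g'"
proof -
  obtain M where M: "bfp C (pw (*)) (PP X) M" using P_bfp[OF X] by blast
  interpret bfp C "pw (*)" "PP X" M by (rule M)
  note c = chain_maps_comp[OF g(1) r_chain[OF Y]] chain_maps_comp[OF g(2) r_chain[OF Y]]
  show ?thesis by (rule lift_unique[OF r_chmap[OF Y] r_qi[OF Y] g Psi_eqD[OF X Perf_cplx[OF Y] c e]])
qed

end

section \<open>Functoriality of the dual\<close>

context serre_setting
begin

lemma S_eq: "SS X = transport_cpx C e (BB X)"
  by (simp add: RD_dual_def RD_def bic_def)

lemma B_cplx: "X \<in> Perf C s \<Longrightarrow> cplx C (pw (*)) (BB X)"
  by (rule cplx.cplx_bic[OF P_cplx])

lemma S_cplx: "X \<in> Perf C s \<Longrightarrow> cplx C s (SS X)"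
  unfolding S_eq by (rule e.transport_cplx[OF B_cplx])

lemma tinB: "X \<in> Perf C s \<Longrightarrow> tinB X \<in> chain_maps C (pw (*)) (BB X) s (SS X)"
  unfolding S_eq by (rule e.tin_chain[OF B_cplx])

lemma toutB: "X \<in> Perf C s \<Longrightarrow> toutB X \<in> chain_maps C s (SS X) (pw (*)) (BB X)"
  unfolding S_eq by (rule e.tout_chain[OF B_cplx])

lemma toutB_tinB: "X \<in> Perf C s \<Longrightarrow> toutB X \<cdot> tinB X = chain_id C (BB X)"
  by (rule e.tout_tin[OF B_cplx])

lemma tinB_toutB: "X \<in> Perf C s \<Longrightarrow> tinB X \<cdot> toutB X = chain_id C (SS X)"
  unfolding S_eq by (rule e.tin_tout[OF B_cplx])

lemma tinB_Ar: "X \<in> Perf C s \<Longrightarrow> cplx C s Y \<Longrightarrow> \<tau> \<in> cB Y X \<Longrightarrow> Ar Y (SS X) (tinB X \<cdot> \<tau>)"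
  unfolding ch_iff using S_cplx chain_maps_comp[OF _ tinB] by blast

lemma tinB_H: "X \<in> Perf C s \<Longrightarrow> cplx C s Y \<Longrightarrow> \<tau> \<in> cB Y X \<Longrightarrow> \<tau>' \<in> cB Y X \<Longrightarrow> hB Y X \<tau> \<tau>' \<Longrightarrow>
    H Y (SS X) (tinB X \<cdot> \<tau>) (tinB X \<cdot> \<tau>')"
  unfolding H_iff using tinB_Ar homotopic_post[OF _ B_cplx S_cplx _ tinB] by blast

lemma toutB_tinB_comp:
  assumes X: "X \<in> Perf C s" and Y: "cplx C r Y" and \<tau>: "\<tau> \<in> chain_maps C r Y (pw (*)) (BB X)"
  shows "toutB X \<cdot> (tinB X \<cdot> \<tau>) = \<tau>"
  unfolding chain_comp_assoc[symmetric] toutB_tinB[OF X] by (rule chmap.id_left[OF chmapI[OF Y B_cplx[OF X] \<tau>]])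

lemma tinB_toutB_comp:
  assumes X: "X \<in> Perf C s" and f: "Ar Y (SS X) f"
  shows "tinB X \<cdot> (toutB X \<cdot> f) = f"
  unfolding chain_comp_assoc[symmetric] tinB_toutB[OF X] by (rule chmap.id_left[OF Ar_chmap[OF f]])

lemma pairing:
  assumes X: "X \<in> Perf C s" and Y: "cplx C r Y"
  shows "\<exists>M. pairing C (pw (*)) (PP X) M r Y"
  using P_bfp[OF X] Y by (auto simp: pairing_def)

lemma Tr_determines:
  assumes X: "X \<in> Perf C s" and Y: "cplx C r Y"
    and \<tau>: "\<tau> \<in> chain_maps C r Y (pw (*)) (BB X)" "\<tau>' \<in> chain_maps C r Y (pw (*)) (BB X)"
    and e: "\<And>f. f \<in> chain_maps C (pw (*)) (PP X) r Y \<Longrightarrow> trP X \<tau> f = trP X \<tau>' f"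
  shows "homotopic C r Y (pw (*)) (BB X) \<tau> \<tau>'"
proof -
  obtain M where "pairing C (pw (*)) (PP X) M r Y" using pairing[OF X Y] by blast
  then interpret p: pairing C "pw (*)" "PP X" M r Y .
  have "homotopic C r Y (pw (*)) (BB X) (\<tau> - \<tau>') 0"
  proof (rule p.Tr_injective[OF chain_maps_diff[OF Y B_cplx[OF X] \<tau>]])
    show "trP X (\<tau> - \<tau>') f = 0" if "f \<in> chain_maps C (pw (*)) (PP X) r Y" for f
      unfolding Tr_diff_left using e[OF that] by simp
  qed
  then show ?thesis unfolding homotopic_diff_iff[OF Y B_cplx[OF X]] .
qed

lemma Tr_cong_right:
  assumes X: "X \<in> Perf C s" and Y: "cplx C r Y" and \<tau>: "\<tau> \<in> chain_maps C r Y (pw (*)) (BB X)"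
    and f: "f \<in> chain_maps C (pw (*)) (PP X) r Y" "f' \<in> chain_maps C (pw (*)) (PP X) r Y"
    and h: "homotopic C (pw (*)) (PP X) r Y f f'"
  shows "trP X \<tau> f = trP X \<tau> f'"
proof -
  obtain M where "pairing C (pw (*)) (PP X) M r Y" using pairing[OF X Y] by blast
  then show ?thesis by (rule pairing.Tr_homotopic[OF _ \<tau> f h])
qed

lemma Tr_cong_left:
  assumes X: "X \<in> Perf C s" and Y: "cplx C r Y"
    and \<tau>: "\<tau> \<in> chain_maps C r Y (pw (*)) (BB X)" "\<tau>' \<in> chain_maps C r Y (pw (*)) (BB X)"
    and f: "f \<in> chain_maps C (pw (*)) (PP X) r Y" and h: "homotopic C r Y (pw (*)) (BB X) \<tau> \<tau>'"
  shows "trP X \<tau> f = trP X \<tau>' f"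
proof -
  obtain M where "pairing C (pw (*)) (PP X) M r Y" using pairing[OF X Y] by blast
  then show ?thesis by (rule pairing.Tr_homotopic_left[OF _ \<tau> f h])
qed

abbreviation "bm X Y \<equiv> bic_map C (pw (*)) (PP X) (PP Y)"

lemma bm_chain: "X \<in> Perf C s \<Longrightarrow> Y \<in> Perf C s \<Longrightarrow> g \<in> cPP X Y \<Longrightarrow> bm X Y g \<in> chain_maps C (pw (*)) (BB X) (pw (*)) (BB Y)"
  by (rule bic_map_chain[OF P_cplx P_cplx])

lemma Tr_bm:
  assumes X: "X \<in> Perf C s" and Y: "Y \<in> Perf C s" and Z: "cplx C r Z" and g: "g \<in> cPP X Y"
    and \<tau>: "\<tau> \<in> chain_maps C r Z (pw (*)) (BB X)" and f: "f \<in> chain_maps C (pw (*)) (PP Y) r Z"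
  shows "trP Y (bm X Y g \<cdot> \<tau>) f = trP X \<tau> (f \<cdot> g)"
proof -
  obtain M where M: "pairing C (pw (*)) (PP X) M r Z" using pairing[OF X Z] by blast
  obtain M' where M': "bfp C (pw (*)) (PP Y) M'" using P_bfp[OF Y] by blast
  show ?thesis by (rule Tr_bic_map[OF M M' g \<tau> f])
qed

text \<open>Rather than pushing a homotopy through \<open>D\<close> and the dual, both maps are
  paired with every \<open>f\<close> into the bidual complex of \<open>X\<close>. By adjunction the
  values are pairings with \<open>f \<cdot> g\<close> and \<open>f \<cdot> g'\<close>, which are
  homotopic, and the pairing separates homotopy classes.\<close>

lemma bm_homotopic:
  assumes X: "X \<in> Perf C s" and Y: "Y \<in> Perf C s" and g: "g \<in> cPP X Y" "g' \<in> cPP X Y" and h: "hPP X Y g g'"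
  shows "homotopic C (pw (*)) (BB X) (pw (*)) (BB Y) (bm X Y g) (bm X Y g')"
proof (rule Tr_determines[OF Y B_cplx[OF X] bm_chain[OF X Y g(1)] bm_chain[OF X Y g(2)]])
  fix f assume f: "f \<in> chain_maps C (pw (*)) (PP Y) (pw (*)) (BB X)"
  have *: "trP Y (bm X Y k) f = trP X (chain_id C (BB X)) (f \<cdot> k)" if k: "k \<in> cPP X Y" for k
    using Tr_bm[OF X Y B_cplx[OF X] k cplx.chain_id_in[OF B_cplx[OF X]] f]
    unfolding chmap.id_right[OF chmapI[OF B_cplx[OF X] B_cplx[OF Y] bm_chain[OF X Y k]]] .
  show "trP Y (bm X Y g) f = trP Y (bm X Y g') f"
    unfolding *[OF g(1)] *[OF g(2)]
    by (rule Tr_cong_right[OF X B_cplx[OF X] cplx.chain_id_in[OF B_cplx[OF X]] chain_maps_comp[OF g(1) f]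
        chain_maps_comp[OF g(2) f] homotopic_post[OF P_cplx[OF X] P_cplx[OF Y] B_cplx[OF X] h f g]])
qed

definition Sg where
  "Sg X Y g = tinB Y \<cdot> (bm X Y g \<cdot> toutB X)"

lemma Sg_in: "X \<in> Perf C s \<Longrightarrow> Y \<in> Perf C s \<Longrightarrow> g \<in> cPP X Y \<Longrightarrow> bm X Y g \<cdot> toutB X \<in> cB (SS X) Y"
  by (rule chain_maps_comp[OF toutB bm_chain])

lemma Sg_Ar: "X \<in> Perf C s \<Longrightarrow> Y \<in> Perf C s \<Longrightarrow> g \<in> cPP X Y \<Longrightarrow> Ar (SS X) (SS Y) (Sg X Y g)"
  unfolding Sg_def by (rule tinB_Ar[OF _ S_cplx Sg_in])

text \<open>The definite description is met: lifts of one morphism are homotopic, and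
  \<open>bm_homotopic\<close> makes the induced maps homotopic, hence equal in the derived
  category.\<close>

lemma RD_dual_map_eq:
  assumes X: "X \<in> Perf C s" and Y: "Y \<in> Perf C s" and g: "g \<in> cPP X Y"
  shows "RD_dual_map C s e X Y (Psi X Y (rr Y \<cdot> g)) = floc (SS X) (SS Y) (Sg X Y g)"
proof -
  let ?a = "Psi X Y (rr Y \<cdot> g)"
  have a: "?a \<in> Hm X Y" by (rule Psi_in[OF X Perf_cplx[OF Y] chain_maps_comp[OF g r_chain[OF Y]]])
  have eq: "transport_map C e (dual_cpx C Dscale (RD C s X))
       (dual_map C Dscale (RD C s X) (D_map C (pw (*)) (PP Y) k)) = Sg X Y k" if k: "k \<in> cPP X Y" for k
    using e.transport_map_eq[OF B_cplx[OF X] B_cplx[OF Y] bm_chain[OF X Y k]]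
    by (simp only: Sg_def RD_def bic_def[symmetric] bic_map_def[symmetric])
  show ?thesis
    unfolding RD_dual_map_def loc_eq
  proof (rule the_equality)
    show "\<exists>k. is_lift C s X Y ?a k \<and> floc (SS X) (SS Y) (Sg X Y g) = floc (SS X) (SS Y)
        (transport_map C e (dual_cpx C Dscale (RD C s X)) (dual_map C Dscale (RD C s X) (D_map C (pw (*)) (PP Y) k)))"
      by (rule exI[of _ g]) (simp only: is_lift_iff[OF X Y a] g eq[OF g] simp_thms)
    fix \<beta> assume "\<exists>k. is_lift C s X Y ?a k \<and> \<beta> = floc (SS X) (SS Y)
        (transport_map C e (dual_cpx C Dscale (RD C s X)) (dual_map C Dscale (RD C s X) (D_map C (pw (*)) (PP Y) k)))"
    then obtain k where k: "k \<in> cPP X Y" "?a = Psi X Y (rr Y \<cdot> k)" and \<beta>: "\<beta> = floc (SS X) (SS Y) (Sg X Y k)"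
      unfolding is_lift_iff[OF X Y a] using eq by auto
    have h: "hPP X Y k g" by (rule lift_unique_homotopic[OF X Y k(1) g k(2)[symmetric]])
    have "homotopic C s (SS X) (pw (*)) (BB Y) (bm X Y k \<cdot> toutB X) (bm X Y g \<cdot> toutB X)"
      by (rule homotopic_pre[OF S_cplx[OF X] B_cplx[OF X] B_cplx[OF Y] bm_homotopic[OF X Y k(1) g h] toutB[OF X]])
    then show "\<beta> = floc (SS X) (SS Y) (Sg X Y g)"
      unfolding \<beta> Sg_def by (intro floc_H tinB_H[OF Y S_cplx[OF X] Sg_in[OF X Y k(1)] Sg_in[OF X Y g]])
  qed
qed

lemma id_Psi: "X \<in> Perf C s \<Longrightarrow> floc X X (chain_id C X) = Psi X X (rr X \<cdot> chain_id C (PP X))"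
proof -
  assume X: "X \<in> Perf C s"
  have O: "X \<in> {X. is_complex C s X}" using Perf_cplx[OF X] by (simp add: cplx_iff)
  show ?thesis
    unfolding floc_fr[OF Ar_id[OF O] R_Q[OF X]] id_left[OF QD[OF R_Q[OF X]]] chmap.id_right[OF r_chmap[OF X]] Psi_def ..
qed

lemma fcat_sel: "Ob fcat = {X. is_complex C s X}" "Hom fcat = Hm" "Idn fcat = (\<lambda>X. floc X X (chain_id C X))"
  "Cmp fcat = fcomp" "Add fcat = fadd" "Smul fcat = fsmul"
  by (simp_all add: fcat_def Hm_def fun_eq_iff)

lemma RD_dual_functor: "is_functor (full_subcat (derived C s) (Perf C s)) (derived C s) (RD_dual C s e) (RD_dual_map C s e)"
proof -
  have Ob: "Ob (full_subcat fcat (Perf C s)) = Perf C s" by (auto simp: full_subcat_def fcat_def Perf_def)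
  show ?thesis
    unfolding derived_eq is_functor_def Ob full_subcat_sel fcat_sel
  proof (intro conjI ballI)
    show "SS X \<in> {X. is_complex C s X}" if "X \<in> Perf C s" for X using S_cplx[OF that] by (simp add: cplx_iff)
    show "RD_dual_map C s e X Y \<alpha> \<in> Hm (SS X) (SS Y)" if X: "X \<in> Perf C s" and Y: "Y \<in> Perf C s" and \<alpha>: "\<alpha> \<in> Hm X Y" for X Y \<alpha>
    proof -
      obtain g where g: "g \<in> cPP X Y" "\<alpha> = Psi X Y (rr Y \<cdot> g)" by (rule lift_ex[OF X Y \<alpha>])
      show ?thesis unfolding g(2) RD_dual_map_eq[OF X Y g(1)] by (rule floc_in[OF Sg_Ar[OF X Y g(1)]])
    qed
    show "RD_dual_map C s e X X (floc X X (chain_id C X)) = floc (SS X) (SS X) (chain_id C (SS X))" if X: "X \<in> Perf C s" for X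
      unfolding id_Psi[OF X] RD_dual_map_eq[OF X X cplx.chain_id_in[OF P_cplx[OF X]]]
        Sg_def bic_map_id[OF P_cplx[OF X]]
        chmap.id_left[OF chmapI[OF S_cplx[OF X] B_cplx[OF X] toutB[OF X]]] tinB_toutB[OF X] ..
    fix X Y Z \<alpha> \<beta> assume X: "X \<in> Perf C s" and Y: "Y \<in> Perf C s" and Z: "Z \<in> Perf C s"
      and \<alpha>: "\<alpha> \<in> Hm X Y" and \<beta>: "\<beta> \<in> Hm Y Z"
    obtain g where g: "g \<in> cPP X Y" "\<alpha> = Psi X Y (rr Y \<cdot> g)" by (rule lift_ex[OF X Y \<alpha>])
    obtain h where h: "h \<in> cPP Y Z" "\<beta> = Psi Y Z (rr Z \<cdot> h)" by (rule lift_ex[OF Y Z \<beta>])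
    note hg = chain_maps_comp[OF g(1) h(1)]
    have c: "fcomp X Y Z \<beta> \<alpha> = Psi X Z (rr Z \<cdot> (h \<cdot> g))"
      unfolding g(2) h(2) Psi_pre[OF X Y Perf_cplx[OF Z] g(1) chain_maps_comp[OF h(1) r_chain[OF Z]]] chain_comp_assoc ..
    have "Sg X Z (h \<cdot> g) = tinB Z \<cdot> (bm Y Z h \<cdot> (bm X Y g \<cdot> toutB X))"
      unfolding Sg_def bic_map_comp[OF P_cplx[OF X] P_cplx[OF Y] P_cplx[OF Z] g(1) h(1)] chain_comp_assoc ..
    \<comment> \<open>Inserting the identity of the bidual complex of \<open>Y\<close>, as
      \<open>toutB Y\<close> after \<open>tinB Y\<close>, splits the composite into two transported
      maps.\<close>
    also have "\<dots> = tinB Z \<cdot> (bm Y Z h \<cdot> (toutB Y \<cdot> (tinB Y \<cdot> (bm X Y g \<cdot> toutB X))))"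
      unfolding toutB_tinB_comp[OF Y S_cplx[OF X] Sg_in[OF X Y g(1)]] ..
    also have "\<dots> = Sg Y Z h \<cdot> Sg X Y g" unfolding Sg_def chain_comp_assoc ..
    finally have s: "Sg X Z (h \<cdot> g) = Sg Y Z h \<cdot> Sg X Y g" .
    show "RD_dual_map C s e X Z (fcomp X Y Z \<beta> \<alpha>) =
        fcomp (SS X) (SS Y) (SS Z) (RD_dual_map C s e Y Z \<beta>) (RD_dual_map C s e X Y \<alpha>)"
      unfolding c RD_dual_map_eq[OF X Z hg] unfolding g(2) h(2) RD_dual_map_eq[OF X Y g(1)] RD_dual_map_eq[OF Y Z h(1)]
        floc_comp[OF Sg_Ar[OF X Y g(1)] Sg_Ar[OF Y Z h(1)]] s ..
  qed
qed

section \<open>The duality isomorphism\<close>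

definition represents where
  "represents a b \<phi> \<tau> \<longleftrightarrow> \<tau> \<in> cB b a \<and> (\<forall>f\<in>cP a b. trP a \<tau> f = \<phi> (Psi a b f))"

text \<open>Any two chain maps that represent the same functional are homotopic by
  \<open>Tr_determines\<close>, so the choice does not affect the resulting morphism.\<close>

definition eta where
  "eta a b \<phi> = floc b (SS a) (tinB a \<cdot> (SOME \<tau>. represents a b \<phi> \<tau>))"

lemma eta_eq:
  assumes a: "a \<in> Perf C s" and b: "cplx C s b" and \<tau>: "represents a b \<phi> \<tau>"
  shows "eta a b \<phi> = floc b (SS a) (tinB a \<cdot> \<tau>)"
proof -
  define \<theta> where "\<theta> = (SOME \<tau>. represents a b \<phi> \<tau>)"
  have \<theta>: "represents a b \<phi> \<theta>"
    unfolding \<theta>_def using someI[where P = "represents a b \<phi>", OF \<tau>] .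
  show ?thesis unfolding eta_def \<theta>_def[symmetric]
    by (rule floc_H[OF tinB_H[OF a b _ _ Tr_determines[OF a b]]]) (use \<tau> \<theta> in \<open>simp_all add: represents_def\<close>)
qed

text \<open>This is \<open>Tr_surjective\<close> for the functional on chain maps that
  \<open>\<phi>\<close> induces through \<open>Psi\<close>.\<close>

lemma represents_ex:
  assumes a: "a \<in> Perf C s" and b: "cplx C s b" and \<phi>: "\<phi> \<in> hom_dual fcat a b"
  obtains \<tau> where "represents a b \<phi> \<tau>"
proof -
  obtain M where "pairing C (pw (*)) (PP a) M s b" using pairing[OF a b] by blast
  then interpret p: pairing C "pw (*)" "PP a" M s b .
  have add: "\<phi> (fadd a b \<alpha> \<beta>) = \<phi> \<alpha> + \<phi> \<beta>" if "\<alpha> \<in> Hm a b" "\<beta> \<in> Hm a b" for \<alpha> \<beta>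
    using \<phi> that by (simp add: hom_dual_def fcat_sel)
  have scale: "\<phi> (fsmul a b c \<alpha>) = c * \<phi> \<alpha>" if "\<alpha> \<in> Hm a b" for c \<alpha>
    using \<phi> that by (simp add: hom_dual_def fcat_sel)
  have s: "\<phi> (Psi a b (\<lambda>n x u. s c (f n x u))) = c * \<phi> (Psi a b f)" if "f \<in> cP a b" for c f
    using scale[OF Psi_in[OF a b that], of c] unfolding Psi_scale[OF a b that] .
  note c0 = chain_maps_zero[OF P_cplx[OF a] b]
  have "(\<lambda>n x u. s 0 ((0 :: int \<Rightarrow> 'o \<Rightarrow> ('m, 'k) pspace \<Rightarrow> 'v) n x u)) = 0" by (simp add: fun_eq_iff)
  then have z: "\<phi> (Psi a b 0) = 0" using s[OF c0, of 0] by (simp only: mult_zero_left)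
  have "\<exists>\<tau>\<in>cB b a. \<forall>f\<in>cP a b. trP a \<tau> f = \<phi> (Psi a b f)"
  proof (rule p.Tr_surjective)
    show "\<phi> (Psi a b (f + g)) = \<phi> (Psi a b f) + \<phi> (Psi a b g)" if "f \<in> cP a b" "g \<in> cP a b" for f g
      unfolding Psi_add[OF a b that, symmetric] by (rule add[OF Psi_in[OF a b that(1)] Psi_in[OF a b that(2)]])
    show "\<phi> (Psi a b f) = 0" if "f \<in> cP a b" "hP a b f 0" for f
      using Psi_eqI[OF a b that(1) c0 that(2)] z by (simp only:)
  qed (rule s)
  then show ?thesis using that unfolding represents_def by blast
qed

lemma eta_bij:
  assumes a: "a \<in> Perf C s" and b: "cplx C s b"
  shows "bij_betw (eta a b) (hom_dual fcat a b) (Hm b (SS a))"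
  unfolding bij_betw_def
proof
  show "inj_on (eta a b) (hom_dual fcat a b)"
  proof (rule inj_onI)
    fix \<phi> \<psi> assume \<phi>: "\<phi> \<in> hom_dual fcat a b" and \<psi>: "\<psi> \<in> hom_dual fcat a b" and e: "eta a b \<phi> = eta a b \<psi>"
    obtain \<tau> where \<tau>: "represents a b \<phi> \<tau>" by (rule represents_ex[OF a b \<phi>])
    obtain \<tau>' where \<tau>': "represents a b \<psi> \<tau>'" by (rule represents_ex[OF a b \<psi>])
    have t: "\<tau> \<in> cB b a" "\<tau>' \<in> cB b a" using \<tau> \<tau>' by (simp_all add: represents_def)
    \<comment> \<open>Equality in the derived category gives a homotopy only after a
      quasi-isomorphism \<open>p\<close>. Every map from the resolution of \<open>a\<close> to
      \<open>b\<close> factors through \<open>p\<close> up to homotopy, so the pairings still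
      agree.\<close>
    obtain W p where p: "Q W b p" "H W (SS a) (tinB a \<cdot> \<tau> \<cdot> p) (tinB a \<cdot> \<tau>' \<cdot> p)"
      using floc_eqD[OF tinB_Ar[OF a b t(1)] tinB_Ar[OF a b t(2)]] e
      unfolding eta_eq[OF a b \<tau>] eta_eq[OF a b \<tau>'] by blast
    note W = Q_cplx(1)[OF p(1)] and pc = Q_ch[OF p(1)]
    note tp = chain_maps_comp[OF pc t(1)] chain_maps_comp[OF pc t(2)]
    have "hB W a (toutB a \<cdot> (tinB a \<cdot> (\<tau> \<cdot> p))) (toutB a \<cdot> (tinB a \<cdot> (\<tau>' \<cdot> p)))"
      by (rule homotopic_post[OF W S_cplx[OF a] B_cplx[OF a] _ toutB[OF a] chain_maps_comp[OF tp(1) tinB[OF a]]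
          chain_maps_comp[OF tp(2) tinB[OF a]]]) (use p(2) in \<open>simp add: H_iff chain_comp_assoc\<close>)
    then have h: "hB W a (\<tau> \<cdot> p) (\<tau>' \<cdot> p)"
      unfolding toutB_tinB_comp[OF a W tp(1)] toutB_tinB_comp[OF a W tp(2)] .
    have eq: "\<phi> \<alpha> = \<psi> \<alpha>" if \<alpha>: "\<alpha> \<in> Hm a b" for \<alpha>
    proof -
      obtain f where f: "f \<in> cP a b" "\<alpha> = Psi a b f" by (rule Psi_cases[OF a b \<alpha>])
      obtain g where g: "g \<in> cP a W" "hP a b (p \<cdot> g) f" by (rule P_lift[OF a p(1) f(1)])
      have pg: "p \<cdot> g \<in> cP a b" by (rule chain_maps_comp[OF g(1) pc])
      have \<alpha>': "\<alpha> = Psi a b (p \<cdot> g)" unfolding f(2) by (rule Psi_eqI[OF a b pg f(1) g(2), symmetric])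
      have "\<phi> \<alpha> = trP a \<tau> (p \<cdot> g)" "\<psi> \<alpha> = trP a \<tau>' (p \<cdot> g)"
        unfolding \<alpha>' using \<tau> \<tau>' pg by (simp_all add: represents_def)
      then show ?thesis using Tr_cong_left[OF a W tp g(1) h] by (simp only: Tr_comp)
    qed
    show "\<phi> = \<psi>"
    proof
      show "\<phi> \<alpha> = \<psi> \<alpha>" for \<alpha>
        using eq[of \<alpha>] \<phi> \<psi> by (cases "\<alpha> \<in> Hm a b") (simp_all add: hom_dual_def fcat_sel)
    qed
  qed
  have "eta a b \<phi> \<in> Hm b (SS a)" if \<phi>: "\<phi> \<in> hom_dual fcat a b" for \<phi>
  proof -
    obtain \<tau> where \<tau>: "represents a b \<phi> \<tau>" by (rule represents_ex[OF a b \<phi>])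
    show ?thesis unfolding eta_eq[OF a b \<tau>] by (rule floc_in[OF tinB_Ar[OF a b]]) (use \<tau> in \<open>simp add: represents_def\<close>)
  qed
  moreover have "\<exists>\<phi>\<in>hom_dual fcat a b. \<beta> = eta a b \<phi>" if \<beta>: "\<beta> \<in> Hm b (SS a)" for \<beta>
  proof -
    obtain Z \<sigma> f where z: "Q Z b \<sigma>" "Ar Z (SS a) f" "\<beta> = fr b (SS a) Z \<sigma> f"
      by (rule Hm_cases[OF _ _ \<beta>]) (use b S_cplx[OF a] in \<open>simp_all add: cplx_iff\<close>)
    note Z = Q_cplx(1)[OF z(1)] and \<sigma> = Q_ch[OF z(1)]
    \<comment> \<open>The numerator of \<open>\<beta>\<close> starts at \<open>Z\<close> and not at
      \<open>b\<close>, so it pairs with maps from the resolution to \<open>Z\<close>;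
      \<open>\<phi>\<close> evaluates a morphism to \<open>b\<close> on its lift along
      \<open>\<sigma>\<close>, which is unique up to homotopy.\<close>
    define \<tau>0 where "\<tau>0 = toutB a \<cdot> f"
    have \<tau>0: "\<tau>0 \<in> cB Z a" unfolding \<tau>0_def by (rule chain_maps_comp[OF Ar_ch[OF z(2)] toutB[OF a]])
    obtain M where "pairing C (pw (*)) (PP a) M s Z" using pairing[OF a Z] by blast
    then interpret p: pairing C "pw (*)" "PP a" M s Z .
    define \<phi> where "\<phi> = (\<lambda>\<alpha>. if \<alpha> \<in> Hm a b then trP a \<tau>0 (SOME g. g \<in> cP a Z \<and> \<alpha> = Psi a b (\<sigma> \<cdot> g)) else 0)"
    have \<sigma>c: "\<sigma> \<cdot> g \<in> cP a b" if "g \<in> cP a Z" for g by (rule chain_maps_comp[OF that \<sigma>])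
    have \<phi>_Psi: "\<phi> (Psi a b (\<sigma> \<cdot> g)) = trP a \<tau>0 g" if g: "g \<in> cP a Z" for g
    proof -
      define g' where "g' = (SOME g'. g' \<in> cP a Z \<and> Psi a b (\<sigma> \<cdot> g) = Psi a b (\<sigma> \<cdot> g'))"
      have g': "g' \<in> cP a Z \<and> Psi a b (\<sigma> \<cdot> g) = Psi a b (\<sigma> \<cdot> g')" unfolding g'_def by (rule someI[of _ g]) (use g in blast)
      have "hP a Z g' g"
        by (rule P_lift_unique[OF a z(1) conjunct1[OF g'] g Psi_eqD[OF a b]]) (use g' g \<sigma>c in auto)
      then have "trP a \<tau>0 g' = trP a \<tau>0 g" by (rule Tr_cong_right[OF a Z \<tau>0 conjunct1[OF g'] g])
      then show ?thesis using Psi_in[OF a b \<sigma>c[OF g]] by (simp add: \<phi>_def g'_def)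
    qed
    have cases: "\<exists>g\<in>cP a Z. \<alpha> = Psi a b (\<sigma> \<cdot> g)" if \<alpha>: "\<alpha> \<in> Hm a b" for \<alpha>
    proof -
      obtain f where f: "f \<in> cP a b" "\<alpha> = Psi a b f" by (rule Psi_cases[OF a b \<alpha>])
      obtain g where g: "g \<in> cP a Z" "hP a b (\<sigma> \<cdot> g) f" by (rule P_lift[OF a z(1) f(1)])
      show ?thesis using g(1) f(2) Psi_eqI[OF a b \<sigma>c[OF g(1)] f(1) g(2)] by blast
    qed
    have "\<phi> \<in> hom_dual fcat a b"
      unfolding hom_dual_def fcat_sel
    proof (intro CollectI conjI ballI allI impI)
      fix \<alpha> \<alpha>' assume "\<alpha> \<in> Hm a b" "\<alpha>' \<in> Hm a b"
      then obtain g g' where g: "g \<in> cP a Z" "\<alpha> = Psi a b (\<sigma> \<cdot> g)" and g': "g' \<in> cP a Z" "\<alpha>' = Psi a b (\<sigma> \<cdot> g')"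
        using cases by blast
      note gg = chain_maps_add[OF P_cplx[OF a] Z g(1) g'(1)]
      have "\<sigma> \<cdot> (g + g') = \<sigma> \<cdot> g + \<sigma> \<cdot> g'"
      proof (rule chain_maps_eqI[OF \<sigma>c[OF gg] chain_maps_add[OF P_cplx[OF a] b \<sigma>c[OF g(1)] \<sigma>c[OF g'(1)]]])
        fix n x u assume "x \<in> Ob C" "u \<in> sp (cx (PP a) n) x"
        interpret \<sigma>: chmap C s Z s b \<sigma> by (rule Ar_chmap[OF QD[OF z(1)]])
        interpret g: chmap C "pw (*)" "PP a" s Z g by (rule chmapI[OF P_cplx[OF a] Z g(1)])
        interpret g': chmap C "pw (*)" "PP a" s Z g' by (rule chmapI[OF P_cplx[OF a] Z g'(1)])
        show "(\<sigma> \<cdot> (g + g')) n x u = (\<sigma> \<cdot> g + \<sigma> \<cdot> g') n x u"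
          using \<sigma>.add[OF \<open>x \<in> Ob C\<close> g.in_sp[OF \<open>x \<in> Ob C\<close> \<open>u \<in> _\<close>] g'.in_sp[OF \<open>x \<in> Ob C\<close> \<open>u \<in> _\<close>]] by simp
      qed
      then have "fadd a b \<alpha> \<alpha>' = Psi a b (\<sigma> \<cdot> (g + g'))"
        unfolding g(2) g'(2) Psi_add[OF a b \<sigma>c[OF g(1)] \<sigma>c[OF g'(1)]] by (simp only:)
      then show "\<phi> (fadd a b \<alpha> \<alpha>') = \<phi> \<alpha> + \<phi> \<alpha>'"
        by (simp only: \<phi>_Psi[OF gg] g(2) g'(2) \<phi>_Psi[OF g(1)] \<phi>_Psi[OF g'(1)]
            p.Tr_add_right[OF p.chain_Nt[OF \<tau>0] p.chain_Nf[OF g(1)] p.chain_Nf[OF g'(1)]])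
    next
      fix \<alpha> c assume "\<alpha> \<in> Hm a b"
      then obtain g where g: "g \<in> cP a Z" "\<alpha> = Psi a b (\<sigma> \<cdot> g)" using cases by blast
      let ?cg = "\<lambda>n x u. s c (g n x u)"
      have cg: "?cg \<in> cP a Z" by (rule chain_maps_scale[OF P_cplx[OF a] Z g(1)])
      have "\<sigma> \<cdot> ?cg = (\<lambda>n x u. s c ((\<sigma> \<cdot> g) n x u))"
      proof (rule chain_maps_eqI[OF \<sigma>c[OF cg] chain_maps_scale[OF P_cplx[OF a] b \<sigma>c[OF g(1)]]])
        fix n x u assume "x \<in> Ob C" "u \<in> sp (cx (PP a) n) x"
        interpret \<sigma>: chmap C s Z s b \<sigma> by (rule Ar_chmap[OF QD[OF z(1)]])
        interpret g: chmap C "pw (*)" "PP a" s Z g by (rule chmapI[OF P_cplx[OF a] Z g(1)])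
        show "(\<sigma> \<cdot> ?cg) n x u = s c ((\<sigma> \<cdot> g) n x u)"
          using \<sigma>.scale[OF \<open>x \<in> Ob C\<close> g.in_sp[OF \<open>x \<in> Ob C\<close> \<open>u \<in> _\<close>]] by simp
      qed
      then have "fsmul a b c \<alpha> = Psi a b (\<sigma> \<cdot> ?cg)"
        unfolding g(2) Psi_scale[OF a b \<sigma>c[OF g(1)]] by (simp only:)
      then show "\<phi> (fsmul a b c \<alpha>) = c * \<phi> \<alpha>"
        by (simp only: \<phi>_Psi[OF cg] g(2) \<phi>_Psi[OF g(1)] p.Tr_scale_right[OF p.chain_Nt[OF \<tau>0] p.chain_Nf[OF g(1)]])
    qed (simp add: \<phi>_def)
    moreover obtain \<tau> where \<tau>: "represents a b \<phi> \<tau>" by (rule represents_ex[OF a b \<open>\<phi> \<in> hom_dual fcat a b\<close>])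
    then have t: "\<tau> \<in> cB b a" by (simp add: represents_def)
    have t\<sigma>: "\<tau> \<cdot> \<sigma> \<in> cB Z a" by (rule chain_maps_comp[OF \<sigma> t])
    \<comment> \<open>The representative of \<open>\<phi>\<close> on \<open>b\<close>, restricted
      along \<open>\<sigma>\<close>, has the same pairings as \<open>\<tau>0\<close>. This
      identifies \<open>eta a b \<phi>\<close> with the fraction \<open>\<beta>\<close>.\<close>
    have "hB Z a (\<tau> \<cdot> \<sigma>) \<tau>0"
    proof (rule Tr_determines[OF a Z t\<sigma> \<tau>0])
      fix g assume g: "g \<in> cP a Z"
      have "trP a \<tau> (\<sigma> \<cdot> g) = \<phi> (Psi a b (\<sigma> \<cdot> g))" using \<tau> \<sigma>c[OF g] unfolding represents_def by blast
      then show "trP a (\<tau> \<cdot> \<sigma>) g = trP a \<tau>0 g" by (simp only: Tr_comp \<phi>_Psi[OF g])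
    qed
    from tinB_H[OF a Z t\<sigma> \<tau>0 this] have h: "H Z (SS a) (tinB a \<cdot> \<tau> \<cdot> \<sigma>) f"
      unfolding \<tau>0_def tinB_toutB_comp[OF a z(2)] chain_comp_assoc .
    have "\<beta> = eta a b \<phi>"
      unfolding eta_eq[OF a b \<tau>] floc_fr[OF tinB_Ar[OF a b t] z(1)] z(3)
      by (rule fr_H[OF z(1) H_refl[OF QD[OF z(1)]] H_sym[OF h]])
    ultimately show ?thesis by blast
  qed
  ultimately show "eta a b ` hom_dual fcat a b = Hm b (SS a)" by blast
qed

lemma eta_add:
  assumes a: "a \<in> Perf C s" and b: "cplx C s b" and \<phi>: "\<phi> \<in> hom_dual fcat a b" and \<psi>: "\<psi> \<in> hom_dual fcat a b"
  shows "eta a b (\<phi> + \<psi>) = fadd b (SS a) (eta a b \<phi>) (eta a b \<psi>)"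
proof -
  obtain \<tau> where \<tau>: "represents a b \<phi> \<tau>" by (rule represents_ex[OF a b \<phi>])
  obtain \<tau>' where \<tau>': "represents a b \<psi> \<tau>'" by (rule represents_ex[OF a b \<psi>])
  have t: "\<tau> \<in> cB b a" "\<tau>' \<in> cB b a" using \<tau> \<tau>' by (simp_all add: represents_def)
  note tt = chain_maps_add[OF b B_cplx[OF a] t]
  have r: "represents a b (\<phi> + \<psi>) (\<tau> + \<tau>')"
    unfolding represents_def using tt \<tau> \<tau>' by (simp only: Tr_add_left) (simp add: represents_def)
  have "tinB a \<cdot> (\<tau> + \<tau>') = tinB a \<cdot> \<tau> + tinB a \<cdot> \<tau>'"
  proof (rule chain_maps_eqI[OF chain_maps_comp[OF tt tinB[OF a]]
      chain_maps_add[OF b S_cplx[OF a] chain_maps_comp[OF t(1) tinB[OF a]] chain_maps_comp[OF t(2) tinB[OF a]]]])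
    fix n x u assume x: "x \<in> Ob C" and u: "u \<in> sp (cx b n) x"
    interpret i: chmap C "pw (*)" "BB a" s "SS a" "tinB a" by (rule chmapI[OF B_cplx[OF a] S_cplx[OF a] tinB[OF a]])
    interpret t: chmap C s b "pw (*)" "BB a" \<tau> by (rule chmapI[OF b B_cplx[OF a] t(1)])
    interpret t': chmap C s b "pw (*)" "BB a" \<tau>' by (rule chmapI[OF b B_cplx[OF a] t(2)])
    show "(tinB a \<cdot> (\<tau> + \<tau>')) n x u = (tinB a \<cdot> \<tau> + tinB a \<cdot> \<tau>') n x u"
      unfolding chain_comp_apply plus_fun_apply[of _ _ n] plus_fun_apply[of _ _ x] plus_fun_apply[of _ _ u]
      by (rule i.add[OF x t.in_sp[OF x u] t'.in_sp[OF x u]])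
  qed
  then show ?thesis
    unfolding eta_eq[OF a b r] eta_eq[OF a b \<tau>] eta_eq[OF a b \<tau>'] floc_add[OF tinB_Ar[OF a b t(1)] tinB_Ar[OF a b t(2)]]
    by (simp only:)
qed

lemma eta_scale:
  assumes a: "a \<in> Perf C s" and b: "cplx C s b" and \<phi>: "\<phi> \<in> hom_dual fcat a b"
  shows "eta a b (\<lambda>f. c * \<phi> f) = fsmul b (SS a) c (eta a b \<phi>)"
proof -
  obtain \<tau> where \<tau>: "represents a b \<phi> \<tau>" by (rule represents_ex[OF a b \<phi>])
  have t: "\<tau> \<in> cB b a" using \<tau> by (simp_all add: represents_def)
  let ?t = "\<lambda>n x u. pw (*) c (\<tau> n x u)"
  note tt = chain_maps_scale[OF b B_cplx[OF a] t]
  have r: "represents a b (\<lambda>f. c * \<phi> f) ?t"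
    unfolding represents_def using tt \<tau> by (simp only: Tr_scale_left) (simp add: represents_def)
  have "tinB a \<cdot> ?t = (\<lambda>n x u. s c ((tinB a \<cdot> \<tau>) n x u))"
  proof (rule chain_maps_eqI[OF chain_maps_comp[OF tt tinB[OF a]]
      chain_maps_scale[OF b S_cplx[OF a] chain_maps_comp[OF t tinB[OF a]]]])
    fix n x u assume x: "x \<in> Ob C" and u: "u \<in> sp (cx b n) x"
    interpret i: chmap C "pw (*)" "BB a" s "SS a" "tinB a" by (rule chmapI[OF B_cplx[OF a] S_cplx[OF a] tinB[OF a]])
    interpret t: chmap C s b "pw (*)" "BB a" \<tau> by (rule chmapI[OF b B_cplx[OF a] t])
    show "(tinB a \<cdot> ?t) n x u = s c ((tinB a \<cdot> \<tau>) n x u)"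
      unfolding chain_comp_apply by (rule i.scale[OF x t.in_sp[OF x u]])
  qed
  then show ?thesis
    unfolding eta_eq[OF a b r] eta_eq[OF a b \<tau>] floc_smul[OF tinB_Ar[OF a b t]] by (simp only:)
qed

text \<open>By the adjunction \<open>Tr_bm\<close>, the bidual of a lift of \<open>u\<close>,
  applied to a representative of \<open>\<phi>\<close>, represents the functional pulled back along
  \<open>u\<close>.\<close>

lemma eta_natural_left:
  assumes a: "a \<in> Perf C s" and a': "a' \<in> Perf C s" and b: "cplx C s b" and u: "u \<in> Hm a a'" and \<phi>: "\<phi> \<in> hom_dual fcat a b"
  shows "eta a' b (\<lambda>f. if f \<in> Hm a' b then \<phi> (fcomp a a' b f u) else 0) =
    fcomp b (SS a) (SS a') (RD_dual_map C s e a a' u) (eta a b \<phi>)"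
proof -
  obtain \<tau> where \<tau>: "represents a b \<phi> \<tau>" by (rule represents_ex[OF a b \<phi>])
  then have t: "\<tau> \<in> cB b a" by (simp add: represents_def)
  obtain g where g: "g \<in> cPP a a'" "u = Psi a a' (rr a' \<cdot> g)" by (rule lift_ex[OF a a' u])
  have bt: "bm a a' g \<cdot> \<tau> \<in> cB b a'" by (rule chain_maps_comp[OF t bm_chain[OF a a' g(1)]])
  have r: "represents a' b (\<lambda>f. if f \<in> Hm a' b then \<phi> (fcomp a a' b f u) else 0) (bm a a' g \<cdot> \<tau>)"
    unfolding represents_def
  proof (intro conjI bt ballI)
    fix f assume f: "f \<in> cP a' b"
    have "trP a \<tau> (f \<cdot> g) = \<phi> (Psi a b (f \<cdot> g))"
      using \<tau> chain_maps_comp[OF g(1) f] unfolding represents_def by blast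
    then show "trP a' (bm a a' g \<cdot> \<tau>) f = (if Psi a' b f \<in> Hm a' b then \<phi> (fcomp a a' b (Psi a' b f) u) else 0)"
      using Psi_in[OF a' b f] by (simp only: Tr_bm[OF a a' b g(1) t f] g(2) Psi_pre[OF a a' b g(1) f] if_True)
  qed
  have "Sg a a' g \<cdot> (tinB a \<cdot> \<tau>) = tinB a' \<cdot> (bm a a' g \<cdot> (toutB a \<cdot> (tinB a \<cdot> \<tau>)))"
    by (simp only: Sg_def chain_comp_assoc)
  also have "\<dots> = tinB a' \<cdot> (bm a a' g \<cdot> \<tau>)" unfolding toutB_tinB_comp[OF a b t] ..
  finally have s: "Sg a a' g \<cdot> (tinB a \<cdot> \<tau>) = tinB a' \<cdot> (bm a a' g \<cdot> \<tau>)" .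
  show ?thesis
    unfolding eta_eq[OF a' b r] eta_eq[OF a b \<tau>] unfolding g(2) RD_dual_map_eq[OF a a' g(1)]
      floc_comp[OF tinB_Ar[OF a b t] Sg_Ar[OF a a' g(1)]] s ..
qed

text \<open>Since \<open>v\<close> is a roof through \<open>Z\<close>, the representatives on
  \<open>b\<close> and on \<open>b'\<close> are compared after restriction to \<open>Z\<close>,
  where both have the same pairings.\<close>

lemma eta_natural_right:
  assumes a: "a \<in> Perf C s" and b: "cplx C s b" and b': "cplx C s b'" and v: "v \<in> Hm b' b" and \<phi>: "\<phi> \<in> hom_dual fcat a b"
  shows "eta a b' (\<lambda>f. if f \<in> Hm a b' then \<phi> (fcomp a b' b v f) else 0) = fcomp b' b (SS a) (eta a b \<phi>) v"
proof -
  let ?\<phi> = "\<lambda>f. if f \<in> Hm a b' then \<phi> (fcomp a b' b v f) else 0"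
  have O: "a \<in> {X. is_complex C s X}" "b \<in> {X. is_complex C s X}" "b' \<in> {X. is_complex C s X}"
    using Perf_cplx[OF a] b b' by (simp_all add: cplx_iff)
  note kl = klinear_fcat[unfolded klinear_category_def fcat_sel]
  note m = bspec[OF bspec[OF bspec[OF kl[THEN conjunct2, THEN conjunct2] O(1)] O(3)] O(2)]
  note l = bspec[OF bspec[OF kl[THEN conjunct2, THEN conjunct1] O(1)] O(3)]
  have ca: "fcomp a b' b v (fadd a b' f g) = fadd a b (fcomp a b' b v f) (fcomp a b' b v g)"
    if f: "f \<in> Hm a b'" and g: "g \<in> Hm a b'" for f g
    by (rule bspec[OF bspec[OF bspec[OF m[THEN conjunct2, THEN conjunct1] f] g] v])
  have cs: "fcomp a b' b v (fsmul a b' c f) = fsmul a b c (fcomp a b' b v f)" if f: "f \<in> Hm a b'" for f c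
    by (rule bspec[OF bspec[OF m[THEN conjunct2, THEN conjunct2] f] v, THEN spec, THEN conjunct2])
  have la: "fadd a b' f g \<in> Hm a b'" if f: "f \<in> Hm a b'" and g: "g \<in> Hm a b'" for f g
    by (rule bspec[OF bspec[OF l[THEN conjunct1] f] g, THEN conjunct1])
  have ls: "fsmul a b' c f \<in> Hm a b'" if f: "f \<in> Hm a b'" for f c
    by (rule bspec[OF l[THEN conjunct2, THEN conjunct2, THEN conjunct2, THEN conjunct1] f, THEN spec])
  \<comment> \<open>Composition in the derived category is bilinear, so the pulled back map is again
    a functional.\<close>
  have \<phi>': "?\<phi> \<in> hom_dual fcat a b'"
    using \<phi> fcomp_in[OF O(1,3,2) _ v] unfolding hom_dual_def fcat_sel by (simp add: ca cs la ls)
  obtain \<tau> where \<tau>: "represents a b \<phi> \<tau>" by (rule represents_ex[OF a b \<phi>])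
  obtain \<tau>' where \<tau>': "represents a b' ?\<phi> \<tau>'" by (rule represents_ex[OF a b' \<phi>'])
  have t: "\<tau> \<in> cB b a" "\<tau>' \<in> cB b' a" using \<tau> \<tau>' by (simp_all add: represents_def)
  obtain Z \<sigma> w where z: "Q Z b' \<sigma>" "Ar Z b w" "v = fr b' b Z \<sigma> w" by (rule Hm_cases[OF O(3,2) v])
  note Z = Q_cplx(1)[OF z(1)] and \<sigma> = Q_ch[OF z(1)] and w = Ar_ch[OF z(2)]
  note ts = chain_maps_comp[OF \<sigma> t(2)] chain_maps_comp[OF w t(1)]
  have "hB Z a (\<tau>' \<cdot> \<sigma>) (\<tau> \<cdot> w)"
  proof (rule Tr_determines[OF a Z ts])
    fix f assume f: "f \<in> cP a Z"
    have \<sigma>f: "\<sigma> \<cdot> f \<in> cP a b'" and wf: "w \<cdot> f \<in> cP a b"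
      using chain_maps_comp[OF f \<sigma>] chain_maps_comp[OF f w] .
    have "trP a \<tau>' (\<sigma> \<cdot> f) = ?\<phi> (Psi a b' (\<sigma> \<cdot> f))" using \<tau>' \<sigma>f unfolding represents_def by blast
    also have "\<dots> = \<phi> (Psi a b (w \<cdot> f))"
      using Psi_in[OF a b' \<sigma>f] by (simp only: if_True z(3) Psi_post[OF a z(1,2) f])
    also have "\<dots> = trP a \<tau> (w \<cdot> f)" using \<tau> wf unfolding represents_def by simp
    finally show "trP a (\<tau>' \<cdot> \<sigma>) f = trP a (\<tau> \<cdot> w) f" unfolding Tr_comp .
  qed
  from tinB_H[OF a Z ts this] have h: "H Z (SS a) (tinB a \<cdot> \<tau>' \<cdot> \<sigma>) (tinB a \<cdot> \<tau> \<cdot> w)"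
    unfolding chain_comp_assoc .
  show ?thesis
    unfolding eta_eq[OF a b' \<tau>'] eta_eq[OF a b \<tau>] floc_fr[OF tinB_Ar[OF a b' t(2)] z(1)] unfolding z(3)
      fcomp_floc_left[OF z(1,2) tinB_Ar[OF a b t(1)]]
    by (rule fr_H[OF z(1) H_refl[OF QD[OF z(1)]] h])
qed

theorem relative: "relative_serre_duality (derived C s) (Perf C s) (RD_dual C s e) (RD_dual_map C s e)"
  unfolding relative_serre_duality_def
proof (intro conjI RD_dual_functor exI[of _ eta])
  show "klinear_category (derived C s)" unfolding derived_eq by (rule klinear_fcat)
  show "Perf C s \<subseteq> Ob (derived C s)" by (auto simp: Perf_def derived_def)
  show "serre_iso (derived C s) (Perf C s) (RD_dual C s e) (RD_dual_map C s e) eta"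
    unfolding derived_eq serre_iso_def fcat_sel
    by (intro conjI ballI allI eta_bij eta_add eta_scale eta_natural_left eta_natural_right Perf_cplx; assumption)
qed

end

theorem proposition1p4:
  fixes C :: "('o, 'm) cat"
    and s :: "'k::field \<Rightarrow> 'v::ab_group_add \<Rightarrow> 'v"
    and e :: "('o, 'm, 'k) bidual_space \<Rightarrow> 'v"
  assumes "category C"
    and "vector_space s"
    and "Vector_Spaces.linear (pw (*)) s e"
    and "inj e"
  shows "relative_serre_duality (derived C s) (Perf C s) (RD_dual C s e) (RD_dual_map C s e)
    \<and> ((\<forall>X\<in>Perf C s. RD_dual C s e X \<in> Perf C s) \<longrightarrow>
        serre_duality (full_subcat (derived C s) (Perf C s)) (RD_dual C s e) (RD_dual_map C s e))"
proof -
  have e: "transp (pw (*)) s e" using assms by (intro transp.intro)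
  obtain j :: "nat \<times> 'm \<Rightarrow> 'o \<Rightarrow> ('m, 'k) pspace \<Rightarrow> 'm \<Rightarrow> 'k" where j: "inj j"
    using pspace_index_injection by blast
  \<comment> \<open>The index type of the functions that \<open>e\<close> embeds contains a copy of
    \<open>nat \<times> 'm\<close>.\<close>
  have "infinite (UNIV :: ('o \<Rightarrow> ('m, 'k) pspace \<Rightarrow> 'm \<Rightarrow> 'k) set)"
  proof
    assume "finite (UNIV :: ('o \<Rightarrow> ('m, 'k) pspace \<Rightarrow> 'm \<Rightarrow> 'k) set)"
    then have "finite (UNIV :: (nat \<times> 'm) set)" using j by (metis finite_imageD finite_subset subset_UNIV)
    then show False by (simp add: finite_prod)
  qed
  then obtain E where "transp (scale3 s s s) s E"
    using vector_space.ex_transp_scale3[OF assms(2) _ assms(3,4)] by blast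
  \<comment> \<open>Resolutions are embedded by \<open>e\<close> after reindexing along
    \<open>j\<close>.\<close>
  then have "serre_setting C s E e (\<lambda>f. e (\<lambda>i. f (inv j i)))"
    by (intro serre_setting.intro derived_setting.intro derived_setting_axioms.intro assms(1) e transp_reindex[OF e j])
  then have "relative_serre_duality (derived C s) (Perf C s) (RD_dual C s e) (RD_dual_map C s e)"
    by (rule serre_setting.relative)
  then show ?thesis using serre_duality_full_subcat by blast
qed

end
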